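(* Any tempered distribution $t$ supported by a crystal $\Lambda=\bigcup_{i=1}^{I}(L+q_{i})$ in $E$ such that $\hat t$ is supported by a crystal $\Sigma=\bigcup_{k=1}^{K}(\Gamma+\eta_{k})$ in $E^{*}$ has the Poisson form $$t=\sum_{k=1}^{K}\sum_{i=1}^{I}\exp\left(-\mathrm{j}\langle\eta_{k},x\rangle\right)P_{ik}(x,D)\sum_{p\in L+q_{i}}\delta_{p},$$ where $P_{ik}(x,D)$ are differential operators with polynomial coefficients. Moreover, $\Gamma=L^{*}$, and $\hat t$ can be calculated by means of the formula $$F\left(P(x,D)\sum_{p\in L+q}\delta_{p}\,\mathrm{d}x\right)=\exp\left(-\mathrm{j}\langle\sigma,q\rangle\right)P\left(\mathrm{j}^{-1}D_{\sigma},\mathrm{j}\sigma\right)\sum_{\sigma\in L^{*}}\delta_{\sigma},$$ for linear operators $P(x,D)$ that are polynomial in both arguments and vectors $q\in E$, where an exponential factor $\exp(-\mathrm{j}\langle\eta,x\rangle)$ inserted in the bracket on the left causes the shift of the right-hand side by the vector $\eta\in E^{*}$.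
   Context: Here $E=\mathbb{R}^{n}$ with linear coordinates $x=(x_{1},\dots,x_{n})$, $E^{*}$ is the dual space with dual coordinates $\xi=(\xi_1,\dots,\xi_n)$, $\langle\cdot,\cdot\rangle$ is the pairing of covectors and vectors, and $\mathrm{j}=2\pi i$ with $i$ the imaginary unit. A full rank lattice in $E$ is a set $L=g\mathbb{Z}^{n}$ with $g$ a nonsingular $n\times n$ matrix; its dual lattice is $L^{*}=h\mathbb{Z}^{n}\subset E^{*}$, $h=(g^{t})^{-1}$. For a lattice $L$, an $L$-crystal is a set $\bigcup_{k=1}^{K}(L+q_{k})$ with finitely many vectors $q_{1},\dots,q_{K}$; crystals in $E^{*}$ are defined in the same way. In the statement, $L$ is a lattice in $E$, $\Gamma$ is a lattice in $E^{*}$, $q_{i}\in E$ and $\eta_{k}\in E^{*}$. A tempered distribution on $E$ is a continuous linear functional on the Schwartz space of $E$; $\delta_{p}$ is the delta distribution at $p$, $\delta_{p}(\varphi)=\varphi(p)$. $D$ denotes the partial derivatives $(\partial_{x_{1}},\dots,\partial_{x_{n}})$ and $D_{\sigma}$ the corresponding derivatives on $E^{*}$. The Fourier transform $\hat t=F(t)$ of a tempered distribution $t$ is the tempered function on $E^{*}$ (continuous linear functional on Schwartz densities) defined by $\hat t(\rho)=t(F(\rho))$, $F(\rho)=\int\exp(-\mathrm{j}\langle\xi,x\rangle)\psi(\xi)\,\mathrm{d}\xi$, for $\rho=\psi\,\mathrm{d}\xi$ with $\psi$ a Schwartz function on $E^{*}$.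
   Formalization: "Γ=L*" becomes: for t≠0, Σ lies in an L*-crystal with vectors η'_k in Σ, and the form uses these (η'=η if Γ=L* ). The form has exp(+j⟨η,x⟩). The formula has a factor 1/|det g|, −j⁻¹D_σ for j⁻¹D_σ, and the exponential next to the delta sum; shift by η means σ→σ+η. *)

theory Defs
  imports "HOL-Analysis.Analysis"
begin

section \<open>Lattices and crystals\<close>

text \<open>The dual space is identified with \<^typ>\<open>real ^ 'n\<close> by means of the dual coordinates, so that the
  pairing of a covector and a vector is the inner product.\<close>

definition lattice_of :: "real ^ 'n ^ 'n \<Rightarrow> (real ^ 'n) set" where
  "lattice_of g = (\<lambda>z. g *v z) ` {z. \<forall>i. z $ i \<in> \<int>}"

definition dual_lattice_of :: "real ^ 'n ^ 'n \<Rightarrow> (real ^ 'n) set" where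
  "dual_lattice_of g = lattice_of (matrix_inv (transpose g))"

definition translate :: "(real ^ 'n) set \<Rightarrow> real ^ 'n \<Rightarrow> (real ^ 'n) set" where
  "translate L q = (\<lambda>x. x + q) ` L"

definition crystal :: "(real ^ 'n) set \<Rightarrow> nat \<Rightarrow> (nat \<Rightarrow> real ^ 'n) \<Rightarrow> (real ^ 'n) set" where
  "crystal L m q = (\<Union>k\<in>{1..m}. translate L (q k))"


section \<open>The Schwartz space\<close>

definition partial :: "('n::finite) \<Rightarrow> (real ^ 'n \<Rightarrow> complex) \<Rightarrow> real ^ 'n \<Rightarrow> complex" where
  "partial i f x = frechet_derivative f (at x) (axis i 1)"

abbreviation partials :: "('n::finite) list \<Rightarrow> (real ^ 'n \<Rightarrow> complex) \<Rightarrow> real ^ 'n \<Rightarrow> complex" where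
  "partials is f \<equiv> foldr partial is f"

definition smooth_fun :: "(real ^ 'n \<Rightarrow> complex) \<Rightarrow> bool" where
  "smooth_fun f \<longleftrightarrow> (\<forall>is. partials is f differentiable_on UNIV)"

definition schwartz :: "(real ^ 'n \<Rightarrow> complex) \<Rightarrow> bool" where
  "schwartz f \<longleftrightarrow> smooth_fun f \<and>
     (\<forall>N is. bounded (range (\<lambda>x. (1 + norm x) ^ N * cmod (partials is f x))))"

definition schwartz_seminorm :: "nat \<Rightarrow> ('n::finite) list \<Rightarrow> (real ^ 'n \<Rightarrow> complex) \<Rightarrow> real" where
  "schwartz_seminorm N is f = (SUP x. (1 + norm x) ^ N * cmod (partials is f x))"

definition schwartz_topology :: "(real ^ 'n \<Rightarrow> complex) topology" where
  "schwartz_topology = topology_generated_by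
     {{\<psi>. schwartz \<psi> \<and> schwartz_seminorm N is (\<lambda>x. \<psi> x - \<phi> x) < \<epsilon>} | N is \<phi> \<epsilon>. schwartz \<phi> \<and> \<epsilon> > 0}"


section \<open>Tempered distributions\<close>

text \<open>A functional is a function on all of \<^typ>\<open>real ^ 'n \<Rightarrow> complex\<close>, of which only the values on Schwartz
  functions matter. On the dual space, a functional on Schwartz densities \<open>\<psi> d\<xi>\<close> is regarded as a functional
  of \<open>\<psi>\<close>; it is then treated by the same definitions.\<close>

type_synonym 'n functional = "(real ^ 'n \<Rightarrow> complex) \<Rightarrow> complex"

definition distr_eq :: "('n::finite) functional \<Rightarrow> 'n functional \<Rightarrow> bool" (infix "\<doteq>" 50) where
  "t \<doteq> u \<longleftrightarrow> (\<forall>\<phi>. schwartz \<phi> \<longrightarrow> t \<phi> = u \<phi>)"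

definition tempered_distribution :: "('n::finite) functional \<Rightarrow> bool" where
  "tempered_distribution t \<longleftrightarrow>
     (\<forall>\<phi> \<psi> a b. schwartz \<phi> \<longrightarrow> schwartz \<psi> \<longrightarrow> t (\<lambda>x. a * \<phi> x + b * \<psi> x) = a * t \<phi> + b * t \<psi>) \<and>
     continuous_map schwartz_topology euclidean t"

definition vanishes_on :: "('n::finite) functional \<Rightarrow> (real ^ 'n) set \<Rightarrow> bool" where
  "vanishes_on t U \<longleftrightarrow> (\<forall>\<phi>. smooth_fun \<phi> \<longrightarrow> compact (closure {x. \<phi> x \<noteq> 0}) \<longrightarrow>
     closure {x. \<phi> x \<noteq> 0} \<subseteq> U \<longrightarrow> t \<phi> = 0)"

definition distr_support :: "('n::finite) functional \<Rightarrow> (real ^ 'n) set" where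
  "distr_support t = - \<Union>{U. open U \<and> vanishes_on t U}"

definition delta_sum :: "(real ^ 'n) set \<Rightarrow> 'n functional" where
  "delta_sum A \<phi> = (\<Sum>\<^sub>\<infinity>p\<in>A. \<phi> p)"

definition scale :: "complex \<Rightarrow> ('n::finite) functional \<Rightarrow> 'n functional" where
  "scale c t \<phi> = c * t \<phi>"

definition fun_mult :: "(real ^ 'n \<Rightarrow> complex) \<Rightarrow> 'n functional \<Rightarrow> 'n functional" where
  "fun_mult f t \<phi> = t (\<lambda>x. f x * \<phi> x)"

definition distr_deriv :: "('n::finite) \<Rightarrow> 'n functional \<Rightarrow> 'n functional" where
  "distr_deriv i t \<phi> = - t (partial i \<phi>)"

definition coord_mult :: "('n::finite) \<Rightarrow> 'n functional \<Rightarrow> 'n functional" where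
  "coord_mult i = fun_mult (\<lambda>x. of_real (x $ i))"

text \<open>The shift by \<open>\<eta>\<close> is the substitution \<open>u(\<sigma>) \<mapsto> u(\<sigma> + \<eta>)\<close>.\<close>

definition shift :: "real ^ 'n \<Rightarrow> 'n functional \<Rightarrow> 'n functional" where
  "shift \<eta> u \<psi> = u (\<lambda>\<sigma>. \<psi> (\<sigma> - \<eta>))"


section \<open>Fourier transform\<close>

definition two_pi_i :: complex where
  "two_pi_i = 2 * of_real pi * \<i>"

definition fourier_fun :: "(real ^ 'n \<Rightarrow> complex) \<Rightarrow> real ^ 'n \<Rightarrow> complex" where
  "fourier_fun \<psi> x = (LINT \<xi>|lborel. exp (- two_pi_i * of_real (\<xi> \<bullet> x)) * \<psi> \<xi>)"

definition fourier :: "('n::finite) functional \<Rightarrow> 'n functional" where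
  "fourier t \<psi> = t (fourier_fun \<psi>)"


section \<open>Differential operators with polynomial coefficients\<close>

text \<open>A polynomial \<open>P(x, y)\<close> in two groups of variables indexed by \<^typ>\<open>'n\<close> is a finite list of terms; the term
  \<open>(a, u, v)\<close> stands for \<open>a\<close> times the product of \<open>x\<^sub>i\<close> over the entries of \<open>u\<close> times the product of \<open>y\<^sub>i\<close> over
  the entries of \<open>v\<close>. The operator \<open>P(A, B)\<close> applies the \<open>B\<^sub>i\<close> before the \<open>A\<^sub>i\<close>, so \<open>P(x, D)\<close> has its
  coefficients to the left of the derivatives.\<close>

type_synonym 'n polynomial_symbol = "(complex \<times> 'n list \<times> 'n list) list"

definition poly_op :: "('n::finite) polynomial_symbol \<Rightarrow> ('n \<Rightarrow> 'n functional \<Rightarrow> 'n functional) \<Rightarrow>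
    ('n \<Rightarrow> 'n functional \<Rightarrow> 'n functional) \<Rightarrow> 'n functional \<Rightarrow> 'n functional" where
  "poly_op P A B t \<phi> = (\<Sum>(a, u, v)\<leftarrow>P. a * foldr A u (foldr B v t) \<phi>)"

definition diff_op :: "('n::finite) polynomial_symbol \<Rightarrow> 'n functional \<Rightarrow> 'n functional" where
  "diff_op P = poly_op P coord_mult distr_deriv"

text \<open>With \<open>j\<close> for \<^const>\<open>two_pi_i\<close>, this is the operator \<open>P(- j\<^sup>-\<^sup>1 D, j \<sigma>)\<close>, to which the Fourier
  transform carries \<open>P(x, D)\<close>: by \<open>\<partial>\<^sub>\<sigma> exp (- j \<langle>\<sigma>, x\<rangle>) = - j x exp (- j \<langle>\<sigma>, x\<rangle>)\<close>, multiplication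
  by \<open>x\<close> becomes \<open>- j\<^sup>-\<^sup>1 D\<close>.\<close>

definition dual_op :: "('n::finite) polynomial_symbol \<Rightarrow> 'n functional \<Rightarrow> 'n functional" where
  "dual_op P = poly_op P (\<lambda>i u. scale (- inverse two_pi_i) (distr_deriv i u))
     (\<lambda>i u. scale two_pi_i (coord_mult i u))"

text \<open>The Fourier transform of \<open>P(x, D)\<close> applied to the delta sum over \<open>L + q\<close>, \<open>L\<close> the lattice of \<open>g\<close>. The
  factor \<open>1 / \<bar>det g\<bar>\<close> is the density of \<open>L\<close> relative to the coordinate volume element.\<close>

definition dual_term :: "real ^ 'n ^ 'n \<Rightarrow> 'n polynomial_symbol \<Rightarrow> real ^ 'n \<Rightarrow> 'n functional" where
  "dual_term g P q = scale (of_real (1 / \<bar>det g\<bar>))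
     (dual_op P (fun_mult (\<lambda>\<sigma>. exp (- two_pi_i * of_real (\<sigma> \<bullet> q))) (delta_sum (dual_lattice_of g))))"

end

theory Submission
  imports Defs "HOL-Complex_Analysis.Complex_Analysis"
begin

text \<open>Write \<open>j\<close> for \<^const>\<open>two_pi_i\<close>. Let the vectors \<open>l b\<close> span \<open>L\<close>, and let the dual basis \<open>lam a\<close> span
  \<open>L\<^sup>*\<close>.

  Multiplications by the characters \<open>exp (j \<langle>lam a, x\<rangle>)\<close> and translations by the vectors \<open>l b\<close> commute. Call
  them \<open>A\<^sub>k\<close>. On the crystal that carries \<open>t\<close> the characters take finitely many values. If the spectrum lies in
  finitely many cosets of \<open>L\<^sup>*\<close>, the same holds on the Fourier side, where the translations become multiplications
  by \<open>exp (j \<langle>\<sigma>, l b\<rangle>)\<close>. A nonnegative function with bounded derivatives that vanishes on the support of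
  a tempered distribution annihilates it after being raised to a high power, so powers of products of factors \<open>A\<^sub>k - r\<close> annihilate \<open>t\<close>
  (\<open>power_annihilates\<close>, \<open>character_product_power_annihilates\<close>).

  If \<open>t\<close> is a joint eigenvector of the \<open>A\<^sub>k\<close>, the annihilators force the eigenvalues to be those of some
  \<open>exp (j \<langle>\<eta>\<^sub>k, x\<rangle>) \<Sum>\<^sub>p \<delta>\<^sub>p\<close>, \<open>p \<in> L + q\<^sub>i\<close>. After a modulation and a translation \<open>t\<close> is
  invariant under all \<open>A\<^sub>k\<close>, hence a multiple of the delta sum over \<open>L\<close> (\<open>lattice_invariant\<close>): cut off
  to a neighbourhood of the origin, \<open>t\<close> is annihilated by the coordinates, and such a distribution is a multiple of
  \<open>\<delta>\<^sub>0\<close>.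

  The passage from generalised to proper eigenvectors is algebra. Every \<open>A\<^sub>k\<close> has a conjugate
  \<open>D\<^sub>k\<close> with \<open>[A\<^sub>k, D\<^sub>k] = 1\<close> that commutes with the other \<open>A\<^sub>m\<close>: a first order differential operator or
  a coordinate, composed with a character or a translation. As in
  Kashiwara's lemma, a distribution that is killed by \<open>(A\<^sub>k - r)\<^sup>M\<close>, \<open>M \<ge> 2\<close>, is a combination of
  one that is killed by \<open>(A\<^sub>k - r)\<^sup>M\<^sup>-\<^sup>1\<close> and of \<open>D\<^sub>k\<close> applied to another such
  (\<open>generated_by_eigenvectors\<close>). So \<open>t\<close> is obtained from modulated delta sums by coordinate multiplications and
  derivatives (\<open>generated_by_modulated_delta_sums\<close>), which is the Poisson form once the operators are ordered.

  The spectrum is given in cosets of \<open>\<Gamma>\<close>, not of \<open>L\<^sup>*\<close>. But the annihilating product for the character of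
  \<open>lam a\<close> acts on the Fourier side as a polynomial in the translation by \<open>lam a\<close> with nonzero constant term. It
  follows that with \<open>\<sigma>\<close> the support of the transform contains \<open>\<sigma> - n lam a\<close> for some \<open>n \<ge> 1\<close>; by
  repetition and the pigeonhole principle a multiple of \<open>lam a\<close> lies in \<open>\<Gamma>\<close> (\<open>commensurable\<close>), and
  finitely many cosets of \<open>L\<^sup>*\<close> cover the spectrum.

  The formula for the transform is Poisson summation together with the exchange of coordinates and
  derivatives. Poisson summation is another case of \<open>lattice_invariant\<close>, and it supplies the nonzero constant in
  the Fourier inversion formula.\<close>

(* The symbol $ stands for vector components only. *)
unbundle no fps_syntax

section \<open>Smooth functions of several variables\<close>

lemma differentiable_has_derivative_partial:
  fixes f :: "real ^ 'n \<Rightarrow> complex"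
  assumes "f differentiable (at x)"
  shows "(f has_derivative (\<lambda>h. \<Sum>i\<in>UNIV. of_real (h $ i) * partial i f x)) (at x)"
proof -
  let ?D = "frechet_derivative f (at x)"
  have D: "(f has_derivative ?D) (at x)"
    using assms frechet_derivative_works by blast
  then have lin: "linear ?D"
    by (rule has_derivative_linear)
  have "?D h = (\<Sum>i\<in>UNIV. of_real (h $ i) * partial i f x)" for h
  proof -
    have "?D h = ?D (\<Sum>i\<in>UNIV. h $ i *\<^sub>R axis i 1)"
      using basis_expansion[of h] by (simp add: scalar_mult_eq_scaleR)
    also have "\<dots> = (\<Sum>i\<in>UNIV. h $ i *\<^sub>R ?D (axis i 1))"
      using lin by (simp add: linear_sum linear_cmul)
    finally show ?thesis
      by (simp add: partial_def scaleR_conv_of_real)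
  qed
  then have "?D = (\<lambda>h. \<Sum>i\<in>UNIV. of_real (h $ i) * partial i f x)"
    by (rule ext)
  then show ?thesis using D by simp
qed

lemma partial_eqI: "(f has_derivative D) (at x) \<Longrightarrow> partial i f x = D (axis i 1)"
  unfolding partial_def using frechet_derivative_at by metis

text \<open>Recursion on the order gives a form of smoothness in which closure under sums and products can be proved by
  induction.\<close>

primrec differentiable_upto :: "nat \<Rightarrow> (real ^ 'n \<Rightarrow> complex) \<Rightarrow> bool" where
  "differentiable_upto 0 f = (\<forall>x. f differentiable (at x))"
| "differentiable_upto (Suc k) f =
     ((\<forall>x. f differentiable (at x)) \<and> (\<forall>i. differentiable_upto k (partial i f)))"

lemma differentiable_upto_iff:
  "differentiable_upto k f \<longleftrightarrow> (\<forall>is. length is \<le> k \<longrightarrow> (\<forall>x. partials is f differentiable (at x)))"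
proof (induction k arbitrary: f)
  case 0
  then show ?case by simp
next
  case (Suc k)
  show ?case
  proof
    assume L: "differentiable_upto (Suc k) f"
    show "\<forall>is. length is \<le> Suc k \<longrightarrow> (\<forall>x. partials is f differentiable (at x))"
    proof (intro allI impI)
      fix "is" :: "'a list" and x
      assume "length is \<le> Suc k"
      then show "partials is f differentiable (at x)"
        using L Suc by (cases "is" rule: rev_cases) auto
    qed
  next
    assume R: "\<forall>is. length is \<le> Suc k \<longrightarrow> (\<forall>x. partials is f differentiable (at x))"
    have "partials js (partial i f) differentiable (at x)" if "length js \<le> k" for js i x
      using R[rule_format, of "js @ [i]" x] that by simp
    moreover have "f differentiable (at x)" for x
      using R[rule_format, of "[]" x] by simp
    ultimately show "differentiable_upto (Suc k) f"
      using Suc by simp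
  qed
qed

lemma smooth_fun_iff: "smooth_fun f \<longleftrightarrow> (\<forall>k. differentiable_upto k f)"
  unfolding smooth_fun_def differentiable_upto_iff differentiable_on_def by auto

lemma smooth_imp_differentiable: "smooth_fun f \<Longrightarrow> f differentiable (at x)"
  unfolding smooth_fun_iff by (metis differentiable_upto.simps(1))

lemma smooth_partial: "smooth_fun f \<Longrightarrow> smooth_fun (partial i f)"
  unfolding smooth_fun_iff by (metis differentiable_upto.simps(2))

lemma smooth_partials: "smooth_fun f \<Longrightarrow> smooth_fun (partials is f)"
  by (induction "is") (auto intro: smooth_partial)

lemma smooth_has_derivative:
  "smooth_fun f \<Longrightarrow> (f has_derivative (\<lambda>h. \<Sum>i\<in>UNIV. of_real (h $ i) * partial i f x)) (at x)"
  by (intro differentiable_has_derivative_partial smooth_imp_differentiable)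

lemma smooth_continuous: "smooth_fun f \<Longrightarrow> continuous_on S f"
  by (meson continuous_at_imp_continuous_on differentiable_imp_continuous_within smooth_imp_differentiable)

lemma partial_const [simp]: "partial i (\<lambda>x. c) = (\<lambda>x. 0)"
  by (rule ext, subst partial_eqI[OF has_derivative_const]) simp

lemma differentiable_upto_zero: "differentiable_upto k (\<lambda>x. 0)"
  by (induction k) auto

lemma smooth_const [simp]: "smooth_fun (\<lambda>x. c)"
  unfolding smooth_fun_iff
proof
  show "differentiable_upto k (\<lambda>x. c)" for k
    by (cases k) (auto simp: differentiable_upto_zero)
qed

lemma partials_zero [simp]: "partials is (\<lambda>x. 0) = (\<lambda>x. 0)"
  by (induction "is") auto

lemma partial_add:
  assumes "\<And>x. f differentiable (at x)" "\<And>x. g differentiable (at x)"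
  shows "partial i (\<lambda>x. f x + g x) = (\<lambda>x. partial i f x + partial i g x)"
  using assms
  by (intro ext, subst partial_eqI[OF has_derivative_add[OF
        differentiable_has_derivative_partial differentiable_has_derivative_partial]])
     (auto simp: sum.distrib[symmetric] axis_def if_distrib if_distribR cong: if_cong)

lemma partial_mult:
  assumes "\<And>x. f differentiable (at x)" "\<And>x. g differentiable (at x)"
  shows "partial i (\<lambda>x. f x * g x) = (\<lambda>x. partial i f x * g x + f x * partial i g x)"
  using assms
  by (intro ext, subst partial_eqI[OF has_derivative_mult[OF
        differentiable_has_derivative_partial differentiable_has_derivative_partial]])
     (auto simp: axis_def if_distrib if_distribR cong: if_cong)

lemma differentiable_upto_mono: "differentiable_upto (Suc k) f \<Longrightarrow> differentiable_upto k f"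
  by (auto simp: differentiable_upto_iff)

lemma differentiable_upto_add:
  "differentiable_upto k f \<Longrightarrow> differentiable_upto k g \<Longrightarrow> differentiable_upto k (\<lambda>x. f x + g x)"
proof (induction k arbitrary: f g)
  case (Suc k)
  then have "partial i (\<lambda>x. f x + g x) = (\<lambda>x. partial i f x + partial i g x)" for i
    by (intro partial_add) auto
  with Suc show ?case by auto
qed auto

lemma differentiable_upto_mult:
  "differentiable_upto k f \<Longrightarrow> differentiable_upto k g \<Longrightarrow> differentiable_upto k (\<lambda>x. f x * g x)"
proof (induction k arbitrary: f g)
  case (Suc k)
  then have "partial i (\<lambda>x. f x * g x) = (\<lambda>x. partial i f x * g x + f x * partial i g x)" for i
    by (intro partial_mult) auto
  moreover have "differentiable_upto k f" "differentiable_upto k g"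
    using Suc.prems by (blast intro: differentiable_upto_mono)+
  ultimately show ?case using Suc
    by (auto intro!: differentiable_upto_add)
qed auto

lemma smooth_add [intro]: "smooth_fun f \<Longrightarrow> smooth_fun g \<Longrightarrow> smooth_fun (\<lambda>x. f x + g x)"
  unfolding smooth_fun_iff by (blast intro: differentiable_upto_add)

lemma smooth_mult [intro]: "smooth_fun f \<Longrightarrow> smooth_fun g \<Longrightarrow> smooth_fun (\<lambda>x. f x * g x)"
  unfolding smooth_fun_iff by (blast intro: differentiable_upto_mult)

lemma smooth_cmult [intro]: "smooth_fun f \<Longrightarrow> smooth_fun (\<lambda>x. c * f x)"
  by (intro smooth_mult smooth_const)

lemma smooth_diff [intro]: "smooth_fun f \<Longrightarrow> smooth_fun g \<Longrightarrow> smooth_fun (\<lambda>x. f x - g x)"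
  using smooth_add[of f "\<lambda>x. - 1 * g x"] smooth_cmult[of g "-1"] by simp

lemma smooth_sum [intro]: "(\<And>a. a \<in> A \<Longrightarrow> smooth_fun (f a)) \<Longrightarrow> smooth_fun (\<lambda>x. \<Sum>a\<in>A. f a x)"
  by (induction A rule: infinite_finite_induct) auto

lemma smooth_partial_add:
  "smooth_fun f \<Longrightarrow> smooth_fun g \<Longrightarrow> partial i (\<lambda>x. f x + g x) = (\<lambda>x. partial i f x + partial i g x)"
  by (intro partial_add smooth_imp_differentiable)

lemma smooth_partial_mult:
  "smooth_fun f \<Longrightarrow> smooth_fun g \<Longrightarrow>
    partial i (\<lambda>x. f x * g x) = (\<lambda>x. partial i f x * g x + f x * partial i g x)"
  by (intro partial_mult smooth_imp_differentiable)

lemma smooth_partial_cmult: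
  "smooth_fun f \<Longrightarrow> partial i (\<lambda>x. c * f x) = (\<lambda>x. c * partial i f x)"
  by (simp add: smooth_partial_mult)

lemma partials_add:
  "smooth_fun f \<Longrightarrow> smooth_fun g \<Longrightarrow> partials is (\<lambda>x. f x + g x) = (\<lambda>x. partials is f x + partials is g x)"
  by (induction "is") (auto simp: smooth_partial_add smooth_partials)

lemma partials_cmult:
  "smooth_fun f \<Longrightarrow> partials is (\<lambda>x. c * f x) = (\<lambda>x. c * partials is f x)"
  by (induction "is") (auto simp: smooth_partial_cmult smooth_partials)

lemma partials_diff:
  "smooth_fun f \<Longrightarrow> smooth_fun g \<Longrightarrow> partials is (\<lambda>x. f x - g x) = (\<lambda>x. partials is f x - partials is g x)"
  using partials_add[of f "\<lambda>x. - 1 * g x" "is"] partials_cmult[of g "is" "-1"] smooth_cmult[of g "-1"] by simp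

lemma partials_sum:
  "(\<And>a. a \<in> A \<Longrightarrow> smooth_fun (f a)) \<Longrightarrow> partials is (\<lambda>x. \<Sum>a\<in>A. f a x) = (\<lambda>x. \<Sum>a\<in>A. partials is (f a) x)"
proof (induction A rule: infinite_finite_induct)
  case (insert a A)
  then show ?case by (simp add: partials_add smooth_sum)
qed auto

lemma smooth_partial_sum:
  "(\<And>a. a \<in> A \<Longrightarrow> smooth_fun (f a)) \<Longrightarrow> partial i (\<lambda>x. \<Sum>a\<in>A. f a x) = (\<lambda>x. \<Sum>a\<in>A. partial i (f a) x)"
  using partials_sum[of A f "[i]"] by simp

lemma partial_inner: "partial i (\<lambda>x. of_real (v \<bullet> x)) = (\<lambda>x. of_real (v $ i))"
  by (rule ext, subst partial_eqI[where D = "\<lambda>h. of_real (v \<bullet> h)"])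
     (auto intro!: derivative_eq_intros simp: inner_axis)

lemma smooth_inner: "smooth_fun (\<lambda>x. of_real (v \<bullet> x))"
  unfolding smooth_fun_iff
proof
  have "(\<lambda>x. of_real (v \<bullet> x)) differentiable (at x)" for x :: "real ^ 'a"
    unfolding differentiable_def
    by (rule exI[where x = "\<lambda>h. of_real (v \<bullet> h)"]) (auto intro!: derivative_eq_intros)
  then show "differentiable_upto k (\<lambda>x. of_real (v \<bullet> x))" for k
    using smooth_const[unfolded smooth_fun_iff]
    by (cases k) (auto simp: partial_inner)
qed

lemma smooth_coord: "smooth_fun (\<lambda>x. of_real (x $ i))"
  using smooth_inner[of "axis i 1"] by (simp add: inner_axis')

lemma partial_coord: "partial i (\<lambda>x. of_real (x $ k)) = (\<lambda>x. if i = k then 1 else 0)"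
  using partial_inner[of i "axis k 1"] by (simp add: inner_axis') (auto simp: fun_eq_iff axis_def)

lemma partial_affine:
  assumes "\<And>x. f differentiable (at x)"
  shows "partial i (\<lambda>x. f (c *\<^sub>R x + a)) = (\<lambda>x. of_real c * partial i f (c *\<^sub>R x + a))"
    and "(\<lambda>x. f (c *\<^sub>R x + a)) differentiable (at x)"
proof -
  have D: "((\<lambda>x. f (c *\<^sub>R x + a)) has_derivative
      (\<lambda>h. \<Sum>i\<in>UNIV. of_real ((c *\<^sub>R h) $ i) * partial i f (c *\<^sub>R x + a))) (at x)" for x
    by (rule has_derivative_compose[OF _ differentiable_has_derivative_partial[OF assms]])
       (auto intro!: derivative_eq_intros)
  show "partial i (\<lambda>x. f (c *\<^sub>R x + a)) = (\<lambda>x. of_real c * partial i f (c *\<^sub>R x + a))"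
    by (rule ext, subst partial_eqI[OF D]) (auto simp: axis_def if_distrib if_distribR cong: if_cong)
  show "(\<lambda>x. f (c *\<^sub>R x + a)) differentiable (at x)"
    using D differentiable_def by blast
qed

lemma smooth_affine:
  assumes "smooth_fun f"
  shows "smooth_fun (\<lambda>x. f (c *\<^sub>R x + a))"
proof -
  have "differentiable_upto k f \<Longrightarrow> differentiable_upto k (\<lambda>x. b * f (c *\<^sub>R x + a))" for k f b
  proof (induction k arbitrary: f b)
    case 0
    then show ?case by (auto intro: partial_affine derivative_intros)
  next
    case (Suc k)
    have "partial i (\<lambda>x. b * f (c *\<^sub>R x + a)) = (\<lambda>x. (b * of_real c) * partial i f (c *\<^sub>R x + a))" for i
      using Suc.prems by (subst partial_mult) (auto intro: partial_affine simp: partial_affine)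
    with Suc show ?case by (auto intro: partial_affine derivative_intros)
  qed
  from this[of _ f 1] show ?thesis using assms by (simp add: smooth_fun_iff)
qed

lemma partials_affine:
  assumes "smooth_fun f"
  shows "partials is (\<lambda>x. f (c *\<^sub>R x + a)) = (\<lambda>x. of_real c ^ length is * partials is f (c *\<^sub>R x + a))"
proof (induction "is")
  case (Cons i "is")
  have "partial i (\<lambda>x. partials is f (c *\<^sub>R x + a)) = (\<lambda>x. of_real c * partial i (partials is f) (c *\<^sub>R x + a))"
    by (intro partial_affine smooth_imp_differentiable smooth_partials assms)
  moreover have "partial i (\<lambda>x. of_real c ^ length is * partials is f (c *\<^sub>R x + a)) =
      (\<lambda>x. of_real c ^ length is * partial i (\<lambda>x. partials is f (c *\<^sub>R x + a)) x)"
    by (intro smooth_partial_cmult smooth_affine smooth_partials assms)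
  ultimately show ?case using Cons
    by (simp add: mult.left_commute mult.assoc)
qed auto

lemma smooth_translation: "smooth_fun f \<Longrightarrow> smooth_fun (\<lambda>x. f (x + a))"
  using smooth_affine[of f 1 a] by simp

lemma partials_translation: "smooth_fun f \<Longrightarrow> partials is (\<lambda>x. f (x + a)) = (\<lambda>x. partials is f (x + a))"
  using partials_affine[of f "is" 1 a] by simp

lemma partial_translation: "smooth_fun f \<Longrightarrow> partial i (\<lambda>x. f (x + a)) = (\<lambda>x. partial i f (x + a))"
  using partials_translation[of f "[i]" a] by simp

lemma partials_cong_open:
  assumes "open U" "\<And>x. x \<in> U \<Longrightarrow> f x = g x" "smooth_fun f" "smooth_fun g" "x \<in> U"
  shows "partials is f x = partials is g x"
  using assms(5)
proof (induction "is" arbitrary: x)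
  case (Cons i "is")
  have D: "(partials is f has_derivative (\<lambda>h. \<Sum>i\<in>UNIV. of_real (h $ i) * partial i (partials is f) x)) (at x)"
    by (intro smooth_has_derivative smooth_partials assms)
  have "(partials is g has_derivative (\<lambda>h. \<Sum>i\<in>UNIV. of_real (h $ i) * partial i (partials is f) x)) (at x)"
    using Cons.IH by (rule has_derivative_transform_within_open[OF D assms(1) Cons.prems])
  from partial_eqI[OF this, of i]
  show ?case by (simp add: axis_def if_distrib if_distribR cong: if_cong)
qed (auto simp: assms)

section \<open>Weighted bounds for derivatives\<close>

text \<open>All derivatives of order at most \<open>m\<close> are bounded by one multiple of a weight. Decaying weights express
  the Schwartz seminorms, the constant weight bounds functions and growing weights multipliers.\<close>

definition partials_le :: "(real ^ 'n \<Rightarrow> real) \<Rightarrow> nat \<Rightarrow> (real ^ ('n::finite) \<Rightarrow> complex) \<Rightarrow> real \<Rightarrow> bool" where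
  "partials_le W m f B \<longleftrightarrow> (\<forall>is x. length is \<le> m \<longrightarrow> cmod (partials is f x) \<le> B * W x)"

lemma partials_leD: "partials_le W m f B \<Longrightarrow> length is \<le> m \<Longrightarrow> cmod (partials is f x) \<le> B * W x"
  by (simp add: partials_le_def)

lemma partials_leD0: "partials_le W m f B \<Longrightarrow> cmod (f x) \<le> B * W x"
  using partials_leD[of W m f B "[]" x] by simp

lemma partials_le_partial: "partials_le W (Suc m) f B \<Longrightarrow> partials_le W m (partial i f) B"
  unfolding partials_le_def
proof (intro allI impI)
  fix "is" :: "'a list" and x
  assume "\<forall>is x. length is \<le> Suc m \<longrightarrow> cmod (partials is f x) \<le> B * W x" "length is \<le> m"
  then show "cmod (partials is (partial i f) x) \<le> B * W x"
    by (auto dest: spec[of _ "is @ [i]"])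
qed

lemma partials_le_Suc:
  "partials_le W (Suc m) f B \<longleftrightarrow> (\<forall>x. cmod (f x) \<le> B * W x) \<and> (\<forall>i. partials_le W m (partial i f) B)"
proof
  assume "partials_le W (Suc m) f B"
  then show "(\<forall>x. cmod (f x) \<le> B * W x) \<and> (\<forall>i. partials_le W m (partial i f) B)"
    using partials_le_partial partials_leD0 by blast
next
  assume A: "(\<forall>x. cmod (f x) \<le> B * W x) \<and> (\<forall>i. partials_le W m (partial i f) B)"
  show "partials_le W (Suc m) f B"
    unfolding partials_le_def
  proof (intro allI impI)
    fix "is" :: "'a list" and x
    assume "length is \<le> Suc m"
    then show "cmod (partials is f x) \<le> B * W x"
      using A by (cases "is" rule: rev_cases) (auto simp: partials_le_def)
  qed
qed

lemma partials_le_0: "partials_le W 0 f B \<longleftrightarrow> (\<forall>x. cmod (f x) \<le> B * W x)"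
  by (simp add: partials_le_def)

lemma partials_le_order: "partials_le W m f B \<Longrightarrow> k \<le> m \<Longrightarrow> partials_le W k f B"
  by (auto simp: partials_le_def)

lemma partials_le_weaken:
  assumes "partials_le W m f B" "\<And>x. B * W x \<le> C * V x"
  shows "partials_le V m f C"
  unfolding partials_le_def
  by (intro allI impI order_trans[OF partials_leD[OF assms(1)] assms(2)])

lemma partials_le_add:
  assumes "smooth_fun f" "smooth_fun g" "partials_le W m f B" "partials_le W m g C"
  shows "partials_le W m (\<lambda>x. f x + g x) (B + C)"
  unfolding partials_le_def partials_add[OF assms(1,2)] distrib_right
  by (intro allI impI norm_triangle_mono partials_leD[OF assms(3)] partials_leD[OF assms(4)])

lemma partials_le_cmult:
  assumes "smooth_fun f" "partials_le W m f B"
  shows "partials_le W m (\<lambda>x. c * f x) (cmod c * B)"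
  unfolding partials_le_def partials_cmult[OF assms(1)] norm_mult mult.assoc
  by (intro allI impI mult_left_mono partials_leD[OF assms(2)] norm_ge_zero)

lemma norm_mult_le_weights:
  assumes "cmod a \<le> B * w" "cmod b \<le> C * v"
  shows "cmod (a * b) \<le> B * C * (w * v)"
proof -
  have "cmod a * cmod b \<le> (B * w) * (C * v)"
    by (rule mult_mono[OF assms order_trans[OF norm_ge_zero assms(1)] norm_ge_zero])
  then show ?thesis by (simp add: norm_mult algebra_simps)
qed

text \<open>By Leibniz's rule a derivative of order \<open>m\<close> of the product has at most \<open>2\<^sup>m\<close> terms.\<close>

lemma partials_le_mult:
  assumes "smooth_fun f" "smooth_fun g" "partials_le W m f B" "partials_le V m g C"
  shows "partials_le (\<lambda>x. W x * V x) m (\<lambda>x. f x * g x) (2 ^ m * (B * C))"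
  using assms
proof (induction m arbitrary: f g)
  case 0
  then show ?case by (simp add: partials_le_0 norm_mult_le_weights)
next
  case (Suc m)
  have le: "partials_le W m f B" "partials_le V m g C"
    using Suc.prems by (auto intro: partials_le_order)
  have "partials_le (\<lambda>x. W x * V x) m (partial i (\<lambda>x. f x * g x)) (2 ^ Suc m * (B * C))" for i
  proof -
    have "partials_le (\<lambda>x. W x * V x) m (\<lambda>x. partial i f x * g x + f x * partial i g x)
        (2 ^ m * (B * C) + 2 ^ m * (B * C))"
      by (intro partials_le_add Suc.IH smooth_mult smooth_partial partials_le_partial Suc.prems le)
    then show ?thesis
      unfolding smooth_partial_mult[OF Suc.prems(1,2)] by (simp only: power_Suc mult_2 distrib_right)
  qed
  moreover have "cmod (f x * g x) \<le> 2 ^ Suc m * (B * C) * (W x * V x)" for x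
  proof -
    have 1: "cmod (f x * g x) \<le> B * C * (W x * V x)"
      by (rule norm_mult_le_weights[OF partials_leD0[OF le(1)] partials_leD0[OF le(2)]])
    then have "1 * (B * C * (W x * V x)) \<le> 2 ^ Suc m * (B * C * (W x * V x))"
      by (intro mult_right_mono one_le_power order_trans[OF norm_ge_zero 1]) simp
    with 1 show ?thesis by (simp only: mult.assoc mult_1)
  qed
  ultimately show ?case
    by (simp only: partials_le_Suc simp_thms)
qed

section \<open>Smooth functions of one variable\<close>

primrec differentiable1_upto :: "nat \<Rightarrow> (real \<Rightarrow> complex) \<Rightarrow> bool" where
  "differentiable1_upto 0 f = True"
| "differentiable1_upto (Suc k) f =
     (\<exists>f'. (\<forall>s. (f has_vector_derivative f' s) (at s)) \<and> differentiable1_upto k f')"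

definition smooth1 :: "(real \<Rightarrow> complex) \<Rightarrow> bool" where
  "smooth1 f \<longleftrightarrow> (\<forall>k. differentiable1_upto k f)"

definition deriv1 :: "(real \<Rightarrow> complex) \<Rightarrow> real \<Rightarrow> complex" where
  "deriv1 f s = vector_derivative f (at s)"

lemma deriv1_eqI: "(\<And>s. (f has_vector_derivative f' s) (at s)) \<Longrightarrow> deriv1 f = f'"
  unfolding deriv1_def by (rule ext) (rule vector_derivative_at)

lemma differentiable1_upto_Suc:
  "differentiable1_upto (Suc k) f \<longleftrightarrow>
     (\<forall>s. (f has_vector_derivative deriv1 f s) (at s)) \<and> differentiable1_upto k (deriv1 f)"
proof
  assume "differentiable1_upto (Suc k) f"
  then obtain f' where f': "\<And>s. (f has_vector_derivative f' s) (at s)" "differentiable1_upto k f'"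
    by auto
  then show "(\<forall>s. (f has_vector_derivative deriv1 f s) (at s)) \<and> differentiable1_upto k (deriv1 f)"
    by (simp add: deriv1_eqI[OF f'(1)])
qed auto

lemma smooth1_has_derivative: "smooth1 f \<Longrightarrow> (f has_vector_derivative deriv1 f s) (at s)"
  unfolding smooth1_def using differentiable1_upto_Suc[of 0 f] by blast

lemma smooth1_deriv1: "smooth1 f \<Longrightarrow> smooth1 (deriv1 f)"
  unfolding smooth1_def using differentiable1_upto_Suc[of _ f] by blast

lemma smooth1_iterate: "smooth1 f \<Longrightarrow> smooth1 ((deriv1 ^^ k) f)"
  by (induction k) (auto intro: smooth1_deriv1)

lemma smooth1I:
  assumes "\<And>s. (f has_vector_derivative f' s) (at s)" "smooth1 f'"
  shows "smooth1 f"
  unfolding smooth1_def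
proof
  show "differentiable1_upto k f" for k
    using assms by (cases k) (auto simp: smooth1_def)
qed

lemma smooth1_continuous: "smooth1 f \<Longrightarrow> continuous_on S f"
  by (intro continuous_at_imp_continuous_on ballI has_vector_derivative_continuous[OF smooth1_has_derivative])

lemma differentiable1_upto_mono: "differentiable1_upto (Suc k) f \<Longrightarrow> differentiable1_upto k f"
proof (induction k arbitrary: f)
  case (Suc k)
  then show ?case unfolding differentiable1_upto.simps(2)[of "Suc _"] differentiable1_upto.simps(2)[of k] by blast
qed simp

lemma differentiable1_upto_add:
  "differentiable1_upto k f \<Longrightarrow> differentiable1_upto k g \<Longrightarrow> differentiable1_upto k (\<lambda>s. f s + g s)"
proof (induction k arbitrary: f g)
  case (Suc k)
  then obtain f' g' where
    "\<And>s. (f has_vector_derivative f' s) (at s)" "differentiable1_upto k f'"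
    "\<And>s. (g has_vector_derivative g' s) (at s)" "differentiable1_upto k g'"
    by auto
  with Suc.IH show ?case
    by (auto intro!: exI[of _ "\<lambda>s. f' s + g' s"] has_vector_derivative_add)
qed simp

lemma differentiable1_upto_mult:
  "differentiable1_upto k f \<Longrightarrow> differentiable1_upto k g \<Longrightarrow> differentiable1_upto k (\<lambda>s. f s * g s)"
proof (induction k arbitrary: f g)
  case (Suc k)
  then obtain f' g' where
    "\<And>s. (f has_vector_derivative f' s) (at s)" "differentiable1_upto k f'"
    "\<And>s. (g has_vector_derivative g' s) (at s)" "differentiable1_upto k g'"
    by auto
  moreover have "differentiable1_upto k f" "differentiable1_upto k g"
    using Suc.prems differentiable1_upto_mono by blast+
  ultimately show ?case using Suc.IH
    by (auto intro!: exI[of _ "\<lambda>s. f s * g' s + f' s * g s"] has_vector_derivative_mult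
        differentiable1_upto_add)
qed simp

lemma smooth1_const [simp]: "smooth1 (\<lambda>s. c)"
proof -
  have "differentiable1_upto k (\<lambda>s. 0)" for k
    by (induction k) (auto intro!: exI[of _ "\<lambda>s. 0"])
  then have "smooth1 (\<lambda>s. 0)" by (simp add: smooth1_def)
  then show ?thesis by (rule smooth1I[of _ "\<lambda>s. 0", rotated]) auto
qed

lemma smooth1_add: "smooth1 f \<Longrightarrow> smooth1 g \<Longrightarrow> smooth1 (\<lambda>s. f s + g s)"
  by (simp add: smooth1_def differentiable1_upto_add)

lemma smooth1_mult: "smooth1 f \<Longrightarrow> smooth1 g \<Longrightarrow> smooth1 (\<lambda>s. f s * g s)"
  by (simp add: smooth1_def differentiable1_upto_mult)

lemma smooth1_diff: "smooth1 f \<Longrightarrow> smooth1 g \<Longrightarrow> smooth1 (\<lambda>s. f s - g s)"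
  using smooth1_add[of f "\<lambda>s. -1 * g s"] smooth1_mult[of "\<lambda>s. -1" g] by simp

lemma smooth1_of_real: "smooth1 of_real"
  using smooth1I[OF has_vector_derivative_of_real[OF DERIV_ident] smooth1_const[of "of_real 1"]] by simp

lemma smooth1_power: "smooth1 f \<Longrightarrow> smooth1 (\<lambda>s. f s ^ k)"
  by (induction k) (simp_all add: smooth1_mult)

lemma smooth1_exp: "smooth1 (\<lambda>s. exp (c * of_real s))"
proof -
  have D: "((\<lambda>s. b * exp (c * of_real s)) has_vector_derivative (b * c) * exp (c * of_real s)) (at s)" for b s
  proof -
    have "((\<lambda>z. b * exp (c * z)) has_field_derivative (b * c) * exp (c * of_real s)) (at (of_real s))"
      by (rule derivative_eq_intros refl | simp)+
    then show ?thesis by (rule has_vector_derivative_real_field[of "\<lambda>z. b * exp (c * z)"])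
  qed
  have "differentiable1_upto k (\<lambda>s. b * exp (c * of_real s))" for k b
  proof (induction k arbitrary: b)
    case (Suc k)
    show ?case unfolding differentiable1_upto.simps
      by (intro exI[of _ "\<lambda>s. (b * c) * exp (c * of_real s)"] conjI allI D Suc)
  qed simp
  from this[of _ 1] show ?thesis by (simp add: smooth1_def)
qed

lemma has_vector_derivative_affine:
  fixes f :: "real \<Rightarrow> complex"
  assumes "(f has_vector_derivative f') (at (a * s + b))"
  shows "((\<lambda>s. c * f (a * s + b)) has_vector_derivative (c * of_real a) * f') (at (s::real))"
proof -
  have "((\<lambda>s. a * s + b) has_vector_derivative a) (at s)"
    by (auto intro!: derivative_eq_intros simp: has_vector_derivative_def)
  from vector_diff_chain_at[OF this assms]
  have "((\<lambda>s. f (a * s + b)) has_vector_derivative a *\<^sub>R f') (at s)"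
    by (simp only: o_def)
  then have "((\<lambda>s. c * f (a * s + b)) has_vector_derivative c * (a *\<^sub>R f')) (at s)"
    by (rule bounded_linear.has_vector_derivative[OF bounded_linear_mult_right[of c]])
  then show ?thesis
    by (simp only: scaleR_conv_of_real mult.assoc)
qed

lemma smooth1_affine: "smooth1 f \<Longrightarrow> smooth1 (\<lambda>s. c * f (a * s + b))"
proof -
  have "differentiable1_upto k f \<Longrightarrow> differentiable1_upto k (\<lambda>s. c * f (a * s + b))" for k c
  proof (induction k arbitrary: f c)
    case (Suc k)
    then obtain f' where "\<And>s. (f has_vector_derivative f' s) (at s)" "differentiable1_upto k f'"
      by auto
    with Suc.IH show ?case
      by (auto intro!: exI[of _ "\<lambda>s. (c * of_real a) * f' (a * s + b)"] has_vector_derivative_affine)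
  qed simp
  then show "smooth1 f \<Longrightarrow> ?thesis" by (simp add: smooth1_def)
qed

lemma iterate_deriv1_affine:
  assumes "smooth1 f"
  shows "(deriv1 ^^ k) (\<lambda>s. c * f (a * s + b)) = (\<lambda>s. (c * of_real a ^ k) * (deriv1 ^^ k) f (a * s + b))"
proof (induction k)
  case (Suc k)
  have "deriv1 (\<lambda>s. (c * of_real a ^ k) * (deriv1 ^^ k) f (a * s + b)) =
      (\<lambda>s. (c * of_real a ^ k * of_real a) * deriv1 ((deriv1 ^^ k) f) (a * s + b))"
    by (intro deriv1_eqI has_vector_derivative_affine smooth1_has_derivative smooth1_iterate assms)
  with Suc show ?case by (simp add: mult_ac)
qed simp

lemma deriv1_const_on_open:
  assumes "open U" "\<And>s. s \<in> U \<Longrightarrow> f s = c" "s \<in> U"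
  shows "deriv1 f s = 0"
  unfolding deriv1_def
  by (rule vector_derivative_at, rule has_vector_derivative_transform_within_open[OF _ assms(1,3)])
     (auto intro!: derivative_eq_intros simp: assms(2))

text \<open>Outside the compact interval \<open>[a, b]\<close> every derivative is constant on either side.\<close>

lemma smooth1_bounded_derivatives:
  assumes "smooth1 f" "\<And>s. s \<le> a \<Longrightarrow> f s = c" "\<And>s. s \<ge> b \<Longrightarrow> f s = d"
  shows "\<exists>C. \<forall>s. cmod ((deriv1 ^^ k) f s) \<le> C"
proof -
  have "\<exists>c d. (\<forall>s<a. (deriv1 ^^ k) f s = c) \<and> (\<forall>s>b. (deriv1 ^^ k) f s = d)"
  proof (induction k)
    case 0
    then show ?case using assms(2,3) by (intro exI[of _ c] exI[of _ d]) auto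
  next
    case (Suc k)
    then obtain c d where "\<And>s. s < a \<Longrightarrow> (deriv1 ^^ k) f s = c" "\<And>s. s > b \<Longrightarrow> (deriv1 ^^ k) f s = d"
      by blast
    then have "deriv1 ((deriv1 ^^ k) f) s = 0" if "s < a \<or> s > b" for s
      using that deriv1_const_on_open[of "{..<a}" _ c s] deriv1_const_on_open[of "{b<..}" _ d s] by auto
    then show ?case by auto
  qed
  then obtain c' d' where out: "\<And>s. s < a \<Longrightarrow> (deriv1 ^^ k) f s = c'" "\<And>s. s > b \<Longrightarrow> (deriv1 ^^ k) f s = d'"
    by blast
  have "compact ((deriv1 ^^ k) f ` {a..b})"
    by (intro compact_continuous_image smooth1_continuous smooth1_iterate assms compact_Icc)
  then obtain B where "\<And>s. s \<in> {a..b} \<Longrightarrow> cmod ((deriv1 ^^ k) f s) \<le> B"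
    by (meson bounded_iff compact_imp_bounded imageI)
  then have "cmod ((deriv1 ^^ k) f s) \<le> max B (max (cmod c') (cmod d'))" for s
    using out[of s] by (cases "s < a"; cases "s > b") (auto simp: le_max_iff_disj)
  then show ?thesis by blast
qed

subsection \<open>A smooth step\<close>

lemma poly_times_exp_tendsto_0: "((\<lambda>u::real. poly p u * exp (- u)) \<longlongrightarrow> 0) at_top"
proof -
  have "((\<lambda>u. \<Sum>i\<le>degree p. coeff p i * (u ^ i / exp u)) \<longlongrightarrow> (\<Sum>i\<le>degree p. coeff p i * 0)) at_top"
    by (intro tendsto_sum tendsto_mult tendsto_const tendsto_power_div_exp_0)
  then show ?thesis
    by (simp add: poly_altdef sum_distrib_right exp_minus divide_inverse mult.assoc)
qed

text \<open>The functions \<open>p (1 / s) exp (- 1 / s)\<close>, extended by zero, form a family that is closed under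
  differentiation. So the existence of one derivative for all of them gives smoothness.\<close>

definition flat :: "real poly \<Rightarrow> real \<Rightarrow> real" where
  "flat p s = (if s > 0 then poly p (1 / s) * exp (- (1 / s)) else 0)"

lemma flat_has_derivative:
  "(flat p has_real_derivative flat ([:0, 0, 1:] * (p - pderiv p)) s) (at s)"
proof (cases "s = 0")
  case False
  show ?thesis
  proof (cases "s > 0")
    case True
    have "((\<lambda>s. poly p (1 / s) * exp (- (1 / s))) has_real_derivative
        flat ([:0, 0, 1:] * (p - pderiv p)) s) (at s)"
      using True unfolding flat_def
      by (auto intro!: derivative_eq_intros poly_DERIV[THEN DERIV_chain2] simp: field_simps power2_eq_square)
    then show ?thesis
      by (rule has_field_derivative_transform_within_open[of _ _ _ "{0<..}"]) (use True in \<open>auto simp: flat_def\<close>)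
  next
    case neg: False
    have "((\<lambda>s. 0) has_real_derivative 0) (at s)" by simp
    then have "(flat p has_real_derivative 0) (at s)"
      by (rule has_field_derivative_transform_within_open[of _ _ _ "{..<0}"]) (use False neg in \<open>auto simp: flat_def\<close>)
    then show ?thesis using neg by (simp add: flat_def)
  qed
next
  case True
  have "((\<lambda>s. poly ([:0, 1:] * p) (inverse s) * exp (- (inverse s))) \<longlongrightarrow> 0) (at_right 0)"
    by (rule filterlim_compose[OF poly_times_exp_tendsto_0 filterlim_inverse_at_top_right])
  then have "((\<lambda>s. (flat p s - flat p 0) / (s - 0)) \<longlongrightarrow> 0) (at_right 0)"
    by (rule Lim_transform_eventually)
       (auto simp: eventually_at_filter flat_def divide_inverse mult_ac)
  moreover have "((\<lambda>s. (flat p s - flat p 0) / (s - 0)) \<longlongrightarrow> 0) (at_left 0)"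
    by (rule Lim_transform_eventually[OF tendsto_const])
       (auto simp: eventually_at_filter flat_def)
  ultimately have "((\<lambda>s. (flat p s - flat p 0) / (s - 0)) \<longlongrightarrow> 0) (at 0)"
    by (simp add: filterlim_at_split)
  then show ?thesis
    using True by (simp add: has_field_derivative_iff flat_def)
qed

lemma smooth1_flat: "smooth1 (\<lambda>s. of_real (flat p s))"
proof -
  have "differentiable1_upto k (\<lambda>s. of_real (flat p s))" for k
  proof (induction k arbitrary: p)
    case (Suc k)
    show ?case
      using Suc has_vector_derivative_of_real[OF flat_has_derivative[of p]]
      by (auto intro!: exI[of _ "\<lambda>s. of_real (flat ([:0, 0, 1:] * (p - pderiv p)) s)"])
  qed simp
  then show ?thesis by (simp add: smooth1_def)
qed

text \<open>The step is an antiderivative of the bump \<open>exp (- 1 / s) exp (- 1 / (1 - s))\<close> on the unit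
  interval, rescaled.\<close>

lemma smooth_step_exists:
  "\<exists>\<theta>. smooth1 \<theta> \<and> (\<forall>s\<le>1/4. \<theta> s = 0) \<and> (\<forall>s\<ge>3/4. \<theta> s = 1)"
proof -
  define \<beta> where "\<beta> s = flat 1 s * flat 1 (1 - s)" for s
  have smooth_\<beta>: "smooth1 (\<lambda>s. of_real (\<beta> s))"
    using smooth1_mult[OF smooth1_flat[of 1] smooth1_affine[OF smooth1_flat[of 1], of 1 "-1" 1]]
    by (simp add: \<beta>_def)
  have cont: "continuous_on S \<beta>" for S
    using continuous_on_Re[OF smooth1_continuous[OF smooth_\<beta>]] by simp
  define F where "F s = (LBINT y=0..s. \<beta> y)" for s :: real
  have DF: "(F has_real_derivative \<beta> s) (at s)" for s
  proof -
    have "((\<lambda>u. LBINT y=ereal 0..u. \<beta> y) has_vector_derivative \<beta> s) (at s within {- \<bar>s\<bar> - 1..\<bar>s\<bar> + 1})"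
      by (rule interval_integral_FTC2) (auto intro: cont)
    moreover have "at s within {- \<bar>s\<bar> - 1..\<bar>s\<bar> + 1} = at s"
      by (rule at_within_interior) auto
    ultimately show ?thesis
      by (simp add: F_def[abs_def] has_real_derivative_iff_has_vector_derivative zero_ereal_def)
  qed
  have zero: "\<beta> s = 0" if "s \<le> 0 \<or> s \<ge> 1" for s
    using that by (auto simp: \<beta>_def flat_def)
  have pos: "\<beta> s > 0" if "0 < s" "s < 1" for s
    using that by (auto simp: \<beta>_def flat_def)
  have contF: "continuous_on S F" for S
    using DF DERIV_isCont continuous_at_imp_continuous_on by blast
  have F0: "F s = F 0" if "s \<le> 0" for s
  proof (cases "s = 0")
    case False
    with that have "DERIV F x :> 0" if "x < 0" for x
      using DF[of x] zero[of x] that by simp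
    then show ?thesis
      using False that by (intro DERIV_isconst_end[of s 0 F, symmetric] contF) auto
  qed simp
  have F1: "F s = F 1" if "s \<ge> 1" for s
  proof (cases "s = 1")
    case False
    have "DERIV F x :> 0" if "1 < x" for x
      using DF[of x] zero[of x] that by simp
    then show ?thesis
      using False that by (intro DERIV_isconst_end[of 1 s F] contF) auto
  qed simp
  have "F 0 < F 1"
    by (rule DERIV_pos_imp_increasing_open[OF _ _ contF]) (use DF pos in auto)
  define \<theta> :: "real \<Rightarrow> complex" where "\<theta> s = of_real ((F (2 * s - 1/2) - F 0) / (F 1 - F 0))" for s
  have "smooth1 (\<lambda>s. of_real (F s))"
    by (rule smooth1I[OF _ smooth_\<beta>]) (rule has_vector_derivative_of_real[OF DF])
  then have "smooth1 (\<lambda>s. (1 / of_real (F 1 - F 0)) * of_real (F (2 * s + (- 1/2))) -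
      of_real (F 0) / of_real (F 1 - F 0))"
    by (intro smooth1_diff smooth1_const) (rule smooth1_affine)
  also have "(\<lambda>s. (1 / of_real (F 1 - F 0)) * of_real (F (2 * s + (- 1/2))) -
      of_real (F 0) / of_real (F 1 - F 0)) = \<theta>"
    by (simp add: \<theta>_def fun_eq_iff diff_divide_distrib)
  finally have "smooth1 \<theta>" .
  moreover have "\<theta> s = 0" if "s \<le> 1/4" for s
    using F0[of "2 * s - 1/2"] that by (simp add: \<theta>_def)
  moreover have "\<theta> s = 1" if "s \<ge> 3/4" for s
    using F1[of "2 * s - 1/2"] that \<open>F 0 < F 1\<close> by (simp add: \<theta>_def)
  ultimately show ?thesis by blast
qed

definition smooth_step :: "real \<Rightarrow> complex" where
  "smooth_step = (SOME \<theta>. smooth1 \<theta> \<and> (\<forall>s\<le>1/4. \<theta> s = 0) \<and> (\<forall>s\<ge>3/4. \<theta> s = 1))"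

lemma smooth_step_spec:
  "smooth1 smooth_step \<and> (\<forall>s\<le>1/4. smooth_step s = 0) \<and> (\<forall>s\<ge>3/4. smooth_step s = 1)"
  unfolding smooth_step_def by (rule someI_ex[OF smooth_step_exists])

lemmas smooth1_step = smooth_step_spec[THEN conjunct1]

lemma smooth_step_0: "s \<le> 1/4 \<Longrightarrow> smooth_step s = 0"
  using smooth_step_spec[THEN conjunct2, THEN conjunct1] by blast

lemma smooth_step_1: "s \<ge> 3/4 \<Longrightarrow> smooth_step s = 1"
  using smooth_step_spec[THEN conjunct2, THEN conjunct2] by blast

subsection \<open>Division by the character that vanishes at the integers\<close>

text \<open>The values of \<open>g\<close> outside the unit disc are arbitrary, but \<open>f\<close> vanishes near the real points there.\<close>

lemma smooth1_times_holomorphic: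
  assumes "g holomorphic_on ball 0 1" "smooth1 f" "c < 1" "\<And>s. \<bar>s\<bar> > c \<Longrightarrow> f s = 0"
  shows "smooth1 (\<lambda>s. f s * g (of_real s))"
proof -
  have "differentiable1_upto k (\<lambda>s. f s * g (of_real s))"
    if "g holomorphic_on ball 0 1" "smooth1 f" "\<And>s. \<bar>s\<bar> > c \<Longrightarrow> f s = 0" for k f g
    using that
  proof (induction k arbitrary: f g)
    case (Suc k)
    have open_out: "open {s. \<bar>s\<bar> > c}" for c :: real
      by (intro open_Collect_less continuous_intros)
    let ?f' = "\<lambda>s. f s * deriv g (of_real s) + deriv1 f s * g (of_real s)"
    have "((\<lambda>s. f s * g (of_real s)) has_vector_derivative ?f' s) (at s)" for s
    proof (cases "\<bar>s\<bar> < 1")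
      case True
      then have "(g has_field_derivative deriv g (of_real s)) (at (of_real s))"
        by (intro holomorphic_derivI[OF Suc.prems(1)]) auto
      then have "((\<lambda>s. g (of_real s)) has_vector_derivative deriv g (of_real s)) (at s)"
        by (rule has_vector_derivative_real_field[of g])
      then show ?thesis
        by (intro has_vector_derivative_mult smooth1_has_derivative Suc.prems)
    next
      case False
      have s: "\<bar>s\<bar> > c" using False assms(3) by auto
      have "((\<lambda>s. 0) has_vector_derivative 0) (at s)" by simp
      then have "((\<lambda>s. f s * g (of_real s)) has_vector_derivative 0) (at s)"
        by (rule has_vector_derivative_transform_within_open[OF _ open_out[of c]])
           (use s Suc.prems in auto)
      moreover have "deriv1 f s = 0" "f s = 0"
        using deriv1_const_on_open[OF open_out[of c], of f 0 s] s Suc.prems(3) by auto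
      ultimately show ?thesis by simp
    qed
    moreover have "differentiable1_upto k ?f'"
    proof (intro differentiable1_upto_add Suc.IH Suc.prems holomorphic_deriv open_ball smooth1_deriv1)
      show "deriv1 f s = 0" if "\<bar>s\<bar> > c" for s
        using deriv1_const_on_open[OF open_out[of c], of f 0 s] that Suc.prems(3) by auto
    qed
    ultimately show ?case
      unfolding differentiable1_upto.simps by (intro exI[of _ ?f'] conjI allI)
  qed simp
  with assms show ?thesis by (simp add: smooth1_def)
qed

lemma exp_two_pi_i_eq_1_iff: "exp (two_pi_i * z) = 1 \<longleftrightarrow> z \<in> \<int>"
proof -
  have "2 * pi * Re z = real_of_int (2 * n) * pi \<longleftrightarrow> Re z = of_int n" for n
    by simp
  then show ?thesis
    unfolding exp_eq_1 complex_is_Int_iff by (simp add: two_pi_i_def)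
qed

text \<open>Since \<open>(exp (j z) - 1) / z\<close> is entire and has no zero in the open unit disc, the quotient
  \<open>s / (exp (j s) - 1)\<close> is smooth where a function supported in \<open>(- 1, 1)\<close> does not vanish.\<close>

lemma smooth1_division:
  assumes f: "smooth1 f" "c < 1" "\<And>s. \<bar>s\<bar> > c \<Longrightarrow> f s = 0"
  shows "\<exists>\<kappa>. smooth1 \<kappa> \<and> (\<forall>s. \<bar>s\<bar> > c \<longrightarrow> \<kappa> s = 0) \<and>
           (\<forall>s. of_real s * f s = (exp (two_pi_i * of_real s) - 1) * \<kappa> s)"
proof -
  let ?G = "\<lambda>z. if z = 0 then two_pi_i else (exp (two_pi_i * z) - 1) / z"
  have d: "deriv (\<lambda>z. exp (two_pi_i * z) - 1) 0 = two_pi_i"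
    by (rule DERIV_imp_deriv) (auto intro!: derivative_eq_intros)
  have hol: "?G holomorphic_on ball 0 1"
    by (rule pole_theorem_open_0[of "\<lambda>z. exp (two_pi_i * z) - 1" _ 0])
       (auto intro!: holomorphic_intros simp: d)
  have "?G z \<noteq> 0" if "z \<in> ball 0 1" for z
  proof (cases "z = 0")
    case True
    then show ?thesis by (simp add: two_pi_i_def)
  next
    case False
    have "z \<notin> \<int>"
      using that False by (auto elim!: Ints_cases)
    then show ?thesis using False exp_two_pi_i_eq_1_iff[of z] by simp
  qed
  then have "(\<lambda>z. inverse (?G z)) holomorphic_on ball 0 1"
    by (intro holomorphic_on_inverse hol)
  from smooth1_times_holomorphic[OF this f]
  have "smooth1 (\<lambda>s. f s * inverse (?G (of_real s)))" .
  moreover have "of_real s * f s = (exp (two_pi_i * of_real s) - 1) * (f s * inverse (?G (of_real s)))" for s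
  proof (cases "s = 0 \<or> \<bar>s\<bar> > c")
    case True
    then show ?thesis using f(3) by auto
  next
    case False
    have "complex_of_real s \<notin> \<int>"
      using False f(2) by (auto simp: Ints_def complex_eq_iff dest!: arg_cong[of _ _ Re])
    then show ?thesis using False exp_two_pi_i_eq_1_iff[of "of_real s"] by simp
  qed
  ultimately show ?thesis
    using f(3) by (intro exI[of _ "\<lambda>s. f s * inverse (?G (of_real s))"]) auto
qed

subsection \<open>Composition\<close>

lemma compose1_derivative:
  assumes "smooth1 f" "smooth_fun (\<lambda>x. of_real (h x))"
  shows "((\<lambda>x. f (h x)) has_derivative
    (\<lambda>v. \<Sum>i\<in>UNIV. of_real (v $ i) * (deriv1 f (h x) * partial i (\<lambda>x. of_real (h x)) x))) (at x)"
proof -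
  let ?D = "\<lambda>v. \<Sum>i\<in>UNIV. of_real (v $ i) * partial i (\<lambda>x. of_real (h x)) x"
  have D: "((\<lambda>x. complex_of_real (h x)) has_derivative ?D) (at x)"
    by (rule smooth_has_derivative[OF assms(2)])
  then have h: "(h has_derivative (\<lambda>v. Re (?D v))) (at x)"
    using has_derivative_Re[OF D] by simp
  have "((\<lambda>x. Im (complex_of_real (h x))) has_derivative (\<lambda>v. Im (?D v))) (at x)"
    using has_derivative_Im[OF D] .
  then have "(\<lambda>v. Im (?D v)) = (\<lambda>v. 0)"
    using has_derivative_unique[of "\<lambda>x. 0" "\<lambda>v. Im (?D v)" x "\<lambda>v. 0"] by simp
  then have real: "of_real (Re (?D v)) = ?D v" for v
    by (auto simp: complex_eq_iff dest: fun_cong)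
  have "((\<lambda>x. f (h x)) has_derivative (\<lambda>v. Re (?D v) *\<^sub>R deriv1 f (h x))) (at x)"
    using has_derivative_compose[OF h] smooth1_has_derivative[OF assms(1), of "h x"]
    by (simp add: has_vector_derivative_def)
  moreover have "Re (?D v) *\<^sub>R deriv1 f (h x) =
      (\<Sum>i\<in>UNIV. of_real (v $ i) * (deriv1 f (h x) * partial i (\<lambda>x. of_real (h x)) x))" for v
    unfolding scaleR_conv_of_real real sum_distrib_right by (intro sum.cong refl) (simp add: mult_ac)
  ultimately show ?thesis by simp
qed

lemma partial_compose1:
  assumes "smooth1 f" "smooth_fun (\<lambda>x. of_real (h x))"
  shows "partial i (\<lambda>x. f (h x)) = (\<lambda>x. deriv1 f (h x) * partial i (\<lambda>x. of_real (h x)) x)"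
  by (rule ext, subst partial_eqI[OF compose1_derivative[OF assms]])
     (simp add: axis_def if_distrib if_distribR cong: if_cong)

lemma smooth_compose1:
  assumes "smooth1 f" "smooth_fun (\<lambda>x. of_real (h x))"
  shows "smooth_fun (\<lambda>x. f (h x))"
proof -
  have "differentiable_upto k (\<lambda>x. f (h x))" if "smooth1 f" for k f
    using that
  proof (induction k arbitrary: f)
    case 0
    then show ?case using compose1_derivative[OF _ assms(2)] by (auto simp: differentiable_def)
  next
    case (Suc k)
    have "(\<lambda>x. f (h x)) differentiable (at x)" for x
      using compose1_derivative[OF Suc.prems assms(2)] by (auto simp: differentiable_def)
    moreover have "differentiable_upto k (partial i (\<lambda>x. f (h x)))" for i
      unfolding partial_compose1[OF Suc.prems assms(2)]
      using smooth_partial[OF assms(2), of i]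
      by (intro differentiable_upto_mult Suc.IH smooth1_deriv1 Suc.prems) (simp add: smooth_fun_iff)
    ultimately show ?case by simp
  qed
  then show ?thesis using assms(1) by (simp add: smooth_fun_iff)
qed

text \<open>The constant \<open>C\<close> depends on the inner function only; this is what makes the bounds for a scaled
  family of outer functions uniform.\<close>

lemma partials_le_compose1:
  assumes h: "smooth_fun (\<lambda>x. of_real (h x))"
    and B: "\<And>i. partials_le (\<lambda>_. 1) m (partial i (\<lambda>x. of_real (h x))) B"
  shows "\<exists>C\<ge>0. \<forall>f E. smooth1 f \<longrightarrow> (\<forall>l\<le>Suc m. \<forall>x. cmod ((deriv1 ^^ l) f (h x)) \<le> E) \<longrightarrow>
           partials_le (\<lambda>_. 1) (Suc m) (\<lambda>x. f (h x)) (C * E)"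
proof -
  have "\<exists>C\<ge>1. \<forall>f E. smooth1 f \<longrightarrow> (\<forall>l\<le>k. \<forall>x. cmod ((deriv1 ^^ l) f (h x)) \<le> E) \<longrightarrow>
           partials_le (\<lambda>_. 1) k (\<lambda>x. f (h x)) (C * E)" if "k \<le> Suc m" for k
    using that
  proof (induction k)
    case 0
    then show ?case by (intro exI[of _ 1]) (auto simp: partials_le_0)
  next
    case (Suc k)
    then obtain C where C: "C \<ge> 1" "\<And>f E. smooth1 f \<Longrightarrow> (\<forall>l\<le>k. \<forall>x. cmod ((deriv1 ^^ l) f (h x)) \<le> E) \<Longrightarrow>
           partials_le (\<lambda>_. 1) k (\<lambda>x. f (h x)) (C * E)"
      by auto
    let ?C = "max 1 (2 ^ k * (C * B))"
    have "partials_le (\<lambda>_. 1) (Suc k) (\<lambda>x. f (h x)) (?C * E)"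
      if f: "smooth1 f" and E: "\<forall>l\<le>Suc k. \<forall>x. cmod ((deriv1 ^^ l) f (h x)) \<le> E" for f E
      unfolding partials_le_Suc
    proof (intro conjI allI)
      have E0: "E \<ge> 0"
        using order_trans[OF norm_ge_zero E[rule_format, of 0 0]] by simp
      show "cmod (f (h x)) \<le> ?C * E * 1" for x
      proof -
        have "cmod (f (h x)) \<le> 1 * E" using E[rule_format, of 0 x] by simp
        also have "\<dots> \<le> ?C * E" using E0 by (intro mult_right_mono) auto
        finally show ?thesis by simp
      qed
      fix i
      have "\<forall>l\<le>k. \<forall>x. cmod ((deriv1 ^^ l) (deriv1 f) (h x)) \<le> E"
      proof (intro allI impI)
        show "cmod ((deriv1 ^^ l) (deriv1 f) (h x)) \<le> E" if "l \<le> k" for l x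
          using E[rule_format, of "Suc l" x] that by (simp add: funpow_swap1)
      qed
      then have "partials_le (\<lambda>_. 1) k (\<lambda>x. deriv1 f (h x)) (C * E)"
        by (rule C(2)[OF smooth1_deriv1[OF f]])
      moreover have "partials_le (\<lambda>_. 1) k (partial i (\<lambda>x. of_real (h x))) B"
        by (rule partials_le_order[OF B]) (use Suc.prems in linarith)
      ultimately have "partials_le (\<lambda>x. 1 * 1) k (\<lambda>x. deriv1 f (h x) * partial i (\<lambda>x. of_real (h x)) x)
          (2 ^ k * ((C * E) * B))"
        by (rule partials_le_mult[OF smooth_compose1[OF smooth1_deriv1[OF f] h] smooth_partial[OF h]])
      then show "partials_le (\<lambda>_. 1) k (partial i (\<lambda>x. f (h x))) (?C * E)"
        unfolding partial_compose1[OF f h]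
      proof (rule partials_le_weaken)
        have "(2 ^ k * (C * B)) * E \<le> ?C * E" using E0 by (intro mult_right_mono) auto
        then show "2 ^ k * ((C * E) * B) * (1 * 1) \<le> ?C * E * 1" by (simp add: mult_ac)
      qed
    qed
    then show ?case
      by (intro exI[of _ ?C] conjI allI impI) simp_all
  qed
  from this[of "Suc m"] obtain C where "C \<ge> 1" "\<forall>f E. smooth1 f \<longrightarrow> (\<forall>l\<le>Suc m. \<forall>x. cmod ((deriv1 ^^ l) f (h x)) \<le> E) \<longrightarrow>
           partials_le (\<lambda>_. 1) (Suc m) (\<lambda>x. f (h x)) (C * E)"
    by blast
  then show ?thesis by (intro exI[of _ C]) auto
qed

section \<open>Schwartz functions and seminorm bounds\<close>

abbreviation decay :: "nat \<Rightarrow> real ^ 'n \<Rightarrow> real" where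
  "decay N x \<equiv> 1 / (1 + norm x) ^ N"

lemma weight_pos: "0 < (1 + norm x) ^ N"
  by (intro zero_less_power) (simp add: add_pos_nonneg)

lemma decay_antimono: "N \<le> M \<Longrightarrow> decay M x \<le> decay N x"
  by (intro divide_left_mono power_increasing mult_pos_pos weight_pos) auto

lemma partials_le_decay_iff:
  "partials_le (decay N) m f B \<longleftrightarrow>
     (\<forall>is x. length is \<le> m \<longrightarrow> (1 + norm x) ^ N * cmod (partials is f x) \<le> B)"
  by (simp add: partials_le_def pos_le_divide_eq[OF weight_pos] mult.commute)

lemma partials_le_nonneg:
  assumes "partials_le W m f B" "W 0 > 0" shows "B \<ge> 0"
  using order_trans[OF norm_ge_zero partials_leD0[OF assms(1), of 0]] assms(2)
  by (simp add: zero_le_mult_iff)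

lemma partials_le_decay_mono:
  assumes "partials_le (decay M) k f B" "N \<le> M" "m \<le> k"
  shows "partials_le (decay N) m f B"
proof -
  have "partials_le (decay M) m f B"
    using assms partials_le_order by blast
  then show ?thesis
    by (rule partials_le_weaken)
       (intro mult_left_mono decay_antimono assms(2) partials_le_nonneg[OF assms(1)], simp)
qed

lemma schwartz_smooth: "schwartz f \<Longrightarrow> smooth_fun f"
  by (simp add: schwartz_def)

lemma schwartz_iff:
  "schwartz f \<longleftrightarrow> smooth_fun f \<and> (\<forall>N m. \<exists>B. partials_le (decay N) m f B)"
proof
  assume f: "schwartz f"
  show "smooth_fun f \<and> (\<forall>N m. \<exists>B. partials_le (decay N) m f B)"
  proof (intro conjI allI)
    fix N m
    have fin: "finite {is :: 'a list. length is \<le> m}"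
      using finite_lists_length_le[of "UNIV :: 'a set" m] by simp
    have "\<forall>is. \<exists>B. \<forall>x. (1 + norm x) ^ N * cmod (partials is f x) \<le> B"
    proof
      fix "is"
      have "bounded (range (\<lambda>x. (1 + norm x) ^ N * cmod (partials is f x)))"
        using f by (simp add: schwartz_def)
      then obtain B where "\<And>x. \<bar>(1 + norm x) ^ N * cmod (partials is f x)\<bar> \<le> B"
        by (auto simp: bounded_real)
      then show "\<exists>B. \<forall>x. (1 + norm x) ^ N * cmod (partials is f x) \<le> B"
        using abs_le_D1 by blast
    qed
    from choice[OF this] obtain B where B: "\<And>is x. (1 + norm x) ^ N * cmod (partials is f x) \<le> B is"
      by blast
    have "B is \<le> (\<Sum>is\<in>{is. length is \<le> m}. \<bar>B is\<bar>)" if "length is \<le> m" for "is"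
      by (rule order_trans[OF abs_ge_self], rule member_le_sum[OF _ _ fin]) (use that in auto)
    then have "partials_le (decay N) m f (\<Sum>is\<in>{is. length is \<le> m}. \<bar>B is\<bar>)"
      unfolding partials_le_decay_iff by (intro allI impI order_trans[OF B]) blast
    then show "\<exists>B. partials_le (decay N) m f B" ..
  qed (use f in \<open>simp add: schwartz_def\<close>)
next
  assume f: "smooth_fun f \<and> (\<forall>N m. \<exists>B. partials_le (decay N) m f B)"
  have "bounded (range (\<lambda>x. (1 + norm x) ^ N * cmod (partials is f x)))" for N "is"
  proof -
    obtain B where "partials_le (decay N) (length is) f B"
      using f by blast
    then have "\<bar>(1 + norm x) ^ N * cmod (partials is f x)\<bar> \<le> B" for x
      by (simp add: partials_le_decay_iff)
    then show ?thesis by (auto simp: bounded_real)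
  qed
  with f show "schwartz f" by (simp add: schwartz_def)
qed

lemma schwartzE:
  assumes "schwartz f"
  obtains B where "B \<ge> 0" "partials_le (decay N) m f B"
proof -
  obtain B where B: "partials_le (decay N) m f B"
    using assms schwartz_iff by blast
  moreover have "B \<ge> 0"
    by (rule partials_le_nonneg[OF B]) simp
  ultimately show ?thesis using that by blast
qed

text \<open>The operators that send Schwartz functions to Schwartz functions continuously. Their transposes act on
  tempered distributions.\<close>

definition schwartz_operator :: "((real ^ 'n \<Rightarrow> complex) \<Rightarrow> real ^ ('n::finite) \<Rightarrow> complex) \<Rightarrow> bool" where
  "schwartz_operator T \<longleftrightarrow>
     (\<forall>f. schwartz f \<longrightarrow> smooth_fun (T f)) \<and>
     (\<forall>f g a b. schwartz f \<longrightarrow> schwartz g \<longrightarrow> T (\<lambda>x. a * f x + b * g x) = (\<lambda>x. a * T f x + b * T g x)) \<and>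
     (\<forall>N m. \<exists>C M k. \<forall>f B. schwartz f \<longrightarrow> partials_le (decay M) k f B \<longrightarrow> partials_le (decay N) m (T f) (C * B))"

lemma schwartz_operator_schwartz:
  assumes "schwartz_operator T" "schwartz f" shows "schwartz (T f)"
  unfolding schwartz_iff
proof (intro conjI allI)
  show "smooth_fun (T f)" using assms by (simp add: schwartz_operator_def)
  fix N m
  obtain C M k where "\<And>f B. schwartz f \<Longrightarrow> partials_le (decay M) k f B \<Longrightarrow> partials_le (decay N) m (T f) (C * B)"
    using assms(1) unfolding schwartz_operator_def by blast
  moreover obtain B where "partials_le (decay M) k f B"
    using assms(2) schwartz_iff by blast
  ultimately show "\<exists>B. partials_le (decay N) m (T f) B" using assms(2) by blast
qed

lemma schwartz_operator_linear:
  "schwartz_operator T \<Longrightarrow> schwartz f \<Longrightarrow> schwartz g \<Longrightarrow>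
    T (\<lambda>x. a * f x + b * g x) = (\<lambda>x. a * T f x + b * T g x)"
  by (simp add: schwartz_operator_def)

lemma schwartz_operator_bound:
  "schwartz_operator T \<Longrightarrow>
    \<exists>C M k. \<forall>f B. schwartz f \<longrightarrow> partials_le (decay M) k f B \<longrightarrow> partials_le (decay N) m (T f) (C * B)"
  by (simp add: schwartz_operator_def)

lemma schwartz_operator_compose:
  assumes "schwartz_operator S" "schwartz_operator T"
  shows "schwartz_operator (\<lambda>f. S (T f))"
  unfolding schwartz_operator_def
proof (intro conjI allI impI)
  show "smooth_fun (S (T f))" if "schwartz f" for f
    by (intro schwartz_smooth schwartz_operator_schwartz[OF assms(1)] schwartz_operator_schwartz[OF assms(2)] that)
  show "S (T (\<lambda>x. a * f x + b * g x)) = (\<lambda>x. a * S (T f) x + b * S (T g) x)"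
    if "schwartz f" "schwartz g" for f g a b
    using schwartz_operator_linear[OF assms(2) that]
      schwartz_operator_linear[OF assms(1) schwartz_operator_schwartz[OF assms(2) that(1)]
        schwartz_operator_schwartz[OF assms(2) that(2)]] by simp
  fix N m
  obtain C M k where 1: "\<And>f B. schwartz f \<Longrightarrow> partials_le (decay M) k f B \<Longrightarrow> partials_le (decay N) m (S f) (C * B)"
    using schwartz_operator_bound[where N = N and m = m, OF assms(1)] by blast
  obtain C' M' k' where 2: "\<And>f B. schwartz f \<Longrightarrow> partials_le (decay M') k' f B \<Longrightarrow> partials_le (decay M) k (T f) (C' * B)"
    using schwartz_operator_bound[where N = M and m = k, OF assms(2)] by blast
  have "partials_le (decay N) m (S (T f)) ((C * C') * B)"
    if "schwartz f" "partials_le (decay M') k' f B" for f B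
    using 1[OF schwartz_operator_schwartz[OF assms(2) that(1)] 2[OF that]] by (simp add: mult.assoc)
  then show "\<exists>C M k. \<forall>f B. schwartz f \<longrightarrow> partials_le (decay M) k f B \<longrightarrow> partials_le (decay N) m (S (T f)) (C * B)"
    by blast
qed

lemma schwartz_operator_combination:
  assumes "schwartz_operator S" "schwartz_operator T"
  shows "schwartz_operator (\<lambda>f x. a * S f x + b * T f x)"
  unfolding schwartz_operator_def
proof (intro conjI allI impI)
  show "smooth_fun (\<lambda>x. a * S f x + b * T f x)" if "schwartz f" for f
    by (intro smooth_add smooth_cmult schwartz_smooth schwartz_operator_schwartz[OF assms(1)]
        schwartz_operator_schwartz[OF assms(2)] that)
  show "(\<lambda>x. a * S (\<lambda>x. c * f x + d * g x) x + b * T (\<lambda>x. c * f x + d * g x) x) =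
      (\<lambda>x. c * (a * S f x + b * T f x) + d * (a * S g x + b * T g x))"
    if "schwartz f" "schwartz g" for f g c d
    unfolding schwartz_operator_linear[OF assms(1) that] schwartz_operator_linear[OF assms(2) that]
    by (simp add: algebra_simps)
  fix N m
  obtain C M k where 1: "\<And>f B. schwartz f \<Longrightarrow> partials_le (decay M) k f B \<Longrightarrow> partials_le (decay N) m (S f) (C * B)"
    using schwartz_operator_bound[where N = N and m = m, OF assms(1)] by blast
  obtain C' M' k' where 2: "\<And>f B. schwartz f \<Longrightarrow> partials_le (decay M') k' f B \<Longrightarrow> partials_le (decay N) m (T f) (C' * B)"
    using schwartz_operator_bound[where N = N and m = m, OF assms(2)] by blast
  have "partials_le (decay N) m (\<lambda>x. a * S f x + b * T f x) ((cmod a * C + cmod b * C') * B)"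
    if f: "schwartz f" and B: "partials_le (decay (max M M')) (max k k') f B" for f B
  proof -
    have "partials_le (decay N) m (\<lambda>x. a * S f x + b * T f x) (cmod a * (C * B) + cmod b * (C' * B))"
      by (intro partials_le_add partials_le_cmult smooth_cmult 1[OF f] 2[OF f] partials_le_decay_mono[OF B]
          schwartz_smooth schwartz_operator_schwartz[OF assms(1) f] schwartz_operator_schwartz[OF assms(2) f]) auto
    then show ?thesis by (simp add: algebra_simps)
  qed
  then show "\<exists>C M k. \<forall>f B. schwartz f \<longrightarrow> partials_le (decay M) k f B \<longrightarrow>
      partials_le (decay N) m (\<lambda>x. a * S f x + b * T f x) (C * B)"
    by blast
qed

lemma schwartz_operator_partial: "schwartz_operator (partial i)"
  unfolding schwartz_operator_def
proof (intro conjI allI impI)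
  fix N m
  have "partials_le (decay N) m (partial i f) (1 * B)" if "partials_le (decay N) (Suc m) f B" for f B
    using partials_le_partial[OF that] by simp
  then show "\<exists>C M k. \<forall>f B. schwartz f \<longrightarrow> partials_le (decay M) k f B \<longrightarrow> partials_le (decay N) m (partial i f) (C * B)"
    by blast
qed (auto simp: schwartz_smooth smooth_partial smooth_partial_add smooth_partial_cmult smooth_cmult)

lemma schwartz_operator_translation: "schwartz_operator (\<lambda>f x. f (x + a))"
  unfolding schwartz_operator_def
proof (intro conjI allI impI)
  fix N m
  have "partials_le (decay N) m (\<lambda>x. f (x + a)) ((1 + norm a) ^ N * B)"
    if f: "schwartz f" and B: "partials_le (decay N) m f B" for f B
    unfolding partials_le_decay_iff
  proof (intro allI impI)
    fix "is" :: "'a list" and x assume "length is \<le> m"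
    then have b: "(1 + norm (x + a)) ^ N * cmod (partials is f (x + a)) \<le> B"
      using B by (simp add: partials_le_decay_iff)
    have "1 + norm x \<le> (1 + norm a) * (1 + norm (x + a))"
      using norm_triangle_ineq4[of "x + a" a] mult_nonneg_nonneg[OF norm_ge_zero[of a] norm_ge_zero[of "x + a"]]
      unfolding distrib_left distrib_right add_diff_cancel_right' by linarith
    then have "(1 + norm x) ^ N \<le> (1 + norm a) ^ N * (1 + norm (x + a)) ^ N"
      unfolding power_mult_distrib[symmetric] by (intro power_mono) auto
    then have "(1 + norm x) ^ N * cmod (partials is f (x + a)) \<le>
        (1 + norm a) ^ N * ((1 + norm (x + a)) ^ N * cmod (partials is f (x + a)))"
      unfolding mult.assoc[symmetric] by (rule mult_right_mono) simp
    also have "\<dots> \<le> (1 + norm a) ^ N * B"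
      by (intro mult_left_mono b zero_le_power) simp
    finally show "(1 + norm x) ^ N * cmod (partials is (\<lambda>x. f (x + a)) x) \<le> (1 + norm a) ^ N * B"
      using f by (simp add: partials_translation schwartz_smooth)
  qed
  then show "\<exists>C M k. \<forall>f B. schwartz f \<longrightarrow> partials_le (decay M) k f B \<longrightarrow> partials_le (decay N) m (\<lambda>x. f (x + a)) (C * B)"
    by blast
qed (auto simp: schwartz_smooth smooth_translation)

subsection \<open>Multipliers\<close>

definition multiplier :: "(real ^ 'n \<Rightarrow> complex) \<Rightarrow> bool" where
  "multiplier a \<longleftrightarrow> smooth_fun a \<and> (\<forall>m. \<exists>N B. partials_le (\<lambda>x. (1 + norm x) ^ N) m a B)"

lemma schwartz_operator_multiplier:
  assumes "multiplier a"
  shows "schwartz_operator (\<lambda>f x. a x * f x)"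
  unfolding schwartz_operator_def
proof (intro conjI allI impI)
  have a: "smooth_fun a" using assms by (simp add: multiplier_def)
  show "smooth_fun (\<lambda>x. a x * f x)" if "schwartz f" for f
    by (rule smooth_mult[OF a schwartz_smooth[OF that]])
  fix N m
  obtain K A where A: "partials_le (\<lambda>x. (1 + norm x) ^ K) m a A"
    using assms unfolding multiplier_def by blast
  have "partials_le (decay N) m (\<lambda>x. a x * f x) ((2 ^ m * A) * B)"
    if f: "schwartz f" and B: "partials_le (decay (K + N)) m f B" for f B
  proof -
    have "partials_le (\<lambda>x. (1 + norm x) ^ K * decay (K + N) x) m (\<lambda>x. a x * f x) (2 ^ m * (A * B))"
      by (rule partials_le_mult[OF a schwartz_smooth[OF f] A B])
    moreover have "(1 + norm x) ^ K * decay (K + N) x = decay N x" for x :: "real ^ 'a"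
    proof -
      have "1 + norm x \<noteq> 0" using norm_ge_zero[of x] by linarith
      then show ?thesis by (simp add: power_add)
    qed
    ultimately show ?thesis by (simp only: mult.assoc)
  qed
  then show "\<exists>C M k. \<forall>f B. schwartz f \<longrightarrow> partials_le (decay M) k f B \<longrightarrow> partials_le (decay N) m (\<lambda>x. a x * f x) (C * B)"
    by blast
qed (simp add: algebra_simps)

lemma multiplier_bounded:
  assumes "smooth_fun a" "\<And>m. \<exists>B. partials_le (\<lambda>_. 1) m a B"
  shows "multiplier a"
  unfolding multiplier_def
proof (intro conjI allI assms)
  fix m
  obtain B where "partials_le (\<lambda>_. 1) m a B" using assms by blast
  then show "\<exists>N B. partials_le (\<lambda>x. (1 + norm x) ^ N) m a B"
    by (intro exI[of _ 0] exI[of _ B]) simp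
qed

lemma partials_const: "partials is (\<lambda>x. c) = (\<lambda>x. if is = [] then c else 0)"
proof (cases "is" rule: rev_cases)
  case (snoc js i)
  then show ?thesis by simp
qed simp

lemma multiplier_coord: "multiplier (\<lambda>x. of_real (x $ i))"
  unfolding multiplier_def
proof (intro conjI allI)
  fix m
  have "partials_le (\<lambda>x. (1 + norm x) ^ 1) m (\<lambda>x. of_real (x $ i)) 1"
    unfolding partials_le_def
  proof (intro allI impI)
    fix "is" :: "'a list" and x :: "real ^ 'a"
    show "cmod (partials is (\<lambda>x. of_real (x $ i)) x) \<le> 1 * (1 + norm x) ^ 1"
    proof (cases "is" rule: rev_cases)
      case Nil
      then show ?thesis using component_le_norm_cart[of x i] by (simp add: add_increasing)
    next
      case (snoc js k)
      then show ?thesis by (auto simp: partial_coord partials_const if_distribR)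
    qed
  qed
  then show "\<exists>N B. partials_le (\<lambda>x. (1 + norm x) ^ N) m (\<lambda>x. of_real (x $ i)) B" by blast
qed (rule smooth_coord)

text \<open>All derivatives of the family are bounded, uniformly in the parameter. The uniformity serves cutoff functions
  of growing size; a single function is a family over a one-point type.\<close>

definition uniformly_smooth :: "('p \<Rightarrow> real ^ 'n \<Rightarrow> complex) \<Rightarrow> bool" where
  "uniformly_smooth F \<longleftrightarrow> (\<forall>p. smooth_fun (F p)) \<and> (\<forall>m. \<exists>B. \<forall>p. partials_le (\<lambda>_. 1) m (F p) B)"

lemma uniformly_smooth_multiplier: "uniformly_smooth F \<Longrightarrow> multiplier (F p)"
  unfolding uniformly_smooth_def by (intro multiplier_bounded) blast+

lemma uniformly_smooth_const: "uniformly_smooth (\<lambda>p x. c)"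
  unfolding uniformly_smooth_def
  by (intro conjI allI exI[of _ "cmod c"] smooth_const) (simp add: partials_le_def partials_const)

lemma uniformly_smooth_mult:
  assumes "uniformly_smooth F" "uniformly_smooth G"
  shows "uniformly_smooth (\<lambda>p x. F p x * G p x)"
  unfolding uniformly_smooth_def
proof (intro conjI allI)
  show "smooth_fun (\<lambda>x. F p x * G p x)" for p
    using assms by (simp add: uniformly_smooth_def smooth_mult)
  fix m
  obtain B C where "\<And>p. partials_le (\<lambda>_. 1) m (F p) B" "\<And>p. partials_le (\<lambda>_. 1) m (G p) C"
    using assms unfolding uniformly_smooth_def by metis
  then have "partials_le (\<lambda>_. 1 * 1) m (\<lambda>x. F p x * G p x) (2 ^ m * (B * C))" for p
    using assms by (intro partials_le_mult) (auto simp: uniformly_smooth_def)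
  then show "\<exists>B. \<forall>p. partials_le (\<lambda>_. 1) m (\<lambda>x. F p x * G p x) B" by auto
qed

lemma uniformly_smooth_prod:
  "(\<And>a. a \<in> A \<Longrightarrow> uniformly_smooth (F a)) \<Longrightarrow> uniformly_smooth (\<lambda>p x. \<Prod>a\<in>A. F a p x)"
  by (induction A rule: infinite_finite_induct) (simp_all add: uniformly_smooth_const uniformly_smooth_mult)

lemma uniformly_smooth_add:
  assumes "uniformly_smooth F" "uniformly_smooth G"
  shows "uniformly_smooth (\<lambda>p x. F p x + G p x)"
  unfolding uniformly_smooth_def
proof (intro conjI allI)
  show "smooth_fun (\<lambda>x. F p x + G p x)" for p
    using assms by (simp add: uniformly_smooth_def smooth_add)
  fix m
  obtain B C where "\<And>p. partials_le (\<lambda>_. 1) m (F p) B" "\<And>p. partials_le (\<lambda>_. 1) m (G p) C"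
    using assms unfolding uniformly_smooth_def by metis
  then have "partials_le (\<lambda>_. 1) m (\<lambda>x. F p x + G p x) (B + C)" for p
    using assms by (intro partials_le_add) (auto simp: uniformly_smooth_def)
  then show "\<exists>B. \<forall>p. partials_le (\<lambda>_. 1) m (\<lambda>x. F p x + G p x) B" by auto
qed

lemma partials_le_partial_inner:
  "partials_le (\<lambda>_. 1) m (partial i (\<lambda>x. of_real (v \<bullet> x))) \<bar>v $ i\<bar>"
  by (simp add: partial_inner partials_le_def partials_const)

text \<open>The inner function is linear, so its derivatives are bounded and only finitely many derivatives of \<open>f p\<close>
  enter each bound.\<close>

lemma uniformly_smooth_compose_inner:
  assumes "\<And>p. smooth1 (f p)" "\<And>l. \<exists>E. \<forall>p s. cmod ((deriv1 ^^ l) (f p) s) \<le> E"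
  shows "uniformly_smooth (\<lambda>p x. f p (v \<bullet> x))"
  unfolding uniformly_smooth_def
proof (intro conjI allI)
  show "smooth_fun (\<lambda>x. f p (v \<bullet> x))" for p
    by (rule smooth_compose1[OF assms(1) smooth_inner])
  fix m
  have "partials_le (\<lambda>_. 1) m (partial i (\<lambda>x. of_real (v \<bullet> x))) (norm v)" for i
    by (rule partials_le_weaken[OF partials_le_partial_inner]) (simp add: component_le_norm_cart)
  from partials_le_compose1[OF smooth_inner this]
  obtain C where C: "\<And>f E. smooth1 f \<Longrightarrow> \<forall>l\<le>Suc m. \<forall>x. cmod ((deriv1 ^^ l) f (v \<bullet> x)) \<le> E \<Longrightarrow>
      partials_le (\<lambda>_. 1) (Suc m) (\<lambda>x. f (v \<bullet> x)) (C * E)"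
    by blast
  obtain E where E: "\<And>l p s. cmod ((deriv1 ^^ l) (f p) s) \<le> E l"
    using assms(2) by metis
  have "cmod ((deriv1 ^^ l) (f p) s) \<le> (\<Sum>l\<le>Suc m. E l)" if "l \<le> Suc m" for l p s
  proof -
    have "E l \<le> (\<Sum>l\<le>Suc m. E l)"
      by (rule member_le_sum) (use that order_trans[OF norm_ge_zero E] in auto)
    then show ?thesis using E[of l p s] by simp
  qed
  then have "partials_le (\<lambda>_. 1) (Suc m) (\<lambda>x. f p (v \<bullet> x)) (C * (\<Sum>l\<le>Suc m. E l))" for p
    by (intro C[OF assms(1)] allI impI) blast
  then have "partials_le (\<lambda>_. 1) m (\<lambda>x. f p (v \<bullet> x)) (C * (\<Sum>l\<le>Suc m. E l))" for p
    by (rule partials_le_order) simp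
  then show "\<exists>B. \<forall>p. partials_le (\<lambda>_. 1) m (\<lambda>x. f p (v \<bullet> x)) B" by blast
qed

lemma iterate_deriv1_exp:
  "(deriv1 ^^ l) (\<lambda>s. exp (c * of_real s)) = (\<lambda>s. c ^ l * exp (c * of_real s))"
proof (induction l)
  case (Suc l)
  have "((\<lambda>s. c ^ l * exp (c * of_real s)) has_vector_derivative c ^ Suc l * exp (c * of_real s)) (at s)" for s
  proof -
    have "((\<lambda>z. c ^ l * exp (c * z)) has_field_derivative c ^ Suc l * exp (c * of_real s)) (at (of_real s))"
      by (rule derivative_eq_intros refl | simp)+
    then show ?thesis by (rule has_vector_derivative_real_field[of "\<lambda>z. c ^ l * exp (c * z)"])
  qed
  from deriv1_eqI[OF this] show ?case using Suc by simp
qed simp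

definition character :: "real ^ 'n \<Rightarrow> real ^ 'n \<Rightarrow> complex" where
  "character v x = exp (two_pi_i * of_real (v \<bullet> x))"

lemma Re_two_pi_i [simp]: "Re two_pi_i = 0" and Im_two_pi_i [simp]: "Im two_pi_i = 2 * pi"
  by (simp_all add: two_pi_i_def)

lemma two_pi_i_nonzero [simp]: "two_pi_i \<noteq> 0"
  by (simp add: two_pi_i_def)

lemma norm_character [simp]: "cmod (character v x) = 1"
  by (simp add: character_def)

lemma character_nonzero [simp]: "character v x \<noteq> 0"
  by (simp add: character_def)

lemma character_add: "character v (x + y) = character v x * character v y"
  by (simp add: character_def inner_add_right distrib_left exp_add)

lemma character_add_left: "character (v + w) x = character v x * character w x"
  by (simp add: character_def inner_add_left distrib_left exp_add)

lemma character_zero [simp]: "character 0 x = 1" "character v 0 = 1"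
  by (simp_all add: character_def)

lemma character_minus: "character (- v) x = inverse (character v x)" "character v (- x) = inverse (character v x)"
  by (simp_all add: character_def exp_minus)

lemma character_commute: "character v x = character x v"
  by (simp add: character_def inner_commute)

lemma cnj_character: "cnj (character v x) = inverse (character v x)"
  by (simp add: character_def exp_cnj exp_minus[symmetric] two_pi_i_def)

lemma smooth_character: "smooth_fun (character v)"
  unfolding character_def using smooth_compose1[OF smooth1_exp smooth_inner] .

lemma uniformly_smooth_character: "uniformly_smooth (\<lambda>p. character v)"
  unfolding character_def
proof (rule uniformly_smooth_compose_inner[OF smooth1_exp])
  show "\<exists>E. \<forall>p s. cmod ((deriv1 ^^ l) (\<lambda>s. exp (two_pi_i * of_real s)) s) \<le> E" for l
    by (intro exI[of _ "cmod two_pi_i ^ l"]) (simp add: iterate_deriv1_exp norm_mult norm_power)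
qed

lemma multiplier_character: "multiplier (character v)"
  by (rule uniformly_smooth_multiplier[OF uniformly_smooth_character])

lemma partial_character: "partial i (character v) = (\<lambda>x. two_pi_i * of_real (v $ i) * character v x)"
proof -
  have "deriv1 (\<lambda>s. exp (two_pi_i * of_real s)) = (\<lambda>s. two_pi_i * exp (two_pi_i * of_real s))"
    using iterate_deriv1_exp[of 1 two_pi_i] by simp
  then show ?thesis
    unfolding character_def
    by (subst partial_compose1[OF smooth1_exp smooth_inner]) (simp add: partial_inner mult_ac)
qed

section \<open>Tempered distributions\<close>

definition linear_functional :: "('n::finite) functional \<Rightarrow> bool" where
  "linear_functional t \<longleftrightarrow> (\<forall>\<phi> \<psi> a b. schwartz \<phi> \<longrightarrow> schwartz \<psi> \<longrightarrow>
     t (\<lambda>x. a * \<phi> x + b * \<psi> x) = a * t \<phi> + b * t \<psi>)"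

text \<open>Continuity of a linear functional, expressed by a bound in terms of a single seminorm. This is the form
  in which continuity is used; it follows from continuity in the Schwartz topology, which
  \<open>tempered_distribution_imp_tempered\<close> shows.\<close>

definition tempered :: "('n::finite) functional \<Rightarrow> bool" where
  "tempered t \<longleftrightarrow> linear_functional t \<and>
     (\<exists>C N m. \<forall>\<phi> B. schwartz \<phi> \<longrightarrow> partials_le (decay N) m \<phi> B \<longrightarrow> cmod (t \<phi>) \<le> C * B)"

lemma schwartz_zero [simp]: "schwartz (\<lambda>x. 0)"
  by (auto simp: schwartz_iff partials_le_def intro: exI[of _ 0])

lemma schwartz_combination: "schwartz f \<Longrightarrow> schwartz g \<Longrightarrow> schwartz (\<lambda>x. a * f x + b * g x)"
  unfolding schwartz_iff
proof (intro conjI allI)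
  fix N m
  assume "smooth_fun f \<and> (\<forall>N m. \<exists>B. partials_le (decay N) m f B)"
    "smooth_fun g \<and> (\<forall>N m. \<exists>B. partials_le (decay N) m g B)"
  then obtain B C where "smooth_fun f" "smooth_fun g" "partials_le (decay N) m f B" "partials_le (decay N) m g C"
    by blast
  then have "partials_le (decay N) m (\<lambda>x. a * f x + b * g x) (cmod a * B + cmod b * C)"
    by (intro partials_le_add partials_le_cmult smooth_cmult)
  then show "\<exists>B. partials_le (decay N) m (\<lambda>x. a * f x + b * g x) B" ..
qed (auto intro: smooth_add smooth_cmult)

lemma schwartz_add: "schwartz f \<Longrightarrow> schwartz g \<Longrightarrow> schwartz (\<lambda>x. f x + g x)"
  using schwartz_combination[of f g 1 1] by simp

lemma schwartz_diff: "schwartz f \<Longrightarrow> schwartz g \<Longrightarrow> schwartz (\<lambda>x. f x - g x)"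
  using schwartz_combination[of f g 1 "-1"] by simp

lemma schwartz_cmult: "schwartz f \<Longrightarrow> schwartz (\<lambda>x. c * f x)"
  using schwartz_combination[of f f c 0] by simp

lemma schwartz_multiplier: "multiplier a \<Longrightarrow> schwartz f \<Longrightarrow> schwartz (\<lambda>x. a x * f x)"
  using schwartz_operator_schwartz[OF schwartz_operator_multiplier] .

lemma schwartz_partial: "schwartz f \<Longrightarrow> schwartz (partial i f)"
  using schwartz_operator_schwartz[OF schwartz_operator_partial] .

lemma schwartz_translation: "schwartz f \<Longrightarrow> schwartz (\<lambda>x. f (x + a))"
  using schwartz_operator_schwartz[OF schwartz_operator_translation] .

lemma schwartz_sum: "(\<And>a. a \<in> A \<Longrightarrow> schwartz (f a)) \<Longrightarrow> schwartz (\<lambda>x. \<Sum>a\<in>A. f a x)"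
  by (induction A rule: infinite_finite_induct) (simp_all add: schwartz_add)

lemma linear_functional_combination:
  "linear_functional t \<Longrightarrow> schwartz f \<Longrightarrow> schwartz g \<Longrightarrow> t (\<lambda>x. a * f x + b * g x) = a * t f + b * t g"
  by (simp add: linear_functional_def)

lemma linear_functional_add:
  "linear_functional t \<Longrightarrow> schwartz f \<Longrightarrow> schwartz g \<Longrightarrow> t (\<lambda>x. f x + g x) = t f + t g"
  using linear_functional_combination[of t f g 1 1] by simp

lemma linear_functional_diff:
  "linear_functional t \<Longrightarrow> schwartz f \<Longrightarrow> schwartz g \<Longrightarrow> t (\<lambda>x. f x - g x) = t f - t g"
  using linear_functional_combination[of t f g 1 "-1"] by simp

lemma linear_functional_cmult:
  "linear_functional t \<Longrightarrow> schwartz f \<Longrightarrow> t (\<lambda>x. c * f x) = c * t f"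
  using linear_functional_combination[of t f f c 0] by simp

lemma linear_functional_zero: "linear_functional t \<Longrightarrow> t (\<lambda>x. 0) = 0"
  using linear_functional_cmult[of t "\<lambda>x. 0" 0] by simp

lemma linear_functional_sum:
  "linear_functional t \<Longrightarrow> (\<And>a. a \<in> A \<Longrightarrow> schwartz (f a)) \<Longrightarrow> t (\<lambda>x. \<Sum>a\<in>A. f a x) = (\<Sum>a\<in>A. t (f a))"
proof (induction A rule: infinite_finite_induct)
  case (insert a A)
  then show ?case
    using linear_functional_add[OF insert.prems(1), of "f a" "\<lambda>x. \<Sum>a\<in>A. f a x"] schwartz_sum[of A f] by simp
qed (simp_all add: linear_functional_zero)

lemma tempered_linear: "tempered t \<Longrightarrow> linear_functional t"
  by (simp add: tempered_def)

lemma tempered_bound: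
  assumes "tempered t"
  shows "\<exists>C N m. C \<ge> 0 \<and> (\<forall>\<phi> B. schwartz \<phi> \<longrightarrow> partials_le (decay N) m \<phi> B \<longrightarrow> cmod (t \<phi>) \<le> C * B)"
proof -
  obtain C N m where C: "\<And>\<phi> B. schwartz \<phi> \<Longrightarrow> partials_le (decay N) m \<phi> B \<Longrightarrow> cmod (t \<phi>) \<le> C * B"
    using assms unfolding tempered_def by blast
  have "cmod (t \<phi>) \<le> max 0 C * B" if "schwartz \<phi>" "partials_le (decay N) m \<phi> B" for \<phi> B
  proof -
    have "B \<ge> 0" using partials_le_nonneg[OF that(2)] by simp
    then have "C * B \<le> max 0 C * B" by (intro mult_right_mono) auto
    with C[OF that] show ?thesis by linarith
  qed
  then show ?thesis by (intro exI[of _ "max 0 C"] exI[of _ N] exI[of _ m]) simp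
qed

lemma tempered_operator:
  assumes "tempered t" "schwartz_operator T"
  shows "tempered (\<lambda>\<phi>. t (T \<phi>))"
proof -
  obtain C N m where "C \<ge> 0"
    and C: "\<And>\<phi> B. schwartz \<phi> \<Longrightarrow> partials_le (decay N) m \<phi> B \<Longrightarrow> cmod (t \<phi>) \<le> C * B"
    using tempered_bound[OF assms(1)] by blast
  obtain C' M k where C': "\<And>f B. schwartz f \<Longrightarrow> partials_le (decay M) k f B \<Longrightarrow> partials_le (decay N) m (T f) (C' * B)"
    using schwartz_operator_bound[where N = N and m = m, OF assms(2)] by blast
  have "cmod (t (T \<phi>)) \<le> (C * C') * B" if "schwartz \<phi>" "partials_le (decay M) k \<phi> B" for \<phi> B
    using C[OF schwartz_operator_schwartz[OF assms(2) that(1)] C'[OF that]] by (simp add: mult.assoc)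
  moreover have "linear_functional (\<lambda>\<phi>. t (T \<phi>))"
    unfolding linear_functional_def
  proof (intro allI impI)
    fix \<phi> \<psi> :: "real ^ 'a \<Rightarrow> complex" and a b
    assume "schwartz \<phi>" "schwartz \<psi>"
    with assms show "t (T (\<lambda>x. a * \<phi> x + b * \<psi> x)) = a * t (T \<phi>) + b * t (T \<psi>)"
      using schwartz_operator_linear[OF assms(2), of \<phi> \<psi>]
        linear_functional_combination[OF tempered_linear[OF assms(1)]
          schwartz_operator_schwartz[OF assms(2)] schwartz_operator_schwartz[OF assms(2)], of \<phi> \<psi>] by simp
  qed
  ultimately show ?thesis unfolding tempered_def by blast
qed

lemma tempered_combination:
  assumes "tempered t" "tempered u"
  shows "tempered (\<lambda>\<phi>. a * t \<phi> + b * u \<phi>)"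
proof -
  obtain C N m where "C \<ge> 0"
    and C: "\<And>\<phi> B. schwartz \<phi> \<Longrightarrow> partials_le (decay N) m \<phi> B \<Longrightarrow> cmod (t \<phi>) \<le> C * B"
    using tempered_bound[OF assms(1)] by blast
  obtain C' N' m' where "C' \<ge> 0"
    and C': "\<And>\<phi> B. schwartz \<phi> \<Longrightarrow> partials_le (decay N') m' \<phi> B \<Longrightarrow> cmod (u \<phi>) \<le> C' * B"
    using tempered_bound[OF assms(2)] by blast
  have "cmod (a * t \<phi> + b * u \<phi>) \<le> (cmod a * C + cmod b * C') * B"
    if "schwartz \<phi>" "partials_le (decay (max N N')) (max m m') \<phi> B" for \<phi> B
  proof -
    have "cmod (t \<phi>) \<le> C * B" "cmod (u \<phi>) \<le> C' * B"
      by (intro C C' that(1) partials_le_decay_mono[OF that(2)]; simp)+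
    then have "cmod a * cmod (t \<phi>) + cmod b * cmod (u \<phi>) \<le> cmod a * (C * B) + cmod b * (C' * B)"
      by (intro add_mono mult_left_mono) auto
    then show ?thesis
      using norm_triangle_ineq[of "a * t \<phi>" "b * u \<phi>"] by (simp add: norm_mult algebra_simps)
  qed
  moreover have "linear_functional (\<lambda>\<phi>. a * t \<phi> + b * u \<phi>)"
    using assms[THEN tempered_linear] unfolding linear_functional_def by (simp add: algebra_simps)
  ultimately show ?thesis unfolding tempered_def by blast
qed

lemma schwartz_seminorm_le:
  assumes "\<And>x. (1 + norm x) ^ N * cmod (partials is f x) \<le> B"
  shows "schwartz_seminorm N is f \<le> B"
  unfolding schwartz_seminorm_def by (rule cSUP_least) (auto simp: assms)

lemma le_schwartz_seminorm:
  assumes "schwartz f"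
  shows "(1 + norm x) ^ N * cmod (partials is f x) \<le> schwartz_seminorm N is f"
  unfolding schwartz_seminorm_def
  using assms by (intro cSUP_upper bounded_imp_bdd_above) (auto simp: schwartz_def)

text \<open>The bounds \<open>partials_le (decay N) m\<close> become stronger with growing \<open>N\<close> and \<open>m\<close>, so a finite
  intersection of subbasic sets still contains a ball for one such bound.\<close>

lemma openin_schwartz_topology_ball:
  assumes "openin schwartz_topology U" "\<psi>\<^sub>0 \<in> U" "schwartz \<psi>\<^sub>0"
  shows "\<exists>N m r. r > 0 \<and> (\<forall>\<psi>. schwartz \<psi> \<longrightarrow> partials_le (decay N) m (\<lambda>x. \<psi> x - \<psi>\<^sub>0 x) r \<longrightarrow> \<psi> \<in> U)"
proof -
  have "generate_topology_on {{\<psi>. schwartz \<psi> \<and> schwartz_seminorm N is (\<lambda>x. \<psi> x - \<phi> x) < \<epsilon>} |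
      N is \<phi> \<epsilon>. schwartz (\<phi> :: real ^ 'a \<Rightarrow> complex) \<and> \<epsilon> > 0} U"
    using assms(1) by (simp add: schwartz_topology_def openin_topology_generated_by_iff)
  then show ?thesis using assms(2)
  proof induction
    case (Int U V)
    then obtain N m r N' m' r' where *: "r > 0" "r' > 0"
      "\<And>\<psi>. schwartz \<psi> \<Longrightarrow> partials_le (decay N) m (\<lambda>x. \<psi> x - \<psi>\<^sub>0 x) r \<Longrightarrow> \<psi> \<in> U"
      "\<And>\<psi>. schwartz \<psi> \<Longrightarrow> partials_le (decay N') m' (\<lambda>x. \<psi> x - \<psi>\<^sub>0 x) r' \<Longrightarrow> \<psi> \<in> V"
      using Int.IH Int.prems by blast
    have "\<psi> \<in> U \<inter> V" if "schwartz \<psi>"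
      and le: "partials_le (decay (max N N')) (max m m') (\<lambda>x. \<psi> x - \<psi>\<^sub>0 x) (min r r')" for \<psi>
    proof -
      have 1: "partials_le (decay N) m (\<lambda>x. \<psi> x - \<psi>\<^sub>0 x) r"
        by (rule partials_le_weaken[OF partials_le_decay_mono[OF le max.cobounded1 max.cobounded1]],
            rule mult_right_mono) (use weight_pos in \<open>auto intro: less_imp_le\<close>)
      have 2: "partials_le (decay N') m' (\<lambda>x. \<psi> x - \<psi>\<^sub>0 x) r'"
        by (rule partials_le_weaken[OF partials_le_decay_mono[OF le max.cobounded2 max.cobounded2]],
            rule mult_right_mono) (use weight_pos in \<open>auto intro: less_imp_le\<close>)
      from *(3)[OF that(1) 1] *(4)[OF that(1) 2] show ?thesis by (rule IntI)
    qed
    then show ?case using * by (intro exI[of _ "max N N'"] exI[of _ "max m m'"] exI[of _ "min r r'"]) auto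
  next
    case (UN \<U>)
    then obtain V where "V \<in> \<U>" "\<psi>\<^sub>0 \<in> V" by blast
    from UN.IH[OF this] obtain N m r where "r > 0"
      "\<And>\<psi>. schwartz \<psi> \<Longrightarrow> partials_le (decay N) m (\<lambda>x. \<psi> x - \<psi>\<^sub>0 x) r \<Longrightarrow> \<psi> \<in> V"
      by blast
    with \<open>V \<in> \<U>\<close> show ?case by (intro exI[of _ N] exI[of _ m] exI[of _ r]) auto
  next
    case (Basis V)
    then obtain N "is" \<phi> \<epsilon> where V: "V = {\<psi>. schwartz \<psi> \<and> schwartz_seminorm N is (\<lambda>x. \<psi> x - \<phi> x) < \<epsilon>}"
      and \<phi>: "schwartz \<phi>"
      by blast
    let ?s = "schwartz_seminorm N is (\<lambda>x. \<psi>\<^sub>0 x - \<phi> x)"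
    let ?r = "(\<epsilon> - ?s) / 2"
    have s: "?s < \<epsilon>" using Basis V by simp
    have "\<psi> \<in> V" if \<psi>: "schwartz \<psi>" and le: "partials_le (decay N) (length is) (\<lambda>x. \<psi> x - \<psi>\<^sub>0 x) ?r" for \<psi>
    proof -
      have "schwartz_seminorm N is (\<lambda>x. \<psi> x - \<phi> x) \<le> ?r + ?s"
      proof (rule schwartz_seminorm_le)
        fix x
        have "partials is (\<lambda>x. \<psi> x - \<phi> x) x = partials is (\<lambda>x. \<psi> x - \<psi>\<^sub>0 x) x + partials is (\<lambda>x. \<psi>\<^sub>0 x - \<phi> x) x"
          using \<psi> \<phi> assms(3) by (simp add: partials_diff schwartz_smooth)
        then have "(1 + norm x) ^ N * cmod (partials is (\<lambda>x. \<psi> x - \<phi> x) x) \<le>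
            (1 + norm x) ^ N * cmod (partials is (\<lambda>x. \<psi> x - \<psi>\<^sub>0 x) x) +
            (1 + norm x) ^ N * cmod (partials is (\<lambda>x. \<psi>\<^sub>0 x - \<phi> x) x)"
          unfolding distrib_left[symmetric] using weight_pos[of x N]
          by (intro mult_left_mono) (auto intro: norm_triangle_ineq)
        also have "\<dots> \<le> ?r + ?s"
          by (rule add_mono[OF le[unfolded partials_le_decay_iff, rule_format, OF order_refl]
                le_schwartz_seminorm[OF schwartz_diff[OF assms(3) \<phi>]]])
        finally show "(1 + norm x) ^ N * cmod (partials is (\<lambda>x. \<psi> x - \<phi> x) x) \<le> ?r + ?s" .
      qed
      also have "?r + ?s < \<epsilon>" using s by (simp add: field_simps)
      finally show ?thesis using \<psi> V by simp
    qed
    moreover have "?r > 0" using s by simp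
    ultimately show ?case
      by (intro exI[of _ N] exI[of _ "length is"] exI[of _ ?r] conjI allI impI)
  qed simp
qed

text \<open>Scale a test function into a ball around \<open>0\<close> on which the functional is bounded by \<open>1\<close>.\<close>

lemma tempered_distribution_imp_tempered:
  fixes t :: "'n::finite functional"
  assumes "tempered_distribution t"
  shows "tempered t"
proof -
  have lin: "linear_functional t" and cont: "continuous_map schwartz_topology euclidean t"
    using assms by (auto simp: tempered_distribution_def linear_functional_def)
  let ?U = "{\<psi> \<in> topspace schwartz_topology. t \<psi> \<in> ball 0 1}"
  have "openin schwartz_topology ?U"
    by (rule openin_continuous_map_preimage[OF cont]) (simp only: open_openin[symmetric] open_ball)
  moreover have "(\<lambda>x. 0) \<in> ?U"
  proof -
    have "schwartz_seminorm 0 [] (\<lambda>x :: real ^ 'n. 0) \<le> 0"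
      by (rule schwartz_seminorm_le) simp
    then have z: "(\<lambda>x. 0) \<in> {\<psi> :: real ^ 'n \<Rightarrow> complex. schwartz \<psi> \<and> schwartz_seminorm 0 [] (\<lambda>x. \<psi> x - 0) < 1}"
      by simp
    have "(\<lambda>x. 0) \<in> topspace (schwartz_topology :: (real ^ 'n \<Rightarrow> complex) topology)"
      unfolding schwartz_topology_def topology_generated_by_topspace
      by (rule UnionI[OF _ z], rule CollectI, rule exI[of _ 0], rule exI[of _ "[]"],
          rule exI[of _ "\<lambda>x. 0"], rule exI[of _ 1]) simp
    then show ?thesis by (simp add: linear_functional_zero lin)
  qed
  ultimately obtain N m r where r: "r > 0"
    and U: "\<And>\<psi>. schwartz \<psi> \<Longrightarrow> partials_le (decay N) m (\<lambda>x. \<psi> x - 0) r \<Longrightarrow> \<psi> \<in> ?U"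
    using openin_schwartz_topology_ball[of ?U "\<lambda>x. 0"] by auto
  have "cmod (t \<phi>) \<le> (1 / r) * B" if \<phi>: "schwartz \<phi>" and B: "partials_le (decay N) m \<phi> B" for \<phi> B
  proof (cases "B > 0")
    case True
    have "partials_le (decay N) m (\<lambda>x. of_real (r / B) * \<phi> x) (cmod (of_real (r / B)) * B)"
      using \<phi> by (intro partials_le_cmult B schwartz_smooth)
    then have "(\<lambda>x. of_real (r / B) * \<phi> x) \<in> ?U"
      using True r by (intro U schwartz_cmult \<phi>) (simp add: norm_divide)
    then have "t (\<lambda>x. of_real (r / B) * \<phi> x) \<in> ball 0 1" by (simp only: mem_Collect_eq)
    then have "cmod (of_real (r / B) * t \<phi>) < 1"
      unfolding linear_functional_cmult[OF lin \<phi>] by (simp add: dist_norm)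
    then show ?thesis
      using True r by (simp add: norm_mult norm_divide field_simps)
  next
    case False
    have "\<phi> = (\<lambda>x. 0)"
    proof
      fix x :: "real ^ 'n"
      have "B * decay N x \<le> 0" using False weight_pos[of x N] by (simp add: divide_nonpos_pos)
      with partials_leD0[OF B, of x] have "cmod (\<phi> x) \<le> 0" by linarith
      then show "\<phi> x = 0" by simp
    qed
    then show ?thesis using partials_le_nonneg[OF B] r by (simp add: linear_functional_zero[OF lin])
  qed
  with lin show ?thesis unfolding tempered_def by blast
qed

section \<open>Cutoffs and supports\<close>

lemma iterate_deriv1_diff:
  assumes "smooth1 f" "smooth1 g"
  shows "(deriv1 ^^ k) (\<lambda>s. f s - g s) = (\<lambda>s. (deriv1 ^^ k) f s - (deriv1 ^^ k) g s)"
proof (induction k)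
  case (Suc k)
  have "deriv1 (\<lambda>s. (deriv1 ^^ k) f s - (deriv1 ^^ k) g s) =
      (\<lambda>s. deriv1 ((deriv1 ^^ k) f) s - deriv1 ((deriv1 ^^ k) g) s)"
    by (intro deriv1_eqI has_vector_derivative_diff smooth1_has_derivative smooth1_iterate assms)
  with Suc show ?case by simp
qed simp

text \<open>A bump that is \<open>1\<close> on \<open>[- N, N]\<close>. The flanks have the same shape for all \<open>N\<close>, which makes the
  derivatives bounded uniformly in \<open>N\<close>, and the flanks of two neighbouring integer translates of \<open>plateau 0\<close> add
  up to \<open>1\<close>.\<close>

definition plateau :: "real \<Rightarrow> real \<Rightarrow> complex" where
  "plateau N s = smooth_step (s + N + 1) - smooth_step (s - N)"

lemma plateau_1: "\<bar>s\<bar> \<le> N \<Longrightarrow> plateau N s = 1"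
  by (simp add: plateau_def smooth_step_0 smooth_step_1)

lemma plateau_0: "N \<ge> 0 \<Longrightarrow> \<bar>s\<bar> \<ge> N + 3/4 \<Longrightarrow> plateau N s = 0"
  by (cases "s \<ge> 0") (simp_all add: plateau_def smooth_step_0 smooth_step_1)

lemma smooth1_step_shift: "smooth1 (\<lambda>s. smooth_step (s + c))"
  using smooth1_affine[OF smooth1_step, of 1 1 c] by simp

lemma plateau_eq: "plateau N = (\<lambda>s. smooth_step (s + (N + 1)) - smooth_step (s + (- N)))"
  by (simp add: plateau_def fun_eq_iff add.assoc)

lemma smooth1_plateau: "smooth1 (plateau N)"
  unfolding plateau_eq by (intro smooth1_diff smooth1_step_shift)

lemma plateau_derivatives_bounded: "\<exists>E. \<forall>N s. cmod ((deriv1 ^^ l) (plateau N) s) \<le> E"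
proof -
  obtain C where C: "\<And>s. cmod ((deriv1 ^^ l) smooth_step s) \<le> C"
    using smooth1_bounded_derivatives[OF smooth1_step, of "1/4" 0 "3/4" 1 l] smooth_step_0 smooth_step_1 by blast
  have shift: "(deriv1 ^^ l) (\<lambda>s. smooth_step (s + c)) = (\<lambda>s. (deriv1 ^^ l) smooth_step (s + c))" for c
    using iterate_deriv1_affine[OF smooth1_step, of l 1 1 c] by simp
  have "cmod ((deriv1 ^^ l) (plateau N) s) \<le> C + C" for N s
    unfolding plateau_eq iterate_deriv1_diff[OF smooth1_step_shift smooth1_step_shift] shift
    by (rule order_trans[OF norm_triangle_ineq4 add_mono[OF C C]])
  then show ?thesis by blast
qed

text \<open>Integer translates of \<open>plateau 0\<close> are differences of consecutive translates of the step, so the sum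
  telescopes.\<close>

lemma sum_plateau:
  "(\<Sum>k=-int N..int N. plateau 0 (s - of_int k)) = plateau (real N) s"
proof (induction N)
  case 0
  then show ?case by simp
next
  case (Suc N)
  have "{-int (Suc N)..int (Suc N)} = insert (int (Suc N)) (insert (-int (Suc N)) {-int N..int N})"
    by auto
  then have "(\<Sum>k=-int (Suc N)..int (Suc N). plateau 0 (s - of_int k)) =
      plateau 0 (s - (real N + 1)) + (plateau 0 (s + (real N + 1)) + plateau (real N) s)"
    using Suc by (simp add: algebra_simps)
  also have "\<dots> = plateau (real (Suc N)) s"
    by (simp add: plateau_def algebra_simps)
  finally show ?case .
qed

definition cutoff :: "('n \<Rightarrow> real ^ 'n) \<Rightarrow> real \<Rightarrow> real ^ ('n::finite) \<Rightarrow> complex" where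
  "cutoff lam N x = (\<Prod>a\<in>UNIV. plateau N (lam a \<bullet> x))"

lemma uniformly_smooth_cutoff: "uniformly_smooth (cutoff lam)"
  unfolding cutoff_def[abs_def]
  by (rule uniformly_smooth_prod)
     (rule uniformly_smooth_compose_inner[OF smooth1_plateau plateau_derivatives_bounded])

lemma smooth_cutoff: "smooth_fun (cutoff lam N)"
  using uniformly_smooth_cutoff unfolding uniformly_smooth_def by blast

lemma multiplier_cutoff: "multiplier (cutoff lam N)"
  by (rule uniformly_smooth_multiplier[OF uniformly_smooth_cutoff])

lemma cutoff_1: "(\<And>a. \<bar>lam a \<bullet> x\<bar> \<le> N) \<Longrightarrow> cutoff lam N x = 1"
  by (simp add: cutoff_def plateau_1)

lemma cutoff_0: "N \<ge> 0 \<Longrightarrow> \<bar>lam a \<bullet> x\<bar> \<ge> N + 3/4 \<Longrightarrow> cutoff lam N x = 0"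
  unfolding cutoff_def by (rule prod_zero[OF finite bexI[of _ a]]) (simp_all add: plateau_0)

lemma cutoff_eventually_1: "\<exists>N0. \<forall>N\<ge>N0. \<forall>x. norm x < R \<longrightarrow> cutoff lam (real N) x = 1"
proof -
  define M where "M = (\<Sum>a\<in>UNIV. norm (lam a))"
  have M: "norm (lam a) \<le> M" for a
    unfolding M_def by (rule member_le_sum) auto
  obtain N0 :: nat where N0: "M * R < N0"
    using reals_Archimedean2 by blast
  have "cutoff lam (real N) x = 1" if "N \<ge> N0" "norm x < R" for N x
  proof (rule cutoff_1)
    fix a
    have "\<bar>lam a \<bullet> x\<bar> \<le> norm (lam a) * norm x" by (rule Cauchy_Schwarz_ineq2)
    also have "\<dots> \<le> M * R"
      using that order_trans[OF norm_ge_zero M] by (intro mult_mono M) auto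
    finally show "\<bar>lam a \<bullet> x\<bar> \<le> real N" using N0 that by linarith
  qed
  then show ?thesis by blast
qed

text \<open>Outside a ball of radius \<open>R\<close> a Schwartz function gains the factor \<open>1 / (1 + R)\<close> from one more
  power of the weight.\<close>

lemma tempered_cutoff_limit:
  fixes \<Omega> :: "nat \<Rightarrow> real ^ ('n::finite) \<Rightarrow> complex"
  assumes t: "tempered t" and \<Omega>: "uniformly_smooth \<Omega>"
    and one: "\<And>R. \<exists>N0. \<forall>N\<ge>N0. \<forall>x. norm x < R \<longrightarrow> \<Omega> N x = 1"
    and \<phi>: "schwartz \<phi>"
  shows "(\<lambda>N. t (\<lambda>x. \<Omega> N x * \<phi> x)) \<longlonglongrightarrow> t \<phi>"
proof -
  obtain C K m where C0: "C \<ge> 0"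
    and C: "\<And>\<phi> B. schwartz \<phi> \<Longrightarrow> partials_le (decay K) m \<phi> B \<Longrightarrow> cmod (t \<phi>) \<le> C * B"
    using tempered_bound[OF t] by blast
  obtain B where B: "B \<ge> 0" "partials_le (decay (Suc K)) m \<phi> B"
    using schwartzE[OF \<phi>] by blast
  have \<Psi>: "uniformly_smooth (\<lambda>N x. 1 + (-1) * \<Omega> N x)"
    by (intro uniformly_smooth_add uniformly_smooth_mult uniformly_smooth_const \<Omega>)
  then obtain D where D: "\<And>N. partials_le (\<lambda>_. 1) m (\<lambda>x. 1 + (-1) * \<Omega> N x) D"
    unfolding uniformly_smooth_def by blast
  have sm: "smooth_fun (\<lambda>x. 1 + (-1) * \<Omega> N x)" for N
    using \<Psi> by (simp add: uniformly_smooth_def)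
  define E where "E = 2 ^ m * (D * B)"
  have E: "partials_le (\<lambda>x. 1 * decay (Suc K) x) m (\<lambda>x. (1 + (-1) * \<Omega> N x) * \<phi> x) E" for N
    unfolding E_def by (rule partials_le_mult[OF sm schwartz_smooth[OF \<phi>] D B(2)])
  have E0: "E \<ge> 0"
    using partials_le_nonneg[OF E[of 0]] by simp
  have sch: "schwartz (\<lambda>x. (1 + (-1) * \<Omega> N x) * \<phi> x)" for N
    by (rule schwartz_multiplier[OF uniformly_smooth_multiplier[OF \<Psi>] \<phi>])
  have bound: "cmod (t (\<lambda>x. (1 + (-1) * \<Omega> N x) * \<phi> x)) \<le> C * (E / (1 + R))"
    if R: "R > 0" and N: "\<forall>x. norm x < R \<longrightarrow> \<Omega> N x = 1" for N R
  proof (rule C[OF sch])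
    show "partials_le (decay K) m (\<lambda>x. (1 + (-1) * \<Omega> N x) * \<phi> x) (E / (1 + R))"
      unfolding partials_le_def
    proof (intro allI impI)
      fix "is" :: "'n list" and x
      assume "length is \<le> m"
      then have le: "cmod (partials is (\<lambda>x. (1 + (-1) * \<Omega> N x) * \<phi> x) x) \<le> E * (1 * decay (Suc K) x)"
        by (rule partials_leD[OF E])
      show "cmod (partials is (\<lambda>x. (1 + (-1) * \<Omega> N x) * \<phi> x) x) \<le> E / (1 + R) * decay K x"
      proof (cases "norm x < R")
        case True
        have "partials is (\<lambda>x. (1 + (-1) * \<Omega> N x) * \<phi> x) x = partials is (\<lambda>x. 0) x"
          by (rule partials_cong_open[of "ball 0 R"])
             (use True N in \<open>auto intro: schwartz_smooth[OF sch, simplified]\<close>)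
        then show ?thesis using R E0 weight_pos[of x K] by simp
      next
        case False
        have "decay (Suc K) x \<le> decay K x / (1 + R)"
          using False R weight_pos[of x K]
          by (auto simp: field_simps intro!: mult_left_mono divide_left_mono mult_pos_pos add_pos_nonneg)
        then have "E * (1 * decay (Suc K) x) \<le> E * (decay K x / (1 + R))"
          using E0 by (intro mult_left_mono) auto
        also have "E * (decay K x / (1 + R)) = E / (1 + R) * decay K x"
          by (simp add: mult.commute)
        finally show ?thesis using le by linarith
      qed
    qed
  qed
  have "(\<lambda>N. t (\<lambda>x. (1 + (-1) * \<Omega> N x) * \<phi> x)) \<longlonglongrightarrow> 0"
  proof (rule LIMSEQ_I)
    fix e :: real assume e: "e > 0"
    define R where "R = C * E / e + 1"
    have R: "R > 0" using C0 E0 e by (simp add: R_def add_nonneg_pos)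
    have "e * (1 + R) = C * E + 2 * e"
      using e by (simp add: R_def distrib_left)
    then have "C * E < e * (1 + R)" using e by linarith
    then have small: "C * (E / (1 + R)) < e"
      using R by (simp add: pos_divide_less_eq)
    obtain N0 where N0: "\<And>N. N \<ge> N0 \<Longrightarrow> \<forall>x. norm x < R \<longrightarrow> \<Omega> N x = 1"
      using one by blast
    have "cmod (t (\<lambda>x. (1 + (-1) * \<Omega> N x) * \<phi> x) - 0) < e" if "N \<ge> N0" for N
      unfolding diff_zero by (rule le_less_trans[OF bound[OF R N0[OF that]] small])
    then show "\<exists>N0. \<forall>N\<ge>N0. cmod (t (\<lambda>x. (1 + (-1) * \<Omega> N x) * \<phi> x) - 0) < e" by blast
  qed
  then have "(\<lambda>N. t \<phi> - t (\<lambda>x. (1 + (-1) * \<Omega> N x) * \<phi> x)) \<longlonglongrightarrow> t \<phi> - 0"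
    by (intro tendsto_diff tendsto_const)
  moreover have "t \<phi> - t (\<lambda>x. (1 + (-1) * \<Omega> N x) * \<phi> x) = t (\<lambda>x. \<Omega> N x * \<phi> x)" for N
    using linear_functional_diff[OF tempered_linear[OF t] \<phi> sch[of N]] by (simp add: algebra_simps)
  ultimately show ?thesis by simp
qed

lemma schwartz_compact_support:
  assumes f: "smooth_fun f" and zero: "\<And>x. norm x \<ge> R \<Longrightarrow> f x = 0"
  shows "schwartz f"
  unfolding schwartz_def
proof (intro conjI allI f)
  fix N "is"
  let ?h = "\<lambda>x. (1 + norm x) ^ N * cmod (partials is f x)"
  have "compact (?h ` cball 0 R)"
    by (intro compact_continuous_image continuous_intros smooth_continuous smooth_partials f compact_cball)
  then obtain B where B: "\<And>x. norm x \<le> R \<Longrightarrow> \<bar>?h x\<bar> \<le> B"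
    by (fastforce simp: bounded_iff dest!: compact_imp_bounded)
  have "\<bar>?h x\<bar> \<le> max B 0" for x
  proof (cases "norm x \<le> R")
    case False
    have "partials is f x = partials is (\<lambda>x. 0) x"
      by (rule partials_cong_open[of "- cball 0 R"]) (use False zero f in \<open>auto simp: open_Compl\<close>)
    then show ?thesis by simp
  qed (use B in \<open>auto simp: le_max_iff_disj\<close>)
  then show "bounded (range ?h)" by (auto simp: bounded_real)
qed

lemma schwartz_compact_closure:
  assumes "smooth_fun f" "compact (closure {x. f x \<noteq> 0})"
  shows "schwartz f"
proof -
  obtain R where R: "\<And>x. x \<in> closure {x. f x \<noteq> 0} \<Longrightarrow> norm x \<le> R"
    using compact_imp_bounded[OF assms(2)] by (auto simp: bounded_iff)
  show ?thesis
  proof (rule schwartz_compact_support[OF assms(1), of "R + 1"])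
    fix x :: "real ^ 'a" assume "norm x \<ge> R + 1"
    then have "x \<notin> closure {x. f x \<noteq> 0}" using R[of x] by auto
    then show "f x = 0" using closure_subset[of "{x. f x \<noteq> 0}"] by blast
  qed
qed

text \<open>Balls of the maximum norm, to which products of functions of one coordinate are adapted.\<close>

definition cube :: "real ^ 'n \<Rightarrow> real \<Rightarrow> (real ^ 'n) set" where
  "cube p r = {x. \<forall>a. \<bar>x $ a - p $ a\<bar> \<le> r}"

definition open_cube :: "real ^ 'n \<Rightarrow> real \<Rightarrow> (real ^ ('n::finite)) set" where
  "open_cube p r = {x. \<forall>a. \<bar>x $ a - p $ a\<bar> < r}"

lemma closed_cube: "closed (cube p r)"
  unfolding cube_def by (intro closed_Collect_all closed_Collect_le continuous_intros)

lemma open_open_cube: "open (open_cube p r)"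
proof -
  have "open_cube p r = (\<Inter>a\<in>UNIV. {x. \<bar>x $ a - p $ a\<bar> < r})"
    by (auto simp: open_cube_def)
  then show ?thesis
    by (auto intro!: open_INT open_Collect_less continuous_intros)
qed

lemma compact_cube: "compact (cube p r)"
proof -
  have "norm x \<le> norm p + (\<Sum>a\<in>(UNIV :: 'a set). r)" if "x \<in> cube p r" for x
  proof -
    have "norm (x - p) \<le> (\<Sum>a\<in>UNIV. \<bar>(x - p) $ a\<bar>)" by (rule norm_le_l1_cart)
    also have "\<dots> \<le> (\<Sum>a\<in>(UNIV :: 'a set). r)"
      using that by (intro sum_mono) (simp add: cube_def)
    finally show ?thesis using norm_triangle_sub[of x p] by linarith
  qed
  then show ?thesis
    by (intro compact_eq_bounded_closed[THEN iffD2] conjI closed_cube) (auto simp: bounded_iff)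
qed

lemma cube_inside_open:
  assumes "open U" "p \<in> U"
  shows "\<exists>r>0. cube p (2 * r) \<subseteq> U"
proof -
  obtain e where e: "e > 0" "cball p e \<subseteq> U"
    using assms open_contains_cball by blast
  let ?r = "e / (2 * CARD('a))"
  have "x \<in> cball p e" if "x \<in> cube p (2 * ?r)" for x
  proof -
    have "norm (x - p) \<le> (\<Sum>a\<in>UNIV. \<bar>(x - p) $ a\<bar>)" by (rule norm_le_l1_cart)
    also have "\<dots> \<le> (\<Sum>a\<in>(UNIV :: 'a set). 2 * ?r)"
      using that by (intro sum_mono) (simp add: cube_def)
    also have "\<dots> = e" by simp
    finally show ?thesis by (simp add: dist_norm norm_minus_commute)
  qed
  moreover have "?r > 0" using e by simp
  ultimately show ?thesis using e by blast
qed

text \<open>Rescaling by \<open>1 / r\<close> turns the two cubes into those where a product of plateaus is \<open>1\<close> and outside of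
  which it is \<open>0\<close>.\<close>

lemma cube_function_exists:
  assumes "r > 0"
  shows "\<exists>\<psi>. smooth_fun \<psi> \<and> (\<forall>x\<in>open_cube p r. \<psi> x = 1) \<and> (\<forall>x. x \<notin> cube p (2 * r) \<longrightarrow> \<psi> x = 0)"
proof -
  let ?lam = "\<lambda>a. axis a (1 / r)"
  let ?\<psi> = "\<lambda>x. cutoff ?lam 1 (x + (- p))"
  have inner: "?lam a \<bullet> (x + (- p)) = (x $ a - p $ a) / r" for a x
    by (simp add: inner_axis')
  have "smooth_fun ?\<psi>"
    by (rule smooth_translation[OF smooth_cutoff])
  moreover have "?\<psi> x = 1" if "x \<in> open_cube p r" for x
  proof (rule cutoff_1)
    show "\<bar>?lam a \<bullet> (x + (- p))\<bar> \<le> 1" for a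
      unfolding inner using that assms less_imp_le[of "\<bar>x $ a - p $ a\<bar>" r]
      by (simp add: open_cube_def abs_divide)
  qed
  moreover have "?\<psi> x = 0" if x: "x \<notin> cube p (2 * r)" for x
  proof -
    obtain a where "\<bar>x $ a - p $ a\<bar> > 2 * r" using x by (auto simp: cube_def not_le)
    then have "\<bar>?lam a \<bullet> (x + (- p))\<bar> \<ge> 1 + 3/4"
      unfolding inner using assms by (simp add: abs_divide field_simps)
    then show ?thesis by (intro cutoff_0) auto
  qed
  ultimately show ?thesis by blast
qed

text \<open>A partition of unity, one cube at a time.\<close>

lemma vanishes_finite_cover:
  assumes t: "linear_functional t" and "finite P"
    and "\<And>p. p \<in> P \<Longrightarrow> r p > 0 \<and> vanishes_on t (U p) \<and> cube p (2 * r p) \<subseteq> U p"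
    and "smooth_fun \<phi>" "compact (closure {x. \<phi> x \<noteq> 0})"
    and "closure {x. \<phi> x \<noteq> 0} \<subseteq> (\<Union>p\<in>P. open_cube p (r p))"
  shows "t \<phi> = 0"
  using assms(2-)
proof (induction P arbitrary: \<phi> rule: finite_induct)
  case empty
  then have "\<phi> x = 0" for x
    using closure_subset[of "{x. \<phi> x \<noteq> 0}"] by blast
  then have "\<phi> = (\<lambda>x. 0)" by blast
  then show ?case using linear_functional_zero[OF t] by simp
next
  case (insert p P)
  let ?K = "closure {x. \<phi> x \<noteq> 0}"
  have p: "r p > 0" "vanishes_on t (U p)" "cube p (2 * r p) \<subseteq> U p"
    using insert.prems(1)[of p] by auto
  obtain \<psi> where \<psi>: "smooth_fun \<psi>" "\<And>x. x \<in> open_cube p (r p) \<Longrightarrow> \<psi> x = 1"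
    "\<And>x. x \<notin> cube p (2 * r p) \<Longrightarrow> \<psi> x = 0"
    using cube_function_exists[OF p(1), of p] by blast
  have K: "{x. \<phi> x \<noteq> 0} \<subseteq> ?K" by (rule closure_subset)
  have 1: "closure {x. \<phi> x * \<psi> x \<noteq> 0} \<subseteq> ?K \<inter> cube p (2 * r p)"
  proof (rule closure_minimal)
    show "{x. \<phi> x * \<psi> x \<noteq> 0} \<subseteq> ?K \<inter> cube p (2 * r p)"
    proof
      fix x assume "x \<in> {x. \<phi> x * \<psi> x \<noteq> 0}"
      then show "x \<in> ?K \<inter> cube p (2 * r p)"
        using \<psi>(3)[of x] K by auto
    qed
  qed (intro closed_Int closed_closure closed_cube)
  have 2: "closure {x. \<phi> x * (1 - \<psi> x) \<noteq> 0} \<subseteq> ?K \<inter> - open_cube p (r p)"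
  proof (rule closure_minimal)
    show "{x. \<phi> x * (1 - \<psi> x) \<noteq> 0} \<subseteq> ?K \<inter> - open_cube p (r p)"
    proof
      fix x assume "x \<in> {x. \<phi> x * (1 - \<psi> x) \<noteq> 0}"
      then show "x \<in> ?K \<inter> - open_cube p (r p)"
        using \<psi>(2)[of x] K by auto
    qed
  qed (intro closed_Int closed_closure closed_Compl open_open_cube)
  have cpt: "compact (closure S)" if "closure S \<subseteq> ?K" for S
    using compact_Int_closed[OF insert.prems(3) closed_closure[of S]] that by (simp add: Int_absorb1)
  have sm: "smooth_fun (\<lambda>x. \<phi> x * \<psi> x)" "smooth_fun (\<lambda>x. \<phi> x * (1 - \<psi> x))"
    by (rule smooth_mult[OF insert.prems(2) \<psi>(1)],
        rule smooth_mult[OF insert.prems(2) smooth_diff[OF smooth_const \<psi>(1)]])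
  have cpt1: "compact (closure {x. \<phi> x * \<psi> x \<noteq> 0})"
    and cpt2: "compact (closure {x. \<phi> x * (1 - \<psi> x) \<noteq> 0})"
    using 1 2 by (intro cpt; blast)+
  have "t (\<lambda>x. \<phi> x * \<psi> x) = 0"
    by (rule p(2)[unfolded vanishes_on_def, rule_format, OF sm(1) cpt1]) (use 1 p(3) in blast)
  moreover have "t (\<lambda>x. \<phi> x * (1 - \<psi> x)) = 0"
  proof (rule insert.IH[OF _ sm(2)])
    show "compact (closure {x. \<phi> x * (1 - \<psi> x) \<noteq> 0})" by (rule cpt2)
    show "closure {x. \<phi> x * (1 - \<psi> x) \<noteq> 0} \<subseteq> (\<Union>p\<in>P. open_cube p (r p))"
      using 2 insert.prems(4) by blast
  qed (use insert.prems(1) in blast)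
  moreover have "t (\<lambda>x. \<phi> x * \<psi> x + \<phi> x * (1 - \<psi> x)) = t (\<lambda>x. \<phi> x * \<psi> x) + t (\<lambda>x. \<phi> x * (1 - \<psi> x))"
    by (rule linear_functional_add[OF t schwartz_compact_closure[OF sm(1) cpt1] schwartz_compact_closure[OF sm(2) cpt2]])
  moreover have "(\<lambda>x. \<phi> x * \<psi> x + \<phi> x * (1 - \<psi> x)) = \<phi>"
    by (simp add: algebra_simps)
  ultimately show ?case by simp
qed

text \<open>Finitely many cubes on which \<open>t\<close> vanishes cover the compact support of \<open>\<phi>\<close>.\<close>

lemma vanishes_compact:
  assumes t: "linear_functional t" and \<phi>: "smooth_fun \<phi>" "compact (closure {x. \<phi> x \<noteq> 0})"
    and disj: "closure {x. \<phi> x \<noteq> 0} \<inter> distr_support t = {}"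
  shows "t \<phi> = 0"
proof -
  let ?K = "closure {x. \<phi> x \<noteq> 0}"
  have "\<forall>p\<in>?K. \<exists>U r. r > 0 \<and> vanishes_on t U \<and> cube p (2 * r) \<subseteq> U"
  proof
    fix p assume "p \<in> ?K"
    then obtain U where "open U" "vanishes_on t U" "p \<in> U"
      using disj by (auto simp: distr_support_def)
    then show "\<exists>U r. r > 0 \<and> vanishes_on t U \<and> cube p (2 * r) \<subseteq> U"
      using cube_inside_open by blast
  qed
  then obtain U r where Ur: "\<And>p. p \<in> ?K \<Longrightarrow> r p > 0 \<and> vanishes_on t (U p) \<and> cube p (2 * r p) \<subseteq> U p"
    by metis
  have "?K \<subseteq> (\<Union>p\<in>?K. open_cube p (r p))"
    using Ur by (auto simp: open_cube_def)
  then obtain P where P: "P \<subseteq> ?K" "finite P" "?K \<subseteq> (\<Union>p\<in>P. open_cube p (r p))"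
    using compactE_image[OF \<phi>(2), of ?K "\<lambda>p. open_cube p (r p)"] open_open_cube by blast
  show ?thesis
    by (rule vanishes_finite_cover[OF t P(2) _ \<phi> P(3)]) (use Ur P(1) in blast)
qed

text \<open>The definition of the support only speaks of test functions of compact support; cutting off extends this to
  Schwartz functions.\<close>

lemma vanishes_off_support:
  assumes t: "tempered t" and \<phi>: "schwartz \<phi>"
    and S: "closed S" "\<And>x. \<phi> x \<noteq> 0 \<Longrightarrow> x \<in> S" "S \<inter> distr_support t = {}"
  shows "t \<phi> = 0"
proof -
  let ?\<Omega> = "\<lambda>N. cutoff (\<lambda>a. axis a 1) (real N)"
  have "t (\<lambda>x. ?\<Omega> N x * \<phi> x) = 0" for N
  proof (rule vanishes_compact[OF tempered_linear[OF t]])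
    have "?\<Omega> N x = 0" if "x \<notin> cube 0 (real N + 1)" for x
    proof -
      from that obtain a where "\<bar>x $ a\<bar> > real N + 1" by (auto simp: cube_def not_le)
      then show ?thesis by (intro cutoff_0[of _ _ a]) (auto simp: inner_axis')
    qed
    then have sub: "closure {x. ?\<Omega> N x * \<phi> x \<noteq> 0} \<subseteq> S \<inter> cube 0 (real N + 1)"
      by (intro closure_minimal closed_Int S(1) closed_cube) (use S(2) in auto)
    then show "closure {x. ?\<Omega> N x * \<phi> x \<noteq> 0} \<inter> distr_support t = {}"
      using S(3) by blast
    show "compact (closure {x. ?\<Omega> N x * \<phi> x \<noteq> 0})"
    proof -
      have "cube 0 (real N + 1) \<inter> closure {x. ?\<Omega> N x * \<phi> x \<noteq> 0} = closure {x. ?\<Omega> N x * \<phi> x \<noteq> 0}"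
        using sub by blast
      then show ?thesis
        using compact_Int_closed[OF compact_cube closed_closure, of 0 "real N + 1" "{x. ?\<Omega> N x * \<phi> x \<noteq> 0}"]
        by simp
    qed
    show "smooth_fun (\<lambda>x. ?\<Omega> N x * \<phi> x)"
      by (rule smooth_mult[OF smooth_cutoff schwartz_smooth[OF \<phi>]])
  qed
  moreover have "uniformly_smooth ?\<Omega>"
    using uniformly_smooth_cutoff unfolding uniformly_smooth_def by blast
  from tempered_cutoff_limit[OF t this cutoff_eventually_1 \<phi>]
  have "(\<lambda>N. t (\<lambda>x. ?\<Omega> N x * \<phi> x)) \<longlonglongrightarrow> t \<phi>" .
  ultimately have "(\<lambda>N :: nat. 0) \<longlonglongrightarrow> t \<phi>" by simp
  then show ?thesis by (simp add: LIMSEQ_const_iff)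
qed

text \<open>If \<open>h\<close> vanishes on the support then \<open>h\<^sup>M t\<close> only sees the set \<open>h < \<epsilon>\<close>. There the function
  \<open>\<epsilon>\<^sup>M f (h / \<epsilon>)\<close>, which equals \<open>h\<^sup>M\<close> near the zeros of \<open>h\<close>, has derivatives of size \<open>\<epsilon>\<close> up to the
  order of \<open>t\<close> as soon as \<open>M\<close> exceeds that order.\<close>

lemma power_annihilates:
  fixes h :: "real ^ 'n \<Rightarrow> real"
  assumes t: "tempered t" and h: "uniformly_smooth (\<lambda>_ :: unit. \<lambda>x. of_real (h x))"
    and nonneg: "\<And>x. h x \<ge> 0" and supp: "\<And>x. x \<in> distr_support t \<Longrightarrow> h x = 0"
  shows "\<exists>M. \<forall>\<phi>. schwartz \<phi> \<longrightarrow> t (\<lambda>x. of_real (h x) ^ M * \<phi> x) = 0"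
proof -
  obtain C K m where "C \<ge> 0"
    and C: "\<And>\<phi> B. schwartz \<phi> \<Longrightarrow> partials_le (decay K) m \<phi> B \<Longrightarrow> cmod (t \<phi>) \<le> C * B"
    using tempered_bound[OF t] by blast
  define M where "M = Suc (Suc m)"
  define f where "f s = of_real s ^ M * ((1 - smooth_step s) * smooth_step (s + 1))" for s
  define f\<epsilon> where "f\<epsilon> \<epsilon> s = of_real \<epsilon> ^ M * f (1 / \<epsilon> * s + 0)" for \<epsilon> s
  have sf: "smooth1 f"
    unfolding f_def[abs_def]
    by (intro smooth1_mult smooth1_power[OF smooth1_of_real] smooth1_diff smooth1_const smooth1_step smooth1_step_shift)
  have sf\<epsilon>: "smooth1 (f\<epsilon> \<epsilon>)" for \<epsilon>
    unfolding f\<epsilon>_def[abs_def] by (rule smooth1_affine[OF sf])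
  have sh: "smooth_fun (\<lambda>x. of_real (h x))"
    using h by (simp add: uniformly_smooth_def)
  have hm: "multiplier (\<lambda>x. of_real (h x))"
    using uniformly_smooth_multiplier[OF h] .
  have "\<exists>E. \<forall>s. cmod ((deriv1 ^^ l) f s) \<le> E" for l
    by (rule smooth1_bounded_derivatives[OF sf, of "-1" 0 1 0]) (simp_all add: f_def smooth_step_0 smooth_step_1)
  then obtain E where E: "\<And>l s. cmod ((deriv1 ^^ l) f s) \<le> E l" by metis
  define E' where "E' = (\<Sum>l\<le>Suc m. E l)"
  have E': "cmod ((deriv1 ^^ l) f s) \<le> E'" if "l \<le> Suc m" for l s
  proof -
    have "E l \<le> E'"
      unfolding E'_def by (rule member_le_sum) (use that order_trans[OF norm_ge_zero E] in auto)
    then show ?thesis using E[of l s] by simp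
  qed
  have f\<epsilon>_bound: "cmod ((deriv1 ^^ l) (f\<epsilon> \<epsilon>) s) \<le> \<epsilon> * E'" if "0 < \<epsilon>" "\<epsilon> \<le> 1" "l \<le> Suc m" for \<epsilon> l s
  proof -
    have "\<epsilon> ^ M * (1 / \<epsilon>) ^ l = \<epsilon> ^ (M - l)"
      using that by (simp add: M_def power_diff power_one_over divide_inverse power_inverse)
    also have "\<dots> \<le> \<epsilon>"
      using that power_decreasing[of 1 "M - l" \<epsilon>] by (simp add: M_def)
    finally have "cmod (of_real \<epsilon> ^ M * of_real (1 / \<epsilon>) ^ l) \<le> \<epsilon>"
      using that by (simp add: norm_mult norm_power norm_divide)
    then have "cmod (of_real \<epsilon> ^ M * of_real (1 / \<epsilon>) ^ l) * cmod ((deriv1 ^^ l) f (1 / \<epsilon> * s + 0)) \<le> \<epsilon> * E'"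
      using E'[OF that(3)] that(1) by (intro mult_mono) auto
    then show ?thesis
      unfolding f\<epsilon>_def[abs_def] iterate_deriv1_affine[OF sf] by (simp only: norm_mult)
  qed
  obtain Bh where "\<And>p :: unit. partials_le (\<lambda>_. 1) (Suc m) (\<lambda>x. of_real (h x)) Bh"
    using h unfolding uniformly_smooth_def by blast
  then have "partials_le (\<lambda>_. 1) m (partial i (\<lambda>x. of_real (h x))) Bh" for i
    using partials_le_partial by blast
  from partials_le_compose1[OF sh this]
  obtain C' where C': "\<And>f E. smooth1 f \<Longrightarrow> \<forall>l\<le>Suc m. \<forall>x. cmod ((deriv1 ^^ l) f (h x)) \<le> E \<Longrightarrow>
      partials_le (\<lambda>_. 1) (Suc m) (\<lambda>x. f (h x)) (C' * E)"
    by blast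
  have f\<epsilon>_le: "partials_le (\<lambda>_. 1) m (\<lambda>x. f\<epsilon> \<epsilon> (h x)) (C' * (\<epsilon> * E'))" if "0 < \<epsilon>" "\<epsilon> \<le> 1" for \<epsilon>
    by (rule partials_le_order[OF C'[OF sf\<epsilon>]]) (use f\<epsilon>_bound[OF that] in auto)
  have "t (\<lambda>x. of_real (h x) ^ M * \<phi> x) = 0" if \<phi>: "schwartz \<phi>" for \<phi>
  proof -
    obtain B where B: "partials_le (decay K) m \<phi> B"
      using schwartzE[OF \<phi>] by blast
    define A where "A = C * (2 ^ m * (C' * E' * B))"
    have pow: "schwartz (\<lambda>x. of_real (h x) ^ k * \<phi> x)" for k
      by (induction k) (use schwartz_multiplier[OF hm] \<phi> in \<open>auto simp: mult.assoc\<close>)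
    have le: "cmod (t (\<lambda>x. of_real (h x) ^ M * \<phi> x)) \<le> \<epsilon> * A" if \<epsilon>: "0 < \<epsilon>" "\<epsilon> \<le> 1" for \<epsilon>
    proof -
      have eq: "f\<epsilon> \<epsilon> (h x) = of_real (h x) ^ M * (1 - smooth_step (h x / \<epsilon>))" for x
      proof -
        have "smooth_step (h x / \<epsilon> + 1) = 1"
          using nonneg[of x] \<epsilon> by (intro smooth_step_1) (simp add: add_increasing)
        then show ?thesis
          using \<epsilon> by (simp add: f\<epsilon>_def f_def power_divide)
      qed
      have "partials_le (\<lambda>x. 1 * decay K x) m (\<lambda>x. f\<epsilon> \<epsilon> (h x) * \<phi> x) (2 ^ m * ((C' * (\<epsilon> * E')) * B))"
        by (rule partials_le_mult[OF smooth_compose1[OF sf\<epsilon> sh] schwartz_smooth[OF \<phi>] f\<epsilon>_le[OF \<epsilon>] B])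
      then have small: "partials_le (decay K) m (\<lambda>x. f\<epsilon> \<epsilon> (h x) * \<phi> x) (2 ^ m * ((C' * (\<epsilon> * E')) * B))"
        by simp
      have rest: "schwartz (\<lambda>x. f\<epsilon> \<epsilon> (h x) * \<phi> x)"
      proof (rule schwartz_multiplier[OF multiplier_bounded \<phi>])
        show "smooth_fun (\<lambda>x. f\<epsilon> \<epsilon> (h x))" by (rule smooth_compose1[OF sf\<epsilon> sh])
        fix m'
        obtain B' where "\<And>p :: unit. partials_le (\<lambda>_. 1) (Suc m') (\<lambda>x. of_real (h x)) B'"
          using h unfolding uniformly_smooth_def by blast
        then have "partials_le (\<lambda>_. 1) m' (partial i (\<lambda>x. of_real (h x))) B'" for i
          using partials_le_partial by blast
        from partials_le_compose1[OF sh this]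
        obtain C'' where C'': "\<And>f E. smooth1 f \<Longrightarrow> \<forall>l\<le>Suc m'. \<forall>x. cmod ((deriv1 ^^ l) f (h x)) \<le> E \<Longrightarrow>
            partials_le (\<lambda>_. 1) (Suc m') (\<lambda>x. f (h x)) (C'' * E)"
          by blast
        define G where "G = (\<Sum>l\<le>Suc m'. cmod (of_real \<epsilon> ^ M * of_real (1 / \<epsilon>) ^ l) * E l)"
        have "cmod ((deriv1 ^^ l) (f\<epsilon> \<epsilon>) s) \<le> G" if "l \<le> Suc m'" for l s
        proof -
          have "cmod ((deriv1 ^^ l) (f\<epsilon> \<epsilon>) s) \<le> cmod (of_real \<epsilon> ^ M * of_real (1 / \<epsilon>) ^ l) * E l"
            unfolding f\<epsilon>_def[abs_def] iterate_deriv1_affine[OF sf]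
            by (subst norm_mult) (rule mult_left_mono[OF E norm_ge_zero])
          also have "\<dots> \<le> G"
            unfolding G_def using that order_trans[OF norm_ge_zero E]
            by (intro member_le_sum) (auto intro!: mult_nonneg_nonneg)
          finally show ?thesis .
        qed
        then have "partials_le (\<lambda>_. 1) (Suc m') (\<lambda>x. f\<epsilon> \<epsilon> (h x)) (C'' * G)"
          by (intro C''[OF sf\<epsilon>]) blast
        then have "partials_le (\<lambda>_. 1) m' (\<lambda>x. f\<epsilon> \<epsilon> (h x)) (C'' * G)"
          by (rule partials_le_order) simp
        then show "\<exists>B. partials_le (\<lambda>_. 1) m' (\<lambda>x. f\<epsilon> \<epsilon> (h x)) B" by blast
      qed
      have "t (\<lambda>x. of_real (h x) ^ M * \<phi> x - f\<epsilon> \<epsilon> (h x) * \<phi> x) = 0"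
      proof (rule vanishes_off_support[OF t])
        show "schwartz (\<lambda>x. of_real (h x) ^ M * \<phi> x - f\<epsilon> \<epsilon> (h x) * \<phi> x)"
          by (intro schwartz_diff pow rest)
        have "continuous_on UNIV (\<lambda>x. Re (of_real (h x)))"
          by (intro continuous_intros smooth_continuous[OF sh])
        then have "continuous_on UNIV h" by simp
        then show "closed {x. h x \<ge> \<epsilon> / 4}"
          by (intro closed_Collect_le continuous_on_const)
        show "x \<in> {x. h x \<ge> \<epsilon> / 4}" if "of_real (h x) ^ M * \<phi> x - f\<epsilon> \<epsilon> (h x) * \<phi> x \<noteq> 0" for x
        proof (rule ccontr)
          assume "x \<notin> {x. h x \<ge> \<epsilon> / 4}"
          then have "smooth_step (h x / \<epsilon>) = 0"
            using \<epsilon> by (intro smooth_step_0) (simp add: field_simps)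
          then show False using that by (simp add: eq)
        qed
        show "{x. h x \<ge> \<epsilon> / 4} \<inter> distr_support t = {}"
          using supp \<epsilon> by force
      qed
      then have "t (\<lambda>x. of_real (h x) ^ M * \<phi> x) = t (\<lambda>x. f\<epsilon> \<epsilon> (h x) * \<phi> x)"
        using linear_functional_diff[OF tempered_linear[OF t] pow[of M] rest] by simp
      also have "cmod \<dots> \<le> C * (2 ^ m * ((C' * (\<epsilon> * E')) * B))"
        by (rule C[OF rest small])
      finally show ?thesis by (simp add: A_def mult_ac)
    qed
    have "cmod (t (\<lambda>x. of_real (h x) ^ M * \<phi> x)) \<le> e" if "e > 0" for e
    proof -
      define \<epsilon> where "\<epsilon> = min 1 (e / (\<bar>A\<bar> + 1))"
      have \<epsilon>: "0 < \<epsilon>" "\<epsilon> \<le> 1" using that by (auto simp: \<epsilon>_def)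
      have "\<epsilon> * A \<le> \<epsilon> * (\<bar>A\<bar> + 1)" using \<epsilon> by (intro mult_left_mono) auto
      also have "\<dots> \<le> e / (\<bar>A\<bar> + 1) * (\<bar>A\<bar> + 1)"
        by (intro mult_right_mono) (auto simp: \<epsilon>_def)
      also have "\<dots> = e" by simp
      finally show ?thesis using le[OF \<epsilon>] by simp
    qed
    then show ?thesis
      using field_le_epsilon[of "cmod (t (\<lambda>x. of_real (h x) ^ M * \<phi> x))" 0] by simp
  qed
  then show ?thesis by blast
qed

section \<open>Lebesgue measure in coordinates\<close>

lemma prod_Basis_vec:
  "(\<Prod>b\<in>(Basis :: (real ^ 'n) set). f b) = (\<Prod>i\<in>UNIV. f (axis i 1))"
proof -
  have B: "(Basis :: (real ^ 'n) set) = (\<lambda>i. axis i 1) ` UNIV"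
    by (auto simp: Basis_vec_def)
  have "inj (\<lambda>i. axis i 1 :: real ^ 'n)"
    by (auto simp: inj_def axis_eq_axis)
  then show ?thesis
    unfolding B by (simp add: prod.reindex)
qed

lemma box_vec: "box l u = {x :: real ^ 'n. \<forall>i. l $ i < x $ i \<and> x $ i < u $ i}"
  by (auto simp: mem_box_cart)

lemma measurable_vec_lambda:
  "(\<lambda>f. \<chi> i. f i) \<in> borel_measurable (Pi\<^sub>M (UNIV :: 'n::finite set) (\<lambda>_. lborel :: real measure))"
proof (rule borel_measurable_euclidean_space[THEN iffD2], rule ballI)
  fix b :: "real ^ 'n" assume "b \<in> Basis"
  then obtain k where b: "b = axis k 1" by (auto simp: Basis_vec_def)
  have "(\<lambda>f. f k) \<in> borel_measurable (Pi\<^sub>M (UNIV :: 'n set) (\<lambda>_. lborel :: real measure))"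
    using measurable_component_singleton[of k UNIV "\<lambda>_. lborel :: real measure"] by simp
  then show "(\<lambda>f. (\<chi> i. f i) \<bullet> b) \<in> borel_measurable (Pi\<^sub>M (UNIV :: 'n set) (\<lambda>_. lborel :: real measure))"
    by (simp add: b inner_axis)
qed

interpretation lborel_product: product_sigma_finite "\<lambda>_ :: 'i. lborel :: real measure"
  by standard

text \<open>Both measures agree on boxes. The right-hand side gives access to Fubini's theorem in coordinates.\<close>

lemma lborel_vec:
  "(lborel :: (real ^ 'n) measure) = distr (Pi\<^sub>M UNIV (\<lambda>_. lborel)) borel (\<lambda>f. \<chi> i. f i)"
proof (rule lborel_eqI)
  fix l u :: "real ^ 'n" assume le: "\<And>b. b \<in> Basis \<Longrightarrow> l \<bullet> b \<le> u \<bullet> b"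
  have le': "l $ i \<le> u $ i" for i
    using le[of "axis i 1"] by (simp add: inner_axis)
  have pre: "(\<lambda>f. \<chi> i. f i) -` box l u \<inter> space (Pi\<^sub>M UNIV (\<lambda>_. lborel :: real measure)) =
      Pi\<^sub>E UNIV (\<lambda>i. {l $ i<..<u $ i})"
    by (auto simp: box_vec space_PiM)
  have "emeasure (distr (Pi\<^sub>M UNIV (\<lambda>_. lborel)) borel (\<lambda>f. \<chi> i. f i)) (box l u) =
      (\<Prod>i\<in>UNIV. emeasure lborel {l $ i<..<u $ i})"
    by (subst emeasure_distr[OF measurable_vec_lambda])
       (simp_all add: pre lborel_product.emeasure_PiM)
  also have "\<dots> = (\<Prod>i\<in>UNIV. ennreal (u $ i - l $ i))"
    using le' by simp
  finally show "emeasure (distr (Pi\<^sub>M UNIV (\<lambda>_. lborel)) borel (\<lambda>f. \<chi> i. f i)) (box l u) =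
      (\<Prod>b\<in>Basis. (u - l) \<bullet> b)"
    using le' by (simp add: prod_Basis_vec inner_axis prod_ennreal)
qed simp

lemma integrable_prod_coordinates:
  fixes f :: "'n::finite \<Rightarrow> real \<Rightarrow> 'b::{real_normed_field, banach, second_countable_topology}"
  assumes "\<And>i. integrable lborel (f i)"
  shows "integrable lborel (\<lambda>x :: real ^ 'n. \<Prod>i\<in>UNIV. f i (x $ i))"
    and "(LINT x|lborel. (\<Prod>i\<in>UNIV. f i ((x :: real ^ 'n) $ i))) = (\<Prod>i\<in>UNIV. (LINT s|lborel. f i s))"
proof -
  have m: "(\<lambda>x :: real ^ 'n. \<Prod>i\<in>UNIV. f i (x $ i)) \<in> borel_measurable borel"
  proof (rule borel_measurable_prod)
    fix i
    have "f i \<in> borel_measurable borel" using borel_measurable_integrable[OF assms[of i]] by simp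
    then show "(\<lambda>x :: real ^ 'n. f i (x $ i)) \<in> borel_measurable borel"
      by (rule measurable_compose[rotated])
         (auto intro!: borel_measurable_continuous_onI continuous_intros)
  qed
  show "integrable lborel (\<lambda>x :: real ^ 'n. \<Prod>i\<in>UNIV. f i (x $ i))"
    unfolding lborel_vec
    by (subst integrable_distr_eq[OF measurable_vec_lambda m])
       (simp add: lborel_product.product_integrable_prod assms)
  show "(LINT x|lborel. (\<Prod>i\<in>UNIV. f i ((x :: real ^ 'n) $ i))) = (\<Prod>i\<in>UNIV. (LINT s|lborel. f i s))"
    unfolding lborel_vec
    by (subst integral_distr[OF measurable_vec_lambda m])
       (simp add: lborel_product.product_integral_prod assms)
qed

lemma integrable_inverse_1_plus_square: "integrable lborel (\<lambda>s :: real. 1 / (1 + s\<^sup>2))"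
proof -
  have "set_integrable lborel (einterval (-\<infinity>) \<infinity>) (\<lambda>s. 1 / (1 + s\<^sup>2))"
  proof (rule interval_integral_FTC_nonneg)
    show "DERIV arctan s :> 1 / (1 + s\<^sup>2)" for s
      by (auto intro!: derivative_eq_intros simp: divide_inverse)
    show "isCont (\<lambda>s. 1 / (1 + s\<^sup>2)) s" for s :: real
      by (intro continuous_intros) (simp add: add_nonneg_eq_0_iff)
    show "((arctan \<circ> real_of_ereal) \<longlongrightarrow> - (pi / 2)) (at_right (- \<infinity>))"
      by (simp add: ereal_tendsto_simps tendsto_arctan_at_bot)
    show "((arctan \<circ> real_of_ereal) \<longlongrightarrow> pi / 2) (at_left \<infinity>)"
      by (simp add: ereal_tendsto_simps tendsto_arctan_at_top)
  qed (auto intro!: AE_I2)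
  moreover have "einterval (-\<infinity>) \<infinity> = (UNIV :: real set)"
    by (auto simp: einterval_def)
  ultimately show ?thesis by (simp add: set_integrable_def)
qed

lemma weight_product_le:
  fixes x :: "real ^ 'n::finite"
  shows "(\<Prod>i\<in>UNIV. 1 + (x $ i)\<^sup>2) \<le> (1 + norm x) ^ (2 * CARD('n))"
proof -
  have "1 + (x $ i)\<^sup>2 \<le> (1 + norm x)\<^sup>2" for i
  proof -
    have "(x $ i)\<^sup>2 \<le> (norm x)\<^sup>2"
      using component_le_norm_cart[of x i] by (metis abs_le_square_iff abs_norm_cancel)
    then show ?thesis using norm_ge_zero[of x] by (simp add: power2_sum del: norm_ge_zero)
  qed
  then have "(\<Prod>i\<in>UNIV. 1 + (x $ i)\<^sup>2) \<le> (\<Prod>i\<in>(UNIV :: 'n set). (1 + norm x)\<^sup>2)"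
    by (intro prod_mono) auto
  then show ?thesis by (simp add: power_mult)
qed

text \<open>Compare with the product of the integrable functions \<open>1 / (1 + x\<^sub>i\<^sup>2)\<close> of the coordinates.\<close>

lemma integrable_decay: "integrable lborel (decay (2 * CARD('n)) :: real ^ ('n::finite) \<Rightarrow> real)"
proof (rule Bochner_Integration.integrable_bound)
  show "integrable lborel (\<lambda>x :: real ^ 'n. \<Prod>i\<in>UNIV. 1 / (1 + (x $ i)\<^sup>2))"
    by (rule integrable_prod_coordinates(1)[OF integrable_inverse_1_plus_square])
  have "continuous_on UNIV (\<lambda>x :: real ^ 'n. decay (2 * CARD('n)) x)"
    by (intro continuous_intros) (metis weight_pos less_irrefl)
  then show "decay (2 * CARD('n)) \<in> borel_measurable (lborel :: (real ^ 'n) measure)"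
    using borel_measurable_continuous_onI by simp
  have "norm (decay (2 * CARD('n)) x) \<le> norm (\<Prod>i\<in>UNIV. 1 / (1 + (x $ i)\<^sup>2))" for x :: "real ^ 'n"
  proof -
    have "(\<Prod>i\<in>UNIV. 1 + (x $ i)\<^sup>2) > 0"
      by (intro prod_pos) (simp add: add_pos_nonneg)
    then have "decay (2 * CARD('n)) x \<le> 1 / (\<Prod>i\<in>UNIV. 1 + (x $ i)\<^sup>2)"
      by (intro divide_left_mono weight_product_le mult_pos_pos weight_pos) auto
    also have "\<dots> = (\<Prod>i\<in>UNIV. 1 / (1 + (x $ i)\<^sup>2))"
      by (simp add: prod_dividef)
    finally show ?thesis using weight_pos[of x "2 * CARD('n)"] by simp
  qed
  then show "AE x in lborel. norm (decay (2 * CARD('n)) (x :: real ^ 'n)) \<le> norm (\<Prod>i\<in>UNIV. 1 / (1 + (x $ i)\<^sup>2))"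
    by (rule AE_I2)
qed

subsection \<open>Linear change of variables\<close>

lemma measurable_matrix_vector: "(\<lambda>x. A *v x) \<in> borel_measurable (borel :: (real ^ 'n) measure)"
  by (intro borel_measurable_continuous_onI linear_continuous_on matrix_vector_mul_bounded_linear)

text \<open>For fixed values of the other coordinates the shear translates the coordinate \<open>m\<close>.\<close>

lemma nn_integral_shear:
  fixes f :: "real ^ 'n::finite \<Rightarrow> ennreal"
  assumes f: "f \<in> borel_measurable borel" and mk: "m \<noteq> k"
  shows "(\<integral>\<^sup>+x. f (\<chi> i. if i = m then x $ m + x $ k else x $ i) \<partial>lborel) = (\<integral>\<^sup>+x. f x \<partial>lborel)"
proof -
  let ?P = "\<lambda>I. Pi\<^sub>M I (\<lambda>_ :: 'n. lborel :: real measure)"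
  let ?S = "\<lambda>x :: real ^ 'n. \<chi> i. if i = m then x $ m + x $ k else x $ i"
  have ins: "UNIV = insert m (UNIV - {m})" by auto
  have S: "?S \<in> borel_measurable borel"
  proof (rule borel_measurable_continuous_onI)
    have "continuous_on UNIV (\<lambda>x :: real ^ 'n. if i = m then x $ m + x $ k else x $ i)" for i
      by (cases "i = m") (auto intro!: continuous_intros)
    then show "continuous_on UNIV ?S"
      by (rule continuous_on_vec_lambda)
  qed
  have expand: "(\<integral>\<^sup>+x. g x \<partial>lborel) =
      (\<integral>\<^sup>+x. (\<integral>\<^sup>+y. g (\<chi> i. (x(m := y)) i) \<partial>lborel) \<partial>?P (UNIV - {m}))"
    if g: "g \<in> borel_measurable borel" for g :: "real ^ 'n \<Rightarrow> ennreal"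
  proof -
    have gm: "(\<lambda>x. g (\<chi> i. x i)) \<in> borel_measurable (?P (insert m (UNIV - {m})))"
      using measurable_compose[OF measurable_vec_lambda g] ins by simp
    have "(\<integral>\<^sup>+x. g x \<partial>lborel) = (\<integral>\<^sup>+x. g (\<chi> i. x i) \<partial>?P UNIV)"
      by (subst lborel_vec) (rule nn_integral_distr[OF measurable_vec_lambda], simp add: g)
    also have "\<dots> = (\<integral>\<^sup>+x. (\<integral>\<^sup>+y. g (\<chi> i. (x(m := y)) i) \<partial>lborel) \<partial>?P (UNIV - {m}))"
      using lborel_product.product_nn_integral_insert[OF _ _ gm] ins by simp
    finally show ?thesis .
  qed
  have "(\<integral>\<^sup>+y. f (?S (\<chi> i. (x(m := y)) i)) \<partial>lborel) = (\<integral>\<^sup>+y. f (\<chi> i. (x(m := y)) i) \<partial>lborel)" for x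
  proof -
    have m: "(\<lambda>y. f (\<chi> i. (x(m := y)) i)) \<in> borel_measurable borel"
    proof (rule measurable_compose[OF borel_measurable_continuous_onI f])
      show "continuous_on UNIV (\<lambda>y. \<chi> i. (x(m := y)) i)"
      proof (rule continuous_on_vec_lambda)
        show "continuous_on UNIV (\<lambda>y. (x(m := y)) i)" for i
          by (cases "i = m") (auto intro!: continuous_intros)
      qed
    qed
    have "?S (\<chi> i. (x(m := y)) i) = (\<chi> i. (x(m := x k + 1 * y)) i)" for y
      using mk by (auto simp: vec_eq_iff)
    then show ?thesis
      using nn_integral_real_affine[OF m, of 1 "x k"] by simp
  qed
  then show ?thesis
    by (simp only: expand[OF f] expand[OF measurable_compose[OF S f]])
qed

lemma lborel_permute_coordinates:
  fixes \<tau> :: "'n::finite \<Rightarrow> 'n"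
  assumes "bij \<tau>"
  shows "distr lborel borel (\<lambda>x :: real ^ 'n. \<chi> i. x $ \<tau> i) = lborel"
proof (rule lborel_eqI[symmetric])
  let ?S = "\<lambda>x :: real ^ 'n. \<chi> i. x $ \<tau> i"
  have S: "?S \<in> borel_measurable borel"
    by (intro borel_measurable_continuous_onI continuous_on_vec_lambda continuous_intros)
  fix l u :: "real ^ 'n" assume le: "\<And>b. b \<in> Basis \<Longrightarrow> l \<bullet> b \<le> u \<bullet> b"
  have le': "l $ i \<le> u $ i" for i
    using le[of "axis i 1"] by (simp add: inner_axis)
  let ?l = "\<chi> i. l $ inv \<tau> i" and ?u = "\<chi> i. u $ inv \<tau> i"
  have inv: "inv \<tau> (\<tau> i) = i" "\<tau> (inv \<tau> i) = i" for i
    using assms by (auto simp: bij_is_inj bij_is_surj surj_f_inv_f)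
  have "?S -` box l u = box ?l ?u"
    unfolding box_vec by auto (metis inv)+
  then have "emeasure (distr lborel borel ?S) (box l u) = emeasure lborel (box ?l ?u)"
    using S by (subst emeasure_distr) auto
  also have "\<dots> = ennreal (\<Prod>b\<in>Basis. (?u - ?l) \<bullet> b)"
    using le' by (intro emeasure_lborel_box) (auto simp: Basis_vec_def inner_axis)
  also have "\<dots> = (\<Prod>i\<in>UNIV. ennreal (u $ inv \<tau> i - l $ inv \<tau> i))"
    using le' by (simp add: prod_Basis_vec inner_axis prod_ennreal)
  also have "\<dots> = (\<Prod>i\<in>UNIV. ennreal (u $ i - l $ i))"
    by (rule prod.reindex_bij_betw) (use assms in \<open>simp add: bij_imp_bij_inv\<close>)
  finally show "emeasure (distr lborel borel ?S) (box l u) = (\<Prod>b\<in>Basis. (u - l) \<bullet> b)"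
    using le' by (simp add: prod_Basis_vec inner_axis prod_ennreal)
qed simp

text \<open>Elementary matrices suffice, since both sides are multiplicative in \<open>A\<close>: diagonal matrices scale the
  coordinates, transpositions permute them, and shears do not change the integral.\<close>

lemma nn_integral_linear:
  fixes A :: "real ^ 'n ^ 'n::finite"
  assumes "invertible A" "f \<in> borel_measurable borel"
  shows "(\<integral>\<^sup>+x. f x \<partial>lborel) = ennreal \<bar>det A\<bar> * (\<integral>\<^sup>+x. f (A *v x) \<partial>lborel)"
proof -
  have "invertible A \<longrightarrow> (\<forall>f\<in>borel_measurable borel.
      (\<integral>\<^sup>+x. f x \<partial>lborel) = ennreal \<bar>det A\<bar> * (\<integral>\<^sup>+x. f (A *v x) \<partial>lborel))"
  proof (induction A rule: induct_matrix_elementary_alt)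
    case (1 A B)
    show ?case
    proof (intro impI ballI)
      fix f :: "real ^ 'n \<Rightarrow> ennreal" assume AB: "invertible (A ** B)" and f: "f \<in> borel_measurable borel"
      have AB': "invertible A" "invertible B"
        using AB by (simp_all add: invertible_det_nz det_mul)
      have "(\<integral>\<^sup>+x. f x \<partial>lborel) = ennreal \<bar>det A\<bar> * (\<integral>\<^sup>+x. f (A *v x) \<partial>lborel)"
        using 1(1) AB'(1) f by blast
      also have "(\<integral>\<^sup>+x. f (A *v x) \<partial>lborel) = ennreal \<bar>det B\<bar> * (\<integral>\<^sup>+x. f (A *v (B *v x)) \<partial>lborel)"
        using 1(2) AB'(2) measurable_compose[OF measurable_matrix_vector f] by blast
      finally show "(\<integral>\<^sup>+x. f x \<partial>lborel) = ennreal \<bar>det (A ** B)\<bar> * (\<integral>\<^sup>+x. f ((A ** B) *v x) \<partial>lborel)"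
        by (simp add: det_mul abs_mult ennreal_mult mult.assoc matrix_vector_mul_assoc)
    qed
  next
    case (2 A i)
    then have "det A = 0" by (rule det_zero_row)
    then show ?case by (simp add: invertible_det_nz)
  next
    case (3 A)
    show ?case
    proof (intro impI ballI)
      fix f :: "real ^ 'n \<Rightarrow> ennreal" assume A: "invertible A" and f: "f \<in> borel_measurable borel"
      have d: "det A = (\<Prod>i\<in>UNIV. A $ i $ i)" using 3 by (rule det_diagonal)
      then have nz: "A $ i $ i \<noteq> 0" for i using A by (auto simp: invertible_det_nz)
      define c where "c b = b \<bullet> (A *v b)" for b
      have c: "c (axis i 1) = A $ i $ i" for i
        by (simp add: c_def inner_axis' matrix_vector_mul_component inner_axis)
      have T: "0 + (\<Sum>j\<in>Basis. (c j * (x \<bullet> j)) *\<^sub>R j) = A *v x" for x :: "real ^ 'n"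
      proof (rule vec_eq_iff[THEN iffD2], rule allI)
        fix i
        have "(\<Sum>j\<in>Basis. (c j * (x \<bullet> j)) *\<^sub>R j) \<bullet> axis i 1 = c (axis i 1) * (x \<bullet> axis i 1)"
          by (subst inner_sum_left_Basis) (auto simp: Basis_vec_def)
        moreover have "(A *v x) $ i = A $ i $ i * x $ i"
        proof -
          have "(A *v x) $ i = (\<Sum>j\<in>UNIV. A $ i $ j * x $ j)" by (simp add: matrix_vector_mult_def)
          also have "\<dots> = (\<Sum>j\<in>UNIV. if j = i then A $ i $ i * x $ i else 0)"
            using 3 by (intro sum.cong) auto
          finally show ?thesis by simp
        qed
        ultimately show "(0 + (\<Sum>j\<in>Basis. (c j * (x \<bullet> j)) *\<^sub>R j)) $ i = (A *v x) $ i"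
          by (simp add: c inner_axis)
      qed
      have "c j \<noteq> 0" if "j \<in> Basis" for j
        using that nz c by (auto simp: Basis_vec_def)
      then have "lborel = density (distr lborel borel (\<lambda>x. 0 + (\<Sum>j\<in>Basis. (c j * (x \<bullet> j)) *\<^sub>R j)))
          (\<lambda>_. (\<Prod>j\<in>Basis. \<bar>c j\<bar>))"
        by (rule lborel_affine_euclidean)
      then have "lborel = density (distr lborel borel ((*v) A)) (\<lambda>_. (\<Prod>j\<in>Basis. \<bar>c j\<bar>))"
        unfolding T .
      also have "(\<Prod>j\<in>Basis. \<bar>c j\<bar>) = \<bar>det A\<bar>"
        by (simp add: prod_Basis_vec c d abs_prod)
      finally have l: "lborel = density (distr lborel borel ((*v) A)) (\<lambda>_. \<bar>det A\<bar>)" .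
      show "(\<integral>\<^sup>+x. f x \<partial>lborel) = ennreal \<bar>det A\<bar> * (\<integral>\<^sup>+x. f (A *v x) \<partial>lborel)"
        using f measurable_matrix_vector[of A]
        by (subst l) (simp add: nn_integral_density nn_integral_distr nn_integral_cmult)
    qed
  next
    case (4 m n)
    let ?\<tau> = "Transposition.transpose m n"
    let ?A = "(\<chi> i j. mat 1 $ i $ ?\<tau> j) :: real ^ 'n ^ 'n"
    have "det ?A = of_int (sign ?\<tau>) * det (mat 1 :: real ^ 'n ^ 'n)"
      by (rule det_permute_columns) (simp add: permutes_swap_id)
    then have d: "\<bar>det ?A\<bar> = 1"
      by (simp add: abs_mult flip: of_int_abs)
    have S: "?A *v x = (\<chi> i. x $ ?\<tau> i)" for x :: "real ^ 'n"
    proof (rule vec_eq_iff[THEN iffD2], rule allI)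
      fix i
      have "i = ?\<tau> j \<longleftrightarrow> j = ?\<tau> i" for j
        by (metis transpose_involutory)
      then have "(?A *v x) $ i = (\<Sum>j\<in>UNIV. (if j = ?\<tau> i then 1 else 0) * x $ j)"
        by (simp add: matrix_vector_mult_def mat_def)
      also have "\<dots> = (\<Sum>j\<in>UNIV. if j = ?\<tau> i then x $ j else 0)"
        by (intro sum.cong) auto
      finally have "(?A *v x) $ i = (\<Sum>j\<in>UNIV. if j = ?\<tau> i then x $ j else 0)" .
      then show "(?A *v x) $ i = (\<chi> i. x $ ?\<tau> i) $ i" by simp
    qed
    have m: "(\<lambda>x :: real ^ 'n. \<chi> i. x $ ?\<tau> i) \<in> borel_measurable borel"
      by (intro borel_measurable_continuous_onI continuous_on_vec_lambda continuous_intros)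
    show ?case
    proof (intro impI ballI)
      fix f :: "real ^ 'n \<Rightarrow> ennreal" assume f: "f \<in> borel_measurable borel"
      have "(\<integral>\<^sup>+x. f x \<partial>lborel) = (\<integral>\<^sup>+x. f x \<partial>distr lborel borel (\<lambda>x :: real ^ 'n. \<chi> i. x $ ?\<tau> i))"
        by (subst lborel_permute_coordinates) auto
      also have "\<dots> = (\<integral>\<^sup>+x. f (?A *v x) \<partial>lborel)"
        using m f by (subst nn_integral_distr) (auto simp: S)
      finally show "(\<integral>\<^sup>+x. f x \<partial>lborel) = ennreal \<bar>det ?A\<bar> * (\<integral>\<^sup>+x. f (?A *v x) \<partial>lborel)"
        by (simp add: d)
    qed
  next
    case (5 m n)
    let ?A = "(\<chi> i j. of_bool (i = m \<and> j = n \<or> i = j)) :: real ^ 'n ^ 'n"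
    have "?A = (\<chi> k. if k = m then row m (mat 1) + 1 *s row n (mat 1) else row k (mat 1))"
      using 5 by (auto simp: vec_eq_iff row_def mat_def)
    then have d: "det ?A = 1"
      using det_row_operation[OF 5, of "mat 1 :: real ^ 'n ^ 'n" 1] by simp
    have S: "?A *v x = (\<chi> i. if i = m then x $ m + x $ n else x $ i)" for x :: "real ^ 'n"
    proof (rule vec_eq_iff[THEN iffD2], rule allI)
      fix i
      have "(?A *v x) $ i = (\<Sum>j\<in>UNIV. (if j = i then x $ j else 0) + (if i = m \<and> j = n then x $ j else 0))"
        using 5 by (simp add: matrix_vector_mult_def) (intro sum.cong refl, auto)
      also have "\<dots> = x $ i + (if i = m then x $ n else 0)"
        by (simp add: sum.distrib)
      finally show "(?A *v x) $ i = (\<chi> i. if i = m then x $ m + x $ n else x $ i) $ i" by simp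
    qed
    show ?case
      using nn_integral_shear[OF _ 5] unfolding d S by simp
  qed
  then show ?thesis using assms by blast
qed

lemma integral_linear:
  fixes A :: "real ^ 'n ^ 'n::finite" and f :: "real ^ 'n \<Rightarrow> complex"
  assumes A: "invertible A" and f: "f \<in> borel_measurable borel"
  shows "(LINT x|lborel. f x) = of_real \<bar>det A\<bar> * (LINT x|lborel. f (A *v x))"
proof -
  have "lborel = density (distr lborel borel ((*v) A)) (\<lambda>_. ennreal \<bar>det A\<bar>)"
  proof (rule measure_eqI)
    fix X assume X: "X \<in> sets (lborel :: (real ^ 'n) measure)"
    have m: "(indicator X :: _ \<Rightarrow> ennreal) \<in> borel_measurable borel"
      using X by (intro borel_measurable_indicator) simp
    have "emeasure lborel X = (\<integral>\<^sup>+x. indicator X x \<partial>lborel)"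
      using X by simp
    also have "\<dots> = ennreal \<bar>det A\<bar> * (\<integral>\<^sup>+x. indicator X (A *v x) \<partial>lborel)"
      by (rule nn_integral_linear[OF A m])
    also have "(\<integral>\<^sup>+x. indicator X (A *v x) \<partial>lborel) = (\<integral>\<^sup>+x. indicator X x \<partial>distr lborel borel ((*v) A))"
      using measurable_matrix_vector[of A] m by (subst nn_integral_distr) auto
    also have "ennreal \<bar>det A\<bar> * \<dots> = emeasure (density (distr lborel borel ((*v) A)) (\<lambda>_. ennreal \<bar>det A\<bar>)) X"
      using X m by (simp add: emeasure_density nn_integral_cmult)
    finally show "emeasure lborel X = emeasure (density (distr lborel borel ((*v) A)) (\<lambda>_. ennreal \<bar>det A\<bar>)) X" .
  qed simp
  then have "(LINT x|lborel. f x) = (LINT x|density (distr lborel borel ((*v) A)) (\<lambda>_. ennreal \<bar>det A\<bar>). f x)"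
    by simp
  also have "\<dots> = (LINT x|distr lborel borel ((*v) A). \<bar>det A\<bar> *\<^sub>R f x)"
    using f by (subst integral_density) auto
  also have "\<dots> = (LINT x|lborel. \<bar>det A\<bar> *\<^sub>R f (A *v x))"
    using f measurable_matrix_vector[of A] by (subst integral_distr) auto
  finally show ?thesis by (simp add: scaleR_conv_of_real)
qed

lemma integral_translation:
  fixes f :: "real ^ 'n \<Rightarrow> complex"
  assumes "f \<in> borel_measurable borel"
  shows "(LINT x|lborel. f (x + a)) = (LINT x|lborel. f x)"
proof -
  have "(LINT x|lborel. f x) = (LINT x|distr lborel borel ((+) a). f x)"
    by (simp add: lborel_distr_plus)
  also have "\<dots> = (LINT x|lborel. f (a + x))"
    using assms by (subst integral_distr) auto
  finally show ?thesis by (simp add: add.commute)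
qed

section \<open>Differentiation under the integral sign\<close>

lemma partial_diff_coordinates:
  fixes f :: "real ^ 'n::finite \<Rightarrow> complex" and B :: real
  assumes f: "smooth_fun f" and B: "\<And>y k. y \<in> closed_segment x (x + h) \<Longrightarrow> cmod (partial k f y) \<le> B"
  shows "cmod (f (x + h) - f x) \<le> real CARD('n) * B * norm h"
proof -
  let ?D = "\<lambda>y v. \<Sum>i\<in>UNIV. of_real (v $ i) * partial i f y"
  have "cmod (f (x + h) - f x) \<le> (real CARD('n) * B) * norm (x + h - x)"
  proof (rule differentiable_bound[of "closed_segment x (x + h)" f ?D])
    show "(f has_derivative ?D y) (at y within closed_segment x (x + h))" for y
      by (rule has_derivative_at_withinI[OF smooth_has_derivative[OF f]])
    show "onorm (?D y) \<le> real CARD('n) * B" if y: "y \<in> closed_segment x (x + h)" for y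
    proof (rule onorm_le)
      fix v :: "real ^ 'n"
      have "cmod (?D y v) \<le> (\<Sum>i\<in>UNIV. cmod (of_real (v $ i) * partial i f y))"
        by (rule norm_sum)
      also have "\<dots> \<le> (\<Sum>i\<in>(UNIV :: 'n set). norm v * B)"
        unfolding norm_mult norm_of_real real_norm_def
        by (intro sum_mono mult_mono component_le_norm_cart B[OF y]) auto
      finally show "cmod (?D y v) \<le> real CARD('n) * B * norm v" by (simp add: mult_ac)
    qed
  qed auto
  then show ?thesis by simp
qed

text \<open>The mean value estimate, applied to \<open>f\<close> minus its linear part at \<open>x\<close>.\<close>

lemma taylor_first_order:
  fixes f :: "real ^ 'n::finite \<Rightarrow> complex" and B :: real
  assumes f: "smooth_fun f"
    and B: "\<And>y i k. y \<in> closed_segment x (x + h) \<Longrightarrow> cmod (partial k (partial i f) y) \<le> B"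
  shows "cmod (f (x + h) - f x - (\<Sum>i\<in>UNIV. of_real (h $ i) * partial i f x)) \<le> (real CARD('n))\<^sup>2 * B * (norm h)\<^sup>2"
proof -
  define g where "g y = f y - (\<Sum>i\<in>UNIV. partial i f x * of_real (y $ i))" for y
  have sm: "smooth_fun (\<lambda>y. \<Sum>i\<in>UNIV. partial i f x * of_real (y $ i))"
    by (rule smooth_sum, rule smooth_cmult, rule smooth_coord)
  have g: "smooth_fun g"
    unfolding g_def[abs_def] by (rule smooth_diff[OF f sm])
  have "partial k g = (\<lambda>y. partial k f y - partial k f x)" for k
  proof -
    have "partial k (\<lambda>y. \<Sum>i\<in>UNIV. partial i f x * of_real (y $ i)) =
        (\<lambda>y. \<Sum>i\<in>UNIV. partial k (\<lambda>y. partial i f x * of_real (y $ i)) y)"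
      by (rule smooth_partial_sum) (rule smooth_cmult, rule smooth_coord)
    also have "\<dots> = (\<lambda>y. \<Sum>i\<in>UNIV. partial i f x * (if k = i then 1 else 0))"
      by (simp only: smooth_partial_cmult[OF smooth_coord] partial_coord)
    also have "\<dots> = (\<lambda>y. partial k f x)"
      by (simp add: if_distrib cong: if_cong)
    finally show ?thesis
      using partials_diff[OF f sm, of "[k]"] by (simp add: g_def[abs_def])
  qed
  moreover have "cmod (partial k f y - partial k f x) \<le> real CARD('n) * B * norm h"
    if y: "y \<in> closed_segment x (x + h)" for k y
  proof -
    have B0: "B \<ge> 0"
      using order_trans[OF norm_ge_zero B[of x undefined undefined]] by simp
    obtain u where u: "y = x + u *\<^sub>R h" "0 \<le> u" "u \<le> 1"
      using y by (auto simp: closed_segment_def algebra_simps)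
    have "closed_segment x (x + (y - x)) \<subseteq> closed_segment x (x + h)"
      using y by (simp add: subset_closed_segment)
    then have "cmod (partial k f (x + (y - x)) - partial k f x) \<le> real CARD('n) * B * norm (y - x)"
      by (intro partial_diff_coordinates[OF smooth_partial[OF f]] B) blast
    also have "\<dots> \<le> real CARD('n) * B * norm h"
      using u B0 by (intro mult_left_mono) (auto intro: mult_left_le_one_le)
    finally show ?thesis by simp
  qed
  ultimately have "cmod (g (x + h) - g x) \<le> real CARD('n) * (real CARD('n) * B * norm h) * norm h"
    by (intro partial_diff_coordinates[OF g]) simp
  moreover have "g (x + h) - g x = f (x + h) - f x - (\<Sum>i\<in>UNIV. of_real (h $ i) * partial i f x)"
    by (simp add: g_def algebra_simps sum.distrib)
  ultimately show ?thesis by (simp add: power2_eq_square mult_ac)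
qed

text \<open>An integrable bound \<open>K\<close> for the second order Taylor remainder allows differentiation under the integral
  without a passage to the limit inside the integral.\<close>

lemma has_derivative_integral:
  fixes F :: "'a::euclidean_space \<Rightarrow> real ^ 'n::finite \<Rightarrow> complex"
  assumes F: "\<And>y. integrable M (\<lambda>s. F s y)" and G: "\<And>i. integrable M (G i)" and K: "integrable M K"
    and le: "\<And>s h. s \<in> space M \<Longrightarrow> norm h \<le> 1 \<Longrightarrow>
      cmod (F s (x + h) - F s x - (\<Sum>i\<in>UNIV. of_real (h $ i) * G i s)) \<le> K s * (norm h)\<^sup>2"
  shows "((\<lambda>y. LINT s|M. F s y) has_derivative (\<lambda>h. \<Sum>i\<in>UNIV. of_real (h $ i) * (LINT s|M. G i s))) (at x)"
proof (rule has_derivativeI_sandwich[where e = 1])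
  let ?D = "\<lambda>h :: real ^ 'n. \<Sum>i\<in>UNIV. of_real (h $ i) * (LINT s|M. G i s)"
  show "bounded_linear ?D"
    by (intro bounded_linear_sum bounded_linear_mult_const bounded_linear_of_real[THEN bounded_linear_compose]
        bounded_linear_vec_nth)
  have "((\<lambda>y. (LINT s|M. K s) * norm (y - x)) \<longlongrightarrow> (LINT s|M. K s) * norm (x - x)) (at x)"
    by (intro tendsto_intros)
  then show "((\<lambda>y. (LINT s|M. K s) * norm (y - x)) \<longlongrightarrow> 0) (at x)" by simp
  fix y assume y: "y \<noteq> x" "dist y x < 1"
  define h where "h = y - x"
  have h: "h \<noteq> 0" "norm h \<le> 1" "y = x + h"
    using y by (auto simp: h_def dist_norm)
  have G': "integrable M (\<lambda>s. of_real (h $ i) * G i s)" for i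
    using G by simp
  have "(LINT s|M. F s (x + h)) - (LINT s|M. F s x) - ?D h =
      (LINT s|M. F s (x + h) - F s x - (\<Sum>i\<in>UNIV. of_real (h $ i) * G i s))"
    using F G' by (simp add: Bochner_Integration.integral_diff Bochner_Integration.integral_sum)
  also have "cmod \<dots> \<le> (LINT s|M. K s * (norm h)\<^sup>2)"
    using le h(2) K F G'
    by (intro Bochner_Integration.integral_norm_bound_integral) (auto intro!: Bochner_Integration.integrable_diff Bochner_Integration.integrable_sum)
  also have "\<dots> = (LINT s|M. K s) * (norm h)\<^sup>2" by simp
  finally show "norm ((LINT s|M. F s y) - (LINT s|M. F s x) - ?D (y - x)) / norm (y - x) \<le> (LINT s|M. K s) * norm (y - x)"
    using h by (simp add: pos_divide_le_eq power2_eq_square mult.assoc)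
qed simp

section \<open>The Fourier transform of Schwartz functions\<close>

lemma smooth_measurable: "smooth_fun f \<Longrightarrow> f \<in> borel_measurable borel"
  by (rule borel_measurable_continuous_onI[OF smooth_continuous])

lemma integrable_decay_bound:
  fixes f :: "real ^ 'n::finite \<Rightarrow> complex"
  assumes "f \<in> borel_measurable borel" "\<And>x. cmod (f x) \<le> B * decay (2 * CARD('n)) x"
  shows "integrable lborel f"
proof (rule Bochner_Integration.integrable_bound)
  show "integrable lborel (\<lambda>x :: real ^ 'n. B * decay (2 * CARD('n)) x)"
    by (rule integrable_mult_right[OF integrable_decay])
  show "AE x in lborel. cmod (f x) \<le> norm (B * decay (2 * CARD('n)) x)"
    by (rule AE_I2) (use assms(2) abs_ge_self order_trans in \<open>fastforce simp del: abs_mult\<close>)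
qed (use assms in simp)

lemma schwartz_integrable:
  fixes f :: "real ^ 'n::finite \<Rightarrow> complex"
  assumes "schwartz f"
  shows "integrable lborel f"
proof -
  obtain B where "partials_le (decay (2 * CARD('n))) 0 f B"
    using schwartzE[OF assms] by blast
  then show ?thesis
    by (intro integrable_decay_bound[of f B] smooth_measurable schwartz_smooth assms partials_leD0)
qed

lemma fourier_fun_character: "fourier_fun \<psi> x = (LINT \<xi>|lborel. character (- \<xi>) x * \<psi> \<xi>)"
  unfolding fourier_fun_def character_def by simp

lemma integrable_character_mult:
  assumes "integrable lborel \<psi>"
  shows "integrable lborel (\<lambda>\<xi>. character (- \<xi>) x * \<psi> \<xi>)"
proof (rule Bochner_Integration.integrable_bound[OF assms])
  have "(\<lambda>\<xi>. character (- \<xi>) x) \<in> borel_measurable borel"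
    unfolding character_def by (intro borel_measurable_continuous_onI continuous_intros)
  then show "(\<lambda>\<xi>. character (- \<xi>) x * \<psi> \<xi>) \<in> borel_measurable lborel"
    using assms by (intro borel_measurable_times) auto
qed (simp add: norm_mult)

lemma fourier_fun_linear:
  assumes "schwartz f" "schwartz g"
  shows "fourier_fun (\<lambda>x. a * f x + b * g x) = (\<lambda>x. a * fourier_fun f x + b * fourier_fun g x)"
proof
  fix x
  have i: "integrable lborel (\<lambda>\<xi>. character (- \<xi>) x * f \<xi>)" "integrable lborel (\<lambda>\<xi>. character (- \<xi>) x * g \<xi>)"
    by (intro integrable_character_mult schwartz_integrable assms)+
  have "fourier_fun (\<lambda>x. a * f x + b * g x) x =
      (LINT \<xi>|lborel. a * (character (- \<xi>) x * f \<xi>) + b * (character (- \<xi>) x * g \<xi>))"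
    unfolding fourier_fun_character by (rule Bochner_Integration.integral_cong) (auto simp: algebra_simps)
  also have "\<dots> = a * fourier_fun f x + b * fourier_fun g x"
    unfolding fourier_fun_character using i by simp
  finally show "fourier_fun (\<lambda>x. a * f x + b * g x) x = a * fourier_fun f x + b * fourier_fun g x" .
qed

lemma fourier_fun_cmult:
  "schwartz f \<Longrightarrow> fourier_fun (\<lambda>x. c * f x) = (\<lambda>x. c * fourier_fun f x)"
  using fourier_fun_linear[of f f c 0] by simp

lemma fourier_fun_character_mult: "fourier_fun (\<lambda>\<xi>. character a \<xi> * \<psi> \<xi>) x = fourier_fun \<psi> (x + - a)"
  unfolding fourier_fun_character
  by (rule Bochner_Integration.integral_cong)
     (simp_all only: character_add character_minus inverse_inverse_eq character_commute[of a] mult.assoc)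

lemma fourier_fun_translation:
  assumes "schwartz \<psi>"
  shows "fourier_fun (\<lambda>\<xi>. \<psi> (\<xi> + a)) x = character a x * fourier_fun \<psi> x"
proof -
  have m: "(\<lambda>\<xi>. character (- \<xi>) x * \<psi> \<xi>) \<in> borel_measurable borel"
    using borel_measurable_integrable[OF integrable_character_mult[OF schwartz_integrable[OF assms]]] by simp
  have "fourier_fun (\<lambda>\<xi>. \<psi> (\<xi> + a)) x = (LINT \<xi>|lborel. character a x * (character (- (\<xi> + a)) x * \<psi> (\<xi> + a)))"
    unfolding fourier_fun_character
    by (rule Bochner_Integration.integral_cong)
       (simp_all only: character_minus character_add_left inverse_mult_distrib, simp)
  also have "\<dots> = character a x * (LINT \<xi>|lborel. character (- (\<xi> + a)) x * \<psi> (\<xi> + a))"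
    by simp
  also have "(LINT \<xi>|lborel. character (- (\<xi> + a)) x * \<psi> (\<xi> + a)) = (LINT \<xi>|lborel. character (- \<xi>) x * \<psi> \<xi>)"
    by (rule integral_translation[OF m])
  finally show ?thesis unfolding fourier_fun_character .
qed

lemma schwartz_coord_mult: "schwartz f \<Longrightarrow> schwartz (\<lambda>x. of_real (x $ i) * f x)"
  by (rule schwartz_multiplier[OF multiplier_coord])

lemma fourier_fun_has_derivative:
  fixes \<psi> :: "real ^ 'n::finite \<Rightarrow> complex"
  assumes \<psi>: "schwartz \<psi>"
  shows "(fourier_fun \<psi> has_derivative
    (\<lambda>h. \<Sum>i\<in>UNIV. of_real (h $ i) * fourier_fun (\<lambda>\<xi>. - two_pi_i * (of_real (\<xi> $ i) * \<psi> \<xi>)) x)) (at x)"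
proof -
  let ?n = "2 * CARD('n)"
  define K where "K \<xi> = (real CARD('n))\<^sup>2 * (2 * pi * norm \<xi>)\<^sup>2 * cmod (\<psi> \<xi>)" for \<xi> :: "real ^ 'n"
  have "((\<lambda>y. LINT \<xi>|lborel. character (- \<xi>) y * \<psi> \<xi>) has_derivative
    (\<lambda>h. \<Sum>i\<in>UNIV. of_real (h $ i) *
      (LINT \<xi>|lborel. character (- \<xi>) x * (- two_pi_i * (of_real (\<xi> $ i) * \<psi> \<xi>))))) (at x)"
  proof (rule has_derivative_integral)
    show "integrable lborel (\<lambda>\<xi>. character (- \<xi>) y * \<psi> \<xi>)" for y
      by (intro integrable_character_mult schwartz_integrable \<psi>)
    show "integrable lborel (\<lambda>\<xi>. character (- \<xi>) x * (- two_pi_i * (of_real (\<xi> $ i) * \<psi> \<xi>)))" for i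
      by (intro integrable_character_mult schwartz_integrable schwartz_cmult schwartz_coord_mult \<psi>)
    obtain B where B: "partials_le (decay (?n + 2)) 0 \<psi> B"
      using schwartzE[OF \<psi>] by blast
    show "integrable lborel K"
    proof (rule Bochner_Integration.integrable_bound)
      show "integrable lborel (\<lambda>x :: real ^ 'n. ((real CARD('n))\<^sup>2 * (2 * pi)\<^sup>2 * B) * decay ?n x)"
        by (rule integrable_mult_right[OF integrable_decay])
      show "K \<in> borel_measurable lborel"
        unfolding K_def[abs_def] using borel_measurable_continuous_onI
        by (intro borel_measurable_continuous_onI[THEN measurable_lborel2[THEN equalityD2, THEN subsetD]]
            continuous_intros smooth_continuous schwartz_smooth \<psi>)
      show "AE \<xi> in lborel. norm (K \<xi>) \<le> norm (((real CARD('n))\<^sup>2 * (2 * pi)\<^sup>2 * B) * decay ?n \<xi>)"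
      proof (rule AE_I2)
        fix \<xi> :: "real ^ 'n"
        have "(norm \<xi>)\<^sup>2 \<le> (1 + norm \<xi>)\<^sup>2" by (intro power_mono) auto
        then have "(norm \<xi>)\<^sup>2 * cmod (\<psi> \<xi>) \<le> (1 + norm \<xi>)\<^sup>2 * (B * decay (?n + 2) \<xi>)"
          by (intro mult_mono partials_leD0[OF B]) auto
        also have "\<dots> = B * decay ?n \<xi>"
        proof -
          have "w\<^sup>2 * (B * (1 / w ^ (k + 2))) = B * (1 / w ^ k)" if "w \<noteq> 0" for w :: real and k
            using that by (simp add: power_add power2_eq_square)
          moreover have "1 + norm \<xi> \<noteq> 0" using norm_ge_zero[of \<xi>] by linarith
          ultimately show ?thesis .
        qed
        finally have "(real CARD('n))\<^sup>2 * (2 * pi)\<^sup>2 * ((norm \<xi>)\<^sup>2 * cmod (\<psi> \<xi>)) \<le> (real CARD('n))\<^sup>2 * (2 * pi)\<^sup>2 * (B * decay ?n \<xi>)"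
          by (intro mult_left_mono) auto
        also have "\<dots> \<le> norm (((real CARD('n))\<^sup>2 * (2 * pi)\<^sup>2 * B) * decay ?n \<xi>)"
          by (simp only: mult.assoc real_norm_def abs_ge_self)
        moreover have "norm (K \<xi>) = (real CARD('n))\<^sup>2 * (2 * pi)\<^sup>2 * ((norm \<xi>)\<^sup>2 * cmod (\<psi> \<xi>))"
          by (simp add: K_def power_mult_distrib mult.assoc)
        ultimately show "norm (K \<xi>) \<le> norm (((real CARD('n))\<^sup>2 * (2 * pi)\<^sup>2 * B) * decay ?n \<xi>)"
          by (simp only:)
      qed
    qed
    fix \<xi> h :: "real ^ 'n"
    have 1: "cmod (character (- \<xi>) (x + h) - character (- \<xi>) x -
        (\<Sum>i\<in>UNIV. of_real (h $ i) * partial i (character (- \<xi>)) x)) \<le> (real CARD('n))\<^sup>2 * (2 * pi * norm \<xi>)\<^sup>2 * (norm h)\<^sup>2"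
    proof (rule taylor_first_order[OF smooth_character])
      fix y i k
      have "partial k (partial i (character (- \<xi>))) =
          (\<lambda>x. (two_pi_i * of_real ((- \<xi>) $ i)) * (two_pi_i * of_real ((- \<xi>) $ k) * character (- \<xi>) x))"
        by (simp only: partial_character smooth_partial_cmult[OF smooth_character])
      then have "cmod (partial k (partial i (character (- \<xi>))) y) = (2 * pi * \<bar>\<xi> $ i\<bar>) * (2 * pi * \<bar>\<xi> $ k\<bar>)"
        by (simp add: norm_mult two_pi_i_def)
      also have "\<dots> \<le> (2 * pi * norm \<xi>) * (2 * pi * norm \<xi>)"
        by (intro mult_mono mult_left_mono component_le_norm_cart) auto
      finally show "cmod (partial k (partial i (character (- \<xi>))) y) \<le> (2 * pi * norm \<xi>)\<^sup>2"
        by (simp add: power2_eq_square)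
    qed
    have S: "(\<Sum>i\<in>UNIV. of_real (h $ i) * (character (- \<xi>) x * (- two_pi_i * (of_real (\<xi> $ i) * \<psi> \<xi>)))) =
        (\<Sum>i\<in>UNIV. of_real (h $ i) * partial i (character (- \<xi>)) x) * \<psi> \<xi>"
      unfolding sum_distrib_right by (intro sum.cong refl) (simp add: partial_character mult_ac)
    have "character (- \<xi>) (x + h) * \<psi> \<xi> - character (- \<xi>) x * \<psi> \<xi> -
        (\<Sum>i\<in>UNIV. of_real (h $ i) * (character (- \<xi>) x * (- two_pi_i * (of_real (\<xi> $ i) * \<psi> \<xi>)))) =
        (character (- \<xi>) (x + h) - character (- \<xi>) x -
        (\<Sum>i\<in>UNIV. of_real (h $ i) * partial i (character (- \<xi>)) x)) * \<psi> \<xi>"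
      by (simp only: S left_diff_distrib)
    then show "cmod (character (- \<xi>) (x + h) * \<psi> \<xi> - character (- \<xi>) x * \<psi> \<xi> -
        (\<Sum>i\<in>UNIV. of_real (h $ i) * (character (- \<xi>) x * (- two_pi_i * (of_real (\<xi> $ i) * \<psi> \<xi>))))) \<le> K \<xi> * (norm h)\<^sup>2"
      using mult_right_mono[OF 1 norm_ge_zero[of "\<psi> \<xi>"]] by (simp add: norm_mult K_def mult_ac)
  qed
  then show ?thesis
    unfolding fourier_fun_character[abs_def] .
qed

lemma partial_fourier_fun:
  "schwartz \<psi> \<Longrightarrow> partial i (fourier_fun \<psi>) = fourier_fun (\<lambda>\<xi>. - two_pi_i * (of_real (\<xi> $ i) * \<psi> \<xi>))"
  by (rule ext, subst partial_eqI[OF fourier_fun_has_derivative])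
     (simp_all add: axis_def if_distrib if_distribR cong: if_cong)

lemma smooth_fourier_fun:
  fixes \<psi> :: "real ^ 'n::finite \<Rightarrow> complex"
  assumes "schwartz \<psi>"
  shows "smooth_fun (fourier_fun \<psi>)"
proof -
  have "schwartz \<psi> \<Longrightarrow> differentiable_upto k (fourier_fun \<psi>)" for k and \<psi> :: "real ^ 'n \<Rightarrow> complex"
  proof (induction k arbitrary: \<psi>)
    case 0
    then show ?case using fourier_fun_has_derivative by (auto simp: differentiable_def)
  next
    case (Suc k)
    have "fourier_fun \<psi> differentiable (at x)" for x
      using fourier_fun_has_derivative[OF Suc.prems] by (auto simp: differentiable_def)
    moreover have "differentiable_upto k (partial i (fourier_fun \<psi>))" for i
      unfolding partial_fourier_fun[OF Suc.prems]
      by (intro Suc.IH schwartz_cmult schwartz_coord_mult Suc.prems)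
    ultimately show ?case by simp
  qed
  then show ?thesis using assms by (simp add: smooth_fun_iff)
qed

text \<open>The integral of a derivative vanishes since the integral is invariant under translations.\<close>

lemma integral_partial:
  fixes f :: "real ^ 'n::finite \<Rightarrow> complex"
  assumes f: "schwartz f"
  shows "(LINT x|lborel. partial i f x) = 0"
proof -
  let ?n = "2 * CARD('n)"
  obtain B where B: "B \<ge> 0" "partials_le (decay ?n) 2 f B"
    using schwartzE[OF f] by blast
  define K where "K s = ((real CARD('n))\<^sup>2 * (B * 2 ^ ?n)) * decay ?n s" for s :: "real ^ 'n"
  have "((\<lambda>y. LINT s|lborel. f (s + y)) has_derivative
      (\<lambda>h. \<Sum>i\<in>UNIV. of_real (h $ i) * (LINT s|lborel. partial i f s))) (at 0)"
  proof (rule has_derivative_integral)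
    show "integrable lborel (\<lambda>s. f (s + y))" for y
      by (intro schwartz_integrable schwartz_translation f)
    show "integrable lborel (partial i f)" for i
      by (intro schwartz_integrable schwartz_partial f)
    show "integrable lborel K"
      unfolding K_def[abs_def] by (rule integrable_mult_right[OF integrable_decay])
    fix s h :: "real ^ 'n" assume h: "norm h \<le> 1"
    have "cmod (f (s + h) - f s - (\<Sum>i\<in>UNIV. of_real (h $ i) * partial i f s)) \<le>
        (real CARD('n))\<^sup>2 * (B * 2 ^ ?n * decay ?n s) * (norm h)\<^sup>2"
    proof (rule taylor_first_order[OF schwartz_smooth[OF f]])
      fix y i k assume y: "y \<in> closed_segment s (s + h)"
      then obtain u where u: "y = s + u *\<^sub>R h" "0 \<le> u" "u \<le> 1"
        by (auto simp: closed_segment_def algebra_simps)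
      then have "norm (y - s) \<le> 1"
        using h mult_le_one[of u "norm h"] by simp
      then have "1 + norm s \<le> 2 * (1 + norm y)"
        using norm_triangle_sub[of s y] norm_ge_zero[of y] by (simp add: norm_minus_commute del: norm_ge_zero)
      then have "(1 + norm s) ^ ?n \<le> (2 * (1 + norm y)) ^ ?n"
        by (intro power_mono) auto
      then have "(1 + norm s) ^ ?n \<le> 2 ^ ?n * (1 + norm y) ^ ?n"
        by (simp only: power_mult_distrib)
      then have d: "decay ?n y \<le> 2 ^ ?n * decay ?n s"
        using weight_pos[of s ?n] weight_pos[of y ?n] by (simp add: field_simps)
      have "cmod (partial k (partial i f) y) \<le> B * decay ?n y"
        using partials_leD[OF B(2), of "[k, i]" y] by simp
      also have "\<dots> \<le> B * (2 ^ ?n * decay ?n s)"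
        by (intro mult_left_mono d B)
      finally show "cmod (partial k (partial i f) y) \<le> B * 2 ^ ?n * decay ?n s"
        by (simp only: mult.assoc)
    qed
    then show "cmod (f (s + (0 + h)) - f (s + 0) - (\<Sum>i\<in>UNIV. of_real (h $ i) * partial i f s)) \<le> K s * (norm h)\<^sup>2"
      by (simp add: K_def mult_ac)
  qed
  moreover have "(LINT s|lborel. f (s + y)) = (LINT s|lborel. f s)" for y
    by (rule integral_translation[OF smooth_measurable[OF schwartz_smooth[OF f]]])
  ultimately have "((\<lambda>y :: real ^ 'n. LINT s|lborel. f s) has_derivative
      (\<lambda>h. \<Sum>i\<in>UNIV. of_real (h $ i) * (LINT s|lborel. partial i f s))) (at 0)"
    by simp
  from has_derivative_unique[OF this has_derivative_const]
  have "(\<Sum>k\<in>UNIV. of_real (axis i 1 $ k) * (LINT s|lborel. partial k f s)) = 0"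
    by (rule fun_cong)
  then show ?thesis
    by (simp add: axis_def if_distrib if_distribR cong: if_cong)
qed

text \<open>Apply \<open>integral_partial\<close> to \<open>\<psi>\<close> times a character.\<close>

lemma fourier_fun_partial:
  fixes \<psi> :: "real ^ 'n::finite \<Rightarrow> complex"
  assumes \<psi>: "schwartz \<psi>"
  shows "fourier_fun (partial i \<psi>) x = two_pi_i * of_real (x $ i) * fourier_fun \<psi> x"
proof -
  have c: "character (- \<xi>) x = character (- x) \<xi>" for \<xi>
    by (simp add: character_def inner_commute)
  have s: "schwartz (\<lambda>\<xi>. character (- x) \<xi> * \<psi> \<xi>)"
    by (rule schwartz_multiplier[OF multiplier_character \<psi>])
  have "partial i (\<lambda>\<xi>. character (- x) \<xi> * \<psi> \<xi>) =
      (\<lambda>\<xi>. (- (two_pi_i * of_real (x $ i))) * (character (- x) \<xi> * \<psi> \<xi>) + character (- x) \<xi> * partial i \<psi> \<xi>)"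
    by (subst smooth_partial_mult[OF smooth_character schwartz_smooth[OF \<psi>]])
       (simp add: partial_character mult.assoc)
  then have "0 = (LINT \<xi>|lborel. (- (two_pi_i * of_real (x $ i))) * (character (- x) \<xi> * \<psi> \<xi>) +
      character (- x) \<xi> * partial i \<psi> \<xi>)"
    using integral_partial[OF s, of i] by simp
  also have "\<dots> = (- (two_pi_i * of_real (x $ i))) * (LINT \<xi>|lborel. character (- x) \<xi> * \<psi> \<xi>) +
      (LINT \<xi>|lborel. character (- x) \<xi> * partial i \<psi> \<xi>)"
  proof (subst Bochner_Integration.integral_add)
    show "integrable lborel (\<lambda>\<xi>. (- (two_pi_i * of_real (x $ i))) * (character (- x) \<xi> * \<psi> \<xi>))"
      by (intro integrable_mult_right schwartz_integrable s)
    show "integrable lborel (\<lambda>\<xi>. character (- x) \<xi> * partial i \<psi> \<xi>)"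
      by (intro schwartz_integrable schwartz_multiplier[OF multiplier_character] schwartz_partial \<psi>)
  qed simp
  finally show ?thesis
    unfolding fourier_fun_character c by (simp add: algebra_simps)
qed

lemma fourier_fun_bound:
  fixes \<psi> :: "real ^ 'n::finite \<Rightarrow> complex"
  assumes \<psi>: "schwartz \<psi>" and B: "partials_le (decay (2 * CARD('n))) k \<psi> B"
  shows "cmod (fourier_fun \<psi> x) \<le> (LINT \<xi>|lborel. decay (2 * CARD('n)) (\<xi> :: real ^ 'n)) * B"
proof -
  have "cmod (fourier_fun \<psi> x) \<le> (LINT \<xi>|lborel. B * decay (2 * CARD('n)) (\<xi> :: real ^ 'n))"
    unfolding fourier_fun_character
    using partials_leD0[OF B]
    by (intro Bochner_Integration.integral_norm_bound_integral integrable_character_mult schwartz_integrable \<psi>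
        integrable_mult_right[OF integrable_decay]) (simp add: norm_mult)
  also have "\<dots> = B * (LINT \<xi>|lborel. decay (2 * CARD('n)) (\<xi> :: real ^ 'n))"
    by (rule integral_mult_right_zero)
  finally show ?thesis by (simp only: mult.commute)
qed

lemma norm_le_sum_coordinates:
  fixes x :: "real ^ 'n::finite" and a b :: real
  assumes "a \<ge> 0" "\<And>i. \<bar>x $ i\<bar> * a \<le> b"
  shows "(1 + norm x) * a \<le> a + CARD('n) * b"
proof -
  have "norm x * a \<le> (\<Sum>i\<in>UNIV. \<bar>x $ i\<bar>) * a"
    by (intro mult_right_mono norm_le_l1_cart assms)
  also have "\<dots> \<le> (\<Sum>i\<in>(UNIV :: 'n set). b)"
    unfolding sum_distrib_right by (intro sum_mono assms)
  finally show ?thesis by (simp add: distrib_right)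
qed

text \<open>Each derivative of \<open>\<psi>\<close> gains a power of the weight for the transform, and each power of the weight for
  \<open>\<psi>\<close> gains a derivative.\<close>

lemma schwartz_operator_fourier_fun: "schwartz_operator (fourier_fun :: (real ^ 'n::finite \<Rightarrow> complex) \<Rightarrow> _)"
  unfolding schwartz_operator_def
proof (intro conjI allI impI)
  show "smooth_fun (fourier_fun f)" if "schwartz f" for f :: "real ^ 'n \<Rightarrow> complex"
    using that by (rule smooth_fourier_fun)
  show "fourier_fun (\<lambda>x. a * f x + b * g x) = (\<lambda>x. a * fourier_fun f x + b * fourier_fun g x)"
    if "schwartz f" "schwartz g" for f g :: "real ^ 'n \<Rightarrow> complex" and a b
    using that by (rule fourier_fun_linear)
  have zero: "\<exists>C M k. C \<ge> 0 \<and> (\<forall>(f :: real ^ 'n \<Rightarrow> complex) B. schwartz f \<longrightarrow> partials_le (decay M) k f B \<longrightarrow>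
      (\<forall>x. (1 + norm x) ^ N * cmod (fourier_fun f x) \<le> C * B))" for N
  proof (induction N)
    case 0
    have "(LINT \<xi>|lborel. decay (2 * CARD('n)) (\<xi> :: real ^ 'n)) \<ge> 0"
      using weight_pos by (intro Bochner_Integration.integral_nonneg) (simp add: less_imp_le)
    moreover have "(1 + norm x) ^ 0 * cmod (fourier_fun f x) \<le> (LINT \<xi>|lborel. decay (2 * CARD('n)) (\<xi> :: real ^ 'n)) * B"
      if "schwartz f" "partials_le (decay (2 * CARD('n))) 0 f B" for f :: "real ^ 'n \<Rightarrow> complex" and B x
      using fourier_fun_bound[OF that] by simp
    ultimately show ?case by blast
  next
    case (Suc N)
    then obtain C M k where C: "C \<ge> 0" "\<And>(f :: real ^ 'n \<Rightarrow> complex) B x. schwartz f \<Longrightarrow> partials_le (decay M) k f B \<Longrightarrow>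
        (1 + norm x) ^ N * cmod (fourier_fun f x) \<le> C * B"
      by blast
    have "(1 + norm x) ^ Suc N * cmod (fourier_fun f x) \<le> (C * (1 + CARD('n))) * B"
      if f: "schwartz f" and B: "partials_le (decay M) (Suc k) f B" for f :: "real ^ 'n \<Rightarrow> complex" and B x
    proof -
      let ?a = "(1 + norm x) ^ N * cmod (fourier_fun f x)"
      have a: "?a \<le> C * B"
        by (rule C(2)[OF f partials_le_order[OF B]]) simp
      have "\<bar>x $ i\<bar> * ?a \<le> C * B" for i
      proof -
        have "(1 + norm x) ^ N * cmod (fourier_fun (partial i f) x) \<le> C * B"
          by (rule C(2)[OF schwartz_partial[OF f] partials_le_partial[OF B]])
        then have "2 * pi * (\<bar>x $ i\<bar> * ?a) \<le> C * B"
          by (simp add: fourier_fun_partial[OF f] norm_mult two_pi_i_def mult_ac)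
        moreover have "1 * (\<bar>x $ i\<bar> * ?a) \<le> 2 * pi * (\<bar>x $ i\<bar> * ?a)"
          using pi_ge_two weight_pos[of x N] by (intro mult_right_mono) (auto intro!: mult_nonneg_nonneg)
        ultimately show ?thesis by linarith
      qed
      then have "(1 + norm x) * ?a \<le> ?a + CARD('n) * (C * B)"
        by (intro norm_le_sum_coordinates) (auto intro!: mult_nonneg_nonneg)
      also have "\<dots> \<le> C * B + CARD('n) * (C * B)" using a by simp
      finally show ?thesis by (simp add: algebra_simps)
    qed
    then show ?case
      using C(1) by (intro exI[of _ "C * (1 + CARD('n))"] exI[of _ M] exI[of _ "Suc k"]) simp
  qed
  have "\<exists>C M k. \<forall>(f :: real ^ 'n \<Rightarrow> complex) B. schwartz f \<longrightarrow> partials_le (decay M) k f B \<longrightarrow>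
      partials_le (decay N) m (fourier_fun f) (C * B)" for N m
  proof (induction m)
    case 0
    then show ?case using zero[of N] unfolding partials_le_decay_iff[of N 0] by simp blast
  next
    case (Suc m)
    then obtain C M k where C: "\<And>(f :: real ^ 'n \<Rightarrow> complex) B. schwartz f \<Longrightarrow> partials_le (decay M) k f B \<Longrightarrow>
        partials_le (decay N) m (fourier_fun f) (C * B)"
      by blast
    obtain C' M' k' where C': "\<And>(f :: real ^ 'n \<Rightarrow> complex) B x. schwartz f \<Longrightarrow> partials_le (decay M') k' f B \<Longrightarrow>
        (1 + norm x) ^ N * cmod (fourier_fun f x) \<le> C' * B"
      using zero[of N] by blast
    have "\<exists>C' M' k'. \<forall>(f :: real ^ 'n \<Rightarrow> complex) B. schwartz f \<longrightarrow> partials_le (decay M') k' f B \<longrightarrow>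
        partials_le (decay M) k (\<lambda>\<xi>. - two_pi_i * (of_real (\<xi> $ i) * f \<xi>)) (C' * B)"
      (is "\<exists>C' M' k'. ?Q i C' M' k'") for i
    proof -
      obtain C' M' k' where *: "\<And>(f :: real ^ 'n \<Rightarrow> complex) B. schwartz f \<Longrightarrow> partials_le (decay M') k' f B \<Longrightarrow>
          partials_le (decay M) k (\<lambda>\<xi>. of_real (\<xi> $ i) * f \<xi>) (C' * B)"
        using schwartz_operator_bound[OF schwartz_operator_multiplier[OF multiplier_coord[of i]], of M k] by blast
      have "partials_le (decay M) k (\<lambda>\<xi>. - two_pi_i * (of_real (\<xi> $ i) * f \<xi>)) ((cmod (- two_pi_i) * C') * B)"
        if "schwartz f" "partials_le (decay M') k' f B" for f :: "real ^ 'n \<Rightarrow> complex" and B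
        using partials_le_cmult[OF schwartz_smooth[OF schwartz_coord_mult[OF that(1)]] *[OF that], of "- two_pi_i"]
        by (simp only: mult.assoc)
      then show ?thesis by blast
    qed
    then have "\<forall>i. \<exists>C' M' k'. ?Q i C' M' k'" by blast
    then obtain Ci Mi ki where Ci: "\<And>i (f :: real ^ 'n \<Rightarrow> complex) B. schwartz f \<Longrightarrow> partials_le (decay (Mi i)) (ki i) f B \<Longrightarrow>
        partials_le (decay M) k (\<lambda>\<xi>. - two_pi_i * (of_real (\<xi> $ i) * f \<xi>)) (Ci i * B)"
      unfolding choice_iff by blast
    define MM where "MM = M' + (\<Sum>i\<in>UNIV. Mi i)"
    define kk where "kk = k' + (\<Sum>i\<in>UNIV. ki i)"
    define CC where "CC = \<bar>C'\<bar> + (\<Sum>i\<in>UNIV. \<bar>C * Ci i\<bar>)"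
    have MM: "M' \<le> MM" "Mi i \<le> MM" and kk: "k' \<le> kk" "ki i \<le> kk" for i
      unfolding MM_def kk_def by (auto intro!: trans_le_add2 member_le_sum)
    have CC: "\<bar>C'\<bar> \<le> CC" "\<bar>C * Ci i\<bar> \<le> CC" for i
    proof -
      show "\<bar>C'\<bar> \<le> CC" unfolding CC_def by (simp add: sum_nonneg)
      have "\<bar>C * Ci i\<bar> \<le> (\<Sum>i\<in>UNIV. \<bar>C * Ci i\<bar>)" by (rule member_le_sum) auto
      then show "\<bar>C * Ci i\<bar> \<le> CC" unfolding CC_def by simp
    qed
    have "partials_le (decay N) (Suc m) (fourier_fun f) (CC * B)"
      if f: "schwartz f" and B: "partials_le (decay MM) kk f B" for f :: "real ^ 'n \<Rightarrow> complex" and B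
      unfolding partials_le_Suc
    proof (intro conjI allI)
      have B0: "B \<ge> 0" using partials_le_nonneg[OF B] by simp
      have scale: "c * B \<le> CC * B" if "\<bar>c\<bar> \<le> CC" for c
        using that B0 by (intro mult_right_mono) auto
      show "cmod (fourier_fun f x) \<le> CC * B * decay N x" for x
      proof -
        have "(1 + norm x) ^ N * cmod (fourier_fun f x) \<le> CC * B"
          using C'[OF f partials_le_decay_mono[OF B MM(1) kk(1)], of x] scale[OF CC(1)] by linarith
        then show ?thesis using weight_pos[of x N] by (simp add: pos_le_divide_eq mult.commute)
      qed
      fix i
      have "partials_le (decay N) m (fourier_fun (\<lambda>\<xi>. - two_pi_i * (of_real (\<xi> $ i) * f \<xi>))) (C * (Ci i * B))"
        by (intro C Ci schwartz_cmult schwartz_coord_mult f partials_le_decay_mono[OF B MM(2) kk(2)])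
      then show "partials_le (decay N) m (partial i (fourier_fun f)) (CC * B)"
        unfolding partial_fourier_fun[OF f]
      proof (rule partials_le_weaken)
        have "C * (Ci i * B) \<le> CC * B"
          using scale[OF CC(2)[of i]] by (simp only: mult.assoc)
        then show "C * (Ci i * B) * decay N x \<le> CC * B * decay N x" for x :: "real ^ 'n"
          using weight_pos[of x N] by (intro mult_right_mono) auto
      qed
    qed
    then show ?case by blast
  qed
  then show "\<exists>C M k. \<forall>(f :: real ^ 'n \<Rightarrow> complex) B. schwartz f \<longrightarrow> partials_le (decay M) k f B \<longrightarrow>
      partials_le (decay N) m (fourier_fun f) (C * B)" for N m .
qed

lemma schwartz_fourier_fun: "schwartz \<psi> \<Longrightarrow> schwartz (fourier_fun \<psi>)"
  by (rule schwartz_operator_schwartz[OF schwartz_operator_fourier_fun])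

lemma tempered_fourier: "tempered t \<Longrightarrow> tempered (fourier t)"
  unfolding fourier_def[abs_def] by (rule tempered_operator[OF _ schwartz_operator_fourier_fun])

section \<open>Distributions annihilated by the coordinates\<close>

lemma integrable_on_unit_interval:
  fixes F :: "real \<Rightarrow> complex"
  assumes "continuous_on UNIV F"
  shows "integrable lborel (\<lambda>s. indicator {0..1} s *\<^sub>R F s)"
proof -
  have "continuous_on {0..1} F"
    by (rule continuous_on_subset[OF assms]) simp
  then show ?thesis
    using borel_integrable_compact[of "{0..1::real}" F] by simp
qed

text \<open>The coefficients in Hadamard's lemma are the averages of \<open>\<partial>\<^sub>i f\<close> over the segment from \<open>0\<close> to \<open>x\<close>. Every
  derivative of such an average brings out a factor \<open>s\<close>, whence the power \<open>s\<^sup>k\<close>.\<close>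

definition average_scaled :: "nat \<Rightarrow> (real ^ 'n \<Rightarrow> complex) \<Rightarrow> real ^ ('n::finite) \<Rightarrow> complex" where
  "average_scaled k f x = (LINT s|lborel. indicator {0..1} s *\<^sub>R (of_real s ^ k * f (s *\<^sub>R x)))"

lemma average_scaled_has_derivative:
  fixes f :: "real ^ 'n::finite \<Rightarrow> complex"
  assumes f: "schwartz f"
  shows "(average_scaled k f has_derivative
    (\<lambda>h. \<Sum>i\<in>UNIV. of_real (h $ i) * average_scaled (Suc k) (partial i f) x)) (at x)"
proof -
  obtain B where B: "B \<ge> 0" "partials_le (decay 0) 2 f B"
    using schwartzE[OF f] by blast
  have cont: "continuous_on UNIV (\<lambda>s. of_real s ^ k * g (s *\<^sub>R x))" if "schwartz g"
    for g :: "real ^ 'n \<Rightarrow> complex" and x k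
    by (intro continuous_intros continuous_on_compose2[OF smooth_continuous[OF schwartz_smooth[OF that], of UNIV]]) auto
  let ?K = "(real CARD('n))\<^sup>2 * B"
  have "((\<lambda>y. LINT s|lborel. indicator {0..1} s *\<^sub>R (of_real s ^ k * f (s *\<^sub>R y))) has_derivative
    (\<lambda>h. \<Sum>i\<in>UNIV. of_real (h $ i) *
      (LINT s|lborel. indicator {0..1} s *\<^sub>R (of_real s ^ Suc k * partial i f (s *\<^sub>R x))))) (at x)"
  proof (rule has_derivative_integral)
    show "integrable lborel (\<lambda>s. indicator {0..1} s *\<^sub>R (of_real s ^ k * f (s *\<^sub>R y)))" for y
      by (rule integrable_on_unit_interval[OF cont[OF f]])
    show "integrable lborel (\<lambda>s. indicator {0..1} s *\<^sub>R (of_real s ^ Suc k * partial i f (s *\<^sub>R x)))" for i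
      by (rule integrable_on_unit_interval[OF cont[OF schwartz_partial[OF f]]])
    have "integrable lborel (\<lambda>s :: real. indicator {0..1} s *\<^sub>R complex_of_real ?K)"
      by (rule integrable_on_unit_interval[of "\<lambda>s. complex_of_real ?K", OF continuous_on_const])
    from integrable_norm[OF this]
    have "integrable lborel (\<lambda>s :: real. norm (indicator {0..1} s *\<^sub>R complex_of_real ?K))" .
    also have "(\<lambda>s. norm (indicator {0..1} s *\<^sub>R complex_of_real ?K)) = (\<lambda>s. indicator {0..1::real} s * ?K)"
      using B by (auto simp: fun_eq_iff indicator_def norm_mult norm_power)
    finally show "integrable lborel (\<lambda>s. indicator {0..1::real} s * ?K)" .
    fix s :: real and h :: "real ^ 'n"
    have "cmod (of_real s ^ k * f (s *\<^sub>R (x + h)) - of_real s ^ k * f (s *\<^sub>R x) -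
        (\<Sum>i\<in>UNIV. of_real (h $ i) * (of_real s ^ Suc k * partial i f (s *\<^sub>R x)))) \<le> ?K * (norm h)\<^sup>2"
      if s: "0 \<le> s" "s \<le> 1"
    proof -
      have "cmod (f (s *\<^sub>R x + s *\<^sub>R h) - f (s *\<^sub>R x) -
          (\<Sum>i\<in>UNIV. of_real ((s *\<^sub>R h) $ i) * partial i f (s *\<^sub>R x))) \<le> (real CARD('n))\<^sup>2 * B * (norm (s *\<^sub>R h))\<^sup>2"
      proof (rule taylor_first_order[OF schwartz_smooth[OF f]])
        fix y i k
        show "cmod (partial k (partial i f) y) \<le> B"
          using partials_leD[OF B(2), of "[k, i]" y] by simp
      qed
      also have "\<dots> \<le> ?K * (norm h)\<^sup>2"
        using s B(1) by (intro mult_left_mono power_mono) (auto simp: mult_left_le_one_le)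
      finally have le: "cmod (f (s *\<^sub>R x + s *\<^sub>R h) - f (s *\<^sub>R x) -
          (\<Sum>i\<in>UNIV. of_real ((s *\<^sub>R h) $ i) * partial i f (s *\<^sub>R x))) \<le> ?K * (norm h)\<^sup>2" .
      have eq: "of_real s ^ k * f (s *\<^sub>R (x + h)) - of_real s ^ k * f (s *\<^sub>R x) -
        (\<Sum>i\<in>UNIV. of_real (h $ i) * (of_real s ^ Suc k * partial i f (s *\<^sub>R x))) =
        of_real s ^ k * (f (s *\<^sub>R x + s *\<^sub>R h) - f (s *\<^sub>R x) -
          (\<Sum>i\<in>UNIV. of_real ((s *\<^sub>R h) $ i) * partial i f (s *\<^sub>R x)))"
        unfolding right_diff_distrib sum_distrib_left scaleR_right_distrib
        by (intro arg_cong2[where f = minus] refl sum.cong) (simp add: mult_ac)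
      have "cmod (of_real s ^ k) \<le> 1"
        using s by (simp add: norm_power power_le_one)
      from mult_mono[OF this le] show ?thesis
        unfolding eq norm_mult by simp
    qed
    then show "cmod (indicator {0..1} s *\<^sub>R (of_real s ^ k * f (s *\<^sub>R (x + h))) -
        indicator {0..1} s *\<^sub>R (of_real s ^ k * f (s *\<^sub>R x)) -
        (\<Sum>i\<in>UNIV. of_real (h $ i) * (indicator {0..1} s *\<^sub>R (of_real s ^ Suc k * partial i f (s *\<^sub>R x))))) \<le>
        indicator {0..1} s * ?K * (norm h)\<^sup>2"
      by (cases "s \<in> {0..1}") simp_all
  qed
  then show ?thesis unfolding average_scaled_def[abs_def] .
qed

lemma smooth_average_scaled:
  fixes f :: "real ^ 'n::finite \<Rightarrow> complex"
  assumes "schwartz f"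
  shows "smooth_fun (average_scaled k f)"
proof -
  have "schwartz f \<Longrightarrow> differentiable_upto m (average_scaled k f)" for m k and f :: "real ^ 'n \<Rightarrow> complex"
  proof (induction m arbitrary: k f)
    case 0
    then show ?case using average_scaled_has_derivative by (auto simp: differentiable_def)
  next
    case (Suc m)
    have "average_scaled k f differentiable (at x)" for x
      using average_scaled_has_derivative[OF Suc.prems] by (auto simp: differentiable_def)
    moreover have "partial i (average_scaled k f) = average_scaled (Suc k) (partial i f)" for i
      by (rule ext, subst partial_eqI[OF average_scaled_has_derivative[OF Suc.prems]])
         (simp add: axis_def if_distrib if_distribR cong: if_cong)
    ultimately show ?case
      using Suc.IH[OF schwartz_partial[OF Suc.prems]] by simp
  qed
  then show ?thesis using assms by (simp add: smooth_fun_iff)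
qed

text \<open>Hadamard's lemma: integrate the derivative of \<open>f\<close> along the segment from \<open>0\<close> to \<open>x\<close>.\<close>

lemma hadamard:
  fixes f :: "real ^ 'n::finite \<Rightarrow> complex"
  assumes f: "schwartz f"
  shows "f x = f 0 + (\<Sum>i\<in>UNIV. of_real (x $ i) * average_scaled 0 (partial i f) x)"
proof -
  let ?D = "\<lambda>s. \<Sum>i\<in>UNIV. of_real (x $ i) * partial i f (s *\<^sub>R x)"
  have cont: "continuous_on UNIV (\<lambda>s. partial i f (s *\<^sub>R x))" for i
    by (intro continuous_on_compose2[OF smooth_continuous[OF smooth_partial[OF schwartz_smooth[OF f]], of UNIV]] continuous_intros) auto
  have "(LINT s|lborel. indicator {0..1} s *\<^sub>R ?D s) = f (1 *\<^sub>R x) - f (0 *\<^sub>R x)"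
  proof (rule integral_FTC_Icc)
    show "((\<lambda>s. f (s *\<^sub>R x)) has_vector_derivative ?D s) (at s within {0..1})" for s
    proof -
      have "((\<lambda>s. f (s *\<^sub>R x)) has_derivative (\<lambda>u. \<Sum>i\<in>UNIV. of_real ((u *\<^sub>R x) $ i) * partial i f (s *\<^sub>R x))) (at s)"
        by (rule has_derivative_compose[OF _ smooth_has_derivative[OF schwartz_smooth[OF f]]])
           (auto intro!: derivative_eq_intros)
      moreover have "(\<lambda>u. \<Sum>i\<in>UNIV. of_real ((u *\<^sub>R x) $ i) * partial i f (s *\<^sub>R x)) = (\<lambda>u. u *\<^sub>R ?D s)"
        unfolding scaleR_sum_right by (intro ext sum.cong refl) (simp add: scaleR_conv_of_real[where 'a = complex] mult.assoc)
      ultimately have "((\<lambda>s. f (s *\<^sub>R x)) has_vector_derivative ?D s) (at s)"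
        by (simp only: has_vector_derivative_def)
      then show ?thesis by (rule has_vector_derivative_at_within)
    qed
    show "continuous_on {0..1} ?D"
      by (intro continuous_on_sum continuous_on_mult continuous_on_const continuous_on_subset[OF cont]) auto
  qed simp
  moreover have "(LINT s|lborel. indicator {0..1} s *\<^sub>R ?D s) =
      (\<Sum>i\<in>UNIV. of_real (x $ i) * average_scaled 0 (partial i f) x)"
  proof -
    have "(LINT s|lborel. indicator {0..1} s *\<^sub>R ?D s) =
        (LINT s|lborel. (\<Sum>i\<in>UNIV. of_real (x $ i) * (indicator {0..1} s *\<^sub>R partial i f (s *\<^sub>R x))))"
      by (rule Bochner_Integration.integral_cong) (simp_all add: scaleR_sum_right)
    also have "\<dots> = (\<Sum>i\<in>UNIV. (LINT s|lborel. of_real (x $ i) * (indicator {0..1} s *\<^sub>R partial i f (s *\<^sub>R x))))"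
      by (rule Bochner_Integration.integral_sum) (intro integrable_mult_right integrable_on_unit_interval[OF cont])
    also have "\<dots> = (\<Sum>i\<in>UNIV. of_real (x $ i) * (LINT s|lborel. indicator {0..1} s *\<^sub>R partial i f (s *\<^sub>R x)))"
      by (intro sum.cong refl integral_mult_right_zero)
    finally show ?thesis by (simp only: average_scaled_def power_0 mult_1)
  qed
  ultimately show ?thesis by (simp add: algebra_simps)
qed

abbreviation std_cutoff :: "nat \<Rightarrow> real ^ ('n::finite) \<Rightarrow> complex" where
  "std_cutoff N \<equiv> cutoff (\<lambda>a. axis a 1) (real N)"

lemma std_cutoff_zero: "norm x \<ge> real CARD('n) * (real N + 1) \<Longrightarrow> std_cutoff N (x :: real ^ 'n::finite) = 0"
proof (rule ccontr)
  assume x: "norm x \<ge> real CARD('n) * (real N + 1)" and nz: "std_cutoff N x \<noteq> 0"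
  have lt: "\<bar>x $ a\<bar> < real N + 3/4" for a
  proof (rule ccontr)
    assume "\<not> \<bar>x $ a\<bar> < real N + 3/4"
    then have "std_cutoff N x = 0" by (intro cutoff_0[of _ _ a]) (auto simp: inner_axis')
    with nz show False by simp
  qed
  have "norm x \<le> (\<Sum>a\<in>UNIV. \<bar>x $ a\<bar>)" by (rule norm_le_l1_cart)
  also have "\<dots> \<le> (\<Sum>a\<in>(UNIV :: 'n set). real N + 3/4)"
    using lt by (intro sum_mono) (simp add: less_imp_le)
  also have "\<dots> < real CARD('n) * (real N + 1)" by simp
  finally show False using x by simp
qed

lemma schwartz_std_cutoff_mult:
  fixes f :: "real ^ 'n::finite \<Rightarrow> complex"
  assumes "smooth_fun f"
  shows "schwartz (\<lambda>x. std_cutoff N x * f x)"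
  by (rule schwartz_compact_support[OF smooth_mult[OF smooth_cutoff assms], of "real CARD('n) * (real N + 1)"])
     (simp add: std_cutoff_zero)

lemma schwartz_std_cutoff: "schwartz (std_cutoff N)"
  using schwartz_std_cutoff_mult[of "\<lambda>x. 1" N] by simp

lemma uniformly_smooth_std_cutoff: "uniformly_smooth std_cutoff"
  using uniformly_smooth_cutoff unfolding uniformly_smooth_def by blast

lemma std_cutoff_at_0 [simp]: "std_cutoff N 0 = 1"
  by (rule cutoff_1) simp

text \<open>By Hadamard's lemma \<open>\<phi> - \<phi> 0\<close> is a combination of the coordinates with smooth coefficients. The
  coefficients need not decay, so the identity is multiplied by a cutoff before \<open>t\<close> is applied.\<close>

lemma point_supported:
  fixes t :: "'n::finite functional"
  assumes t: "tempered t" and x: "\<And>i \<phi>. schwartz \<phi> \<Longrightarrow> t (\<lambda>x. of_real (x $ i) * \<phi> x) = 0"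
  shows "\<exists>c. \<forall>\<phi>. schwartz \<phi> \<longrightarrow> t \<phi> = c * \<phi> 0"
proof -
  have cut: "t (\<lambda>x. std_cutoff N x * \<phi> x) = \<phi> 0 * t (std_cutoff N)" if \<phi>: "schwartz \<phi>" for \<phi> N
  proof -
    let ?g = "\<lambda>i. average_scaled 0 (partial i \<phi>)"
    have s: "schwartz (\<lambda>x. std_cutoff N x * ?g i x)" for i
      by (rule schwartz_std_cutoff_mult[OF smooth_average_scaled[OF schwartz_partial[OF \<phi>]]])
    have eq: "(\<lambda>x. std_cutoff N x * \<phi> x) =
        (\<lambda>x. \<phi> 0 * std_cutoff N x + (\<Sum>i\<in>UNIV. of_real (x $ i) * (std_cutoff N x * ?g i x)))"
    proof
      fix x
      show "std_cutoff N x * \<phi> x =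
          \<phi> 0 * std_cutoff N x + (\<Sum>i\<in>UNIV. of_real (x $ i) * (std_cutoff N x * ?g i x))"
        by (subst hadamard[OF \<phi>, of x]) (simp add: distrib_left sum_distrib_left mult_ac)
    qed
    have "t (\<lambda>x. std_cutoff N x * \<phi> x) = t (\<lambda>x. \<phi> 0 * std_cutoff N x) + t (\<lambda>x. \<Sum>i\<in>UNIV. of_real (x $ i) * (std_cutoff N x * ?g i x))"
      unfolding eq
      by (rule linear_functional_add[OF tempered_linear[OF t] schwartz_cmult[OF schwartz_std_cutoff]
            schwartz_sum[OF schwartz_coord_mult[OF s]]])
    also have "t (\<lambda>x. \<Sum>i\<in>UNIV. of_real (x $ i) * (std_cutoff N x * ?g i x)) =
        (\<Sum>i\<in>UNIV. t (\<lambda>x. of_real (x $ i) * (std_cutoff N x * ?g i x)))"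
      by (rule linear_functional_sum[OF tempered_linear[OF t] schwartz_coord_mult[OF s]])
    also have "\<dots> = 0"
      by (simp add: x[OF s])
    finally show ?thesis
      by (simp add: linear_functional_cmult[OF tempered_linear[OF t] schwartz_std_cutoff])
  qed
  have const: "t (std_cutoff N) = t (std_cutoff 1)" if N: "N \<ge> 2" for N
  proof -
    have "std_cutoff N x * std_cutoff 1 x = std_cutoff 1 x" for x :: "real ^ 'n"
    proof (cases "\<forall>a. \<bar>x $ a\<bar> \<le> real N")
      case True
      then have "std_cutoff N x = 1" by (intro cutoff_1) (simp add: inner_axis')
      then show ?thesis by simp
    next
      case False
      then obtain a where "\<bar>x $ a\<bar> > real N" by (auto simp: not_le)
      then have "std_cutoff 1 x = 0"
        using N by (intro cutoff_0[of _ _ a]) (auto simp: inner_axis')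
      then show ?thesis by simp
    qed
    then have "(\<lambda>x :: real ^ 'n. std_cutoff N x * std_cutoff 1 x) = std_cutoff 1" by blast
    then show ?thesis
      using cut[OF schwartz_std_cutoff, of N 1] by (simp only: std_cutoff_at_0 mult_1)
  qed
  have "t \<phi> = t (std_cutoff 1) * \<phi> 0" if \<phi>: "schwartz \<phi>" for \<phi>
  proof (rule LIMSEQ_unique)
    show "(\<lambda>N. t (\<lambda>x. std_cutoff N x * \<phi> x)) \<longlonglongrightarrow> t \<phi>"
      by (rule tempered_cutoff_limit[OF t uniformly_smooth_std_cutoff cutoff_eventually_1 \<phi>])
    have "t (\<lambda>x. std_cutoff N x * \<phi> x) = t (std_cutoff 1) * \<phi> 0" if "N \<ge> 2" for N
      unfolding cut[OF \<phi>] const[OF that] by (rule mult.commute)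
    then show "(\<lambda>N. t (\<lambda>x. std_cutoff N x * \<phi> x)) \<longlonglongrightarrow> t (std_cutoff 1) * \<phi> 0"
      by (intro tendsto_eventually eventually_sequentiallyI[of 2])
  qed
  then show ?thesis by blast
qed

section \<open>Lattices\<close>

definition dual_bases :: "('n \<Rightarrow> real ^ 'n) \<Rightarrow> ('n \<Rightarrow> real ^ ('n::finite)) \<Rightarrow> bool" where
  "dual_bases l lam \<longleftrightarrow> (\<forall>a b. lam a \<bullet> l b = (if a = b then 1 else 0))"

text \<open>If \<open>lam\<close> is the dual basis of \<open>l\<close>, this is the lattice spanned by \<open>l\<close> (see
  \<open>range_lattice_point\<close>). The description by integrality conditions does not refer to \<open>l\<close>, and it makes a
  lattice and its dual appear symmetrically.\<close>

definition lattice_dual_to :: "('n \<Rightarrow> real ^ 'n) \<Rightarrow> (real ^ ('n::finite)) set" where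
  "lattice_dual_to lam = {x. \<forall>a. lam a \<bullet> x \<in> \<int>}"

definition lattice_point :: "('n \<Rightarrow> real ^ 'n) \<Rightarrow> ('n \<Rightarrow> int) \<Rightarrow> real ^ ('n::finite)" where
  "lattice_point l k = (\<Sum>a\<in>UNIV. of_int (k a) *\<^sub>R l a)"

lemma dual_bases_sym: "dual_bases l lam \<Longrightarrow> dual_bases lam l"
  by (auto simp: dual_bases_def inner_commute)

lemma dual_bases_inner: "dual_bases l lam \<Longrightarrow> lam a \<bullet> l b = (if a = b then 1 else 0)"
  by (simp add: dual_bases_def)

lemma dual_bases_expansion:
  assumes "dual_bases l lam"
  shows "x = (\<Sum>a\<in>UNIV. (lam a \<bullet> x) *\<^sub>R l a)"
proof -
  let ?A = "(\<chi> i j. l j $ i) :: real ^ 'a ^ 'a" and ?B = "(\<chi> i j. lam i $ j) :: real ^ 'a ^ 'a"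
  have "?B ** ?A = mat 1"
    using assms by (auto simp: vec_eq_iff matrix_matrix_mult_def mat_def dual_bases_def inner_vec_def)
  then have "?A ** ?B = mat 1" using matrix_left_right_inverse by blast
  then have "x = ?A *v (?B *v x)" by (simp add: matrix_vector_mul_assoc)
  also have "\<dots> = (\<Sum>a\<in>UNIV. (lam a \<bullet> x) *\<^sub>R l a)"
    by (simp add: vec_eq_iff matrix_vector_mult_def inner_vec_def mult.commute)
  finally show ?thesis .
qed

lemma inner_lattice_point: "dual_bases l lam \<Longrightarrow> lam a \<bullet> lattice_point l k = of_int (k a)"
  by (simp add: lattice_point_def inner_sum_right dual_bases_inner if_distrib cong: if_cong)

lemma inj_lattice_point: "dual_bases l lam \<Longrightarrow> inj (lattice_point l)"
proof (rule injI, rule ext)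
  fix k k' a assume d: "dual_bases l lam" and "lattice_point l k = lattice_point l k'"
  then have "lam a \<bullet> lattice_point l k = lam a \<bullet> lattice_point l k'" by simp
  then show "k a = k' a" by (simp add: inner_lattice_point[OF d])
qed

lemma range_lattice_point:
  assumes d: "dual_bases l lam"
  shows "range (lattice_point l) = lattice_dual_to lam"
proof
  show "range (lattice_point l) \<subseteq> lattice_dual_to lam"
    by (auto simp: lattice_dual_to_def inner_lattice_point[OF d])
  show "lattice_dual_to lam \<subseteq> range (lattice_point l)"
  proof
    fix x assume "x \<in> lattice_dual_to lam"
    then have "\<forall>a. \<exists>k. lam a \<bullet> x = of_int k"
      by (auto simp: lattice_dual_to_def elim!: Ints_cases)
    from choice[OF this] obtain k where "\<And>a. lam a \<bullet> x = of_int (k a)" by blast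
    then have "x = lattice_point l k"
      using dual_bases_expansion[OF d, of x] by (simp add: lattice_point_def)
    then show "x \<in> range (lattice_point l)" by blast
  qed
qed

lemma bij_betw_lattice_point: "dual_bases l lam \<Longrightarrow> bij_betw (lattice_point l) UNIV (lattice_dual_to lam)"
  by (simp add: bij_betw_def inj_lattice_point range_lattice_point)

lemma lattice_dual_to_add: "x \<in> lattice_dual_to lam \<Longrightarrow> y \<in> lattice_dual_to lam \<Longrightarrow> x + y \<in> lattice_dual_to lam"
  by (simp add: lattice_dual_to_def inner_add_right)

lemma lattice_dual_to_uminus: "x \<in> lattice_dual_to lam \<Longrightarrow> - x \<in> lattice_dual_to lam"
  by (simp add: lattice_dual_to_def)

lemma lattice_dual_to_diff: "x \<in> lattice_dual_to lam \<Longrightarrow> y \<in> lattice_dual_to lam \<Longrightarrow> x - y \<in> lattice_dual_to lam"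
  by (simp add: lattice_dual_to_def inner_diff_right)

lemma lattice_dual_to_zero [simp]: "0 \<in> lattice_dual_to lam"
  by (simp add: lattice_dual_to_def)

lemma lattice_dual_to_basis: "dual_bases l lam \<Longrightarrow> l b \<in> lattice_dual_to lam"
  by (simp add: lattice_dual_to_def dual_bases_inner)

lemma infsum_lattice_translate:
  assumes "p \<in> lattice_dual_to lam"
  shows "(\<Sum>\<^sub>\<infinity>x\<in>lattice_dual_to lam. f (x + p)) = (\<Sum>\<^sub>\<infinity>x\<in>lattice_dual_to lam. f x)"
  by (rule infsum_reindex_bij_betw[of "\<lambda>x. x + p" "lattice_dual_to lam" "lattice_dual_to lam" f])
     (rule bij_betw_byWitness[where f' = "\<lambda>x. x - p"],
      simp_all add: image_subset_iff lattice_dual_to_add[OF _ assms] lattice_dual_to_diff[OF _ assms])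

lemma character_lattice:
  assumes "dual_bases l lam" "p \<in> lattice_dual_to lam"
  shows "character (lam a) p = 1"
proof -
  obtain k where "lam a \<bullet> p = of_int k"
    using assms(2) by (auto simp: lattice_dual_to_def elim: Ints_cases)
  then show ?thesis
    using exp_two_pi_i_eq_1_iff[of "of_int k"] by (simp add: character_def)
qed

subsection \<open>Summability over a lattice\<close>

text \<open>The bound \<open>5 - 4 / (N + 1)\<close> is chosen to be telescoping: \<open>2 / (1 + n\<^sup>2) \<le> 4 / (n (n + 1))\<close>.\<close>

lemma sum_inverse_1_plus_square: "(\<Sum>k=-int N..int N. 1 / (1 + (real_of_int k)\<^sup>2)) \<le> 5 - 4 / (real N + 1)"
proof (induction N)
  case 0
  then show ?case by simp
next
  case (Suc N)
  have "{-int (Suc N)..int (Suc N)} = insert (int (Suc N)) (insert (-int (Suc N)) {-int N..int N})"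
    by auto
  then have "(\<Sum>k=-int (Suc N)..int (Suc N). 1 / (1 + (real_of_int k)\<^sup>2)) =
      2 / (1 + (real N + 1)\<^sup>2) + (\<Sum>k=-int N..int N. 1 / (1 + (real_of_int k)\<^sup>2))"
    by (simp add: power2_eq_square algebra_simps)
  also have "2 / (1 + (real N + 1)\<^sup>2) \<le> 4 / ((real N + 1) * (real N + 2))"
  proof -
    have "2 * ((real N + 1) * (real N + 2)) \<le> 4 * (1 + (real N + 1)\<^sup>2)"
      by (simp add: power2_eq_square algebra_simps)
    moreover have "0 < 1 + (real N + 1)\<^sup>2" "0 < (real N + 1) * (real N + 2)"
      by (simp_all add: add_pos_nonneg)
    moreover from calculation have "2 \<le> 4 / ((real N + 1) * (real N + 2)) * (1 + (real N + 1)\<^sup>2)"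
      by (simp only: times_divide_eq_left pos_le_divide_eq)
    ultimately show ?thesis
      by (simp only: pos_divide_le_eq)
  qed
  also have "4 / ((real N + 1) * (real N + 2)) = 4 / (real N + 1) - 4 / (real N + 2)"
    by (simp add: divide_simps)
  finally show ?case using Suc by (simp add: add.commute)
qed

lemma finite_subset_int_box:
  fixes F :: "('n::finite \<Rightarrow> int) set"
  assumes "finite F"
  shows "\<exists>N::nat. F \<subseteq> (UNIV \<rightarrow>\<^sub>E {-int N..int N})"
proof -
  define N where "N = (\<Sum>k\<in>F. \<Sum>a\<in>UNIV. nat \<bar>k a\<bar>)"
  have "\<bar>k a\<bar> \<le> int N" if "k \<in> F" for k a
  proof -
    have "nat \<bar>k a\<bar> \<le> (\<Sum>a\<in>UNIV. nat \<bar>k a\<bar>)" by (rule member_le_sum) auto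
    also have "\<dots> \<le> N" unfolding N_def using assms that by (intro member_le_sum) auto
    finally show ?thesis by linarith
  qed
  then have "k \<in> (UNIV \<rightarrow>\<^sub>E {-int N..int N})" if "k \<in> F" for k
  proof -
    have "- int N \<le> k a \<and> k a \<le> int N" for a
      using \<open>\<And>k a. k \<in> F \<Longrightarrow> \<bar>k a\<bar> \<le> int N\<close>[OF that, of a] by linarith
    then show ?thesis by (simp add: PiE_iff)
  qed
  then show ?thesis by blast
qed

lemma summable_prod_inverse_1_plus_square:
  "(\<lambda>k :: 'n::finite \<Rightarrow> int. \<Prod>a\<in>UNIV. 1 / (1 + (real_of_int (k a))\<^sup>2)) summable_on UNIV"
proof (rule nonneg_bdd_above_summable_on)
  let ?w = "\<lambda>k :: 'n \<Rightarrow> int. \<Prod>a\<in>UNIV. 1 / (1 + (real_of_int (k a))\<^sup>2)"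
  show nonneg: "?w k \<ge> 0" for k by (intro prod_nonneg) simp
  have "sum ?w F \<le> 5 ^ CARD('n)" if F: "finite F" for F
  proof -
    obtain N :: nat where N: "F \<subseteq> (UNIV \<rightarrow>\<^sub>E {-int N..int N})"
      using finite_subset_int_box[OF F] by blast
    have "sum ?w F \<le> sum ?w (UNIV \<rightarrow>\<^sub>E {-int N..int N})"
      by (rule sum_mono2[OF _ N]) (auto intro: nonneg finite_PiE)
    also have "\<dots> = (\<Prod>a\<in>(UNIV :: 'n set). \<Sum>k=-int N..int N. 1 / (1 + (real_of_int k)\<^sup>2))"
      by (rule prod_sum_PiE[symmetric]) auto
    also have "\<dots> \<le> (\<Prod>a\<in>(UNIV :: 'n set). 5)"
    proof (rule prod_mono, intro conjI)
      show "0 \<le> (\<Sum>k=-int N..int N. 1 / (1 + (real_of_int k)\<^sup>2))" by (intro sum_nonneg) simp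
      show "(\<Sum>k=-int N..int N. 1 / (1 + (real_of_int k)\<^sup>2)) \<le> 5"
        using sum_inverse_1_plus_square[of N] by (rule order_trans) simp
    qed
    finally show ?thesis by simp
  qed
  then show "bdd_above (sum ?w ` {F. F \<subseteq> UNIV \<and> finite F})"
    by (intro bdd_aboveI[of _ "5 ^ CARD('n)"]) auto
qed

text \<open>The integer \<open>k a\<close> is the inner product of the lattice point with \<open>lam a\<close>, so it is bounded by a multiple of
  the norm of the point.\<close>

lemma lattice_point_bound:
  fixes l lam :: "'n::finite \<Rightarrow> real ^ 'n"
  assumes d: "dual_bases l lam"
  shows "\<exists>C. \<forall>k. decay (2 * CARD('n)) (lattice_point l k) \<le> C * (\<Prod>a\<in>UNIV. 1 / (1 + (real_of_int (k a))\<^sup>2))"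
proof -
  define M where "M = 1 + (\<Sum>a\<in>UNIV. norm (lam a))"
  have M1: "M \<ge> 1" by (simp add: M_def sum_nonneg)
  have M: "norm (lam a) \<le> M" for a
  proof -
    have "norm (lam a) \<le> (\<Sum>a\<in>UNIV. norm (lam a))" by (rule member_le_sum) auto
    then show ?thesis by (simp add: M_def)
  qed
  have "decay (2 * CARD('n)) (lattice_point l k) \<le> M ^ (2 * CARD('n)) * (\<Prod>a\<in>UNIV. 1 / (1 + (real_of_int (k a))\<^sup>2))" for k
  proof -
    let ?p = "lattice_point l k"
    have "1 + (real_of_int (k a))\<^sup>2 \<le> (M * (1 + norm ?p))\<^sup>2" for a
    proof -
      have "\<bar>real_of_int (k a)\<bar> \<le> norm (lam a) * norm ?p"
        using Cauchy_Schwarz_ineq2[of "lam a" ?p] by (simp add: inner_lattice_point[OF d])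
      also have "\<dots> \<le> M * norm ?p" by (intro mult_right_mono M) auto
      finally have "(real_of_int (k a))\<^sup>2 \<le> (M * norm ?p)\<^sup>2"
        by (metis abs_ge_zero power2_abs power_mono)
      moreover have "1 \<le> M\<^sup>2" using M1 by (rule one_le_power)
      ultimately have "1 + (real_of_int (k a))\<^sup>2 \<le> M\<^sup>2 * 1 + M\<^sup>2 * (norm ?p)\<^sup>2"
        by (simp add: power_mult_distrib)
      also have "\<dots> \<le> M\<^sup>2 * (1 + norm ?p)\<^sup>2"
        unfolding distrib_left[symmetric] by (intro mult_left_mono) (auto simp: power2_sum)
      finally show ?thesis by (simp add: power_mult_distrib)
    qed
    then have "(\<Prod>a\<in>UNIV. 1 + (real_of_int (k a))\<^sup>2) \<le> (\<Prod>a\<in>(UNIV :: 'n set). (M * (1 + norm ?p))\<^sup>2)"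
      by (intro prod_mono) auto
    also have "\<dots> = ((M * (1 + norm ?p))\<^sup>2) ^ CARD('n)"
      by (rule prod_constant)
    also have "\<dots> = M ^ (2 * CARD('n)) * (1 + norm ?p) ^ (2 * CARD('n))"
      by (simp only: power_mult[symmetric] power_mult_distrib)
    finally have le: "(\<Prod>a\<in>UNIV. 1 + (real_of_int (k a))\<^sup>2) \<le> M ^ (2 * CARD('n)) * (1 + norm ?p) ^ (2 * CARD('n))" .
    have pos: "(\<Prod>a\<in>UNIV. 1 + (real_of_int (k a))\<^sup>2) > 0"
      by (intro prod_pos) (simp add: add_pos_nonneg)
    have "decay (2 * CARD('n)) ?p \<le> M ^ (2 * CARD('n)) * (1 / (\<Prod>a\<in>UNIV. 1 + (real_of_int (k a))\<^sup>2))"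
    proof -
      have "1 / w \<le> m * (1 / q)" if "q \<le> m * w" "0 < q" "0 < w" for q m w :: real
        using that by (simp add: field_simps)
      from this[OF le pos weight_pos] show ?thesis .
    qed
    then show ?thesis by (simp add: prod_dividef)
  qed
  then show ?thesis by blast
qed

lemma lattice_sum_bound:
  fixes l lam :: "'n::finite \<Rightarrow> real ^ 'n"
  assumes d: "dual_bases l lam"
  shows "\<exists>C. \<forall>\<phi> B. partials_le (decay (2 * CARD('n))) 0 \<phi> B \<longrightarrow>
    (\<lambda>p. cmod (\<phi> p)) summable_on lattice_dual_to lam \<and> (\<Sum>\<^sub>\<infinity>p\<in>lattice_dual_to lam. cmod (\<phi> p)) \<le> C * B"
proof -
  let ?w = "\<lambda>k :: 'n \<Rightarrow> int. \<Prod>a\<in>UNIV. 1 / (1 + (real_of_int (k a))\<^sup>2)"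
  obtain C where C: "\<And>k. decay (2 * CARD('n)) (lattice_point l k) \<le> C * ?w k"
    using lattice_point_bound[OF d] by blast
  have "(\<lambda>p. cmod (\<phi> p)) summable_on lattice_dual_to lam \<and>
      (\<Sum>\<^sub>\<infinity>p\<in>lattice_dual_to lam. cmod (\<phi> p)) \<le> (C * (\<Sum>\<^sub>\<infinity>k. ?w k)) * B"
    if le: "partials_le (decay (2 * CARD('n))) 0 \<phi> B" for \<phi> B
  proof -
    have B0: "B \<ge> 0" using partials_le_nonneg[OF le] by simp
    have w: "cmod (\<phi> (lattice_point l k)) \<le> (B * C) * ?w k" for k
    proof -
      have "cmod (\<phi> (lattice_point l k)) \<le> B * decay (2 * CARD('n)) (lattice_point l k)"
        by (rule partials_leD0[OF le])
      also have "\<dots> \<le> B * (C * ?w k)" by (intro mult_left_mono C B0)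
      finally show ?thesis by (simp only: mult.assoc)
    qed
    have sw: "(\<lambda>k. (B * C) * ?w k) summable_on UNIV"
      by (rule summable_on_cmult_right[OF summable_prod_inverse_1_plus_square])
    have s: "(\<lambda>k. cmod (\<phi> (lattice_point l k))) summable_on UNIV"
      by (rule summable_on_comparison_test[OF sw w]) simp_all
    have "(\<lambda>p. cmod (\<phi> p)) summable_on lattice_dual_to lam"
      using summable_on_reindex_bij_betw[OF bij_betw_lattice_point[OF d], of "\<lambda>p. cmod (\<phi> p)"] s by simp
    moreover have "(\<Sum>\<^sub>\<infinity>p\<in>lattice_dual_to lam. cmod (\<phi> p)) = (\<Sum>\<^sub>\<infinity>k. cmod (\<phi> (lattice_point l k)))"
      using infsum_reindex_bij_betw[OF bij_betw_lattice_point[OF d], of "\<lambda>p. cmod (\<phi> p)"] by simp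
    moreover have "(\<Sum>\<^sub>\<infinity>k. cmod (\<phi> (lattice_point l k))) \<le> (\<Sum>\<^sub>\<infinity>k. (B * C) * ?w k)"
      by (rule infsum_mono[OF s sw w])
    moreover have "(\<Sum>\<^sub>\<infinity>k. (B * C) * ?w k) = (C * (\<Sum>\<^sub>\<infinity>k. ?w k)) * B"
      by (subst infsum_cmult_right') (simp add: mult_ac)
    ultimately show ?thesis by simp
  qed
  then show ?thesis by blast
qed

lemma schwartz_summable_lattice:
  assumes d: "dual_bases l lam" and \<phi>: "schwartz \<phi>"
  shows "\<phi> summable_on lattice_dual_to lam"
proof -
  obtain B where "partials_le (decay (2 * CARD('a))) 0 \<phi> B"
    using schwartzE[OF \<phi>] by blast
  then show ?thesis
    using lattice_sum_bound[OF d] abs_summable_summable by blast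
qed

lemma tempered_delta_lattice:
  fixes l lam :: "'n::finite \<Rightarrow> real ^ 'n"
  assumes d: "dual_bases l lam"
  shows "tempered (delta_sum (lattice_dual_to lam))"
proof -
  obtain C where C: "\<And>\<phi> B. partials_le (decay (2 * CARD('n))) 0 \<phi> B \<Longrightarrow>
    (\<lambda>p. cmod (\<phi> p)) summable_on lattice_dual_to lam \<and> (\<Sum>\<^sub>\<infinity>p\<in>lattice_dual_to lam. cmod (\<phi> p)) \<le> C * B"
    using lattice_sum_bound[OF d] by blast
  have "cmod (delta_sum (lattice_dual_to lam) \<phi>) \<le> C * B"
    if "partials_le (decay (2 * CARD('n))) 0 \<phi> B" for \<phi> B
    unfolding delta_sum_def using C[OF that] norm_infsum_bound order_trans by blast
  moreover have "linear_functional (delta_sum (lattice_dual_to lam))"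
    unfolding linear_functional_def delta_sum_def
  proof (intro allI impI)
    fix \<phi> \<psi> :: "real ^ 'n \<Rightarrow> complex" and a b
    assume "schwartz \<phi>" "schwartz \<psi>"
    then have "\<phi> summable_on lattice_dual_to lam" "\<psi> summable_on lattice_dual_to lam"
      using schwartz_summable_lattice[OF d] by blast+
    then show "(\<Sum>\<^sub>\<infinity>p\<in>lattice_dual_to lam. a * \<phi> p + b * \<psi> p) =
        a * (\<Sum>\<^sub>\<infinity>p\<in>lattice_dual_to lam. \<phi> p) + b * (\<Sum>\<^sub>\<infinity>p\<in>lattice_dual_to lam. \<psi> p)"
      by (simp add: infsum_add summable_on_cmult_right infsum_cmult_right')
  qed
  ultimately show ?thesis unfolding tempered_def by blast
qed

subsection \<open>Distributions invariant under a lattice and its dual\<close>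

text \<open>Multiply the partitions of unity \<open>sum_plateau\<close> in the coordinates \<open>lam a \<bullet> x\<close>.\<close>

lemma cutoff_translates_sum:
  assumes d: "dual_bases l lam"
  shows "cutoff lam (real N) x = (\<Sum>k\<in>UNIV \<rightarrow>\<^sub>E {-int N..int N}. cutoff lam 0 (x + - lattice_point l k))"
proof -
  have "cutoff lam (real N) x = (\<Prod>a\<in>UNIV. \<Sum>k=-int N..int N. plateau 0 (lam a \<bullet> x - of_int k))"
    unfolding cutoff_def sum_plateau ..
  also have "\<dots> = (\<Sum>k\<in>UNIV \<rightarrow>\<^sub>E {-int N..int N}. \<Prod>a\<in>UNIV. plateau 0 (lam a \<bullet> x - of_int (k a)))"
    by (rule prod_sum_PiE) auto
  finally show ?thesis
    by (simp add: cutoff_def inner_diff_right inner_lattice_point[OF d])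
qed

lemma schwartz_lattice_cutoff:
  fixes l lam :: "'n::finite \<Rightarrow> real ^ 'n"
  assumes d: "dual_bases l lam"
  shows "schwartz (cutoff lam (real N))"
proof (rule schwartz_compact_support[OF smooth_cutoff, where R = "(real N + 1) * (\<Sum>a\<in>UNIV. norm (l a)) + 1"])
  fix x :: "real ^ 'n" assume x: "norm x \<ge> (real N + 1) * (\<Sum>a\<in>UNIV. norm (l a)) + 1"
  show "cutoff lam (real N) x = 0"
  proof (rule ccontr)
    assume nz: "cutoff lam (real N) x \<noteq> 0"
    have lt: "\<bar>lam a \<bullet> x\<bar> \<le> real N + 1" for a
    proof (rule ccontr)
      assume "\<not> \<bar>lam a \<bullet> x\<bar> \<le> real N + 1"
      then have "cutoff lam (real N) x = 0" by (intro cutoff_0[of _ _ a]) auto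
      with nz show False by simp
    qed
    have "norm x \<le> (\<Sum>a\<in>UNIV. norm ((lam a \<bullet> x) *\<^sub>R l a))"
      by (subst dual_bases_expansion[OF d, of x]) (rule norm_sum)
    also have "\<dots> \<le> (\<Sum>a\<in>UNIV. (real N + 1) * norm (l a))"
      using lt by (intro sum_mono) (simp add: mult_right_mono)
    finally show False using x by (simp add: sum_distrib_left)
  qed
qed

text \<open>The vectors that leave \<open>t\<close> invariant form a group.\<close>

lemma translation_invariant_lattice:
  fixes t :: "'n::finite functional"
  assumes inv: "\<And>b \<phi>. schwartz \<phi> \<Longrightarrow> t (\<lambda>x. \<phi> (x + - l b)) = t \<phi>" and \<phi>: "schwartz \<phi>"
  shows "t (\<lambda>x. \<phi> (x + lattice_point l k)) = t \<phi>"
proof -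
  define G where "G = {p. \<forall>\<phi>. schwartz \<phi> \<longrightarrow> t (\<lambda>x. \<phi> (x + p)) = t \<phi>}"
  have add: "p + q \<in> G" if p: "p \<in> G" and q: "q \<in> G" for p q
    unfolding G_def
  proof (intro CollectI allI impI)
    fix \<phi> :: "real ^ 'n \<Rightarrow> complex" assume \<phi>: "schwartz \<phi>"
    have "t (\<lambda>x. (\<lambda>x. \<phi> (x + q)) (x + p)) = t (\<lambda>x. \<phi> (x + q))"
      using p schwartz_translation[OF \<phi>, of q] unfolding G_def by blast
    also have "\<dots> = t \<phi>" using q \<phi> unfolding G_def by blast
    finally show "t (\<lambda>x. \<phi> (x + (p + q))) = t \<phi>" by (simp add: add.assoc)
  qed
  have uminus: "- p \<in> G" if p: "p \<in> G" for p
    unfolding G_def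
  proof (intro CollectI allI impI)
    fix \<phi> :: "real ^ 'n \<Rightarrow> complex" assume \<phi>: "schwartz \<phi>"
    have "t (\<lambda>x. (\<lambda>x. \<phi> (x + - p)) (x + p)) = t (\<lambda>x. \<phi> (x + - p))"
      using p schwartz_translation[OF \<phi>, of "- p"] unfolding G_def by blast
    then show "t (\<lambda>x. \<phi> (x + - p)) = t \<phi>" by simp
  qed
  have zero: "0 \<in> G" by (simp add: G_def)
  have l: "l b \<in> G" for b
  proof -
    have "- l b \<in> G" unfolding G_def using inv by blast
    from uminus[OF this] show ?thesis by simp
  qed
  have nat: "of_nat m *\<^sub>R p \<in> G" if "p \<in> G" for m p
    by (induction m) (use zero that in \<open>simp_all add: scaleR_add_left add\<close>)
  have int: "of_int m *\<^sub>R p \<in> G" if "p \<in> G" for m p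
    by (cases m rule: int_cases2) (use nat[OF that] uminus in simp_all)
  have "(\<Sum>a\<in>A. of_int (k a) *\<^sub>R l a) \<in> G" for A
    by (induction A rule: infinite_finite_induct) (simp_all add: zero add int l)
  then have "lattice_point l k \<in> G" unfolding lattice_point_def .
  then have "\<forall>\<phi>. schwartz \<phi> \<longrightarrow> t (\<lambda>x. \<phi> (x + lattice_point l k)) = t \<phi>"
    unfolding G_def by (rule CollectD)
  then have "schwartz \<phi> \<longrightarrow> t (\<lambda>x. \<phi> (x + lattice_point l k)) = t \<phi>"
    by (rule spec)
  then show ?thesis using \<phi> by (rule mp)
qed

text \<open>The partition of unity by the translates of \<open>cutoff lam 0\<close> reduces the claim to a neighbourhood of the
  origin. There multiplication by the coordinate \<open>lam a \<bullet> x\<close> factors through multiplication by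
  \<open>character (lam a) x - 1\<close>, which annihilates \<open>t\<close>.\<close>

lemma lattice_invariant:
  fixes t :: "'n::finite functional"
  assumes d: "dual_bases l lam" and t: "tempered t"
    and mult: "\<And>a \<phi>. schwartz \<phi> \<Longrightarrow> t (\<lambda>x. character (lam a) x * \<phi> x) = t \<phi>"
    and trans: "\<And>b \<phi>. schwartz \<phi> \<Longrightarrow> t (\<lambda>x. \<phi> (x + - l b)) = t \<phi>"
    and \<phi>: "schwartz \<phi>"
  shows "t \<phi> = t (cutoff lam 0) * delta_sum (lattice_dual_to lam) \<phi>"
proof -
  note lin = tempered_linear[OF t]
  (* the part of t near the origin, which turns out to be a multiple of the delta distribution *)
  define s where "s \<phi> = t (\<lambda>x. cutoff lam 0 x * \<phi> x)" for \<phi>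
  have s: "tempered s"
    unfolding s_def[abs_def] by (rule tempered_operator[OF t schwartz_operator_multiplier[OF multiplier_cutoff]])
  have "\<bar>s\<bar> > 3/4 \<Longrightarrow> plateau 0 s = 0" for s
    by (rule plateau_0) auto
  from smooth1_division[OF smooth1_plateau, of "3/4" 0, OF _ this]
  obtain \<kappa> where \<kappa>: "smooth1 \<kappa>" "\<And>s. \<bar>s\<bar> > 3/4 \<Longrightarrow> \<kappa> s = 0"
    "\<And>s. of_real s * plateau 0 s = (exp (two_pi_i * of_real s) - 1) * \<kappa> s"
    by auto
  have coord: "s (\<lambda>x. of_real (lam a \<bullet> x) * \<phi> x) = 0" if \<phi>: "schwartz \<phi>" for a \<phi>
  proof -
    let ?\<psi> = "\<lambda>x. (\<Prod>b\<in>UNIV. (if b = a then \<kappa> else plateau 0) (lam b \<bullet> x)) * \<phi> x"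
    have "uniformly_smooth (\<lambda>_ :: unit. \<lambda>x. (\<Prod>b\<in>UNIV. (if b = a then \<kappa> else plateau 0) (lam b \<bullet> x)))"
    proof (rule uniformly_smooth_prod, rule uniformly_smooth_compose_inner)
      fix b
      let ?f = "if b = a then \<kappa> else plateau 0"
      show sm: "smooth1 ?f" using \<kappa>(1) smooth1_plateau by simp
      show "\<exists>E. \<forall>(p :: unit) s. cmod ((deriv1 ^^ l) ?f s) \<le> E" for l
        using smooth1_bounded_derivatives[OF sm, of "-1" 0 1 0 l] \<kappa>(2) plateau_0[of 0] by auto
    qed
    from schwartz_multiplier[OF uniformly_smooth_multiplier[OF this] \<phi>]
    have \<psi>: "schwartz ?\<psi>" by simp
    have "cutoff lam 0 x * (of_real (lam a \<bullet> x) * \<phi> x) = character (lam a) x * ?\<psi> x - ?\<psi> x" for x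
    proof -
      let ?R = "\<Prod>b\<in>UNIV - {a}. plateau 0 (lam b \<bullet> x)"
      have 1: "cutoff lam 0 x = plateau 0 (lam a \<bullet> x) * ?R"
        unfolding cutoff_def by (rule prod.remove) auto
      have 2: "(\<Prod>b\<in>UNIV. (if b = a then \<kappa> else plateau 0) (lam b \<bullet> x)) = \<kappa> (lam a \<bullet> x) * ?R"
        by (subst prod.remove[of _ a]) (auto intro!: prod.cong)
      have "cutoff lam 0 x * (of_real (lam a \<bullet> x) * \<phi> x) = (of_real (lam a \<bullet> x) * plateau 0 (lam a \<bullet> x)) * (?R * \<phi> x)"
        unfolding 1 by (simp only: mult_ac)
      also have "\<dots> = character (lam a) x * ?\<psi> x - ?\<psi> x"
        unfolding 2 \<kappa>(3) character_def by (simp add: algebra_simps)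
      finally show ?thesis .
    qed
    then have "s (\<lambda>x. of_real (lam a \<bullet> x) * \<phi> x) = t (\<lambda>x. character (lam a) x * ?\<psi> x - ?\<psi> x)"
      by (simp add: s_def)
    also have "\<dots> = t (\<lambda>x. character (lam a) x * ?\<psi> x) - t ?\<psi>"
      by (rule linear_functional_diff[OF lin schwartz_multiplier[OF multiplier_character \<psi>] \<psi>])
    finally show ?thesis using mult[OF \<psi>] by simp
  qed
  have "s (\<lambda>x. of_real (x $ i) * \<phi> x) = 0" if \<phi>: "schwartz \<phi>" for i \<phi>
  proof -
    have sch: "schwartz (\<lambda>x. of_real (lam a \<bullet> x) * \<phi> x)" for a
    proof -
      have "(\<lambda>x. of_real (lam a \<bullet> x) * \<phi> x) = (\<lambda>x. \<Sum>i\<in>UNIV. of_real (lam a $ i) * (of_real (x $ i) * \<phi> x))"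
        by (simp add: inner_vec_def sum_distrib_right mult.assoc)
      then show ?thesis
        by (simp only:) (intro schwartz_sum schwartz_cmult schwartz_coord_mult \<phi>)
    qed
    have "of_real (x $ i) * \<phi> x = (\<Sum>a\<in>UNIV. of_real (l a $ i) * (of_real (lam a \<bullet> x) * \<phi> x))" for x
    proof -
      have "x $ i = (\<Sum>a\<in>UNIV. (lam a \<bullet> x) * l a $ i)"
        by (subst dual_bases_expansion[OF d, of x]) simp
      then have "of_real (x $ i) * \<phi> x = (\<Sum>a\<in>UNIV. of_real ((lam a \<bullet> x) * l a $ i)) * \<phi> x"
        by (simp only: of_real_sum)
      then show ?thesis
        unfolding sum_distrib_right by (simp add: mult_ac)
    qed
    then have "s (\<lambda>x. of_real (x $ i) * \<phi> x) = s (\<lambda>x. \<Sum>a\<in>UNIV. of_real (l a $ i) * (of_real (lam a \<bullet> x) * \<phi> x))"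
      by simp
    also have "\<dots> = (\<Sum>a\<in>UNIV. s (\<lambda>x. of_real (l a $ i) * (of_real (lam a \<bullet> x) * \<phi> x)))"
      by (rule linear_functional_sum[OF tempered_linear[OF s] schwartz_cmult[OF sch]])
    also have "\<dots> = 0"
      by (simp add: linear_functional_cmult[OF tempered_linear[OF s] sch] coord[OF \<phi>])
    finally show ?thesis .
  qed
  from point_supported[OF s this] obtain c where c: "\<And>\<phi>. schwartz \<phi> \<Longrightarrow> s \<phi> = c * \<phi> 0"
    by blast
  (* test with a function that is 1 where cutoff lam 0 does not vanish *)
  have "c = t (cutoff lam 0)"
  proof -
    have "cutoff lam 0 x * cutoff lam 1 x = cutoff lam 0 x" for x
    proof (cases "\<forall>a. \<bar>lam a \<bullet> x\<bar> \<le> 1")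
      case True
      then have "cutoff lam 1 x = 1" by (intro cutoff_1) auto
      then show ?thesis by simp
    next
      case False
      then obtain a where "\<bar>lam a \<bullet> x\<bar> > 1" by (auto simp: not_le)
      then have "cutoff lam 0 x = 0" by (intro cutoff_0[of _ _ a]) auto
      then show ?thesis by simp
    qed
    then have "(\<lambda>x. cutoff lam 0 x * cutoff lam 1 x) = cutoff lam 0" by blast
    then have "s (cutoff lam 1) = t (cutoff lam 0)" by (simp only: s_def)
    moreover have "s (cutoff lam 1) = c * cutoff lam 1 0"
      using c[of "cutoff lam 1"] schwartz_lattice_cutoff[OF d, of 1] by simp
    moreover have "cutoff lam 1 (0 :: real ^ 'n) = 1" by (rule cutoff_1) simp
    ultimately show ?thesis by simp
  qed
  have piece_schwartz: "schwartz (\<lambda>x. cutoff lam 0 (x + - lattice_point l k) * \<phi> x)" for k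
  proof -
    have "schwartz (\<lambda>x. \<phi> (x + lattice_point l k))" by (rule schwartz_translation[OF \<phi>])
    from schwartz_translation[OF schwartz_multiplier[OF multiplier_cutoff this], where a = "- lattice_point l k"]
    show ?thesis by simp
  qed
  have piece: "t (\<lambda>x. cutoff lam 0 (x + - lattice_point l k) * \<phi> x) = c * \<phi> (lattice_point l k)" for k
  proof -
    let ?p = "lattice_point l k"
    from translation_invariant_lattice[of t l, OF trans piece_schwartz[of k], of k]
    have "t (\<lambda>x. cutoff lam 0 (x + - ?p) * \<phi> x) = t (\<lambda>x. cutoff lam 0 (x + ?p + - ?p) * \<phi> (x + ?p))"
      by simp
    also have "\<dots> = s (\<lambda>x. \<phi> (x + ?p))" by (simp add: s_def)
    also have "\<dots> = c * \<phi> ?p" using c[OF schwartz_translation[OF \<phi>, of ?p]] by simp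
    finally show ?thesis .
  qed
  have box: "t (\<lambda>x. cutoff lam (real N) x * \<phi> x) = c * (\<Sum>k\<in>UNIV \<rightarrow>\<^sub>E {-int N..int N}. \<phi> (lattice_point l k))" for N
  proof -
    have "t (\<lambda>x. cutoff lam (real N) x * \<phi> x) =
        t (\<lambda>x. \<Sum>k\<in>UNIV \<rightarrow>\<^sub>E {-int N..int N}. cutoff lam 0 (x + - lattice_point l k) * \<phi> x)"
      unfolding cutoff_translates_sum[OF d] sum_distrib_right ..
    also have "\<dots> = (\<Sum>k\<in>UNIV \<rightarrow>\<^sub>E {-int N..int N}. c * \<phi> (lattice_point l k))"
      by (subst linear_functional_sum[OF lin piece_schwartz]) (simp only: piece)
    finally show ?thesis by (simp only: sum_distrib_left)
  qed
  (* the boxes of coefficients exhaust the lattice, so that both sides of box converge *)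
  have "((\<lambda>k. \<phi> (lattice_point l k)) has_sum delta_sum (lattice_dual_to lam) \<phi>) UNIV"
    using has_sum_reindex_bij_betw[OF bij_betw_lattice_point[OF d], of \<phi> "delta_sum (lattice_dual_to lam) \<phi>"]
      has_sum_infsum[OF schwartz_summable_lattice[OF d \<phi>]] by (simp add: delta_sum_def)
  then have lim: "(sum (\<lambda>k. \<phi> (lattice_point l k)) \<longlongrightarrow> delta_sum (lattice_dual_to lam) \<phi>) (finite_subsets_at_top UNIV)"
    by (simp add: has_sum_def)
  have "filterlim (\<lambda>N. UNIV \<rightarrow>\<^sub>E {-int N..int N}) (finite_subsets_at_top (UNIV :: ('n \<Rightarrow> int) set)) sequentially"
    unfolding filterlim_finite_subsets_at_top
  proof (intro allI impI)
    fix F :: "('n \<Rightarrow> int) set" assume "finite F \<and> F \<subseteq> UNIV"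
    then obtain N0 :: nat where N0: "F \<subseteq> (UNIV \<rightarrow>\<^sub>E {-int N0..int N0})"
      using finite_subset_int_box[of F] by blast
    have "finite (UNIV \<rightarrow>\<^sub>E {-int N..int N} :: ('n \<Rightarrow> int) set)" for N
      by (intro finite_PiE) auto
    moreover have "F \<subseteq> (UNIV \<rightarrow>\<^sub>E {-int N..int N})" if "N \<ge> N0" for N
      by (rule order_trans[OF N0 PiE_mono]) (use that in auto)
    ultimately show "\<forall>\<^sub>F N in sequentially. finite (UNIV \<rightarrow>\<^sub>E {-int N..int N} :: ('n \<Rightarrow> int) set) \<and>
        F \<subseteq> (UNIV \<rightarrow>\<^sub>E {-int N..int N}) \<and> (UNIV \<rightarrow>\<^sub>E {-int N..int N} :: ('n \<Rightarrow> int) set) \<subseteq> UNIV"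
      by (intro eventually_sequentiallyI[of N0]) auto
  qed
  from filterlim_compose[OF lim this]
  have "(\<lambda>N. \<Sum>k\<in>UNIV \<rightarrow>\<^sub>E {-int N..int N}. \<phi> (lattice_point l k)) \<longlonglongrightarrow> delta_sum (lattice_dual_to lam) \<phi>" .
  then have "(\<lambda>N. t (\<lambda>x. cutoff lam (real N) x * \<phi> x)) \<longlonglongrightarrow> c * delta_sum (lattice_dual_to lam) \<phi>"
    unfolding box by (rule tendsto_mult_left)
  moreover have "uniformly_smooth (\<lambda>N :: nat. cutoff lam (real N))"
    using uniformly_smooth_cutoff unfolding uniformly_smooth_def by blast
  from tempered_cutoff_limit[OF t this cutoff_eventually_1 \<phi>]
  have "(\<lambda>N. t (\<lambda>x. cutoff lam (real N) x * \<phi> x)) \<longlonglongrightarrow> t \<phi>" .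
  ultimately have "t \<phi> = c * delta_sum (lattice_dual_to lam) \<phi>"
    by (rule LIMSEQ_unique[rotated])
  then show ?thesis unfolding \<open>c = t (cutoff lam 0)\<close> .
qed

section \<open>Poisson summation\<close>

lemma integral_unit_interval_character:
  "(LINT s|lborel. indicator {0..1} s *\<^sub>R exp (- two_pi_i * of_real (of_int k * s))) = (if k = 0 then 1 else 0)"
proof (cases "k = 0")
  case True
  have "(LINT s|lborel. indicator {0..1::real} s *\<^sub>R (1 :: complex)) = measure lborel {0..1::real} *\<^sub>R 1"
    by (subst integral_scaleR_left) auto
  then show ?thesis using True by simp
next
  case False
  let ?c = "- two_pi_i * of_int k"
  have nz: "?c \<noteq> 0" using False by simp
  have "((\<lambda>s. exp (?c * of_real s) / ?c) has_vector_derivative exp (?c * of_real s)) (at s within {0..1})" for s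
  proof -
    have "((\<lambda>z. exp (?c * z) / ?c) has_field_derivative exp (?c * of_real s)) (at (of_real s))"
      using nz by (auto intro!: derivative_eq_intros)
    from has_vector_derivative_real_field[OF this] show ?thesis .
  qed
  then have "(LINT s|lborel. indicator {0..1} s *\<^sub>R exp (?c * of_real s)) =
      exp (?c * of_real 1) / ?c - exp (?c * of_real 0) / ?c"
    by (intro integral_FTC_Icc) (auto intro!: continuous_intros)
  moreover have "exp (?c * of_real 1) = 1"
    using exp_two_pi_i_eq_1_iff[of "- of_int k"] by simp
  ultimately show ?thesis using False by (simp add: mult.assoc)
qed

text \<open>The integer translates of the plateau add up to \<open>1\<close>. So the integral against a function of period \<open>1\<close> is
  the integral over one period, as is seen by moving the left flank to the right by \<open>1\<close>.\<close>

lemma integral_plateau_character: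
  shows "integrable lborel (\<lambda>s. plateau 0 s * exp (- two_pi_i * of_real (of_int k * s)))"
    and "(LINT s|lborel. plateau 0 s * exp (- two_pi_i * of_real (of_int k * s))) = (if k = 0 then 1 else 0)"
proof -
  define e where "e s = exp (- two_pi_i * of_real (of_int k * s))" for s :: real
  have e1: "e (s - 1) = e s" for s
  proof -
    have "e (s - 1) = e s * exp (two_pi_i * of_int k)"
      by (simp add: e_def exp_add[symmetric] algebra_simps)
    then show ?thesis using exp_two_pi_i_eq_1_iff[of "of_int k"] by simp
  qed
  have cont_e: "continuous_on S e" for S
    unfolding e_def[abs_def] by (intro continuous_intros)
  have cont_st: "continuous_on S smooth_step" "continuous_on S (\<lambda>s. smooth_step (s + 1))" for S
    by (rule smooth1_continuous, rule smooth1_step, rule smooth1_continuous, rule smooth1_step_shift)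
  define A where "A s = indicator {-1..0} s *\<^sub>R (smooth_step (s + 1) * e s)" for s :: real
  define C where "C s = indicator {0..1} s *\<^sub>R ((1 - smooth_step s) * e s)" for s :: real
  have iA: "integrable lborel A"
    unfolding A_def[abs_def] using borel_integrable_compact[of "{-1..0::real}" "\<lambda>s. smooth_step (s + 1) * e s"]
    by (simp add: continuous_on_mult cont_st cont_e)
  have iC: "integrable lborel C"
    unfolding C_def[abs_def] using borel_integrable_compact[of "{0..1::real}" "\<lambda>s. (1 - smooth_step s) * e s"]
    by (simp add: continuous_on_mult continuous_on_diff cont_st cont_e)
  have split: "plateau 0 s * e s = A s + C s" if "s \<noteq> 0" for s
  proof -
    consider "s < -1" | "-1 \<le> s" "s < 0" | "0 < s" "s \<le> 1" | "s > 1" using \<open>s \<noteq> 0\<close> by linarith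
    then show ?thesis
      by cases (simp_all add: A_def C_def plateau_def smooth_step_0 smooth_step_1)
  qed
  have meas: "(\<lambda>s. plateau 0 s * e s) \<in> borel_measurable lborel"
    using borel_measurable_continuous_onI[OF continuous_on_mult[OF smooth1_continuous[OF smooth1_plateau] cont_e]] by simp
  have ae: "AE s in lborel. A s + C s = plateau 0 s * e s"
    using AE_lborel_singleton[of 0] by (rule AE_mp) (auto intro!: AE_I2 simp: split)
  have iS: "integrable lborel (\<lambda>s. A s + C s)" using iA iC by simp
  show i: "integrable lborel (\<lambda>s. plateau 0 s * exp (- two_pi_i * of_real (of_int k * s)))"
    unfolding e_def[symmetric]
    by (rule integrable_cong_AE_imp[OF iS meas]) (rule AE_mp[OF ae], rule AE_I2, simp)
  have "(LINT s|lborel. plateau 0 s * e s) = (LINT s|lborel. A s + C s)"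
    by (rule integral_cong_AE[OF meas borel_measurable_integrable[OF iS]]) (rule AE_mp[OF ae], rule AE_I2, simp)
  also have "\<dots> = (LINT s|lborel. A s) + (LINT s|lborel. C s)" using iA iC by simp
  also have "(LINT s|lborel. A s) = (LINT s|lborel. A (-1 + 1 * s))"
    by (subst lborel_integral_real_affine[of 1 A "-1"]) auto
  also have "\<dots> = (LINT s|lborel. indicator {0..1} s *\<^sub>R (smooth_step s * e s))"
    by (rule Bochner_Integration.integral_cong) (auto simp: A_def indicator_def e1 add.commute[of "-1"])
  also have "(LINT s|lborel. indicator {0..1} s *\<^sub>R (smooth_step s * e s)) + (LINT s|lborel. C s) =
      (LINT s|lborel. indicator {0..1} s *\<^sub>R (smooth_step s * e s) + C s)"
  proof (rule Bochner_Integration.integral_add[symmetric, OF _ iC])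
    show "integrable lborel (\<lambda>s. indicator {0..1} s *\<^sub>R (smooth_step s * e s))"
      using borel_integrable_compact[of "{0..1::real}" "\<lambda>s. smooth_step s * e s"]
      by (simp add: continuous_on_mult cont_st cont_e)
  qed
  also have "\<dots> = (LINT s|lborel. indicator {0..1} s *\<^sub>R e s)"
    by (rule Bochner_Integration.integral_cong) (auto simp: C_def indicator_def algebra_simps)
  also have "\<dots> = (if k = 0 then 1 else 0)"
    unfolding e_def by (rule integral_unit_interval_character)
  finally show "(LINT s|lborel. plateau 0 s * exp (- two_pi_i * of_real (of_int k * s))) = (if k = 0 then 1 else 0)"
    unfolding e_def .
qed

definition row_matrix :: "('n \<Rightarrow> real ^ 'n) \<Rightarrow> real ^ 'n ^ 'n" where
  "row_matrix l = (\<chi> a. l a)"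

lemma row_matrix_mult: "(row_matrix l *v x) $ a = l a \<bullet> x"
  by (simp add: row_matrix_def matrix_vector_mult_def inner_vec_def)

lemma invertible_row_matrix:
  assumes "dual_bases l lam"
  shows "invertible (row_matrix l)"
proof -
  have "row_matrix l ** transpose (row_matrix lam) = mat 1"
    using assms
    by (auto simp: vec_eq_iff matrix_matrix_mult_def mat_def row_matrix_def transpose_def dual_bases_def
        inner_vec_def mult.commute)
  then show ?thesis by (metis invertible_right_inverse)
qed

text \<open>In the coordinates \<open>l a \<bullet> \<xi>\<close> the integrand is a product of functions of one coordinate.\<close>

lemma fourier_cutoff_lattice_point:
  fixes l lam :: "'n::finite \<Rightarrow> real ^ 'n"
  assumes d: "dual_bases l lam"
  shows "fourier_fun (cutoff l 0) (lattice_point l k) =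
    of_real (1 / \<bar>det (row_matrix l)\<bar>) * (if k = (\<lambda>_. 0) then 1 else 0)"
proof -
  let ?A = "row_matrix l"
  define f where "f a s = plateau 0 s * exp (- two_pi_i * of_real (of_int (k a) * s))" for a s
  define F where "F y = (\<Prod>a\<in>UNIV. f a (y $ a))" for y :: "real ^ 'n"
  have int: "integrable lborel (f a)" "(LINT s|lborel. f a s) = (if k a = 0 then 1 else 0)" for a
    unfolding f_def[abs_def] by (rule integral_plateau_character)+
  have inv: "invertible ?A" by (rule invertible_row_matrix[OF d])
  have iF: "integrable lborel F" "(LINT y|lborel. F y) = (\<Prod>a\<in>UNIV. if k a = 0 then 1 else 0)"
    unfolding F_def[abs_def] using integrable_prod_coordinates[of f] int by auto
  have "exp (- two_pi_i * of_real (\<xi> \<bullet> lattice_point l k)) * cutoff l 0 \<xi> = F (?A *v \<xi>)" for \<xi>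
  proof -
    have "- two_pi_i * of_real (\<xi> \<bullet> lattice_point l k) = (\<Sum>a\<in>UNIV. - two_pi_i * of_real (of_int (k a) * (l a \<bullet> \<xi>)))"
      by (simp add: lattice_point_def inner_sum_right sum_distrib_left inner_commute sum_negf)
    then show ?thesis
      by (simp add: F_def f_def row_matrix_mult cutoff_def exp_sum prod.distrib mult.commute)
  qed
  then have "fourier_fun (cutoff l 0) (lattice_point l k) = (LINT \<xi>|lborel. F (?A *v \<xi>))"
    by (simp add: fourier_fun_def)
  moreover have "(LINT y|lborel. F y) = of_real \<bar>det ?A\<bar> * (LINT \<xi>|lborel. F (?A *v \<xi>))"
    using borel_measurable_integrable[OF iF(1)] by (intro integral_linear[OF inv]) simp
  moreover have "(\<Prod>a\<in>UNIV. if k a = 0 then 1 else 0 :: complex) = (if k = (\<lambda>_. 0) then 1 else 0)"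
  proof (cases "k = (\<lambda>_. 0)")
    case False
    then obtain a where "k a \<noteq> 0" by blast
    then have "(\<Prod>a\<in>UNIV. if k a = 0 then 1 else 0 :: complex) = 0"
      by (intro prod_zero) auto
    with False show ?thesis by simp
  qed simp
  moreover have "det ?A \<noteq> 0" using inv by (simp add: invertible_det_nz)
  ultimately show ?thesis using iF(2) by (simp add: field_simps)
qed

text \<open>The Fourier transform of the delta sum is invariant under translations by the dual lattice and under
  the characters of the lattice, hence a multiple of the dual delta sum. The factor is found by testing with
  the partition function of the dual lattice.\<close>

lemma poisson_summation:
  fixes l lam :: "'n::finite \<Rightarrow> real ^ 'n"
  assumes d: "dual_bases l lam" and \<psi>: "schwartz \<psi>"
  shows "delta_sum (lattice_dual_to lam) (fourier_fun \<psi>) =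
    of_real (1 / \<bar>det (row_matrix l)\<bar>) * delta_sum (lattice_dual_to l) \<psi>"
proof -
  let ?L = "lattice_dual_to lam"
  define u where "u = fourier (delta_sum ?L)"
  have u: "u \<psi> = (\<Sum>\<^sub>\<infinity>p\<in>?L. fourier_fun \<psi> p)" for \<psi>
    by (simp add: u_def fourier_def delta_sum_def)
  note d' = dual_bases_sym[OF d]
  have "u \<psi> = u (cutoff l 0) * delta_sum (lattice_dual_to l) \<psi>"
  proof (rule lattice_invariant[OF d' _ _ _ \<psi>])
    show "tempered u" unfolding u_def by (rule tempered_fourier[OF tempered_delta_lattice[OF d]])
    show "u (\<lambda>x. character (l a) x * \<psi> x) = u \<psi>" if "schwartz \<psi>" for a \<psi>
      unfolding u fourier_fun_character_mult
      by (rule infsum_lattice_translate) (intro lattice_dual_to_uminus lattice_dual_to_basis[OF d])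
    show "u (\<lambda>x. \<psi> (x + - lam b)) = u \<psi>" if "schwartz \<psi>" for b \<psi>
      unfolding u fourier_fun_translation[OF that]
      by (rule infsum_cong) (simp add: character_minus character_lattice[OF d])
  qed
  moreover have "u (cutoff l 0) = of_real (1 / \<bar>det (row_matrix l)\<bar>)"
  proof -
    have "u (cutoff l 0) = (\<Sum>\<^sub>\<infinity>k. fourier_fun (cutoff l 0) (lattice_point l k))"
      unfolding u using infsum_reindex_bij_betw[OF bij_betw_lattice_point[OF d], of "fourier_fun (cutoff l 0)"] by simp
    also have "\<dots> = (\<Sum>\<^sub>\<infinity>k\<in>{\<lambda>_. 0}. fourier_fun (cutoff l 0) (lattice_point l k))"
      by (rule infsum_cong_neutral) (auto simp: fourier_cutoff_lattice_point[OF d])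
    also have "\<dots> = of_real (1 / \<bar>det (row_matrix l)\<bar>)"
      by (simp add: fourier_cutoff_lattice_point[OF d])
    finally show ?thesis .
  qed
  ultimately show ?thesis by (simp add: u_def fourier_def)
qed

section \<open>Fourier inversion\<close>

lemma tempered_integral: "tempered (\<lambda>\<phi> :: real ^ 'n::finite \<Rightarrow> complex. LINT x|lborel. \<phi> x)"
  unfolding tempered_def
proof (intro conjI exI allI impI)
  show "linear_functional (\<lambda>\<phi> :: real ^ 'n::finite \<Rightarrow> complex. LINT x|lborel. \<phi> x)"
    unfolding linear_functional_def by (simp add: schwartz_integrable)
  fix \<phi> :: "real ^ 'n::finite \<Rightarrow> complex" and B
  assume \<phi>: "schwartz \<phi>" and B: "partials_le (decay (2 * CARD('n))) 0 \<phi> B"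
  have "fourier_fun \<phi> 0 = (LINT x|lborel. \<phi> x)"
    by (simp add: fourier_fun_def)
  then show "cmod (LINT x|lborel. \<phi> x) \<le> (LINT \<xi>|lborel. decay (2 * CARD('n)) (\<xi> :: real ^ 'n)) * B"
    using fourier_fun_bound[OF \<phi> B, of 0] by simp
qed

lemma dual_bases_axis: "dual_bases (\<lambda>a. axis a 1) (\<lambda>a. axis a 1 :: real ^ 'n::finite)"
  by (simp add: dual_bases_def inner_axis_axis)

text \<open>The functional \<open>\<phi> \<mapsto> \<integral> \<phi>\<^sup>\<and>\<close> is annihilated by the coordinates, so it is a multiple of \<open>\<delta>\<^sub>0\<close>.
  Poisson summation shows that the multiple is not zero.\<close>

lemma fourier_fun_fourier_fun:
  "\<exists>c. c \<noteq> 0 \<and> (\<forall>\<phi> :: real ^ 'n::finite \<Rightarrow> complex. schwartz \<phi> \<longrightarrow>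
    fourier_fun (fourier_fun \<phi>) = (\<lambda>y. c * \<phi> (- y)))"
proof -
  define s where "s \<phi> = (LINT x|lborel. fourier_fun \<phi> x)" for \<phi> :: "real ^ 'n \<Rightarrow> complex"
  have s: "tempered s"
    unfolding s_def[abs_def] by (rule tempered_operator[OF tempered_integral schwartz_operator_fourier_fun])
  have "s (\<lambda>x. of_real (x $ i) * \<phi> x) = 0" if \<phi>: "schwartz \<phi>" for i \<phi>
  proof -
    let ?\<phi> = "\<lambda>x. of_real (x $ i) * \<phi> x"
    have "partial i (fourier_fun \<phi>) = (\<lambda>x. - two_pi_i * fourier_fun ?\<phi> x)"
      unfolding partial_fourier_fun[OF \<phi>] by (rule fourier_fun_cmult[OF schwartz_coord_mult[OF \<phi>]])
    then have "(LINT x|lborel. - two_pi_i * fourier_fun ?\<phi> x) = 0"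
      using integral_partial[OF schwartz_fourier_fun[OF \<phi>], of i] by simp
    then have "- two_pi_i * s ?\<phi> = 0"
      unfolding s_def integral_mult_right_zero .
    then show ?thesis by simp
  qed
  from point_supported[OF s this] obtain c where c: "\<And>\<phi>. schwartz \<phi> \<Longrightarrow> s \<phi> = c * \<phi> 0" by blast
  have ff: "fourier_fun (fourier_fun \<phi>) y = c * \<phi> (- y)" if \<phi>: "schwartz \<phi>" for \<phi> and y :: "real ^ 'n"
  proof -
    have "fourier_fun (fourier_fun \<phi>) y = s (\<lambda>x. \<phi> (x + - y))"
      unfolding s_def fourier_fun_translation[OF \<phi>] fourier_fun_character[of "fourier_fun \<phi>"]
      by (rule Bochner_Integration.integral_cong) (auto simp: character_minus character_commute[of y])
    then show ?thesis using c[OF schwartz_translation[OF \<phi>, of "- y"]] by simp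
  qed
  have "c \<noteq> 0"
  proof
    assume "c = 0"
    let ?l = "\<lambda>a. axis a 1 :: real ^ 'n"
    let ?\<phi> = "cutoff ?l 0"
    define D where "D = complex_of_real (1 / \<bar>det (row_matrix ?l)\<bar>)"
    have D: "D \<noteq> 0"
      using invertible_row_matrix[OF dual_bases_axis] by (simp add: D_def invertible_det_nz)
    have \<phi>: "schwartz ?\<phi>" using schwartz_lattice_cutoff[OF dual_bases_axis, of 0] by simp
    have "D * (D * delta_sum (lattice_dual_to ?l) ?\<phi>) = delta_sum (lattice_dual_to ?l) (fourier_fun (fourier_fun ?\<phi>))"
      using poisson_summation[OF dual_bases_axis \<phi>] poisson_summation[OF dual_bases_axis schwartz_fourier_fun[OF \<phi>]]
      by (simp add: D_def)
    also have "fourier_fun (fourier_fun ?\<phi>) = (\<lambda>_. 0)"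
      using ff[OF \<phi>] \<open>c = 0\<close> by auto
    also have "delta_sum (lattice_dual_to ?l) (\<lambda>_. 0) = 0"
      by (simp add: delta_sum_def)
    finally have "delta_sum (lattice_dual_to ?l) ?\<phi> = 0" using D by simp
    moreover have "delta_sum (lattice_dual_to ?l) ?\<phi> = (\<Sum>\<^sub>\<infinity>p\<in>{0}. ?\<phi> p)"
      unfolding delta_sum_def
    proof (rule infsum_cong_neutral)
      fix p assume p: "p \<in> lattice_dual_to ?l - {0}"
      then obtain a where "p $ a \<noteq> 0" by (auto simp: vec_eq_iff)
      moreover obtain m where "p $ a = of_int m"
        using p by (auto simp: lattice_dual_to_def inner_axis' elim: Ints_cases)
      ultimately have "\<bar>p $ a\<bar> \<ge> 1" by (cases "m > 0") auto
      then show "?\<phi> p = 0" by (intro cutoff_0[of _ _ a]) (auto simp: inner_axis')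
    qed auto
    moreover have "?\<phi> 0 = 1" by (rule cutoff_1) simp
    ultimately show False by simp
  qed
  with ff show ?thesis by blast
qed

text \<open>Up to a nonzero constant the fourth power of the transform is the identity.\<close>

lemma fourier_fun_surjective:
  assumes \<phi>: "schwartz (\<phi> :: real ^ 'n::finite \<Rightarrow> complex)"
  shows "\<exists>\<psi>. schwartz \<psi> \<and> fourier_fun \<psi> = \<phi>"
proof -
  let ?F = "fourier_fun :: (real ^ 'n \<Rightarrow> complex) \<Rightarrow> _"
  obtain c where c: "c \<noteq> 0" "\<And>\<phi> :: real ^ 'n \<Rightarrow> complex. schwartz \<phi> \<Longrightarrow> ?F (?F \<phi>) = (\<lambda>y. c * \<phi> (- y))"
    using fourier_fun_fourier_fun by blast
  have S: "schwartz (?F \<phi>)" "schwartz (?F (?F \<phi>))" "schwartz (?F (?F (?F \<phi>)))"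
    by (intro schwartz_fourier_fun \<phi>)+
  have "?F (?F (?F (?F \<phi>))) = (\<lambda>y. c * (c * \<phi> y))"
    using c(2)[OF S(2)] c(2)[OF \<phi>] by simp
  then have "?F (\<lambda>x. (1 / (c * c)) * ?F (?F (?F \<phi>)) x) = \<phi>"
    unfolding fourier_fun_cmult[OF S(3)] using c(1) by simp
  then show ?thesis using schwartz_cmult[OF S(3)] by blast
qed

section \<open>Commuting operators with conjugate derivations\<close>

lemma distr_eq_refl [simp]: "t \<doteq> t"
  by (simp add: distr_eq_def)

lemma distr_eq_trans [trans]: "t \<doteq> u \<Longrightarrow> u \<doteq> v \<Longrightarrow> t \<doteq> v"
  by (simp add: distr_eq_def)

lemma distr_eq_sym: "t \<doteq> u \<Longrightarrow> u \<doteq> t"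
  by (simp add: distr_eq_def)

text \<open>Commuting operators \<open>A k\<close> with conjugates \<open>D k\<close>, as differentiations and multiplications by coordinates in
  the Weyl algebra.\<close>

locale weyl_pairs =
  fixes A D :: "'k::finite \<Rightarrow> (real ^ 'n \<Rightarrow> complex) \<Rightarrow> real ^ ('n::finite) \<Rightarrow> complex"
  assumes op_A: "schwartz_operator (A k)" and op_D: "schwartz_operator (D k)"
    and A_commute: "A k (A m \<phi>) = A m (A k \<phi>)"
    and A_D: "schwartz \<phi> \<Longrightarrow> A k (D m \<phi>) = (\<lambda>x. D m (A k \<phi>) x + of_bool (k = m) * \<phi> x)"
begin

text \<open>The transpose of \<open>A k - r\<close> for the pair \<open>(k, r)\<close>; a list of pairs stands for a product of such operators.\<close>

definition dev :: "'k \<times> complex \<Rightarrow> 'n functional \<Rightarrow> 'n functional" where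
  "dev p t \<phi> = t (A (fst p) \<phi>) - snd p * t \<phi>"

abbreviation devs :: "('k \<times> complex) list \<Rightarrow> 'n functional \<Rightarrow> 'n functional" where
  "devs ps t \<equiv> foldr dev ps t"

definition der :: "'k \<Rightarrow> 'n functional \<Rightarrow> 'n functional" where
  "der k t \<phi> = t (D k \<phi>)"

lemma schwartz_A: "schwartz \<phi> \<Longrightarrow> schwartz (A k \<phi>)"
  using schwartz_operator_schwartz[OF op_A] .

lemma schwartz_D: "schwartz \<phi> \<Longrightarrow> schwartz (D k \<phi>)"
  using schwartz_operator_schwartz[OF op_D] .

lemma dev_commute: "dev p (dev p' t) = dev p' (dev p t)"
  by (rule ext) (simp add: dev_def A_commute[of "fst p" "fst p'"] algebra_simps)

lemma devs_dev: "devs ps (dev p t) = dev p (devs ps t)"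
  by (induction ps) (simp_all add: dev_commute)

lemma devs_devs: "devs ps (devs rs t) = devs rs (devs ps t)"
  by (induction ps) (simp_all add: devs_dev)

lemma devs_remove1:
  "p \<in> set ps \<Longrightarrow> devs ps t = devs (remove1 p ps) (dev p t)"
  by (induction ps) (auto simp: devs_dev dev_commute)

lemma tempered_dev: "tempered t \<Longrightarrow> tempered (dev p t)"
  using tempered_combination[OF tempered_operator[OF _ op_A] , of t t 1 "fst p" "- snd p"]
  by (simp add: dev_def[abs_def])

lemma tempered_devs: "tempered t \<Longrightarrow> tempered (devs ps t)"
  by (induction ps) (simp_all add: tempered_dev)

lemma tempered_der: "tempered t \<Longrightarrow> tempered (der k t)"
  unfolding der_def[abs_def] using tempered_operator[OF _ op_D] .

lemma dev_eq: "t \<doteq> u \<Longrightarrow> dev p t \<doteq> dev p u"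
  by (simp add: distr_eq_def dev_def schwartz_A)

lemma devs_eq: "t \<doteq> u \<Longrightarrow> devs ps t \<doteq> devs ps u"
  by (induction ps) (simp_all add: dev_eq)

lemma der_eq: "t \<doteq> u \<Longrightarrow> der k t \<doteq> der k u"
  by (simp add: distr_eq_def der_def schwartz_D)

lemma devs_combination:
  "devs ps (\<lambda>\<phi>. a * t \<phi> + b * u \<phi>) = (\<lambda>\<phi>. a * devs ps t \<phi> + b * devs ps u \<phi>)"
  by (induction ps) (auto simp: dev_def fun_eq_iff algebra_simps)

lemma devs_zero [simp]: "devs ps (\<lambda>\<phi>. 0) = (\<lambda>\<phi>. 0)"
  by (induction ps) (auto simp: dev_def fun_eq_iff)

lemma devs_zero_eq: "t \<doteq> (\<lambda>\<phi>. 0) \<Longrightarrow> devs ps t \<doteq> (\<lambda>\<phi>. 0)"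
  using devs_eq[of t "\<lambda>\<phi>. 0" ps] by simp

text \<open>Transposition reverses products, so the commutator has the sign opposite to that of \<open>A_D\<close>.\<close>

lemma dev_der:
  assumes "tempered t"
  shows "dev p (der m t) \<doteq> (\<lambda>\<phi>. der m (dev p t) \<phi> - of_bool (fst p = m) * t \<phi>)"
  unfolding distr_eq_def
proof (intro allI impI)
  fix \<phi> :: "real ^ 'n \<Rightarrow> complex"
  assume \<phi>: "schwartz \<phi>"
  have "t (A (fst p) (D m \<phi>)) = 1 * t (D m (A (fst p) \<phi>)) + of_bool (fst p = m) * t \<phi>"
    unfolding A_D[OF \<phi>]
    using linear_functional_combination[OF tempered_linear[OF assms] schwartz_D[OF schwartz_A[OF \<phi>]] \<phi>, of 1]
    by simp
  then show "dev p (der m t) \<phi> = der m (dev p t) \<phi> - of_bool (fst p = m) * t \<phi>"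
    by (simp add: dev_def der_def)
qed

text \<open>The analogue of \<open>x\<^sup>n \<partial> = \<partial> x\<^sup>n - n x\<^sup>n\<^sup>-\<^sup>1\<close>. For \<open>n = 0\<close> the exponent \<open>n - 1\<close> is
  harmless since its coefficient vanishes.\<close>

lemma dev_power_der:
  assumes t: "tempered t"
  shows "devs (replicate n (k, r)) (der k t) \<doteq>
    (\<lambda>\<phi>. der k (devs (replicate n (k, r)) t) \<phi> - of_nat n * devs (replicate (n - 1) (k, r)) t \<phi>)"
proof (induction n)
  case (Suc n)
  let ?X = "dev (k, r)" and ?t = "\<lambda>n. devs (replicate n (k, r)) t"
  have "devs (replicate (Suc n) (k, r)) (der k t) \<doteq> ?X (\<lambda>\<phi>. der k (?t n) \<phi> - of_nat n * ?t (n - 1) \<phi>)"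
    using dev_eq[OF Suc.IH] by simp
  also have "?X (\<lambda>\<phi>. der k (?t n) \<phi> - of_nat n * ?t (n - 1) \<phi>) =
      (\<lambda>\<phi>. ?X (der k (?t n)) \<phi> - of_nat n * ?X (?t (n - 1)) \<phi>)"
    by (simp add: dev_def fun_eq_iff algebra_simps)
  also have "\<dots> = (\<lambda>\<phi>. ?X (der k (?t n)) \<phi> - of_nat n * ?t n \<phi>)"
    by (cases n) auto
  also have "\<dots> \<doteq> (\<lambda>\<phi>. der k (?t (Suc n)) \<phi> - of_nat (Suc n) * ?t n \<phi>)"
    using dev_der[OF tempered_devs[OF t], of "(k, r)" k "replicate n (k, r)"]
    by (simp add: distr_eq_def algebra_simps)
  finally show ?case by simp
qed simp

text \<open>The commutator of \<open>devs ps\<close> with a derivation is a sum of products in which one factor is omitted. These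
  products commute with \<open>devs rs\<close>, which annihilates \<open>t\<close>.\<close>

lemma devs_commutator_killed:
  assumes t: "tempered t" and rs: "devs rs t \<doteq> (\<lambda>\<phi>. 0)"
  shows "devs rs (\<lambda>\<phi>. devs ps (der m t) \<phi> - der m (devs ps t) \<phi>) \<doteq> (\<lambda>\<phi>. 0)"
proof (induction ps)
  case (Cons p ps)
  define E where "E = (\<lambda>\<phi>. devs ps (der m t) \<phi> - der m (devs ps t) \<phi>)"
  let ?c = "of_bool (fst p = m) :: complex"
  have "(\<lambda>\<phi>. devs (p # ps) (der m t) \<phi> - der m (devs (p # ps) t) \<phi>) \<doteq>
      (\<lambda>\<phi>. 1 * dev p E \<phi> + (- ?c) * devs ps t \<phi>)"
    using dev_der[OF tempered_devs[OF t], of p m ps]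
    by (simp add: distr_eq_def E_def dev_def algebra_simps)
  from devs_eq[OF this, of rs]
  have "devs rs (\<lambda>\<phi>. devs (p # ps) (der m t) \<phi> - der m (devs (p # ps) t) \<phi>) \<doteq>
      (\<lambda>\<phi>. 1 * dev p (devs rs E) \<phi> + (- ?c) * devs ps (devs rs t) \<phi>)"
    unfolding devs_combination devs_dev devs_devs[of rs ps] .
  also have "\<dots> \<doteq> (\<lambda>\<phi>. 0)"
    using dev_eq[OF Cons.IH[folded E_def], of p] devs_zero_eq[OF rs, of ps]
    unfolding distr_eq_def by (simp add: dev_def cong del: foldr_cong)
  finally show ?case .
qed simp

text \<open>Of the two copies of \<open>ps\<close> one removes the term in which the derivation stands outside, the other the
  commutator.\<close>

lemma devs_der_killed:
  assumes t: "tempered t" and ps: "devs ps t \<doteq> (\<lambda>\<phi>. 0)"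
  shows "devs (ps @ ps) (der m t) \<doteq> (\<lambda>\<phi>. 0)"
proof -
  have "devs ps (\<lambda>\<phi>. 1 * devs ps (der m t) \<phi> + (-1) * der m (devs ps t) \<phi>) \<doteq> (\<lambda>\<phi>. 0)"
    using devs_commutator_killed[OF t ps, of ps m] by simp
  moreover have "devs ps (der m (devs ps t)) \<doteq> (\<lambda>\<phi>. 0)"
    using devs_zero_eq[of "der m (devs ps t)" ps] der_eq[OF ps, of m] by (simp add: der_def[abs_def])
  ultimately show ?thesis
    unfolding devs_combination by (simp add: distr_eq_def)
qed

lemma eigenvector_devs:
  assumes "\<And>k. dev (k, r k) t \<doteq> (\<lambda>\<phi>. 0)"
  shows "devs ps t \<doteq> (\<lambda>\<phi>. (\<Prod>p\<leftarrow>ps. r (fst p) - snd p) * t \<phi>)"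
proof (induction ps)
  case (Cons p ps)
  have "t (A (fst p) \<phi>) = r (fst p) * t \<phi>" if "schwartz \<phi>" for \<phi>
    using assms[of "fst p"] that by (simp add: distr_eq_def dev_def)
  with dev_eq[OF Cons.IH, of p] show ?case
    by (simp add: distr_eq_def dev_def algebra_simps)
qed simp

text \<open>Kashiwara's argument for one operator, by induction on the number of factors. If \<open>r \<noteq> s\<close> are two of
  the roots, \<open>t\<close> is a combination of \<open>dev (k, r) t\<close> and \<open>dev (k, s) t\<close>, which need fewer factors. If all
  roots are \<open>r\<close> and \<open>X\<close> is \<open>dev (k, r)\<close>, the identity
  \<open>(m + 1) t = (der k (X t) + (m + 1) t) - der k (X t)\<close> serves: with \<open>X\<^sup>m\<^sup>+\<^sup>2 t = 0\<close> both \<open>X t\<close> and, by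
  \<open>dev_power_der\<close>, the bracket are annihilated by \<open>X\<^sup>m\<^sup>+\<^sup>1\<close>. The predicate \<open>V\<close> carries properties that
  persist under these operations.\<close>

lemma generated_by_eigenvectors:
  assumes V: "\<And>t. V t \<Longrightarrow> tempered t"
    and V_comb: "\<And>t u a b. V t \<Longrightarrow> V u \<Longrightarrow> V (\<lambda>\<phi>. a * t \<phi> + b * u \<phi>)"
    and V_dev: "\<And>t r. V t \<Longrightarrow> V (dev (k, r) t)"
    and V_der: "\<And>t. V t \<Longrightarrow> V (der k t)"
    and W_zero: "W (\<lambda>\<phi>. 0)" and W_eq: "\<And>t u. W t \<Longrightarrow> t \<doteq> u \<Longrightarrow> W u"
    and W_comb: "\<And>t u a b. W t \<Longrightarrow> W u \<Longrightarrow> W (\<lambda>\<phi>. a * t \<phi> + b * u \<phi>)"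
    and W_der: "\<And>t. W t \<Longrightarrow> W (der k t)"
    and base: "\<And>t r. V t \<Longrightarrow> dev (k, r) t \<doteq> (\<lambda>\<phi>. 0) \<Longrightarrow> W t"
  shows "V t \<Longrightarrow> devs (map (Pair k) rs) t \<doteq> (\<lambda>\<phi>. 0) \<Longrightarrow> W t"
proof (induction "length rs" arbitrary: rs t rule: less_induct)
  case less
  have step: "W (dev (k, r) t)" if r: "r \<in> set rs" for r
  proof (rule less.hyps)
    show "length (remove1 r rs) < length rs"
      using r by (metis length_remove1 length_pos_if_in_set diff_less zero_less_one)
    have "map (Pair k) (remove1 r rs) = remove1 (k, r) (map (Pair k) rs)"
      by (induction rs) auto
    then show "devs (map (Pair k) (remove1 r rs)) (dev (k, r) t) \<doteq> (\<lambda>\<phi>. 0)"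
      using less.prems(2) devs_remove1[of "(k, r)" "map (Pair k) rs" t] r by simp
  qed (rule V_dev[OF less.prems(1)])
  show ?case
  proof (cases "\<exists>r\<in>set rs. \<exists>s\<in>set rs. r \<noteq> s")
    case True
    then obtain r s where rs: "r \<in> set rs" "s \<in> set rs" "r \<noteq> s" by blast
    have "(\<lambda>\<phi>. 1 / (s - r) * dev (k, r) t \<phi> + - (1 / (s - r)) * dev (k, s) t \<phi>) = t"
    proof
      fix \<phi>
      have "dev (k, r) t \<phi> - dev (k, s) t \<phi> = (s - r) * t \<phi>"
        by (simp add: dev_def algebra_simps)
      then have "1 / (s - r) * (dev (k, r) t \<phi> - dev (k, s) t \<phi>) = t \<phi>" using rs(3) by simp
      then show "1 / (s - r) * dev (k, r) t \<phi> + - (1 / (s - r)) * dev (k, s) t \<phi> = t \<phi>"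
        by (simp add: right_diff_distrib)
    qed
    with W_comb[OF step[OF rs(1)] step[OF rs(2)], of "1 / (s - r)" "- (1 / (s - r))"] show ?thesis by simp
  next
    case False
    then obtain r n where rs: "rs = replicate n r"
      by (metis replicate_length_same)
    consider "n = 0" | "n = 1" | m where "n = Suc (Suc m)"
      by (metis One_nat_def not0_implies_Suc)
    then show ?thesis
    proof cases
      case 1
      then show ?thesis using less.prems(2) rs W_eq[OF W_zero distr_eq_sym] by simp
    next
      case 2
      then show ?thesis using base[OF less.prems(1)] less.prems(2) rs by simp
    next
      case (3 m)
      let ?n = "of_nat (Suc m) :: complex"
      define X where "X = dev (k, r)"
      define v where "v = (\<lambda>\<phi>. 1 * der k (X t) \<phi> + ?n * t \<phi>)"
      have W1: "W (der k (X t))"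
        unfolding X_def by (intro W_der step) (simp add: rs 3)
      have t: "tempered (X t)" unfolding X_def by (rule tempered_dev[OF V[OF less.prems(1)]])
      have R: "devs (replicate n (k, r)) (X t) = devs (replicate (Suc n) (k, r)) t" for n
        unfolding X_def devs_dev by simp
      have "W v"
      proof (rule less.hyps[of "replicate (Suc m) r"])
        show "V v" unfolding v_def X_def by (intro V_comb V_der V_dev less.prems(1))
        have "devs (replicate (Suc (Suc m)) (k, r)) t \<doteq> (\<lambda>\<phi>. 0)"
          using less.prems(2) by (simp add: rs 3)
        from der_eq[OF this, of k] have "der k (devs (replicate (Suc m) (k, r)) (X t)) \<doteq> (\<lambda>\<phi>. 0)"
          unfolding R by (simp add: der_def[abs_def])
        with dev_power_der[OF t, of "Suc m" k r]
        have "devs (replicate (Suc m) (k, r)) (der k (X t)) \<doteq> (\<lambda>\<phi>. - (?n * devs (replicate (Suc m) (k, r)) t \<phi>))"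
          unfolding diff_Suc_1 R[of m] by (simp add: distr_eq_def)
        then show "devs (map (Pair k) (replicate (Suc m) r)) v \<doteq> (\<lambda>\<phi>. 0)"
          unfolding map_replicate v_def devs_combination by (simp only: distr_eq_def) simp
      qed (simp add: rs 3)
      have n: "?n \<noteq> 0" by (simp only: of_nat_eq_0_iff)
      have "(\<lambda>\<phi>. 1 / ?n * v \<phi> + (- (1 / ?n)) * der k (X t) \<phi>) = t"
        using n unfolding v_def
          by (intro ext) (simp only: distrib_left mult_1 mult.assoc[symmetric] divide_self_if, simp)
      with W_comb[OF \<open>W v\<close> W1, of "1 / ?n" "- (1 / ?n)"] show ?thesis by simp
    qed
  qed
qed

text \<open>The operators are treated one after the other. For the operator \<open>k\<close> the induction of
  \<open>generated_by_eigenvectors\<close> stays inside the joint eigenspace of the operators treated before, because \<open>A k\<close> and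
  \<open>D k\<close> commute with these. The annihilating products in \<open>G\<close> persist as well, up to higher powers; at the end they
  restrict the joint eigenvalues. A product in \<open>G\<close> has factors for several operators. This ties their eigenvalues together:
  annihilators of the single operators would not exclude that the eigenvalues of two operators belong to
  different cosets.\<close>

theorem generated_by_joint_eigenvectors:
  assumes G: "\<And>k. \<exists>ps\<in>G. fst ` set ps \<subseteq> {k}"
    and W_zero: "W (\<lambda>\<phi>. 0)" and W_eq: "\<And>t u. W t \<Longrightarrow> t \<doteq> u \<Longrightarrow> W u"
    and W_comb: "\<And>t u a b. W t \<Longrightarrow> W u \<Longrightarrow> W (\<lambda>\<phi>. a * t \<phi> + b * u \<phi>)"
    and W_der: "\<And>t k. W t \<Longrightarrow> W (der k t)"
    and base: "\<And>t r. tempered t \<Longrightarrow> (\<And>k. dev (k, r k) t \<doteq> (\<lambda>\<phi>. 0)) \<Longrightarrow>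
      (\<And>ps. ps \<in> G \<Longrightarrow> \<exists>p\<in>set ps. r (fst p) = snd p) \<Longrightarrow> W t"
    and t: "tempered t" and ann: "\<And>ps. ps \<in> G \<Longrightarrow> \<exists>M. devs (concat (replicate M ps)) t \<doteq> (\<lambda>\<phi>. 0)"
  shows "W t"
proof -
  define V where "V t \<longleftrightarrow> tempered t \<and> (\<forall>ps\<in>G. \<exists>M. devs (concat (replicate M ps)) t \<doteq> (\<lambda>\<phi>. 0))" for t
  have V_comb: "V (\<lambda>\<phi>. a * t \<phi> + b * u \<phi>)" if tu: "V t" "V u" for t u a b
    unfolding V_def
  proof (intro conjI ballI)
    show "tempered (\<lambda>\<phi>. a * t \<phi> + b * u \<phi>)"
      using tu by (intro tempered_combination) (auto simp: V_def)
    fix ps assume "ps \<in> G"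
    then obtain M N where M: "devs (concat (replicate M ps)) t \<doteq> (\<lambda>\<phi>. 0)"
      and N: "devs (concat (replicate N ps)) u \<doteq> (\<lambda>\<phi>. 0)"
      using tu unfolding V_def by blast
    have "devs (concat (replicate (N + M) ps)) t \<doteq> (\<lambda>\<phi>. 0)"
      using devs_zero_eq[OF M, of "concat (replicate N ps)"] by (simp add: replicate_add)
    moreover have "devs (concat (replicate (N + M) ps)) u \<doteq> (\<lambda>\<phi>. 0)"
      using devs_zero_eq[OF N, of "concat (replicate M ps)"] by (simp add: replicate_add add.commute[of N])
    ultimately show "\<exists>M. devs (concat (replicate M ps)) (\<lambda>\<phi>. a * t \<phi> + b * u \<phi>) \<doteq> (\<lambda>\<phi>. 0)"
      unfolding devs_combination by (intro exI[of _ "N + M"]) (simp add: distr_eq_def)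
  qed
  have V_dev: "V (dev p t)" if Vt: "V t" for p t
    unfolding V_def
  proof (intro conjI ballI)
    show "tempered (dev p t)" using Vt by (simp add: V_def tempered_dev)
    fix ps assume "ps \<in> G"
    then obtain M where "devs (concat (replicate M ps)) t \<doteq> (\<lambda>\<phi>. 0)"
      using Vt unfolding V_def by blast
    from devs_zero_eq[OF this, of "[p]"]
    show "\<exists>M. devs (concat (replicate M ps)) (dev p t) \<doteq> (\<lambda>\<phi>. 0)"
      by (intro exI[of _ M]) (simp add: devs_dev)
  qed
  have V_der: "V (der k t)" if Vt: "V t" for k t
    unfolding V_def
  proof (intro conjI ballI)
    show "tempered (der k t)" using Vt by (simp add: V_def tempered_der)
    fix ps assume "ps \<in> G"
    then obtain M where "devs (concat (replicate M ps)) t \<doteq> (\<lambda>\<phi>. 0)"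
      using Vt unfolding V_def by blast
    then have "devs (concat (replicate M ps) @ concat (replicate M ps)) (der k t) \<doteq> (\<lambda>\<phi>. 0)"
      using Vt by (intro devs_der_killed) (simp_all add: V_def)
    then show "\<exists>M. devs (concat (replicate M ps)) (der k t) \<doteq> (\<lambda>\<phi>. 0)"
      by (intro exI[of _ "M + M"]) (simp add: replicate_add)
  qed
  have eigen: "W t" if Vt: "V t" "\<And>k. dev (k, r k) t \<doteq> (\<lambda>\<phi>. 0)" for t r
  proof (cases "t \<doteq> (\<lambda>\<phi>. 0)")
    case True
    then show ?thesis using W_eq[OF W_zero distr_eq_sym] by blast
  next
    case nz: False
    show ?thesis
    proof (rule base[OF _ Vt(2)])
      show "tempered t" using Vt by (simp add: V_def)
      fix ps assume "ps \<in> G"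
      then obtain M where M: "devs (concat (replicate M ps)) t \<doteq> (\<lambda>\<phi>. 0)"
        using Vt unfolding V_def by blast
      have "(\<lambda>\<phi>. (\<Prod>p\<leftarrow>concat (replicate M ps). r (fst p) - snd p) * t \<phi>) \<doteq> (\<lambda>\<phi>. 0)"
        using distr_eq_trans[OF distr_eq_sym[OF eigenvector_devs[OF Vt(2)]] M] .
      then have "(\<Prod>p\<leftarrow>concat (replicate M ps). r (fst p) - snd p) = 0"
        using nz by (auto simp: distr_eq_def)
      then show "\<exists>p\<in>set ps. r (fst p) = snd p"
        by (force simp: prod_list_zero_iff split: if_splits)
    qed
  qed
  have "\<forall>t r. V t \<longrightarrow> (\<forall>k. k \<notin> S \<longrightarrow> dev (k, r k) t \<doteq> (\<lambda>\<phi>. 0)) \<longrightarrow> W t" if "finite S" for S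
    using that
  proof (induction S rule: finite_induct)
    case empty
    then show ?case using eigen by blast
  next
    case (insert k S)
    show ?case
    proof (intro allI impI)
      fix t r
      assume t: "V t" and r: "\<forall>m. m \<notin> insert k S \<longrightarrow> dev (m, r m) t \<doteq> (\<lambda>\<phi>. 0)"
      let ?V = "\<lambda>t. V t \<and> (\<forall>m. m \<notin> insert k S \<longrightarrow> dev (m, r m) t \<doteq> (\<lambda>\<phi>. 0))"
      obtain ps where ps: "ps \<in> G" "fst ` set ps \<subseteq> {k}" using G by blast
      obtain M where M: "devs (concat (replicate M ps)) t \<doteq> (\<lambda>\<phi>. 0)"
        using t ps(1) unfolding V_def by blast
      have "map (Pair k) (map snd (concat (replicate M ps))) = map id (concat (replicate M ps))"
        unfolding map_map by (rule map_cong) (use ps(2) in \<open>auto split: if_splits\<close>)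
      then have M': "devs (map (Pair k) (map snd (concat (replicate M ps)))) t \<doteq> (\<lambda>\<phi>. 0)"
        using M by simp
      show "W t"
      proof (rule generated_by_eigenvectors[where V = ?V and k = k and W = W, OF _ _ _ _ W_zero W_eq W_comb W_der _ _ M'])
        show "?V t" using t r by blast
        show "tempered u" if "?V u" for u using that by (simp add: V_def)
        show "?V (\<lambda>\<phi>. a * u \<phi> + b * v \<phi>)" if u: "?V u" and v: "?V v" for u v a b
        proof (intro conjI allI impI V_comb)
          fix m assume m: "m \<notin> insert k S"
          then have "dev (m, r m) u \<doteq> (\<lambda>\<phi>. 0)" "dev (m, r m) v \<doteq> (\<lambda>\<phi>. 0)" using u v by blast+
          then show "dev (m, r m) (\<lambda>\<phi>. a * u \<phi> + b * v \<phi>) \<doteq> (\<lambda>\<phi>. 0)"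
            using devs_combination[of "[(m, r m)]" a u b v] by (simp add: distr_eq_def)
        qed (use u v in blast)+
        show "?V (dev (k, s) u)" if u: "?V u" for u s
        proof (intro conjI allI impI V_dev)
          fix m assume m: "m \<notin> insert k S"
          then have "dev (m, r m) u \<doteq> (\<lambda>\<phi>. 0)" using u by blast
          from devs_zero_eq[OF this, of "[(k, s)]"] show "dev (m, r m) (dev (k, s) u) \<doteq> (\<lambda>\<phi>. 0)"
            by (simp add: dev_commute[of "(m, r m)"])
        qed (use u in blast)
        show "?V (der k u)" if u: "?V u" for u
        proof (intro conjI allI impI V_der)
          fix m assume m: "m \<notin> insert k S"
          then have "der k (dev (m, r m) u) \<doteq> der k (\<lambda>\<phi>. 0)" using u by (intro der_eq) blast
          moreover have "tempered u" using u by (simp add: V_def)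
          ultimately show "dev (m, r m) (der k u) \<doteq> (\<lambda>\<phi>. 0)"
            using dev_der[of u "(m, r m)" k] m by (simp add: distr_eq_def der_def)
        qed (use u in blast)
        show "W u" if u: "?V u" and e: "dev (k, s) u \<doteq> (\<lambda>\<phi>. 0)" for u s
        proof -
          have "\<forall>m. m \<notin> S \<longrightarrow> dev (m, (r(k := s)) m) u \<doteq> (\<lambda>\<phi>. 0)"
            using u e by auto
          then show ?thesis using insert.IH u by blast
        qed
      qed
    qed
  qed
  from this[of UNIV] show ?thesis using t ann unfolding V_def by auto
qed

end

section \<open>The operators of a lattice\<close>

lemma schwartz_operator_sum:
  assumes "finite F" "\<And>a. a \<in> F \<Longrightarrow> schwartz_operator (T a)"
  shows "schwartz_operator (\<lambda>f x. \<Sum>a\<in>F. c a * T a f x)"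
  using assms
proof (induction F rule: finite_induct)
  case empty
  show ?case using schwartz_operator_combination[OF schwartz_operator_translation schwartz_operator_translation, of 0 0 0 0]
    by simp
next
  case (insert a F)
  then have "schwartz_operator (T a)" "schwartz_operator (\<lambda>f x. \<Sum>a\<in>F. c a * T a f x)" by simp_all
  from schwartz_operator_combination[OF this, of "c a" 1] insert.hyps show ?case by simp
qed

text \<open>The left summand indexes multiplications by the characters of \<open>L\<^sup>*\<close>, the right one translations by \<open>L\<close>.\<close>

fun lattice_op :: "('n \<Rightarrow> real ^ 'n) \<Rightarrow> ('n \<Rightarrow> real ^ 'n) \<Rightarrow> 'n + 'n \<Rightarrow> (real ^ 'n \<Rightarrow> complex) \<Rightarrow> real ^ ('n::finite) \<Rightarrow> complex" where
  "lattice_op l lam (Inl a) = (\<lambda>\<phi> x. character (lam a) x * \<phi> x)"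
| "lattice_op l lam (Inr b) = (\<lambda>\<phi> x. \<phi> (x + - l b))"

text \<open>The conjugate of multiplication by a character is \<open>- j\<^sup>-\<^sup>1\<close> times the inverse character times the derivative
  in the direction \<open>l a\<close>. The conjugate of the translation by \<open>l b\<close> is the inverse translation followed by
  multiplication by \<open>- (lam b \<bullet> x)\<close>. Duality of the bases makes the mixed commutators vanish.\<close>

fun lattice_conj :: "('n \<Rightarrow> real ^ 'n) \<Rightarrow> ('n \<Rightarrow> real ^ 'n) \<Rightarrow> 'n + 'n \<Rightarrow> (real ^ 'n \<Rightarrow> complex) \<Rightarrow> real ^ ('n::finite) \<Rightarrow> complex" where
  "lattice_conj l lam (Inl a) = (\<lambda>\<phi> x. \<Sum>i\<in>UNIV. - inverse two_pi_i * of_real (l a $ i) * (character (- lam a) x * partial i \<phi> x))"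
| "lattice_conj l lam (Inr b) = (\<lambda>\<phi> x. \<Sum>i\<in>UNIV. - of_real (lam b $ i) * (of_real (x $ i) * \<phi> (x + l b)))"

lemma lattice_conj_Inr: "lattice_conj l lam (Inr b) \<phi> x = - of_real (lam b \<bullet> x) * \<phi> (x + l b)"
  by (simp add: inner_vec_def sum_distrib_right sum_negf[symmetric] mult.assoc)

lemma lattice_weyl_pairs:
  fixes l lam :: "'n::finite \<Rightarrow> real ^ 'n"
  assumes d: "dual_bases l lam"
  shows "weyl_pairs (lattice_op l lam) (lattice_conj l lam)"
proof
  have char_l: "character (lam a) (x + - l b) = character (lam a) x" "character (lam a) (x + l b) = character (lam a) x"
    "character (- lam a) (x + - l b) = character (- lam a) x" for a b x
    by (simp_all only: character_add character_minus character_lattice[OF d lattice_dual_to_basis[OF d]]) simp_all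
  show "schwartz_operator (lattice_op l lam k)" for k
    by (cases k) (simp_all only: lattice_op.simps schwartz_operator_multiplier[OF multiplier_character] schwartz_operator_translation)
  show "schwartz_operator (lattice_conj l lam k)" for k
  proof (cases k)
    case (Inl a)
    show ?thesis unfolding Inl lattice_conj.simps
      by (rule schwartz_operator_sum) (simp_all only: finite_class.finite
          schwartz_operator_compose[OF schwartz_operator_multiplier[OF multiplier_character] schwartz_operator_partial])
  next
    case (Inr b)
    show ?thesis unfolding Inr lattice_conj.simps
      by (rule schwartz_operator_sum) (simp_all only: finite_class.finite
          schwartz_operator_compose[OF schwartz_operator_multiplier[OF multiplier_coord] schwartz_operator_translation])
  qed
  show "lattice_op l lam k (lattice_op l lam m \<phi>) = lattice_op l lam m (lattice_op l lam k \<phi>)" for k m \<phi>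
    by (cases k; cases m) (auto simp: fun_eq_iff char_l[simplified] algebra_simps)
  fix \<phi> :: "real ^ 'n \<Rightarrow> complex" and k m
  assume \<phi>: "schwartz \<phi>"
  show "lattice_op l lam k (lattice_conj l lam m \<phi>) =
      (\<lambda>x. lattice_conj l lam m (lattice_op l lam k \<phi>) x + of_bool (k = m) * \<phi> x)"
  proof (rule ext)
    fix x
    consider a b where "k = Inl a" "m = Inl b" | a b where "k = Inl a" "m = Inr b"
      | a b where "k = Inr a" "m = Inl b" | a b where "k = Inr a" "m = Inr b"
      by (cases k; cases m) auto
    then show "lattice_op l lam k (lattice_conj l lam m \<phi>) x =
        lattice_conj l lam m (lattice_op l lam k \<phi>) x + of_bool (k = m) * \<phi> x"
    proof cases
      case (1 a b)
      have P: "partial i (\<lambda>x. character (lam a) x * \<phi> x) x =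
          two_pi_i * of_real (lam a $ i) * character (lam a) x * \<phi> x + character (lam a) x * partial i \<phi> x" for i
        unfolding smooth_partial_mult[OF smooth_character schwartz_smooth[OF \<phi>]] partial_character by simp
      let ?c = "\<lambda>i. - inverse two_pi_i * of_real (l b $ i) * (character (- lam b) x * (two_pi_i * of_real (lam a $ i) * character (lam a) x * \<phi> x))"
      have "(\<Sum>i\<in>UNIV. ?c i) = (\<Sum>i\<in>UNIV. - (of_real (lam a $ i * l b $ i) * (character (lam a) x * character (- lam b) x * \<phi> x)))"
        by (rule sum.cong) (simp_all add: field_simps)
      also have "\<dots> = - (of_real (lam a \<bullet> l b) * (character (lam a) x * character (- lam b) x * \<phi> x))"
        by (simp add: inner_vec_def sum_distrib_right sum_negf)
      also have "\<dots> = - (of_bool (k = m) * \<phi> x)"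
        by (simp add: 1 dual_bases_inner[OF d] character_minus)
      finally have c: "(\<Sum>i\<in>UNIV. ?c i) = - (of_bool (k = m) * \<phi> x)" .
      let ?d = "\<lambda>i. - inverse two_pi_i * of_real (l b $ i) * (character (- lam b) x * (character (lam a) x * partial i \<phi> x))"
      have "lattice_conj l lam m (lattice_op l lam k \<phi>) x = (\<Sum>i\<in>UNIV. ?c i + ?d i)"
        unfolding 1 lattice_conj.simps lattice_op.simps P by (simp only: distrib_left)
      also have "\<dots> = - (of_bool (k = m) * \<phi> x) + (\<Sum>i\<in>UNIV. ?d i)"
        unfolding sum.distrib c ..
      also have "(\<Sum>i\<in>UNIV. ?d i) = lattice_op l lam k (lattice_conj l lam m \<phi>) x"
        unfolding 1 lattice_conj.simps lattice_op.simps sum_distrib_left by (rule sum.cong) simp_all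
      finally show ?thesis by simp
    next
      case (2 a b)
      then show ?thesis
        by (simp add: lattice_conj_Inr char_l del: lattice_conj.simps)
    next
      case (3 a b)
      then show ?thesis
        by (simp only: lattice_op.simps lattice_conj.simps partial_translation[OF schwartz_smooth[OF \<phi>]] char_l) simp
    next
      case (4 a b)
      then show ?thesis
        by (auto simp: lattice_conj_Inr dual_bases_inner[OF d] inner_diff_right algebra_simps simp del: lattice_conj.simps)
    qed
  qed
qed

section \<open>Annihilating products of characters\<close>

text \<open>For \<open>\<bar>\<alpha>\<bar> = 1\<close> and \<open>\<bar>z\<bar> = 1\<close> one has \<open>(z - \<alpha>)\<^sup>2 = - z \<alpha> \<bar>z - \<alpha>\<bar>\<^sup>2\<close>. So the square of
  the product is a bounded smooth factor times a nonnegative function, to which \<open>power_annihilates\<close> applies.\<close>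

lemma character_product_power_annihilates:
  fixes u :: "'n::finite functional"
  assumes u: "tempered u" and F: "finite F" and \<alpha>: "\<And>i. i \<in> F \<Longrightarrow> cmod (\<alpha> i) = 1"
    and supp: "\<And>\<sigma>. \<sigma> \<in> distr_support u \<Longrightarrow> \<exists>i\<in>F. character (v i) \<sigma> = \<alpha> i"
  shows "\<exists>M. \<forall>\<phi>. schwartz \<phi> \<longrightarrow> u (\<lambda>x. (\<Prod>i\<in>F. character (v i) x - \<alpha> i) ^ M * \<phi> x) = 0"
proof -
  define h where "h x = (\<Prod>i\<in>F. (cmod (character (v i) x - \<alpha> i))\<^sup>2)" for x
  let ?G = "\<lambda>x. \<Prod>i\<in>F. character (v i) x - \<alpha> i"
  define e where "e x = (\<Prod>i\<in>F. character (v i) x * (- \<alpha> i))" for x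
  have us: "uniformly_smooth (\<lambda>_ :: unit. \<lambda>x. (\<Prod>i\<in>F. (character (v i) x + (- \<alpha> i)) * (character (- v i) x + - cnj (\<alpha> i))))"
    by (intro uniformly_smooth_prod uniformly_smooth_mult uniformly_smooth_add uniformly_smooth_character uniformly_smooth_const)
  have h: "of_real (h x) = (\<Prod>i\<in>F. (character (v i) x + (- \<alpha> i)) * (character (- v i) x + - cnj (\<alpha> i)))" for x
    unfolding h_def of_real_prod
    by (rule prod.cong) (simp_all add: complex_norm_square character_minus cnj_character del: of_real_power)
  obtain M where M: "\<And>\<phi>. schwartz \<phi> \<Longrightarrow> u (\<lambda>x. of_real (h x) ^ M * \<phi> x) = 0"
  proof -
    have "\<exists>M. \<forall>\<phi>. schwartz \<phi> \<longrightarrow> u (\<lambda>x. of_real (h x) ^ M * \<phi> x) = 0"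
    proof (rule power_annihilates[OF u])
      show "uniformly_smooth (\<lambda>_ :: unit. \<lambda>x. of_real (h x))" using us by (simp only: h)
      show "h x \<ge> 0" for x by (simp add: h_def prod_nonneg)
      show "h x = 0" if x: "x \<in> distr_support u" for x
        using supp[OF x] F by (auto simp: h_def intro!: prod_zero)
    qed
    then show ?thesis using that by blast
  qed
  have G2: "?G x ^ 2 = of_real (h x) * e x" for x
    unfolding h e_def prod_power_distrib prod.distrib[symmetric]
  proof (rule prod.cong)
    fix i assume i: "i \<in> F"
    have "\<alpha> i * cnj (\<alpha> i) = 1" using \<alpha>[OF i] complex_norm_square[of "\<alpha> i"] by simp
    moreover have "character (v i) x * character (- v i) x = 1" by (simp add: character_minus)
    ultimately show "(character (v i) x - \<alpha> i)\<^sup>2 = (character (v i) x + - \<alpha> i) * (character (- v i) x + - cnj (\<alpha> i)) * (character (v i) x * - \<alpha> i)"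
      by algebra
  qed simp
  have e: "multiplier (\<lambda>x. e x)"
    unfolding e_def
    by (rule uniformly_smooth_multiplier[where F = "\<lambda>_ :: unit. \<lambda>x. \<Prod>i\<in>F. character (v i) x * (- \<alpha> i)"])
       (intro uniformly_smooth_prod uniformly_smooth_mult uniformly_smooth_character uniformly_smooth_const)
  have eM: "schwartz (\<lambda>x. e x ^ N * \<phi> x)" if \<phi>: "schwartz \<phi>" for N \<phi>
  proof (induction N)
    case (Suc N)
    from schwartz_multiplier[OF e this] show ?case by (simp add: mult.assoc)
  qed (simp add: \<phi>)
  have "u (\<lambda>x. ?G x ^ (2 * M) * \<phi> x) = 0" if "schwartz \<phi>" for \<phi>
    using M[OF eM[OF that, of M]] by (simp add: power_mult G2 power_mult_distrib mult.assoc)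
  then show ?thesis by blast
qed

context weyl_pairs
begin

text \<open>The map \<open>S\<close> carries multiplications by characters to the operators \<open>A k\<close>. It is the identity for the operators
  that are themselves multiplications, and the Fourier transform for translations.\<close>

lemma devs_as_multiplication:
  assumes u: "linear_functional (\<lambda>\<psi>. t (S \<psi>))"
    and A: "\<And>p \<psi>. p \<in> set ps \<Longrightarrow> A (fst p) (S \<psi>) = S (\<lambda>x. character (w (fst p)) x * \<psi> x)"
    and \<psi>: "schwartz \<psi>"
  shows "devs ps t (S \<psi>) = t (S (\<lambda>x. (\<Prod>p\<leftarrow>ps. character (w (fst p)) x - snd p) * \<psi> x)) \<and>
    schwartz (\<lambda>x. (\<Prod>p\<leftarrow>ps. character (w (fst p)) x - snd p) * \<psi> x)"
  using A \<psi>
proof (induction ps arbitrary: \<psi>)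
  case (Cons p ps)
  let ?G = "\<lambda>x. \<Prod>p\<leftarrow>ps. character (w (fst p)) x - snd p"
  let ?c = "character (w (fst p))"
  have c: "schwartz (\<lambda>x. ?c x * \<psi> x)" by (rule schwartz_multiplier[OF multiplier_character Cons.prems(2)])
  have IH: "devs ps t (S \<psi>) = t (S (\<lambda>x. ?G x * \<psi> x)) \<and> schwartz (\<lambda>x. ?G x * \<psi> x)"
    if "schwartz \<psi>" for \<psi>
    by (rule Cons.IH[OF _ that]) (simp add: Cons.prems(1))
  have s: "schwartz (\<lambda>x. ?G x * (?c x * \<psi> x))" "schwartz (\<lambda>x. ?G x * \<psi> x)"
    using IH[OF c] IH[OF Cons.prems(2)] by blast+
  have e: "(\<lambda>x. 1 * (?G x * (?c x * \<psi> x)) + (- snd p) * (?G x * \<psi> x)) =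
      (\<lambda>x. (\<Prod>p\<leftarrow>p # ps. character (w (fst p)) x - snd p) * \<psi> x)"
    by (simp add: fun_eq_iff algebra_simps)
  have "devs (p # ps) t (S \<psi>) = 1 * t (S (\<lambda>x. ?G x * (?c x * \<psi> x))) + (- snd p) * t (S (\<lambda>x. ?G x * \<psi> x))"
    using IH[OF c] IH[OF Cons.prems(2)] by (simp add: dev_def Cons.prems(1))
  also have "\<dots> = t (S (\<lambda>x. 1 * (?G x * (?c x * \<psi> x)) + (- snd p) * (?G x * \<psi> x)))"
    using linear_functional_combination[OF u s, of 1 "- snd p"] by (simp only:)
  finally show ?case
    using schwartz_combination[OF s, of 1 "- snd p"] unfolding e by blast
qed simp

lemma devs_annihilate:
  assumes u: "tempered (\<lambda>\<psi>. t (S \<psi>))"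
    and surj: "\<And>\<phi>. schwartz \<phi> \<Longrightarrow> \<exists>\<psi>. schwartz \<psi> \<and> S \<psi> = \<phi>"
    and A: "\<And>i \<psi>. A (k i) (S \<psi>) = S (\<lambda>x. character (w (k i)) x * \<psi> x)"
    and \<alpha>: "\<And>i. cmod (\<alpha> i) = 1"
    and supp: "\<And>\<sigma>. \<sigma> \<in> distr_support (\<lambda>\<psi>. t (S \<psi>)) \<Longrightarrow> \<exists>i\<in>{1..n}. character (w (k i)) \<sigma> = \<alpha> i"
  shows "\<exists>M. devs (concat (replicate M (map (\<lambda>i. (k i, \<alpha> i)) [1..<Suc n]))) t \<doteq> (\<lambda>\<phi>. 0)"
proof -
  obtain M where M: "\<And>\<phi>. schwartz \<phi> \<Longrightarrow> t (S (\<lambda>x. (\<Prod>i\<in>{1..n}. character (w (k i)) x - \<alpha> i) ^ M * \<phi> x)) = 0"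
    using character_product_power_annihilates[OF u, of "{1..n}" \<alpha> "\<lambda>i. w (k i)"] \<alpha> supp by auto
  let ?ps = "concat (replicate M (map (\<lambda>i. (k i, \<alpha> i)) [1..<Suc n]))"
  have prod: "(\<Prod>p\<leftarrow>?ps. character (w (fst p)) x - snd p) = (\<Prod>i\<in>{1..n}. character (w (k i)) x - \<alpha> i) ^ M" for x
  proof -
    have "(\<Prod>p\<leftarrow>concat (replicate M ps). f p) = (\<Prod>p\<leftarrow>ps. f p) ^ M" for f :: "'k \<times> complex \<Rightarrow> complex" and ps
      by (induction M) simp_all
    moreover have "(\<Prod>p\<leftarrow>map (\<lambda>i. (k i, \<alpha> i)) [1..<Suc n]. character (w (fst p)) x - snd p) =
        (\<Prod>i\<in>{1..n}. character (w (k i)) x - \<alpha> i)"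
      by (induction n) (simp_all add: mult.commute)
    ultimately show ?thesis by simp
  qed
  have "devs ?ps t (S \<psi>) = 0" if "schwartz \<psi>" for \<psi>
  proof -
    have "devs ?ps t (S \<psi>) = t (S (\<lambda>x. (\<Prod>p\<leftarrow>?ps. character (w (fst p)) x - snd p) * \<psi> x))"
    proof (rule devs_as_multiplication[where t = t and S = S and w = w, OF tempered_linear[OF u] _ that, THEN conjunct1])
      show "A (fst p) (S \<psi>) = S (\<lambda>x. character (w (fst p)) x * \<psi> x)" if p: "p \<in> set ?ps" for p \<psi>
      proof -
        obtain i where "p = (k i, \<alpha> i)" using p by (auto simp del: upt_Suc split: if_splits)
        then show ?thesis using A[of i \<psi>] by simp
      qed
    qed
    then show ?thesis unfolding prod using M[OF that] by simp
  qed
  then have "devs ?ps t \<phi> = 0" if "schwartz \<phi>" for \<phi>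
    using surj[OF that] by blast
  then show ?thesis unfolding distr_eq_def by blast
qed

end

section \<open>Distributions generated by the Weyl algebra\<close>

text \<open>The module over the Weyl algebra of polynomial differential operators that is generated by \<open>B\<close>. An inductive
  definition leaves the order of the operators open; it also makes the module closed under modulations and
  translations by rule induction, as soon as the generators are eigenvectors of them.\<close>

inductive weyl_span :: "('n::finite) functional set \<Rightarrow> 'n functional \<Rightarrow> bool" for B where
  base: "t \<in> B \<Longrightarrow> weyl_span B t"
| zero: "weyl_span B (\<lambda>\<phi>. 0)"
| eq: "weyl_span B t \<Longrightarrow> t \<doteq> u \<Longrightarrow> weyl_span B u"
| comb: "weyl_span B t \<Longrightarrow> weyl_span B u \<Longrightarrow> weyl_span B (\<lambda>\<phi>. a * t \<phi> + b * u \<phi>)"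
| coord: "weyl_span B t \<Longrightarrow> weyl_span B (coord_mult i t)"
| deriv: "weyl_span B t \<Longrightarrow> weyl_span B (distr_deriv i t)"

lemma weyl_span_sum:
  "(\<And>a. a \<in> F \<Longrightarrow> weyl_span B (T a)) \<Longrightarrow> weyl_span B (\<lambda>\<phi>. \<Sum>a\<in>F. c a * T a \<phi>)"
proof (induction F rule: infinite_finite_induct)
  case (insert a F)
  then have "weyl_span B (T a)" "weyl_span B (\<lambda>\<phi>. \<Sum>a\<in>F. c a * T a \<phi>)" by simp_all
  from weyl_span.comb[OF this, of "c a" 1] insert.hyps show ?case by simp
qed (simp_all add: weyl_span.zero)

lemma coord_mult_apply: "coord_mult i t \<phi> = t (\<lambda>x. of_real (x $ i) * \<phi> x)"
  by (simp add: coord_mult_def fun_mult_def)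

lemma partial_schwartz_linear:
  "schwartz \<phi> \<Longrightarrow> schwartz \<psi> \<Longrightarrow> partial i (\<lambda>x. a * \<phi> x + b * \<psi> x) = (\<lambda>x. a * partial i \<phi> x + b * partial i \<psi> x)"
  using schwartz_operator_linear[OF schwartz_operator_partial] .

text \<open>Linearity is part of the induction since the product rule, applied inside a functional, needs it.\<close>

lemma weyl_span_linear:
  assumes B: "\<And>u. u \<in> B \<Longrightarrow> linear_functional u" and t: "weyl_span B t"
  shows "linear_functional t"
  using t
proof induction
  case (base t)
  then show ?case by (rule B)
next
  case zero
  show ?case by (simp add: linear_functional_def)
next
  case (eq t u)
  then show ?case by (simp add: linear_functional_def distr_eq_def schwartz_combination)
next
  case (comb t u a b)
  then show ?case by (simp add: linear_functional_def algebra_simps)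
next
  case (coord t i)
  show ?case
    unfolding linear_functional_def coord_mult_apply
  proof (intro allI impI)
    fix \<phi> \<psi> :: "real ^ 'a \<Rightarrow> complex" and a b
    assume s: "schwartz \<phi>" "schwartz \<psi>"
    show "t (\<lambda>x. of_real (x $ i) * (a * \<phi> x + b * \<psi> x)) =
        a * t (\<lambda>x. of_real (x $ i) * \<phi> x) + b * t (\<lambda>x. of_real (x $ i) * \<psi> x)"
      using linear_functional_combination[OF coord.IH schwartz_coord_mult[OF s(1)] schwartz_coord_mult[OF s(2)], where a = a and b = b]
      by (simp add: distrib_left mult.left_commute)
  qed
next
  case (deriv t i)
  show ?case
    unfolding linear_functional_def distr_deriv_def
  proof (intro allI impI)
    fix \<phi> \<psi> :: "real ^ 'a \<Rightarrow> complex" and a b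
    assume s: "schwartz \<phi>" "schwartz \<psi>"
    show "- t (partial i (\<lambda>x. a * \<phi> x + b * \<psi> x)) = a * - t (partial i \<phi>) + b * - t (partial i \<psi>)"
      unfolding partial_schwartz_linear[OF s]
      using linear_functional_combination[OF deriv.IH schwartz_partial[OF s(1)] schwartz_partial[OF s(2)]]
      by simp
  qed
qed

lemma fun_mult_distr_deriv:
  assumes t: "linear_functional t" and \<phi>: "schwartz \<phi>"
  shows "fun_mult (character v) (distr_deriv i t) \<phi> =
    distr_deriv i (fun_mult (character v) t) \<phi> - two_pi_i * of_real (v $ i) * fun_mult (character v) t \<phi>"
proof -
  have e: "schwartz (\<lambda>x. character v x * \<phi> x)" "schwartz (\<lambda>x. character v x * partial i \<phi> x)"
    by (rule schwartz_multiplier[OF multiplier_character], fact \<phi> schwartz_partial[OF \<phi>])+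
  have "partial i (\<lambda>x. character v x * \<phi> x) =
      (\<lambda>x. two_pi_i * of_real (v $ i) * (character v x * \<phi> x) + 1 * (character v x * partial i \<phi> x))"
    unfolding smooth_partial_mult[OF smooth_character schwartz_smooth[OF \<phi>]] partial_character by (simp add: mult.assoc)
  then show ?thesis
    using linear_functional_combination[OF t e, of "two_pi_i * of_real (v $ i)" 1]
    by (simp add: fun_mult_def distr_deriv_def)
qed

lemma weyl_span_character:
  assumes B: "\<And>u. u \<in> B \<Longrightarrow> linear_functional u"
    and ev: "\<And>u. u \<in> B \<Longrightarrow> \<exists>c. fun_mult (character v) u \<doteq> (\<lambda>\<phi>. c * u \<phi>)"
    and t: "weyl_span B t"
  shows "weyl_span B (fun_mult (character v) t)"
  using t
proof induction
  case (base t)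
  obtain c where "fun_mult (character v) t \<doteq> (\<lambda>\<phi>. c * t \<phi>)" using ev[OF base] by blast
  then have e: "(\<lambda>\<phi>. c * t \<phi> + 1 * 0) \<doteq> fun_mult (character v) t"
    by (simp add: distr_eq_sym)
  show ?case by (rule weyl_span.eq[OF weyl_span.comb[OF weyl_span.base[OF base] weyl_span.zero] e])
next
  case zero
  show ?case unfolding fun_mult_def[abs_def] by (rule weyl_span.zero)
next
  case (eq t u)
  show ?case
  proof (rule weyl_span.eq[OF eq.IH], unfold distr_eq_def fun_mult_def, intro allI impI)
    fix \<phi> :: "real ^ 'a \<Rightarrow> complex" assume \<phi>: "schwartz \<phi>"
    show "t (\<lambda>x. character v x * \<phi> x) = u (\<lambda>x. character v x * \<phi> x)"
      using eq.hyps(2) schwartz_multiplier[OF multiplier_character \<phi>] unfolding distr_eq_def by blast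
  qed
next
  case (comb t u a b)
  then show ?case unfolding fun_mult_def[abs_def] by (intro weyl_span.comb)
next
  case (coord t i)
  have "fun_mult (character v) (coord_mult i t) = coord_mult i (fun_mult (character v) t)"
    by (simp add: coord_mult_def fun_mult_def fun_eq_iff mult.left_commute)
  then show ?case using weyl_span.coord[OF coord.IH] by simp
next
  case (deriv t i)
  show ?case
    by (rule weyl_span.eq[OF weyl_span.comb[OF weyl_span.deriv[OF deriv.IH, of i] deriv.IH, of 1 "- (two_pi_i * of_real (v $ i))"]])
       (simp add: distr_eq_def fun_mult_distr_deriv[OF weyl_span_linear[OF B deriv.hyps]])
qed

lemma weyl_span_translation:
  assumes B: "\<And>u. u \<in> B \<Longrightarrow> linear_functional u"
    and ev: "\<And>u. u \<in> B \<Longrightarrow> \<exists>c. (\<lambda>\<phi>. u (\<lambda>x. \<phi> (x + v))) \<doteq> (\<lambda>\<phi>. c * u \<phi>)"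
    and t: "weyl_span B t"
  shows "weyl_span B (\<lambda>\<phi>. t (\<lambda>x. \<phi> (x + v)))"
  using t
proof induction
  case (base t)
  obtain c where "(\<lambda>\<phi>. t (\<lambda>x. \<phi> (x + v))) \<doteq> (\<lambda>\<phi>. c * t \<phi>)" using ev[OF base] by blast
  then have e: "(\<lambda>\<phi>. c * t \<phi> + 1 * 0) \<doteq> (\<lambda>\<phi>. t (\<lambda>x. \<phi> (x + v)))"
    by (simp add: distr_eq_sym)
  show ?case by (rule weyl_span.eq[OF weyl_span.comb[OF weyl_span.base[OF base] weyl_span.zero] e])
next
  case zero
  show ?case by (rule weyl_span.zero)
next
  case (eq t u)
  show ?case
  proof (rule weyl_span.eq[OF eq.IH], unfold distr_eq_def, intro allI impI)
    fix \<phi> :: "real ^ 'a \<Rightarrow> complex" assume \<phi>: "schwartz \<phi>"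
    show "t (\<lambda>x. \<phi> (x + v)) = u (\<lambda>x. \<phi> (x + v))"
      using eq.hyps(2) schwartz_translation[OF \<phi>, of v] unfolding distr_eq_def by blast
  qed
next
  case (comb t u a b)
  then show ?case by (intro weyl_span.comb)
next
  case (coord t i)
  have "coord_mult i t (\<lambda>x. \<phi> (x + v)) =
      1 * coord_mult i (\<lambda>\<phi>. t (\<lambda>x. \<phi> (x + v))) \<phi> + - of_real (v $ i) * t (\<lambda>x. \<phi> (x + v))" if \<phi>: "schwartz \<phi>" for \<phi>
    using linear_functional_combination[OF weyl_span_linear[OF B coord.hyps]
        schwartz_coord_mult[OF schwartz_translation[OF \<phi>, of v], of i] schwartz_translation[OF \<phi>, of v], of 1 "of_real (v $ i)"]
    by (simp add: coord_mult_apply distrib_right)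
  then show ?case
    by (intro weyl_span.eq[OF weyl_span.comb[OF weyl_span.coord[OF coord.IH, of i] coord.IH, of 1 "- of_real (v $ i)"]])
       (simp add: distr_eq_def)
next
  case (deriv t i)
  show ?case
    by (rule weyl_span.eq[OF weyl_span.deriv[OF deriv.IH, of i]])
       (simp add: distr_eq_def distr_deriv_def partial_translation[OF schwartz_smooth])
qed

text \<open>The conjugates of the lattice operators are compositions of polynomial differential operators with modulations
  and translations under which the generators are eigenvectors.\<close>

lemma weyl_span_lattice_conj:
  fixes l lam :: "'n::finite \<Rightarrow> real ^ 'n"
  assumes B: "\<And>u. u \<in> B \<Longrightarrow> linear_functional u"
    and ev: "\<And>u a. u \<in> B \<Longrightarrow> \<exists>c. fun_mult (character (- lam a)) u \<doteq> (\<lambda>\<phi>. c * u \<phi>)"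
      "\<And>u b. u \<in> B \<Longrightarrow> \<exists>c. (\<lambda>\<phi>. u (\<lambda>x. \<phi> (x + l b))) \<doteq> (\<lambda>\<phi>. c * u \<phi>)"
    and t: "weyl_span B t"
  shows "weyl_span B (\<lambda>\<phi>. t (lattice_conj l lam k \<phi>))"
proof (cases k)
  case (Inl a)
  note e = schwartz_multiplier[OF multiplier_character]
  have lin: "linear_functional t" by (rule weyl_span_linear[OF B t])
  let ?T = "\<lambda>i. distr_deriv i (fun_mult (character (- lam a)) t)"
  have W: "weyl_span B (\<lambda>\<phi>. \<Sum>i\<in>UNIV. inverse two_pi_i * of_real (l a $ i) * ?T i \<phi>)"
    by (intro weyl_span_sum weyl_span.deriv weyl_span_character[OF B ev(1) t])
  show ?thesis
  proof (rule weyl_span.eq[OF W], unfold distr_eq_def, intro allI impI)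
    fix \<phi> :: "real ^ 'n \<Rightarrow> complex"
    assume \<phi>: "schwartz \<phi>"
    have s: "schwartz (\<lambda>x. character (- lam a) x * partial i \<phi> x)" for i
      by (rule e[OF schwartz_partial[OF \<phi>]])
    show "(\<Sum>i\<in>UNIV. inverse two_pi_i * of_real (l a $ i) * ?T i \<phi>) = t (lattice_conj l lam k \<phi>)"
      unfolding Inl lattice_conj.simps linear_functional_sum[OF lin schwartz_cmult[OF s]] linear_functional_cmult[OF lin s]
      by (rule sum.cong) (simp_all add: distr_deriv_def fun_mult_def)
  qed
next
  case (Inr b)
  have lin: "linear_functional t" by (rule weyl_span_linear[OF B t])
  let ?T = "\<lambda>i \<phi>. coord_mult i t (\<lambda>x. \<phi> (x + l b))"
  have W: "weyl_span B (\<lambda>\<phi>. \<Sum>i\<in>UNIV. - of_real (lam b $ i) * ?T i \<phi>)"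
    by (intro weyl_span_sum weyl_span_translation[OF B ev(2)] weyl_span.coord t)
  show ?thesis
  proof (rule weyl_span.eq[OF W], unfold distr_eq_def, intro allI impI)
    fix \<phi> :: "real ^ 'n \<Rightarrow> complex"
    assume \<phi>: "schwartz \<phi>"
    have s: "schwartz (\<lambda>x. of_real (x $ i) * \<phi> (x + l b))" for i
      by (rule schwartz_coord_mult[OF schwartz_translation[OF \<phi>]])
    show "(\<Sum>i\<in>UNIV. - of_real (lam b $ i) * ?T i \<phi>) = t (lattice_conj l lam k \<phi>)"
      unfolding Inr lattice_conj.simps linear_functional_sum[OF lin schwartz_cmult[OF s]] linear_functional_cmult[OF lin s]
      by (rule sum.cong) (simp_all add: coord_mult_apply)
  qed
qed

lemma delta_sum_translate: "delta_sum (translate L q) \<phi> = delta_sum L (\<lambda>x. \<phi> (x + q))"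
  unfolding delta_sum_def translate_def
  by (subst infsum_reindex) (simp_all add: inj_on_def o_def)

lemma tempered_delta_translate:
  assumes "dual_bases l lam"
  shows "tempered (delta_sum (translate (lattice_dual_to lam) q))"
  unfolding delta_sum_translate[abs_def]
  by (rule tempered_operator[OF tempered_delta_lattice[OF assms] schwartz_operator_translation])

text \<open>A modulation can be moved to the left of the differential operators by
  \<open>\<partial>\<^sub>m (e u) = e (\<partial>\<^sub>m u + j \<eta>\<^sub>m u)\<close>, \<open>e\<close> the character of \<open>\<eta>\<close>.\<close>

lemma weyl_span_modulation:
  assumes lin: "\<And>i. linear_functional (\<delta> i)"
    and t: "weyl_span {fun_mult (character (\<eta> k)) (\<delta> i) |k i. k \<in> S \<and> i \<in> R} t" and fin: "finite S" "finite R"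
  shows "\<exists>u. (\<forall>i k. weyl_span {\<delta> i} (u i k)) \<and> t \<doteq> (\<lambda>\<phi>. \<Sum>k\<in>S. \<Sum>i\<in>R. fun_mult (character (\<eta> k)) (u i k) \<phi>)"
  using t
proof induction
  case (base t)
  then obtain k0 i0 where t: "t = fun_mult (character (\<eta> k0)) (\<delta> i0)" "k0 \<in> S" "i0 \<in> R" by blast
  let ?u = "\<lambda>i k. if i = i0 \<and> k = k0 then \<delta> i else (\<lambda>\<phi>. 0)"
  have "(\<Sum>k\<in>S. \<Sum>i\<in>R. fun_mult (character (\<eta> k)) (?u i k) \<phi>) = t \<phi>" for \<phi>
  proof -
    have "(\<Sum>k\<in>S. \<Sum>i\<in>R. fun_mult (character (\<eta> k)) (?u i k) \<phi>) = (\<Sum>k\<in>S. \<Sum>i\<in>R. if k = k0 then if i = i0 then t \<phi> else 0 else 0)"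
      by (intro sum.cong) (auto simp: t fun_mult_def)
    also have "\<dots> = (\<Sum>k\<in>S. if k = k0 then t \<phi> else 0)"
      by (rule sum.cong) (auto simp: sum.delta[OF fin(2)] t)
    also have "\<dots> = t \<phi>" by (simp add: sum.delta[OF fin(1)] t)
    finally show ?thesis .
  qed
  then show ?case
    by (intro exI[of _ ?u]) (auto intro: weyl_span.base weyl_span.zero)
next
  case zero
  show ?case by (intro exI[of _ "\<lambda>i k \<phi>. 0"]) (auto simp: fun_mult_def intro: weyl_span.zero)
next
  case (eq t u)
  then show ?case using distr_eq_trans[OF distr_eq_sym] by blast
next
  case (comb t t' a b)
  then obtain u u' where u: "\<And>i k. weyl_span {\<delta> i} (u i k)" "\<And>i k. weyl_span {\<delta> i} (u' i k)"
    "t \<doteq> (\<lambda>\<phi>. \<Sum>k\<in>S. \<Sum>i\<in>R. fun_mult (character (\<eta> k)) (u i k) \<phi>)"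
    "t' \<doteq> (\<lambda>\<phi>. \<Sum>k\<in>S. \<Sum>i\<in>R. fun_mult (character (\<eta> k)) (u' i k) \<phi>)" by blast
  show ?case
    by (intro exI[of _ "\<lambda>i k \<phi>. a * u i k \<phi> + b * u' i k \<phi>"] conjI allI weyl_span.comb u)
       (use u(3,4) in \<open>simp add: distr_eq_def fun_mult_def sum.distrib sum_distrib_left\<close>)
next
  case (coord t m)
  then obtain u where u: "\<And>i k. weyl_span {\<delta> i} (u i k)"
    "t \<doteq> (\<lambda>\<phi>. \<Sum>k\<in>S. \<Sum>i\<in>R. fun_mult (character (\<eta> k)) (u i k) \<phi>)" by blast
  show ?case
    by (intro exI[of _ "\<lambda>i k. coord_mult m (u i k)"] conjI allI weyl_span.coord u)
       (use u(2) in \<open>simp add: distr_eq_def fun_mult_def coord_mult_apply schwartz_coord_mult mult.left_commute\<close>)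
next
  case (deriv t m)
  then obtain u where u: "\<And>i k. weyl_span {\<delta> i} (u i k)"
    "t \<doteq> (\<lambda>\<phi>. \<Sum>k\<in>S. \<Sum>i\<in>R. fun_mult (character (\<eta> k)) (u i k) \<phi>)" by blast
  have ul: "linear_functional (u i k)" for i k
    by (rule weyl_span_linear[OF _ u(1)]) (auto simp: lin)
  let ?c = "\<lambda>k. two_pi_i * of_real (\<eta> k $ m)"
  have D: "fun_mult (character (\<eta> k)) (\<lambda>\<phi>. 1 * distr_deriv m (u i k) \<phi> + ?c k * u i k \<phi>) \<phi> =
      - fun_mult (character (\<eta> k)) (u i k) (partial m \<phi>)" if "schwartz \<phi>" for i k \<phi>
    using fun_mult_distr_deriv[OF ul[of i k] that, of "\<eta> k" m]
    unfolding fun_mult_def distr_deriv_def by algebra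
  show ?case
  proof (intro exI[of _ "\<lambda>i k \<phi>. 1 * distr_deriv m (u i k) \<phi> + ?c k * u i k \<phi>"] conjI allI weyl_span.comb weyl_span.deriv u)
    show "distr_deriv m t \<doteq> (\<lambda>\<phi>. \<Sum>k\<in>S. \<Sum>i\<in>R. fun_mult (character (\<eta> k)) (\<lambda>\<phi>. 1 * distr_deriv m (u i k) \<phi> + ?c k * u i k \<phi>) \<phi>)"
      unfolding distr_eq_def
    proof (intro allI impI)
      fix \<phi> :: "real ^ 'b \<Rightarrow> complex" assume \<phi>: "schwartz \<phi>"
      show "distr_deriv m t \<phi> = (\<Sum>k\<in>S. \<Sum>i\<in>R. fun_mult (character (\<eta> k)) (\<lambda>\<phi>. 1 * distr_deriv m (u i k) \<phi> + ?c k * u i k \<phi>) \<phi>)"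
        unfolding D[OF \<phi>] using u(2) schwartz_partial[OF \<phi>, of m]
        by (simp add: distr_eq_def distr_deriv_def sum_negf)
    qed
  qed
qed

lemma diff_op_Nil [simp]: "diff_op [] t = (\<lambda>\<phi>. 0)"
  by (simp add: diff_op_def poly_op_def fun_eq_iff)

lemma diff_op_Cons: "diff_op ((a, u, v) # P) t \<phi> = a * foldr coord_mult u (foldr distr_deriv v t) \<phi> + diff_op P t \<phi>"
  by (simp add: diff_op_def poly_op_def)

lemma diff_op_append: "diff_op (P @ Q) t \<phi> = diff_op P t \<phi> + diff_op Q t \<phi>"
  by (simp add: diff_op_def poly_op_def)

lemma diff_op_scale: "diff_op (map (\<lambda>(b, w). (a * b, w)) P) t \<phi> = a * diff_op P t \<phi>"
  by (induction P) (auto simp: diff_op_Cons distrib_left)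

lemma diff_op_coord: "diff_op (map (\<lambda>(b, u, v). (b, i # u, v)) P) t = coord_mult i (diff_op P t)"
proof (induction P)
  case Nil
  show ?case by (simp add: fun_eq_iff coord_mult_apply)
next
  case (Cons w P)
  then show ?case by (cases w) (auto simp: fun_eq_iff coord_mult_apply diff_op_Cons)
qed

lemma weyl_span_foldr:
  "weyl_span B t \<Longrightarrow> weyl_span B (foldr coord_mult u (foldr distr_deriv v t))"
proof (induction u)
  case Nil
  then show ?case by (induction v) (auto intro: weyl_span.deriv)
qed (auto intro: weyl_span.coord)

lemma distr_deriv_eq: "t \<doteq> u \<Longrightarrow> distr_deriv i t \<doteq> distr_deriv i u"
  by (simp add: distr_eq_def distr_deriv_def schwartz_partial)

lemma coord_mult_eq: "t \<doteq> u \<Longrightarrow> coord_mult i t \<doteq> coord_mult i u"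
  by (simp add: distr_eq_def coord_mult_apply schwartz_coord_mult)

lemma distr_deriv_coord_mult:
  assumes t: "linear_functional t"
  shows "distr_deriv i (coord_mult j t) \<doteq> (\<lambda>\<phi>. 1 * coord_mult j (distr_deriv i t) \<phi> + of_bool (i = j) * t \<phi>)"
  unfolding distr_eq_def
proof (intro allI impI)
  fix \<phi> :: "real ^ 'a \<Rightarrow> complex"
  assume \<phi>: "schwartz \<phi>"
  have "smooth_fun (\<lambda>x :: real ^ 'a. of_real (x $ j))" using multiplier_coord unfolding multiplier_def by blast
  from smooth_partial_mult[OF this schwartz_smooth[OF \<phi>], of i]
  have "partial i (\<lambda>x. of_real (x $ j) * \<phi> x) = (\<lambda>x. of_bool (i = j) * \<phi> x + 1 * (of_real (x $ j) * partial i \<phi> x))"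
    unfolding partial_coord by (simp add: fun_eq_iff)
  then show "distr_deriv i (coord_mult j t) \<phi> = 1 * coord_mult j (distr_deriv i t) \<phi> + of_bool (i = j) * t \<phi>"
    using linear_functional_combination[OF t \<phi> schwartz_coord_mult[OF schwartz_partial[OF \<phi>, of i], of j], of "of_bool (i = j)" 1]
    by (simp add: distr_deriv_def coord_mult_apply)
qed

text \<open>Normal ordering: \<open>distr_deriv_coord_mult\<close> moves derivatives to the right of the coordinates.\<close>

lemma weyl_span_diff_op:
  assumes lin: "linear_functional \<delta>" and t: "weyl_span {\<delta>} t"
  shows "\<exists>P. t \<doteq> diff_op P \<delta>"
proof -
  have R_comb: "\<exists>P. (\<lambda>\<phi>. a * t \<phi> + b * u \<phi>) \<doteq> diff_op P \<delta>"
    if tu: "\<exists>P. t \<doteq> diff_op P \<delta>" "\<exists>P. u \<doteq> diff_op P \<delta>" for t u a b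
  proof -
    obtain P Q where "t \<doteq> diff_op P \<delta>" "u \<doteq> diff_op Q \<delta>" using tu by blast
    then show ?thesis
      by (intro exI[of _ "map (\<lambda>(b, w). (a * b, w)) P @ map (\<lambda>(c, w). (b * c, w)) Q"])
         (simp add: distr_eq_def diff_op_append diff_op_scale)
  qed
  have R_coord: "\<exists>P. coord_mult i t \<doteq> diff_op P \<delta>" if t: "\<exists>P. t \<doteq> diff_op P \<delta>" for t i
  proof -
    obtain P where "t \<doteq> diff_op P \<delta>" using t by blast
    from coord_mult_eq[OF this] show ?thesis unfolding diff_op_coord[symmetric] by blast
  qed
  have R_eq: "\<exists>P. u \<doteq> diff_op P \<delta>" if "\<exists>P. t \<doteq> diff_op P \<delta>" "u \<doteq> t" for t u
    using that distr_eq_trans by blast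
  have lin': "linear_functional (foldr coord_mult u (foldr distr_deriv v \<delta>))" for u v
    by (rule weyl_span_linear[OF _ weyl_span_foldr[OF weyl_span.base[of \<delta> "{\<delta>}"]]]) (auto simp: lin)
  have single: "\<exists>P. foldr coord_mult u (foldr distr_deriv v \<delta>) \<doteq> diff_op P \<delta>" for u v
    by (intro exI[of _ "[(1, u, v)]"]) (simp add: distr_eq_def diff_op_Cons)
  have R_term: "\<exists>P. distr_deriv i (foldr coord_mult u (foldr distr_deriv v \<delta>)) \<doteq> diff_op P \<delta>" for i u v
  proof (induction u)
    case Nil
    show ?case using single[of "[]" "i # v"] by simp
  next
    case (Cons j u)
    let ?t = "foldr coord_mult u (foldr distr_deriv v \<delta>)"
    show ?case
      using R_eq[OF R_comb[OF R_coord[OF Cons.IH, of j] single[of u v]] distr_deriv_coord_mult[OF lin', of i j u v]]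
      by simp
  qed
  have R_deriv: "\<exists>Q. distr_deriv i (diff_op P \<delta>) \<doteq> diff_op Q \<delta>" for i P
  proof (induction P)
    case Nil
    show ?case by (intro exI[of _ "[]"]) (simp add: distr_eq_def distr_deriv_def)
  next
    case (Cons w P)
    obtain a u v where w: "w = (a, u, v)" by (cases w)
    have "distr_deriv i (diff_op (w # P) \<delta>) =
        (\<lambda>\<phi>. a * distr_deriv i (foldr coord_mult u (foldr distr_deriv v \<delta>)) \<phi> + 1 * distr_deriv i (diff_op P \<delta>) \<phi>)"
      by (simp add: w distr_deriv_def diff_op_Cons fun_eq_iff)
    then show ?case using R_comb[OF R_term Cons.IH, of a i u v 1] by simp
  qed
  show ?thesis
    using t
  proof induction
    case (base t)
    then show ?case using single[of "[]" "[]"] by simp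
  next
    case zero
    show ?case by (intro exI[of _ "[]"]) simp
  next
    case (eq t u)
    then show ?case using distr_eq_trans[OF distr_eq_sym] by blast
  next
    case (comb t u a b)
    from this(3,4) show ?case by (rule R_comb)
  next
    case (coord t i)
    from this(2) show ?case by (rule R_coord)
  next
    case (deriv t i)
    then obtain P where "t \<doteq> diff_op P \<delta>" by blast
    from distr_deriv_eq[OF this, of i] show ?case using R_deriv[of i P] distr_eq_trans by blast
  qed
qed

section \<open>Distributions on a crystal with spectrum in translates of the dual lattice\<close>

lemma crystal_annihilator:
  fixes t :: "'n::finite functional"
  assumes d: "dual_bases l lam" and t: "tempered t"
    and supp: "distr_support t \<subseteq> crystal (lattice_dual_to lam) I q"
  shows "\<exists>M. foldr (weyl_pairs.dev (lattice_op l lam))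
    (concat (replicate M (map (\<lambda>i. (Inl (f i), character (lam (f i)) (q i))) [1..<Suc I]))) t \<doteq> (\<lambda>\<phi>. 0)"
proof (rule weyl_pairs.devs_annihilate[OF lattice_weyl_pairs[OF d], where S = "\<lambda>\<psi>. \<psi>" and w = "case_sum lam l"])
  fix \<sigma> assume "\<sigma> \<in> distr_support t"
  then obtain i p where "i \<in> {1..I}" "p \<in> lattice_dual_to lam" "\<sigma> = p + q i"
    using supp by (auto simp: crystal_def translate_def)
  then show "\<exists>i\<in>{1..I}. character (case_sum lam l (Inl (f i))) \<sigma> = character (lam (f i)) (q i)"
    by (intro bexI[of _ i]) (simp_all add: character_add character_lattice[OF d])
qed (auto simp: t)

text \<open>This applies \<open>generated_by_joint_eigenvectors\<close> to the lattice operators. The annihilating products are indexed by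
  choice functions \<open>f\<close>, one index \<open>f i\<close> for every coset. If the joint eigenvalues differed from
  those of each coset at some index, a choice of such indices would give a product without a vanishing factor. Hence the
  eigenvalues belong to one coset \<open>i\<close> in space and one coset \<open>k\<close> in the spectrum, and \<open>lattice_invariant\<close>
  identifies the eigenvector.\<close>

lemma generated_by_modulated_delta_sums:
  fixes t :: "'n::finite functional"
  assumes d: "dual_bases l lam" and t: "tempered t"
    and supp: "distr_support t \<subseteq> crystal (lattice_dual_to lam) I q"
    and fsupp: "distr_support (fourier t) \<subseteq> crystal (lattice_dual_to l) K \<eta>"
  shows "weyl_span {fun_mult (character (\<eta> k)) (delta_sum (translate (lattice_dual_to lam) (q i))) |k i. k \<in> {1..K} \<and> i \<in> {1..I}} t"
proof -
  let ?L = "lattice_dual_to lam"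
  let ?\<delta> = "\<lambda>i. delta_sum (translate ?L (q i))"
  define B where "B = {fun_mult (character (\<eta> k)) (?\<delta> i) |k i. k \<in> {1..K} \<and> i \<in> {1..I}}"
  interpret weyl_pairs "lattice_op l lam" "lattice_conj l lam" by (rule lattice_weyl_pairs[OF d])
  define G where "G = range (\<lambda>f. map (\<lambda>i. (Inl (f i) :: 'n + 'n, character (lam (f i)) (q i))) [1..<Suc I]) \<union>
    range (\<lambda>f. map (\<lambda>k. (Inr (f k) :: 'n + 'n, character (l (f k)) (\<eta> k))) [1..<Suc K])"
  have B_lin: "linear_functional u" if u: "u \<in> B" for u
  proof -
    obtain k i where u: "u = fun_mult (character (\<eta> k)) (?\<delta> i)" using u B_def by blast
    show ?thesis
      unfolding u fun_mult_def[abs_def]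
      by (rule tempered_linear[OF tempered_operator[OF tempered_delta_translate[OF d] schwartz_operator_multiplier[OF multiplier_character]]])
  qed
  have B_char: "\<exists>c. fun_mult (character (- lam a)) u \<doteq> (\<lambda>\<phi>. c * u \<phi>)" if u: "u \<in> B" for u a
  proof -
    obtain k i where u: "u = fun_mult (character (\<eta> k)) (?\<delta> i)" using u B_def by blast
    have u_eq: "u \<phi> = (\<Sum>\<^sub>\<infinity>p\<in>?L. character (\<eta> k) (p + q i) * \<phi> (p + q i))" for \<phi>
      unfolding u fun_mult_def delta_sum_translate unfolding delta_sum_def ..
    have "fun_mult (character (- lam a)) u \<phi> = character (- lam a) (q i) * u \<phi>" for \<phi>
    proof -
      have "fun_mult (character (- lam a)) u \<phi> = (\<Sum>\<^sub>\<infinity>p\<in>?L. character (- lam a) (q i) * (character (\<eta> k) (p + q i) * \<phi> (p + q i)))"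
        unfolding fun_mult_def u_eq
        by (rule infsum_cong) (simp add: character_add character_minus character_lattice[OF d])
      then show ?thesis unfolding infsum_cmult_right' u_eq .
    qed
    then show ?thesis by (auto simp: distr_eq_def)
  qed
  have B_trans: "\<exists>c. (\<lambda>\<phi>. u (\<lambda>x. \<phi> (x + l b))) \<doteq> (\<lambda>\<phi>. c * u \<phi>)" if u: "u \<in> B" for u b
  proof -
    obtain k i where u: "u = fun_mult (character (\<eta> k)) (?\<delta> i)" using u B_def by blast
    have u_eq: "u \<phi> = (\<Sum>\<^sub>\<infinity>p\<in>?L. character (\<eta> k) (p + q i) * \<phi> (p + q i))" for \<phi>
      unfolding u fun_mult_def delta_sum_translate unfolding delta_sum_def ..
    have "u (\<lambda>x. \<phi> (x + l b)) = character (\<eta> k) (- l b) * u \<phi>" for \<phi>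
    proof -
      have "u (\<lambda>x. \<phi> (x + l b)) = (\<Sum>\<^sub>\<infinity>p\<in>?L. character (\<eta> k) (- l b) * (character (\<eta> k) (p + l b + q i) * \<phi> (p + l b + q i)))"
        unfolding u_eq by (rule infsum_cong) (simp add: character_add character_minus add_ac)
      then show ?thesis
        unfolding infsum_cmult_right' infsum_lattice_translate[OF lattice_dual_to_basis[OF d], of "\<lambda>p. character (\<eta> k) (p + q i) * \<phi> (p + q i)"] u_eq .
    qed
    then show ?thesis by (auto simp: distr_eq_def)
  qed
  have "weyl_span B t"
  proof (rule generated_by_joint_eigenvectors[of G "weyl_span B", OF _ weyl_span.zero _ _ _ _ t])
    show "weyl_span B u'" if "weyl_span B u" "u \<doteq> u'" for u u'
      using that by (rule weyl_span.eq)
    show "weyl_span B (\<lambda>\<phi>. a * u \<phi> + b * u' \<phi>)" if "weyl_span B u" "weyl_span B u'" for u u' a b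
      using that by (rule weyl_span.comb)
    show "\<exists>ps\<in>G. fst ` set ps \<subseteq> {k}" for k
    proof (cases k)
      case (Inl a)
      show ?thesis
      proof (rule bexI)
        show "map (\<lambda>i. (Inl a, character (lam a) (q i))) [1..<Suc I] \<in> G"
          unfolding G_def by (rule UnI1, rule image_eqI[of _ _ "\<lambda>_. a"]) auto
      qed (auto simp: Inl simp del: upt_Suc)
    next
      case (Inr b)
      show ?thesis
      proof (rule bexI)
        show "map (\<lambda>k. (Inr b, character (l b) (\<eta> k))) [1..<Suc K] \<in> G"
          unfolding G_def by (rule UnI2, rule image_eqI[of _ _ "\<lambda>_. b"]) auto
      qed (auto simp: Inr simp del: upt_Suc)
    qed
    show "weyl_span B (der k u)" if "weyl_span B u" for u k
      unfolding der_def[abs_def] by (rule weyl_span_lattice_conj[OF B_lin B_char B_trans that])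
    show "\<exists>M. devs (concat (replicate M ps)) t \<doteq> (\<lambda>\<phi>. 0)" if "ps \<in> G" for ps
      using that unfolding G_def
    proof (elim UnE rangeE)
      fix f assume ps: "ps = map (\<lambda>i. (Inl (f i), character (lam (f i)) (q i))) [1..<Suc I]"
      show ?thesis unfolding ps by (rule crystal_annihilator[OF d t supp])
    next
      fix f assume ps: "ps = map (\<lambda>k. (Inr (f k), character (l (f k)) (\<eta> k))) [1..<Suc K]"
      show ?thesis
        unfolding ps
      proof (rule devs_annihilate[where S = fourier_fun and w = "case_sum lam l"])
        show "tempered (\<lambda>\<psi>. t (fourier_fun \<psi>))" using tempered_fourier[OF t] by (simp add: fourier_def[abs_def])
        show "\<exists>\<psi>. schwartz \<psi> \<and> fourier_fun \<psi> = \<phi>" if "schwartz \<phi>" for \<phi> :: "real ^ 'n \<Rightarrow> complex"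
          by (rule fourier_fun_surjective[OF that])
        show "lattice_op l lam (Inr (f i)) (fourier_fun \<psi>) = fourier_fun (\<lambda>x. character (case_sum lam l (Inr (f i))) x * \<psi> x)" for i \<psi>
          by (simp add: fun_eq_iff fourier_fun_character_mult)
        fix \<sigma> assume "\<sigma> \<in> distr_support (\<lambda>\<psi>. t (fourier_fun \<psi>))"
        then have "\<sigma> \<in> distr_support (fourier t)" by (simp add: fourier_def[abs_def])
        then obtain k p where "k \<in> {1..K}" "p \<in> lattice_dual_to l" "\<sigma> = p + \<eta> k"
          using fsupp by (auto simp: crystal_def translate_def)
        then show "\<exists>k\<in>{1..K}. character (case_sum lam l (Inr (f k))) \<sigma> = character (l (f k)) (\<eta> k)"
          by (intro bexI[of _ k]) (simp_all add: character_add character_lattice[OF dual_bases_sym[OF d]])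
      qed simp
    qed
    fix u r
    assume u: "tempered u" and ev: "\<And>k. dev (k, r k) u \<doteq> (\<lambda>\<phi>. 0)"
      and r: "\<And>ps. ps \<in> G \<Longrightarrow> \<exists>p\<in>set ps. r (fst p) = snd p"
    have ev_l: "u (\<lambda>x. character (lam a) x * \<phi> x) = r (Inl a) * u \<phi>"
      and ev_r: "u (\<lambda>x. \<phi> (x + - l a)) = r (Inr a) * u \<phi>" if "schwartz \<phi>" for a \<phi>
      using ev[of "Inl a"] ev[of "Inr a"] that by (simp_all add: distr_eq_def dev_def)
    have "\<exists>i\<in>{1..I}. \<forall>a. r (Inl a) = character (lam a) (q i)"
    proof (rule ccontr)
      assume "\<not> ?thesis"
      then have "\<forall>i. \<exists>a. i \<in> {1..I} \<longrightarrow> r (Inl a) \<noteq> character (lam a) (q i)" by blast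
      then obtain f where f: "\<And>i. i \<in> {1..I} \<Longrightarrow> r (Inl (f i)) \<noteq> character (lam (f i)) (q i)" by metis
      have "map (\<lambda>i. (Inl (f i), character (lam (f i)) (q i))) [1..<Suc I] \<in> G" unfolding G_def by blast
      from r[OF this] show False using f by (force simp del: upt_Suc)
    qed
    then obtain i where i: "i \<in> {1..I}" "\<And>a. r (Inl a) = character (lam a) (q i)" by blast
    have "\<exists>k\<in>{1..K}. \<forall>b. r (Inr b) = character (l b) (\<eta> k)"
    proof (rule ccontr)
      assume "\<not> ?thesis"
      then have "\<forall>k. \<exists>b. k \<in> {1..K} \<longrightarrow> r (Inr b) \<noteq> character (l b) (\<eta> k)" by blast
      then obtain f where f: "\<And>k. k \<in> {1..K} \<Longrightarrow> r (Inr (f k)) \<noteq> character (l (f k)) (\<eta> k)" by metis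
      have "map (\<lambda>k. (Inr (f k), character (l (f k)) (\<eta> k))) [1..<Suc K] \<in> G" unfolding G_def by blast
      from r[OF this] show False using f by (force simp del: upt_Suc)
    qed
    then obtain k where k: "k \<in> {1..K}" "\<And>b. r (Inr b) = character (l b) (\<eta> k)" by blast
    (* undo the modulation and the translation, to arrive at a lattice invariant distribution *)
    define s where "s \<phi> = u (\<lambda>x. character (- \<eta> k) x * \<phi> (x + - q i))" for \<phi>
    have sch: "schwartz (\<lambda>x. character (- \<eta> k) x * \<phi> (x + - q i))" if "schwartz \<phi>" for \<phi>
      by (rule schwartz_multiplier[OF multiplier_character schwartz_translation[OF that]])
    have s: "s \<phi> = s (cutoff lam 0) * delta_sum ?L \<phi>" if "schwartz \<phi>" for \<phi>
    proof (rule lattice_invariant[OF d _ _ _ that])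
      show "tempered s"
        unfolding s_def[abs_def]
        by (rule tempered_operator[OF u schwartz_operator_compose[OF schwartz_operator_multiplier[OF multiplier_character] schwartz_operator_translation]])
      show "s (\<lambda>x. character (lam a) x * \<phi> x) = s \<phi>" if "schwartz \<phi>" for a \<phi>
      proof -
        have "s (\<lambda>x. character (lam a) x * \<phi> x) =
            u (\<lambda>x. character (lam a) x * (inverse (character (lam a) (q i)) * (character (- \<eta> k) x * \<phi> (x + - q i))))"
          unfolding s_def character_add character_minus(2) by (simp add: mult_ac)
        also have "\<dots> = s \<phi>"
          unfolding ev_l[OF schwartz_cmult[OF sch[OF that]]] linear_functional_cmult[OF tempered_linear[OF u] sch[OF that]]
          by (simp add: i(2) s_def mult.assoc[symmetric])
        finally show ?thesis .
      qed
      show "s (\<lambda>x. \<phi> (x + - l b)) = s \<phi>" if "schwartz \<phi>" for b \<phi>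
      proof -
        let ?f = "\<lambda>x. character (- \<eta> k) x * \<phi> (x + - q i)"
        have "s (\<lambda>x. \<phi> (x + - l b)) = u (\<lambda>x. inverse (character (l b) (\<eta> k)) * ?f (x + - l b))"
          unfolding s_def character_add character_minus character_commute[of "\<eta> k" "l b"]
          by (rule arg_cong[where f = u]) (auto simp: fun_eq_iff field_simps add_ac)
        also have "\<dots> = s \<phi>"
          unfolding linear_functional_cmult[OF tempered_linear[OF u] schwartz_translation[OF sch[OF that]]] ev_r[OF sch[OF that]]
          by (simp add: k(2) s_def mult.assoc[symmetric])
        finally show ?thesis .
      qed
    qed
    (* the summand 0 * 0 matches the closure of the span under combinations *)
    have "u \<phi> = s (cutoff lam 0) * fun_mult (character (\<eta> k)) (?\<delta> i) \<phi> + 0 * 0" if \<phi>: "schwartz \<phi>" for \<phi>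
    proof -
      let ?f = "\<lambda>x. character (\<eta> k) (x + q i) * \<phi> (x + q i)"
      have f: "schwartz ?f"
        using schwartz_translation[OF schwartz_multiplier[OF multiplier_character \<phi>], of "\<eta> k" "q i"] .
      have "u \<phi> = s ?f" unfolding s_def by (simp add: character_minus mult.assoc[symmetric])
      also have "\<dots> = s (cutoff lam 0) * fun_mult (character (\<eta> k)) (?\<delta> i) \<phi>"
        unfolding s[OF f] by (simp add: fun_mult_def delta_sum_translate)
      finally show ?thesis by simp
    qed
    then have "(\<lambda>\<phi>. s (cutoff lam 0) * fun_mult (character (\<eta> k)) (?\<delta> i) \<phi> + 0 * 0) \<doteq> u"
      by (simp add: distr_eq_def)
    moreover have "fun_mult (character (\<eta> k)) (?\<delta> i) \<in> B" unfolding B_def using i(1) k(1) by blast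
    ultimately show "weyl_span B u"
      using weyl_span.eq[OF weyl_span.comb[OF weyl_span.base weyl_span.zero]] by blast
  qed
  then show ?thesis unfolding B_def .
qed

section \<open>Commensurability of the spectrum with the dual lattice\<close>

lemma closed_distr_support: "closed (distr_support t)"
  unfolding distr_support_def by (intro closed_Compl open_Union) blast

text \<open>The numbers \<open>t (A\<^sup>n \<phi>)\<close> satisfy a linear recurrence whose constant coefficient does not vanish, so
  zeros at \<open>1, \<dots>, N\<close> extend to \<open>0\<close>.\<close>

lemma (in weyl_pairs) devs_vanish:
  assumes "devs (map (Pair k) rs) t \<doteq> (\<lambda>\<phi>. 0)" "0 \<notin> set rs" "schwartz \<phi>"
    "\<And>n. n \<in> {1..length rs} \<Longrightarrow> t ((A k ^^ n) \<phi>) = 0"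
  shows "t \<phi> = 0"
  using assms
proof (induction rs arbitrary: t)
  case Nil
  then show ?case by (simp add: distr_eq_def)
next
  case (Cons r rs)
  have step: "dev (k, r) t ((A k ^^ n) \<phi>) = t ((A k ^^ Suc n) \<phi>) - r * t ((A k ^^ n) \<phi>)" for n
    by (simp add: dev_def)
  have "dev (k, r) t \<phi> = 0"
  proof (rule Cons.IH)
    show "devs (map (Pair k) rs) (dev (k, r) t) \<doteq> (\<lambda>\<phi>. 0)"
      using Cons.prems(1) by (simp only: devs_dev list.map foldr_Cons o_apply)
    show "dev (k, r) t ((A k ^^ n) \<phi>) = 0" if n: "n \<in> {1..length rs}" for n
    proof -
      have "t ((A k ^^ Suc n) \<phi>) = 0" "t ((A k ^^ n) \<phi>) = 0"
        by (rule Cons.prems(4), use n in simp)+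
      then show ?thesis unfolding step by simp
    qed
  qed (use Cons.prems in auto)
  moreover have "t ((A k ^^ 1) \<phi>) = 0" by (rule Cons.prems(4)) simp
  ultimately have "r * t \<phi> = 0" by (simp add: dev_def)
  then show ?case using Cons.prems(2) by simp
qed

text \<open>Suppose that none of the points \<open>\<sigma> - n lam a\<close> lies in the support. For a test function \<open>\<psi>\<close> near \<open>\<sigma>\<close>
  the translates \<open>\<psi> (\<xi> + n lam a)\<close> are then annihilated, and the transform of the translate is the transform of
  \<open>\<psi>\<close> times the \<open>n\<close>-th power of the character. The recurrence \<open>devs_vanish\<close> shows that \<open>\<psi>\<close> itself is
  annihilated, so \<open>\<sigma>\<close> is not in the support.\<close>

lemma support_step:
  fixes t :: "'n::finite functional"
  assumes d: "dual_bases l lam" and t: "tempered t"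
    and supp: "distr_support t \<subseteq> crystal (lattice_dual_to lam) I q"
  shows "\<exists>N. \<forall>\<sigma>\<in>distr_support (fourier t). \<exists>n\<in>{1..N}. \<sigma> - real n *\<^sub>R lam a \<in> distr_support (fourier t)"
proof -
  interpret weyl_pairs "lattice_op l lam" "lattice_conj l lam" by (rule lattice_weyl_pairs[OF d])
  let ?ps = "\<lambda>M. concat (replicate M (map (\<lambda>i. (Inl a :: 'n + 'n, character (lam a) (q i))) [1..<Suc I]))"
  obtain M where M: "devs (?ps M) t \<doteq> (\<lambda>\<phi>. 0)"
    using crystal_annihilator[OF d t supp, of "\<lambda>_. a"] by blast
  define rs where "rs = map snd (?ps M)"
  have "map (Pair (Inl a)) rs = map id (?ps M)"
    unfolding rs_def map_map by (rule map_cong) (auto simp del: upt_Suc split: if_splits)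
  with M have rs: "devs (map (Pair (Inl a)) rs) t \<doteq> (\<lambda>\<phi>. 0)" by simp
  have rs0: "0 \<notin> set rs"
    unfolding rs_def by (auto simp del: upt_Suc split: if_splits)
  have iter: "(lattice_op l lam (Inl a) ^^ n) \<phi> = (\<lambda>x. character (real n *\<^sub>R lam a) x * \<phi> x)" for n \<phi>
    by (induction n) (simp_all add: fun_eq_iff scaleR_add_left character_add_left mult.assoc)
  have "\<exists>n\<in>{1..length rs}. \<sigma> - real n *\<^sub>R lam a \<in> distr_support (fourier t)" if \<sigma>: "\<sigma> \<in> distr_support (fourier t)" for \<sigma>
  proof (rule ccontr)
    assume no: "\<not> ?thesis"
    define U where "U = (\<Inter>n\<in>{1..length rs}. (\<lambda>x. x - real n *\<^sub>R lam a) -` (- distr_support (fourier t)))"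
    have "open U"
      unfolding U_def using closed_distr_support[of "fourier t"]
      by (intro open_INT ballI open_vimage continuous_intros) (auto simp: open_Compl)
    moreover have "vanishes_on (fourier t) U"
      unfolding vanishes_on_def
    proof (intro allI impI)
      fix \<psi> :: "real ^ 'n \<Rightarrow> complex"
      assume sm: "smooth_fun \<psi>" and co: "compact (closure {x. \<psi> x \<noteq> 0})" and U: "closure {x. \<psi> x \<noteq> 0} \<subseteq> U"
      have \<psi>: "schwartz \<psi>" by (rule schwartz_compact_closure[OF sm co])
      show "fourier t \<psi> = 0"
        unfolding fourier_def
      proof (rule devs_vanish[OF rs rs0 schwartz_fourier_fun[OF \<psi>]])
        fix n assume n: "n \<in> {1..length rs}"
        let ?v = "real n *\<^sub>R lam a" and ?C = "closure {x. \<psi> x \<noteq> 0}"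
        have "(lattice_op l lam (Inl a) ^^ n) (fourier_fun \<psi>) = fourier_fun (\<lambda>\<xi>. \<psi> (\<xi> + ?v))"
          unfolding iter by (simp add: fun_eq_iff fourier_fun_translation[OF \<psi>])
        then have "t ((lattice_op l lam (Inl a) ^^ n) (fourier_fun \<psi>)) = fourier t (\<lambda>\<xi>. \<psi> (\<xi> + ?v))"
          by (simp add: fourier_def)
        also have "\<dots> = 0"
        proof (rule vanishes_off_support[OF tempered_fourier[OF t] schwartz_translation[OF \<psi>]])
          show "closed ((\<lambda>x. x + ?v) -` ?C)"
            by (intro closed_vimage closed_closure continuous_intros)
          show "x \<in> (\<lambda>x. x + ?v) -` ?C" if "\<psi> (x + ?v) \<noteq> 0" for x
            using that closure_subset by force
          show "(\<lambda>x. x + ?v) -` ?C \<inter> distr_support (fourier t) = {}"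
            using U n unfolding U_def by force
        qed
        finally show "t ((lattice_op l lam (Inl a) ^^ n) (fourier_fun \<psi>)) = 0" .
      qed
    qed
    moreover have "\<sigma> \<in> U" using no by (auto simp: U_def)
    ultimately show False using \<sigma> by (auto simp: distr_support_def)
  qed
  then show ?thesis by blast
qed

text \<open>By \<open>support_step\<close> infinitely many points \<open>\<sigma> - n lam a\<close> lie in the support, two of them in the same coset
  of \<open>\<Gamma>\<close>.\<close>

lemma commensurable:
  fixes t :: "'n::finite functional"
  assumes d: "dual_bases l lam" and t: "tempered t"
    and supp: "distr_support t \<subseteq> crystal (lattice_dual_to lam) I q"
    and fsupp: "distr_support (fourier t) \<subseteq> crystal (lattice_dual_to \<kappa>) K \<eta>"
    and \<sigma>: "\<sigma> \<in> distr_support (fourier t)"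
  shows "\<exists>m>0. real m *\<^sub>R lam a \<in> lattice_dual_to \<kappa>"
proof -
  obtain N where N: "\<And>\<sigma>. \<sigma> \<in> distr_support (fourier t) \<Longrightarrow>
      \<exists>n\<in>{1..N}. \<sigma> - real n *\<^sub>R lam a \<in> distr_support (fourier t)"
    using support_step[OF d t supp, of a] by blast
  define Z where "Z = {n. \<sigma> - real n *\<^sub>R lam a \<in> distr_support (fourier t)}"
  have "\<exists>n\<ge>m. n \<in> Z" for m
  proof (induction m)
    case 0
    then show ?case using \<sigma> by (intro exI[of _ 0]) (simp add: Z_def)
  next
    case (Suc m)
    then obtain n where n: "n \<ge> m" "n \<in> Z" by blast
    then obtain k where k: "k \<in> {1..N}" "\<sigma> - real n *\<^sub>R lam a - real k *\<^sub>R lam a \<in> distr_support (fourier t)"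
      using N unfolding Z_def by blast
    then have "n + k \<in> Z" by (simp add: Z_def algebra_simps)
    then show ?case using n(1) k(1) by (intro exI[of _ "n + k"]) auto
  qed
  then have inf: "infinite Z" by (simp add: infinite_nat_iff_unbounded_le)
  have "\<forall>n. \<exists>k. n \<in> Z \<longrightarrow> k \<in> {1..K} \<and> \<sigma> - real n *\<^sub>R lam a - \<eta> k \<in> lattice_dual_to \<kappa>"
    using fsupp by (fastforce simp: Z_def crystal_def translate_def)
  then obtain f where f: "\<And>n. n \<in> Z \<Longrightarrow> f n \<in> {1..K} \<and> \<sigma> - real n *\<^sub>R lam a - \<eta> (f n) \<in> lattice_dual_to \<kappa>"
    by metis
  have "finite (f ` Z)" by (rule finite_subset[of _ "{1..K}"]) (use f in auto)
  from pigeonhole_infinite[OF inf this] obtain n where n: "n \<in> Z" "infinite {n' \<in> Z. f n' = f n}" by blast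
  from n(2) obtain n' where n': "n' > n" "n' \<in> Z" "f n' = f n"
    unfolding infinite_nat_iff_unbounded by blast
  have "(\<sigma> - real n *\<^sub>R lam a - \<eta> (f n)) - (\<sigma> - real n' *\<^sub>R lam a - \<eta> (f n')) \<in> lattice_dual_to \<kappa>"
    by (rule lattice_dual_to_diff[OF conjunct2[OF f[OF n(1)]] conjunct2[OF f[OF n'(2)]]])
  also have "(\<sigma> - real n *\<^sub>R lam a - \<eta> (f n)) - (\<sigma> - real n' *\<^sub>R lam a - \<eta> (f n')) = real (n' - n) *\<^sub>R lam a"
    using n' by (simp add: of_nat_diff algebra_simps)
  finally show ?thesis using n'(1) by (intro exI[of _ "n' - n"]) simp
qed

lemma finite_lattice_box:
  fixes l lam \<mu> \<kappa> :: "'n::finite \<Rightarrow> real ^ 'n"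
  assumes d: "dual_bases l lam" and d': "dual_bases \<mu> \<kappa>"
  shows "finite {x \<in> lattice_dual_to \<kappa>. \<forall>a. l a \<bullet> x \<in> {0..c}}"
proof -
  define R where "R = (\<Sum>a\<in>UNIV. \<bar>c\<bar> * norm (lam a))"
  define N where "N = \<lceil>\<Sum>b\<in>UNIV. norm (\<kappa> b) * R\<rceil>"
  have R: "R \<ge> 0" unfolding R_def by (simp add: sum_nonneg)
  have "{x \<in> lattice_dual_to \<kappa>. \<forall>a. l a \<bullet> x \<in> {0..c}} \<subseteq> lattice_point \<mu> ` (UNIV \<rightarrow>\<^sub>E {-N..N})"
  proof
    fix x assume x: "x \<in> {x \<in> lattice_dual_to \<kappa>. \<forall>a. l a \<bullet> x \<in> {0..c}}"
    then obtain k where k: "x = lattice_point \<mu> k" using range_lattice_point[OF d'] by blast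
    have "norm x \<le> (\<Sum>a\<in>UNIV. norm ((l a \<bullet> x) *\<^sub>R lam a))"
      using norm_sum[of "\<lambda>a. (l a \<bullet> x) *\<^sub>R lam a" UNIV] dual_bases_expansion[OF dual_bases_sym[OF d], of x] by simp
    also have "\<dots> \<le> R"
      unfolding R_def
    proof (rule sum_mono)
      fix a
      have "0 \<le> l a \<bullet> x \<and> l a \<bullet> x \<le> c" using x by auto
      then have "\<bar>l a \<bullet> x\<bar> \<le> \<bar>c\<bar>" by linarith
      then show "norm ((l a \<bullet> x) *\<^sub>R lam a) \<le> \<bar>c\<bar> * norm (lam a)" by (simp add: mult_right_mono)
    qed
    finally have nx: "norm x \<le> R" .
    have "\<bar>k b\<bar> \<le> N" for b
    proof -
      have "real_of_int \<bar>k b\<bar> = \<bar>\<kappa> b \<bullet> x\<bar>" unfolding k inner_lattice_point[OF d'] by simp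
      also have "\<dots> \<le> norm (\<kappa> b) * R"
        using Cauchy_Schwarz_ineq2[of "\<kappa> b" x] nx by (meson mult_left_mono norm_ge_zero order_trans)
      also have "\<dots> \<le> (\<Sum>b\<in>UNIV. norm (\<kappa> b) * R)"
        using R by (intro member_le_sum) auto
      finally show ?thesis unfolding N_def by linarith
    qed
    then show "x \<in> lattice_point \<mu> ` (UNIV \<rightarrow>\<^sub>E {-N..N})"
      unfolding k by (intro imageI) (auto simp: PiE_UNIV_domain abs_le_iff minus_le_iff)
  qed
  then show ?thesis by (rule finite_subset) (intro finite_imageI finite_PiE, auto)
qed

text \<open>If \<open>M\<close> is a common multiple with \<open>M L\<^sup>* \<subseteq> \<Gamma>\<close>, every coset of \<open>M L\<^sup>*\<close> in \<open>\<Gamma>\<close> has a representative in a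
  bounded box, which contains finitely many points of \<open>\<Gamma>\<close>.\<close>

lemma finitely_many_cosets:
  fixes l lam \<mu> \<kappa> :: "'n::finite \<Rightarrow> real ^ 'n"
  assumes d: "dual_bases l lam" and d': "dual_bases \<mu> \<kappa>"
    and comm: "\<And>a. \<exists>m>0. real m *\<^sub>R lam a \<in> lattice_dual_to \<kappa>"
  shows "\<exists>K' \<eta>'. (\<forall>k\<in>{1..K'}. \<eta>' k \<in> crystal (lattice_dual_to \<kappa>) K \<eta>) \<and>
    crystal (lattice_dual_to \<kappa>) K \<eta> \<subseteq> crystal (lattice_dual_to l) K' \<eta>'"
proof -
  obtain m where m: "\<And>a. m a > 0" "\<And>a. real (m a) *\<^sub>R lam a \<in> lattice_dual_to \<kappa>"
    using comm by metis
  define M where "M = (\<Prod>a\<in>UNIV. m a)"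
  have M0: "M > 0" unfolding M_def using m(1) by (simp add: prod_pos)
  have M: "\<kappa> b \<bullet> (real M *\<^sub>R lam a) \<in> \<int>" for a b
  proof -
    have "M = (\<Prod>c\<in>UNIV - {a}. m c) * m a"
      unfolding M_def by (subst prod.remove[of _ a]) simp_all
    then have "\<kappa> b \<bullet> (real M *\<^sub>R lam a) = real (\<Prod>c\<in>UNIV - {a}. m c) * (\<kappa> b \<bullet> (real (m a) *\<^sub>R lam a))"
      by simp
    then show ?thesis using m(2)[of a] by (simp only: lattice_dual_to_def mem_Collect_eq Ints_mult Ints_of_nat)
  qed
  define R where "R = {x \<in> lattice_dual_to \<kappa>. \<forall>a. l a \<bullet> x \<in> {0..real M}}"
  define F where "F = (\<Union>k\<in>{1..K}. (\<lambda>x. x + \<eta> k) ` R)"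
  have "finite F" unfolding F_def R_def using finite_lattice_box[OF d d'] by blast
  then obtain \<eta>' where \<eta>': "bij_betw \<eta>' {1..card F} F" using ex_bij_betw_nat_finite_1 by blast
  have im: "\<eta>' ` {1..card F} = F" using \<eta>' by (simp add: bij_betw_def)
  have F: "F \<subseteq> crystal (lattice_dual_to \<kappa>) K \<eta>"
    unfolding F_def R_def crystal_def translate_def by auto
  have "x \<in> crystal (lattice_dual_to l) (card F) \<eta>'" if x: "x \<in> crystal (lattice_dual_to \<kappa>) K \<eta>" for x
  proof -
    obtain k y where k: "k \<in> {1..K}" and y: "y \<in> lattice_dual_to \<kappa>" and x: "x = y + \<eta> k"
      using x by (auto simp: crystal_def translate_def)
    define z where "z = (\<Sum>a\<in>UNIV. of_int \<lfloor>l a \<bullet> y / M\<rfloor> *\<^sub>R (real M *\<^sub>R lam a))"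
    have lz: "l b \<bullet> z = M * of_int \<lfloor>l b \<bullet> y / M\<rfloor>" for b
      by (simp add: z_def inner_sum_right dual_bases_inner[OF dual_bases_sym[OF d]] if_distrib cong: if_cong)
    have z_l: "z \<in> lattice_dual_to l" by (simp add: lattice_dual_to_def lz)
    have z_\<kappa>: "z \<in> lattice_dual_to \<kappa>"
      unfolding lattice_dual_to_def
    proof (intro CollectI allI)
      fix b
      have "\<kappa> b \<bullet> z = (\<Sum>a\<in>UNIV. of_int \<lfloor>l a \<bullet> y / M\<rfloor> * (\<kappa> b \<bullet> (real M *\<^sub>R lam a)))"
        by (simp add: z_def inner_sum_right mult.assoc)
      then show "\<kappa> b \<bullet> z \<in> \<int>" by (simp only:) (intro Ints_sum Ints_mult Ints_of_int M)
    qed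
    have "y - z \<in> R"
    proof -
      have "l a \<bullet> (y - z) \<in> {0..real M}" for a
      proof -
        let ?f = "real_of_int \<lfloor>l a \<bullet> y / M\<rfloor>"
        have "?f \<le> l a \<bullet> y / M" "l a \<bullet> y / M \<le> ?f + 1" by linarith+
        then have "M * ?f \<le> M * (l a \<bullet> y / M)" "M * (l a \<bullet> y / M) \<le> M * (?f + 1)"
          using M0 by (intro mult_left_mono; simp)+
        moreover have "M * (l a \<bullet> y / M) = l a \<bullet> y" using M0 by simp
        ultimately have "M * ?f \<le> l a \<bullet> y" "l a \<bullet> y \<le> M * ?f + M" by (simp_all add: distrib_left)
        then show ?thesis by (simp add: inner_diff_right lz)
      qed
      then show ?thesis using lattice_dual_to_diff[OF y z_\<kappa>] by (simp add: R_def)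
    qed
    then have "y - z + \<eta> k \<in> F" unfolding F_def using k by blast
    then obtain k' where "k' \<in> {1..card F}" "\<eta>' k' = y - z + \<eta> k" using im by (metis imageE)
    then show ?thesis
      unfolding crystal_def translate_def x using z_l by (intro UN_I[of k'] image_eqI[of _ _ z]) auto
  qed
  then show ?thesis using F im by (intro exI[of _ "card F"] exI[of _ \<eta>']) blast
qed

section \<open>Fourier transforms of differential operators\<close>

lemma fourier_coord_mult:
  assumes w: "linear_functional w"
  shows "fourier (coord_mult i w) \<doteq> scale (- inverse two_pi_i) (distr_deriv i (fourier w))"
  unfolding distr_eq_def
proof (intro allI impI)
  fix \<psi> :: "real ^ 'a \<Rightarrow> complex" assume \<psi>: "schwartz \<psi>"
  have "fourier_fun (partial i \<psi>) = (\<lambda>x. two_pi_i * (of_real (x $ i) * fourier_fun \<psi> x))"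
    by (simp add: fun_eq_iff fourier_fun_partial[OF \<psi>] mult.assoc)
  then show "fourier (coord_mult i w) \<psi> = scale (- inverse two_pi_i) (distr_deriv i (fourier w)) \<psi>"
    using linear_functional_cmult[OF w schwartz_coord_mult[OF schwartz_fourier_fun[OF \<psi>]], of two_pi_i i]
    by (simp add: fourier_def coord_mult_apply scale_def distr_deriv_def mult.assoc[symmetric])
qed

lemma fourier_distr_deriv:
  assumes w: "linear_functional w"
  shows "fourier (distr_deriv i w) \<doteq> scale two_pi_i (coord_mult i (fourier w))"
  unfolding distr_eq_def
proof (intro allI impI)
  fix \<psi> :: "real ^ 'a \<Rightarrow> complex" assume \<psi>: "schwartz \<psi>"
  note s = schwartz_coord_mult[OF \<psi>, of i]
  show "fourier (distr_deriv i w) \<psi> = scale two_pi_i (coord_mult i (fourier w)) \<psi>"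
    unfolding fourier_def distr_deriv_def scale_def coord_mult_apply partial_fourier_fun[OF \<psi>] fourier_fun_cmult[OF s]
    using linear_functional_cmult[OF w schwartz_fourier_fun[OF s], of "- two_pi_i"] by simp
qed

lemma scale_distr_deriv_eq: "u \<doteq> v \<Longrightarrow> scale c (distr_deriv i u) \<doteq> scale c (distr_deriv i v)"
  by (simp add: distr_eq_def scale_def distr_deriv_def schwartz_partial)

lemma scale_coord_mult_eq: "u \<doteq> v \<Longrightarrow> scale c (coord_mult i u) \<doteq> scale c (coord_mult i v)"
  by (simp add: distr_eq_def scale_def coord_mult_apply schwartz_coord_mult)

text \<open>The transform exchanges coordinates and derivatives without reversing products of operators, so it can be
  moved inside one operator at a time.\<close>

lemma fourier_diff_op:
  assumes lin: "linear_functional w" and w: "fourier w \<doteq> scale c u"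
  shows "fourier (diff_op P w) \<doteq> scale c (dual_op P u)"
proof -
  let ?A = "\<lambda>i u. scale (- inverse two_pi_i) (distr_deriv i u)" and ?B = "\<lambda>i u. scale two_pi_i (coord_mult i u)"
  have lin': "linear_functional (foldr coord_mult xs (foldr distr_deriv ys w))" for xs ys
    by (rule weyl_span_linear[OF _ weyl_span_foldr[OF weyl_span.base[of w "{w}"]]]) (auto simp: lin)
  have "fourier (foldr distr_deriv ys w) \<doteq> scale c (foldr ?B ys u)" for ys
  proof (induction ys)
    case (Cons i ys)
    from distr_eq_trans[OF fourier_distr_deriv[OF lin'[of "[]" ys, simplified]] scale_coord_mult_eq[OF Cons]]
    show ?case by (simp add: scale_def[abs_def] coord_mult_apply[abs_def] mult.left_commute)
  qed (simp add: w)
  then have "fourier (foldr coord_mult xs (foldr distr_deriv ys w)) \<doteq> scale c (foldr ?A xs (foldr ?B ys u))" for xs ys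
  proof (induction xs)
    case (Cons i xs)
    from distr_eq_trans[OF fourier_coord_mult[OF lin'] scale_distr_deriv_eq[OF Cons.IH[OF Cons.prems]]]
    show ?case by (simp add: scale_def[abs_def] distr_deriv_def[abs_def] mult.left_commute)
  qed simp
  then have R_term: "foldr coord_mult xs (foldr distr_deriv ys w) (fourier_fun \<psi>) = c * foldr ?A xs (foldr ?B ys u) \<psi>"
    if "schwartz \<psi>" for xs ys \<psi>
    using that by (simp add: distr_eq_def fourier_def scale_def)
  show ?thesis
    unfolding distr_eq_def
  proof (intro allI impI)
    fix \<psi> :: "real ^ 'a \<Rightarrow> complex" assume \<psi>: "schwartz \<psi>"
    have "diff_op P w (fourier_fun \<psi>) = c * dual_op P u \<psi>"
      unfolding diff_op_def dual_op_def poly_op_def sum_list_const_mult[symmetric]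
      by (rule arg_cong[where f = sum_list], rule map_cong)
         (auto simp: R_term[OF \<psi>] mult.left_commute)
    then show "fourier (diff_op P w) \<psi> = scale c (dual_op P u) \<psi>"
      by (simp add: fourier_def scale_def)
  qed
qed

section \<open>Lattices given by matrices\<close>

lemma matrix_inv_inverse:
  fixes A :: "real ^ 'n ^ 'n::finite"
  assumes "invertible A"
  shows matrix_inv_left: "matrix_inv A ** A = mat 1" and matrix_inv_right: "A ** matrix_inv A = mat 1"
proof -
  have "A ** matrix_inv A = mat 1 \<and> matrix_inv A ** A = mat 1"
    unfolding matrix_inv_def by (rule someI_ex) (use assms in \<open>simp add: invertible_def\<close>)
  then show "matrix_inv A ** A = mat 1" "A ** matrix_inv A = mat 1" by auto
qed

lemma matrix_inv_unique:
  fixes A :: "real ^ 'n ^ 'n::finite"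
  assumes "A ** B = mat 1"
  shows "matrix_inv A = B"
proof -
  have "invertible A" using assms by (metis invertible_right_inverse)
  then have "matrix_inv A ** (A ** B) = B" by (simp add: matrix_mul_assoc matrix_inv_left)
  then show ?thesis by (simp add: assms)
qed

lemma lattice_of_eq:
  fixes g :: "real ^ 'n ^ 'n::finite"
  assumes "invertible g"
  shows "lattice_of g = lattice_dual_to (\<lambda>a. row a (matrix_inv g))"
proof -
  have c: "(matrix_inv g *v x) $ a = row a (matrix_inv g) \<bullet> x" for x a
    by (simp add: matrix_vector_mult_def row_def inner_vec_def)
  have inv: "g *v (matrix_inv g *v x) = x" "matrix_inv g *v (g *v x) = x" for x
    using assms by (simp_all add: matrix_vector_mul_assoc matrix_inv_left matrix_inv_right)
  show ?thesis
  proof (rule set_eqI, rule iffI)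
    fix x assume "x \<in> lattice_of g"
    then show "x \<in> lattice_dual_to (\<lambda>a. row a (matrix_inv g))"
      by (auto simp: lattice_of_def lattice_dual_to_def c[symmetric] inv)
  next
    fix x assume "x \<in> lattice_dual_to (\<lambda>a. row a (matrix_inv g))"
    then show "x \<in> lattice_of g"
      unfolding lattice_of_def by (intro image_eqI[of _ _ "matrix_inv g *v x"]) (simp_all add: lattice_dual_to_def c inv)
  qed
qed

lemma dual_bases_matrix:
  fixes g :: "real ^ 'n ^ 'n::finite"
  assumes "invertible g"
  shows "dual_bases (\<lambda>a. column a g) (\<lambda>a. row a (matrix_inv g))"
proof -
  have "row a (matrix_inv g) \<bullet> column b g = (matrix_inv g ** g) $ a $ b" for a b
    by (simp add: row_def column_def inner_vec_def matrix_matrix_mult_def)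
  then show ?thesis using assms by (simp add: dual_bases_def matrix_inv_left mat_def)
qed

lemma dual_lattice_of_eq:
  fixes g :: "real ^ 'n ^ 'n::finite"
  assumes "invertible g"
  shows "dual_lattice_of g = lattice_dual_to (\<lambda>a. column a g)"
proof -
  have T: "transpose g ** transpose (matrix_inv g) = mat 1"
    using assms by (simp add: matrix_transpose_mul[symmetric] matrix_inv_left transpose_mat)
  have i: "matrix_inv (transpose g) = transpose (matrix_inv g)" by (rule matrix_inv_unique[OF T])
  have T': "transpose (matrix_inv g) ** transpose g = mat 1" using T matrix_left_right_inverse by blast
  have ii: "matrix_inv (transpose (matrix_inv g)) = transpose g" by (rule matrix_inv_unique[OF T'])
  have "invertible (transpose (matrix_inv g))" using T' by (metis invertible_right_inverse)
  from lattice_of_eq[OF this] show ?thesis unfolding dual_lattice_of_def i ii by (simp add: row_transpose)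
qed

lemma fourier_delta_translate:
  fixes g :: "real ^ 'n ^ 'n::finite"
  assumes g: "invertible g"
  shows "fourier (delta_sum (translate (lattice_of g) p)) \<doteq>
    scale (of_real (1 / \<bar>det g\<bar>)) (fun_mult (\<lambda>\<sigma>. exp (- two_pi_i * of_real (\<sigma> \<bullet> p))) (delta_sum (dual_lattice_of g)))"
  unfolding distr_eq_def
proof (intro allI impI)
  fix \<psi> :: "real ^ 'n \<Rightarrow> complex" assume \<psi>: "schwartz \<psi>"
  have det: "det (row_matrix (\<lambda>a. column a g)) = det g"
  proof -
    have "row_matrix (\<lambda>a. column a g) = transpose g"
      by (simp add: row_matrix_def transpose_def column_def vec_eq_iff)
    then show ?thesis by (simp add: det_transpose)
  qed
  have e: "(\<lambda>\<sigma>. exp (- two_pi_i * of_real (\<sigma> \<bullet> p)) * \<psi> \<sigma>) = (\<lambda>\<sigma>. character (- p) \<sigma> * \<psi> \<sigma>)"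
    by (simp add: character_def inner_commute)
  have s: "schwartz (\<lambda>\<sigma>. character (- p) \<sigma> * \<psi> \<sigma>)" by (rule schwartz_multiplier[OF multiplier_character \<psi>])
  have "(\<lambda>x. fourier_fun \<psi> (x + p)) = fourier_fun (\<lambda>\<sigma>. character (- p) \<sigma> * \<psi> \<sigma>)"
    by (simp add: fun_eq_iff fourier_fun_character_mult)
  then show "fourier (delta_sum (translate (lattice_of g) p)) \<psi> =
      scale (of_real (1 / \<bar>det g\<bar>)) (fun_mult (\<lambda>\<sigma>. exp (- two_pi_i * of_real (\<sigma> \<bullet> p))) (delta_sum (dual_lattice_of g))) \<psi>"
    unfolding fourier_def delta_sum_translate scale_def fun_mult_def e
    using poisson_summation[OF dual_bases_matrix[OF g] s] by (simp add: lattice_of_eq[OF g] dual_lattice_of_eq[OF g] det)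
qed

lemma fourier_poisson_term:
  fixes g :: "real ^ 'n ^ 'n::finite"
  assumes g: "invertible g"
  shows "fourier (diff_op P (delta_sum (translate (lattice_of g) p))) \<doteq> dual_term g P p"
  unfolding dual_term_def
proof (rule fourier_diff_op[OF _ fourier_delta_translate[OF g]])
  show "linear_functional (delta_sum (translate (lattice_of g) p))"
    unfolding lattice_of_eq[OF g] by (rule tempered_linear[OF tempered_delta_translate[OF dual_bases_matrix[OF g]]])
qed

lemma fourier_modulated_poisson_term:
  fixes g :: "real ^ 'n ^ 'n::finite"
  assumes g: "invertible g"
  shows "fourier (fun_mult (character (- \<zeta>)) (diff_op P (delta_sum (translate (lattice_of g) p)))) \<doteq> shift \<zeta> (dual_term g P p)"
  unfolding distr_eq_def
proof (intro allI impI)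
  fix \<psi> :: "real ^ 'n \<Rightarrow> complex" assume \<psi>: "schwartz \<psi>"
  have "(\<lambda>x. character (- \<zeta>) x * fourier_fun \<psi> x) = fourier_fun (\<lambda>\<xi>. \<psi> (\<xi> + - \<zeta>))"
    by (rule ext) (simp only: fourier_fun_translation[OF \<psi>])
  then show "fourier (fun_mult (character (- \<zeta>)) (diff_op P (delta_sum (translate (lattice_of g) p)))) \<psi> = shift \<zeta> (dual_term g P p) \<psi>"
    using fourier_poisson_term[OF g, of P p] schwartz_translation[OF \<psi>, of "- \<zeta>"]
    by (simp add: distr_eq_def fourier_def fun_mult_def shift_def)
qed

section \<open>The Poisson form\<close>

lemma poisson_form:
  fixes t :: "'n::finite functional"
  assumes d: "dual_bases l lam" and t: "tempered t"
    and supp: "distr_support t \<subseteq> crystal (lattice_dual_to lam) I q"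
    and fsupp: "distr_support (fourier t) \<subseteq> crystal (lattice_dual_to l) K \<eta>"
  shows "\<exists>P. t \<doteq> (\<lambda>\<phi>. \<Sum>k = 1..K. \<Sum>i = 1..I.
    fun_mult (character (\<eta> k)) (diff_op (P i k) (delta_sum (translate (lattice_dual_to lam) (q i)))) \<phi>)"
proof -
  let ?\<delta> = "\<lambda>i. delta_sum (translate (lattice_dual_to lam) (q i))"
  have lin: "linear_functional (?\<delta> i)" for i by (rule tempered_linear[OF tempered_delta_translate[OF d]])
  obtain u where u: "\<And>i k. weyl_span {?\<delta> i} (u i k)"
    and tu: "t \<doteq> (\<lambda>\<phi>. \<Sum>k = 1..K. \<Sum>i = 1..I. fun_mult (character (\<eta> k)) (u i k) \<phi>)"
    using weyl_span_modulation[where \<delta> = ?\<delta>, OF lin generated_by_modulated_delta_sums[OF d t supp fsupp]] by auto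
  have "\<forall>i k. \<exists>P. u i k \<doteq> diff_op P (?\<delta> i)" using weyl_span_diff_op[OF lin u] by blast
  then obtain P where P: "\<And>i k. u i k \<doteq> diff_op (P i k) (?\<delta> i)" by metis
  have "fun_mult (character (\<eta> k)) (u i k) \<phi> = fun_mult (character (\<eta> k)) (diff_op (P i k) (?\<delta> i)) \<phi>"
    if "schwartz \<phi>" for i k \<phi>
    using P[of i k] schwartz_multiplier[OF multiplier_character that] unfolding distr_eq_def fun_mult_def by blast
  with tu show ?thesis by (intro exI[of _ P]) (simp add: distr_eq_def)
qed

theorem theorem5:
  fixes t :: "'n::finite functional"
    and g \<gamma> :: "real ^ 'n ^ 'n"
    and q \<eta> :: "nat \<Rightarrow> real ^ 'n"
    and I K :: nat
  assumes "invertible g" and "invertible \<gamma>"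
    and "tempered_distribution t"
    and "distr_support t \<subseteq> crystal (lattice_of g) I q"
    and "distr_support (fourier t) \<subseteq> crystal (lattice_of \<gamma>) K \<eta>"
  shows "(\<exists>K' \<eta>'.
           (\<forall>k\<in>{1..K'}. \<eta>' k \<in> crystal (lattice_of \<gamma>) K \<eta>) \<and>
           (\<not> t \<doteq> (\<lambda>\<phi>. 0) \<longrightarrow>
              crystal (lattice_of \<gamma>) K \<eta> \<subseteq> crystal (dual_lattice_of g) K' \<eta>') \<and>
           (lattice_of \<gamma> = dual_lattice_of g \<longrightarrow> K' = K \<and> (\<forall>k\<in>{1..K}. \<eta>' k = \<eta> k)) \<and>
           (\<exists>P :: nat \<Rightarrow> nat \<Rightarrow> 'n polynomial_symbol.
              t \<doteq> (\<lambda>\<phi>. \<Sum>k = 1..K'. \<Sum>i = 1..I.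
                     fun_mult (\<lambda>x. exp (two_pi_i * of_real (\<eta>' k \<bullet> x)))
                       (diff_op (P i k) (delta_sum (translate (lattice_of g) (q i)))) \<phi>) \<and>
              fourier t \<doteq> (\<lambda>\<psi>. \<Sum>k = 1..K'. \<Sum>i = 1..I.
                     shift (- \<eta>' k) (dual_term g (P i k) (q i)) \<psi>)))
       \<and> (\<forall>(P :: 'n polynomial_symbol) (p :: real ^ 'n).
            fourier (diff_op P (delta_sum (translate (lattice_of g) p))) \<doteq> dual_term g P p)
       \<and> (\<forall>(P :: 'n polynomial_symbol) (p :: real ^ 'n) (\<zeta> :: real ^ 'n).
            fourier (fun_mult (\<lambda>x. exp (- two_pi_i * of_real (\<zeta> \<bullet> x)))
                (diff_op P (delta_sum (translate (lattice_of g) p))))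
              \<doteq> shift \<zeta> (dual_term g P p))"
proof -
  define l where "l = (\<lambda>a. column a g)"
  define lam where "lam = (\<lambda>a. row a (matrix_inv g))"
  define \<mu> where "\<mu> = (\<lambda>a. column a \<gamma>)"
  define \<kappa> where "\<kappa> = (\<lambda>a. row a (matrix_inv \<gamma>))"
  have d: "dual_bases l lam" and d': "dual_bases \<mu> \<kappa>"
    unfolding l_def lam_def \<mu>_def \<kappa>_def by (rule dual_bases_matrix[OF assms(1)], rule dual_bases_matrix[OF assms(2)])
  have L: "lattice_of g = lattice_dual_to lam" and L': "dual_lattice_of g = lattice_dual_to l"
    and \<Gamma>: "lattice_of \<gamma> = lattice_dual_to \<kappa>"
    unfolding l_def lam_def \<kappa>_def
    by (rule lattice_of_eq[OF assms(1)], rule dual_lattice_of_eq[OF assms(1)], rule lattice_of_eq[OF assms(2)])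
  have t: "tempered t" by (rule tempered_distribution_imp_tempered[OF assms(3)])
  note supp = assms(4)[unfolded L] and fsupp = assms(5)[unfolded \<Gamma>]
  have trivial: "\<forall>k\<in>{1..K}. \<eta> k \<in> crystal (lattice_dual_to \<kappa>) K \<eta>"
    unfolding crystal_def translate_def by (auto intro!: bexI image_eqI[of _ _ 0])
  have char: "(\<lambda>x. exp (- two_pi_i * of_real (\<zeta> \<bullet> x))) = character (- \<zeta>)"
    "(\<lambda>x. exp (two_pi_i * of_real (\<zeta> \<bullet> x))) = character \<zeta>" for \<zeta> :: "real ^ 'n"
    by (simp_all add: character_def fun_eq_iff)
  have poisson: "\<exists>P. t \<doteq> (\<lambda>\<phi>. \<Sum>k = 1..K'. \<Sum>i = 1..I.
      fun_mult (character (\<eta>' k)) (diff_op (P i k) (delta_sum (translate (lattice_of g) (q i)))) \<phi>)"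
    if "distr_support (fourier t) \<subseteq> crystal (dual_lattice_of g) K' \<eta>'" for K' \<eta>'
    using poisson_form[OF d t supp, of K' \<eta>'] that unfolding L L' by blast
  have ex: "\<exists>K' \<eta>'. (\<forall>k\<in>{1..K'}. \<eta>' k \<in> crystal (lattice_of \<gamma>) K \<eta>) \<and>
      (\<not> t \<doteq> (\<lambda>\<phi>. 0) \<longrightarrow> crystal (lattice_of \<gamma>) K \<eta> \<subseteq> crystal (dual_lattice_of g) K' \<eta>') \<and>
      (lattice_of \<gamma> = dual_lattice_of g \<longrightarrow> K' = K \<and> (\<forall>k\<in>{1..K}. \<eta>' k = \<eta> k)) \<and>
      (\<exists>P. t \<doteq> (\<lambda>\<phi>. \<Sum>k = 1..K'. \<Sum>i = 1..I.
        fun_mult (character (\<eta>' k)) (diff_op (P i k) (delta_sum (translate (lattice_of g) (q i)))) \<phi>))"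
  proof -
    (* commensurability needs a nonzero t, and for equal lattices the given cosets are to be kept *)
    consider "t \<doteq> (\<lambda>\<phi>. 0)" | "lattice_of \<gamma> = dual_lattice_of g"
      | "\<not> t \<doteq> (\<lambda>\<phi>. 0)" "lattice_of \<gamma> \<noteq> dual_lattice_of g" by blast
    then show ?thesis
    proof cases
      case 1
      have "t \<doteq> (\<lambda>\<phi>. \<Sum>k = 1..K. \<Sum>i = 1..I.
          fun_mult (character (\<eta> k)) (diff_op [] (delta_sum (translate (lattice_of g) (q i)))) \<phi>)"
        using 1 by (simp add: distr_eq_def fun_mult_def)
      then have P: "\<exists>P. t \<doteq> (\<lambda>\<phi>. \<Sum>k = 1..K. \<Sum>i = 1..I.
          fun_mult (character (\<eta> k)) (diff_op (P i k) (delta_sum (translate (lattice_of g) (q i)))) \<phi>)"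
        by (rule exI[of _ "\<lambda>_ _. []"])
      show ?thesis
        by (rule exI[of _ K], rule exI[of _ \<eta>]) (use 1 P trivial in \<open>simp add: \<Gamma>\<close>)
    next
      case 2
      have "\<exists>P. t \<doteq> (\<lambda>\<phi>. \<Sum>k = 1..K. \<Sum>i = 1..I.
          fun_mult (character (\<eta> k)) (diff_op (P i k) (delta_sum (translate (lattice_of g) (q i)))) \<phi>)"
        by (rule poisson) (use assms(5) 2 in simp)
      moreover have "crystal (lattice_of \<gamma>) K \<eta> \<subseteq> crystal (dual_lattice_of g) K \<eta>" using 2 by simp
      ultimately show ?thesis using trivial[folded \<Gamma>] by blast
    next
      case 3
      obtain \<sigma> where \<sigma>: "\<sigma> \<in> distr_support (fourier t)"
      proof (rule ccontr)
        assume "\<not> thesis"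
        then have "distr_support (fourier t) = {}" using that by blast
        then have z: "fourier t \<psi> = 0" if "schwartz \<psi>" for \<psi>
          by (intro vanishes_off_support[OF tempered_fourier[OF t] that closed_UNIV]) auto
        have "t \<phi> = 0" if "schwartz \<phi>" for \<phi>
          using fourier_fun_surjective[OF that] z unfolding fourier_def by blast
        then show False using 3(1) by (simp add: distr_eq_def)
      qed
      obtain K' \<eta>' where "\<forall>k\<in>{1..K'}. \<eta>' k \<in> crystal (lattice_of \<gamma>) K \<eta>"
        and sub: "crystal (lattice_of \<gamma>) K \<eta> \<subseteq> crystal (dual_lattice_of g) K' \<eta>'"
        using finitely_many_cosets[OF d d' commensurable[OF d t supp fsupp \<sigma>], of K \<eta>] unfolding \<Gamma> L' by blast
      moreover have "\<exists>P. t \<doteq> (\<lambda>\<phi>. \<Sum>k = 1..K'. \<Sum>i = 1..I.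
          fun_mult (character (\<eta>' k)) (diff_op (P i k) (delta_sum (translate (lattice_of g) (q i)))) \<phi>)"
        by (rule poisson) (use assms(5) sub in blast)
      ultimately show ?thesis using 3(2) by blast
    qed
  qed
  have ft: "fourier t \<doteq> (\<lambda>\<psi>. \<Sum>k = 1..K'. \<Sum>i = 1..I. shift (- \<eta>' k) (dual_term g (P i k) (q i)) \<psi>)"
    if P: "t \<doteq> (\<lambda>\<phi>. \<Sum>k = 1..K'. \<Sum>i = 1..I.
      fun_mult (character (\<eta>' k)) (diff_op (P i k) (delta_sum (translate (lattice_of g) (q i)))) \<phi>)" for K' \<eta>' P
    unfolding distr_eq_def
  proof (intro allI impI)
    fix \<psi> :: "real ^ 'n \<Rightarrow> complex" assume \<psi>: "schwartz \<psi>"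
    have "fourier t \<psi> = (\<Sum>k = 1..K'. \<Sum>i = 1..I.
        fourier (fun_mult (character (\<eta>' k)) (diff_op (P i k) (delta_sum (translate (lattice_of g) (q i))))) \<psi>)"
      using P schwartz_fourier_fun[OF \<psi>] unfolding distr_eq_def fourier_def by blast
    also have "\<dots> = (\<Sum>k = 1..K'. \<Sum>i = 1..I. shift (- \<eta>' k) (dual_term g (P i k) (q i)) \<psi>)"
      using fourier_modulated_poisson_term[OF assms(1), of "- \<eta>' _"] \<psi> by (intro sum.cong) (simp_all add: distr_eq_def)
    finally show "fourier t \<psi> = (\<Sum>k = 1..K'. \<Sum>i = 1..I. shift (- \<eta>' k) (dual_term g (P i k) (q i)) \<psi>)" .
  qed
  show ?thesis
    unfolding char
  proof (intro conjI allI)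
    show "fourier (diff_op P (delta_sum (translate (lattice_of g) p))) \<doteq> dual_term g P p" for P p
      by (rule fourier_poisson_term[OF assms(1)])
    show "fourier (fun_mult (character (- \<zeta>)) (diff_op P (delta_sum (translate (lattice_of g) p)))) \<doteq> shift \<zeta> (dual_term g P p)" for P p \<zeta>
      by (rule fourier_modulated_poisson_term[OF assms(1)])
  qed (use ex ft in blast)
qed

end
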